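(* Let $d\in\{1,2\}$, $\beta\in(0,2]$, and let the random walk $(S_n)$, the scenery $(\xi_y)_{y\in\mathbb Z^d}$, the random walk in random scenery $(Z_n)$ and the constant $A$ be as described in the context. Assume that $\xi_0$ is strongly non-lattice, i.e. its characteristic function $\varphi_\xi$ satisfies $\limsup_{|u|\to+\infty}|\varphi_\xi(u)|<1$. For $n\ge2$ let $b_n:=n^{1/\beta}(\log(n))^{(\beta-1)/\beta}$, and let $C(\cdot)$ be the density function of $\tilde Y_1:=\left(\frac{\Gamma(\beta+1)}{(\pi A)^{\beta-1}}\right)^{1/\beta}Y(1)$, where $Y(1)$ has distribution $\mathcal S_\beta$. Then, for every $x,a,b\in\mathbb R$ such that $a<b$, $$\lim_{n\to+\infty}b_n\,\mathbb P\left(Z_n\in[b_nx+a;\,b_nx+b]\right)=C(x)(b-a).$$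
   Context: Let $X=(X_k)_{k\ge1}$ be i.i.d. random variables with values in $\mathbb Z^d$ and $\xi=(\xi_y)_{y\in\mathbb Z^d}$ be i.i.d. real random variables, the two sequences being independent. Set $S_0:=0$, $S_n:=\sum_{i=1}^n X_i$, and $Z_0:=0$, $Z_n:=\sum_{k=0}^{n-1}\xi_{S_k}$ for $n\ge1$. Assumptions on the random walk: either (a) $d=2$ and $X_1$ is centered, square integrable with invertible variance matrix $\Sigma$, and then $A:=2\sqrt{\det\Sigma}$; or (b) $d=1$ and $(S_n/n)_n$ converges in distribution to a random variable with characteristic function $t\mapsto\exp(-a_0|t|)$ with $a_0>0$, and then $A:=a_0$. Assumptions on the scenery: $\xi_0$ belongs to the normal domain of attraction of a strictly stable distribution $\mathcal S_\beta$ of index $\beta\in(0,2]$, i.e. $n^{-1/\beta}$ times the sum of $n$ i.i.d. copies of $\xi_0$ converges in distribution to $\mathcal S_\beta$, where $\mathcal S_\beta$ has characteristic function $\phi(u)=e^{-|u|^\beta(A_1+iA_2\,\mathrm{sgn}(u))}$ with $0<A_1<\infty$ and $|A_1^{-1}A_2|\le|\tan(\pi\beta/2)|$ (no restriction on $A_2\in\mathbb R$ when $\beta=1$). When $\beta=1$ it is further assumed that $\sup_{t>0}\left|\mathbb E[\xi_0\mathbf 1_{\{|\xi_0|\le t\}}]\right|<+\infty$.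
   Formalization: The steps of the walk are assumed not to lie almost surely in a proper subgroup of Z^d; without this the claim fails for β≠1 (doubling every step changes A but not the law of Z_n), while for β=1 the remaining walks follow by relabelling the sites. *)

theory Defs
  imports "HOL-Probability.Probability"
begin

text \<open>The lattice \<open>\<int>\<^sup>d\<close> is the type \<^typ>\<open>int ^ 'd\<close> with \<open>d = CARD('d)\<close>.\<close>

definition iid :: "'w measure \<Rightarrow> 'a measure \<Rightarrow> ('i \<Rightarrow> 'w \<Rightarrow> 'a) \<Rightarrow> 'i set \<Rightarrow> bool" where
  "iid M N X I \<longleftrightarrow> prob_space.indep_vars M (\<lambda>_. N) X I \<and>
     (\<forall>i\<in>I. \<forall>j\<in>I. distr M N (X i) = distr M N (X j))"

text \<open>The two sequences are independent as a whole: the \<open>\<sigma>\<close>-algebras they generate are independent.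
  The steps are \<open>X 1, X 2, \<dots>\<close>; the value \<open>X 0\<close> plays no role.\<close>

definition walk_scenery ::
  "'w measure \<Rightarrow> (nat \<Rightarrow> 'w \<Rightarrow> int ^ 'd) \<Rightarrow> (int ^ 'd \<Rightarrow> 'w \<Rightarrow> real) \<Rightarrow> bool" where
  "walk_scenery M X \<xi> \<longleftrightarrow>
     iid M (count_space UNIV) X {1..} \<and>
     iid M borel \<xi> UNIV \<and>
     prob_space.indep_set M
       (sets (vimage_algebra (space M) (\<lambda>\<omega>. \<lambda>k\<in>{1..}. X k \<omega>)
                (Pi\<^sub>M {1..} (\<lambda>_. count_space UNIV))))
       (sets (vimage_algebra (space M) (\<lambda>\<omega> y. \<xi> y \<omega>) (Pi\<^sub>M UNIV (\<lambda>_. borel))))"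

definition walk :: "(nat \<Rightarrow> 'w \<Rightarrow> int ^ 'd) \<Rightarrow> nat \<Rightarrow> 'w \<Rightarrow> int ^ 'd" where
  "walk X n \<omega> = (\<Sum>i=1..n. X i \<omega>)"

definition rwrs ::
  "(nat \<Rightarrow> 'w \<Rightarrow> int ^ 'd) \<Rightarrow> (int ^ 'd \<Rightarrow> 'w \<Rightarrow> real) \<Rightarrow> nat \<Rightarrow> 'w \<Rightarrow> real" where
  "rwrs X \<xi> n \<omega> = (\<Sum>k<n. \<xi> (walk X k \<omega>) \<omega>)"

definition variance_matrix :: "'w measure \<Rightarrow> ('w \<Rightarrow> int ^ 'd) \<Rightarrow> real ^ 'd ^ 'd" where
  "variance_matrix M V = (\<chi> i j.
     (\<integral>\<omega>. (real_of_int (V \<omega> $ i) - (\<integral>\<omega>'. real_of_int (V \<omega>' $ i) \<partial>M)) *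
           (real_of_int (V \<omega> $ j) - (\<integral>\<omega>'. real_of_int (V \<omega>' $ j) \<partial>M)) \<partial>M))"

definition planar_walk :: "'w measure \<Rightarrow> (nat \<Rightarrow> 'w \<Rightarrow> int ^ 'd) \<Rightarrow> bool" where
  "planar_walk M X \<longleftrightarrow> CARD('d) = 2 \<and>
     (\<forall>i. integrable M (\<lambda>\<omega>. (real_of_int (X 1 \<omega> $ i))\<^sup>2)) \<and>
     (\<forall>i. (\<integral>\<omega>. real_of_int (X 1 \<omega> $ i) \<partial>M) = 0) \<and>
     invertible (variance_matrix M (X 1))"

text \<open>In dimension one the quantifier over \<open>i\<close> ranges over the single coordinate.\<close>

definition cauchy_walk :: "'w measure \<Rightarrow> (nat \<Rightarrow> 'w \<Rightarrow> int ^ 'd) \<Rightarrow> real \<Rightarrow> bool" where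
  "cauchy_walk M X a\<^sub>0 \<longleftrightarrow> CARD('d) = 1 \<and> a\<^sub>0 > 0 \<and>
     (\<exists>\<mu>. real_distribution \<mu> \<and> (\<forall>t. char \<mu> t = of_real (exp (- a\<^sub>0 * \<bar>t\<bar>))) \<and>
       (\<forall>i. weak_conv_m (\<lambda>n. distr M borel (\<lambda>\<omega>. real_of_int (walk X n \<omega> $ i) / real n)) \<mu>))"

text \<open>Both constants \<open>2 * sqrt (det \<Sigma>)\<close> and \<open>a\<^sub>0\<close> are normalised relative to the lattice
  \<open>\<int>\<^sup>d\<close> itself: rescaling the steps changes them but not the law of \<^const>\<open>rwrs\<close>. They are the
  right constants only if the steps are not confined to a proper subgroup of \<open>\<int>\<^sup>d\<close>.\<close>

definition spans_lattice :: "'w measure \<Rightarrow> ('w \<Rightarrow> int ^ 'd) \<Rightarrow> bool" where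
  "spans_lattice M V \<longleftrightarrow>
     (\<forall>H. 0 \<in> H \<and> (\<forall>x\<in>H. \<forall>y\<in>H. x - y \<in> H) \<and> (AE \<omega> in M. V \<omega> \<in> H) \<longrightarrow> H = UNIV)"

text \<open>The case \<open>\<beta> = 1\<close> is separate because \<open>tan (pi / 2) = 0\<close> in HOL.\<close>

definition strictly_stable :: "real \<Rightarrow> real \<Rightarrow> real \<Rightarrow> real measure \<Rightarrow> bool" where
  "strictly_stable \<beta> A\<^sub>1 A\<^sub>2 \<mu> \<longleftrightarrow>
     0 < \<beta> \<and> \<beta> \<le> 2 \<and> 0 < A\<^sub>1 \<and> (\<beta> \<noteq> 1 \<longrightarrow> \<bar>A\<^sub>2 / A\<^sub>1\<bar> \<le> \<bar>tan (pi * \<beta> / 2)\<bar>) \<and>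
     real_distribution \<mu> \<and>
     (\<forall>u. char \<mu> u =
        exp (- (of_real (\<bar>u\<bar> powr \<beta>) * (of_real A\<^sub>1 + \<i> * of_real (A\<^sub>2 * sgn u)))))"

definition normal_domain_of_attraction :: "real measure \<Rightarrow> real \<Rightarrow> real measure \<Rightarrow> bool" where
  "normal_domain_of_attraction \<nu> \<beta> \<mu> \<longleftrightarrow>
     weak_conv_m (\<lambda>n. distr (Pi\<^sub>M {..<n} (\<lambda>_. \<nu>)) borel
                        (\<lambda>x. real n powr (- 1 / \<beta>) * (\<Sum>k<n. x k))) \<mu>"

definition strongly_nonlattice :: "real measure \<Rightarrow> bool" where
  "strongly_nonlattice \<nu> \<longleftrightarrow> Limsup at_infinity (\<lambda>u. ereal (cmod (char \<nu> u))) < 1"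

definition norming :: "real \<Rightarrow> nat \<Rightarrow> real" where
  "norming \<beta> n = real n powr (1 / \<beta>) * ln (real n) powr ((\<beta> - 1) / \<beta>)"

text \<open>Densities are determined only almost everywhere; continuity selects the version for which
  pointwise values make sense.\<close>

definition continuous_density :: "real measure \<Rightarrow> (real \<Rightarrow> real) \<Rightarrow> (real \<Rightarrow> real) \<Rightarrow> bool" where
  "continuous_density \<mu> f C \<longleftrightarrow> continuous_on UNIV C \<and> (\<forall>x. 0 \<le> C x) \<and>
     distributed \<mu> lborel f (\<lambda>x. ennreal (C x))"

end

theory Submission
  imports Defs "HOL-Real_Asymp.Real_Asymp"
begin

text \<open>Given the walk, the characteristic function of \<open>Z\<^sub>n\<close> is the mean of
  \<open>\<Prod>\<^sub>y \<phi> (u * N\<^sub>n y)\<close>, where \<open>N\<^sub>n y\<close> is the number of visits to \<open>y\<close> before time \<open>n\<close> and \<open>\<phi>\<close> is the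
  characteristic function of the scenery. Near the origin \<open>\<phi>\<close> has the stable expansion, so with
  \<open>u = t / b\<^sub>n\<close> the product is close to \<open>exp (- \<bar>t\<bar> powr \<beta> * (A\<^sub>1 + i A\<^sub>2 sgn t) * V\<^sub>n)\<close> with
  \<open>V\<^sub>n = (\<Sum>\<^sub>y N\<^sub>n y powr \<beta>) / b\<^sub>n powr \<beta>\<close>.

  Fourier inversion on the torus shows that the Green function of the walk up to time \<open>n\<close> grows like
  \<open>ln n / (\<pi> A)\<close>, in the plane and in the Cauchy case alike. Hence the number of returns to a typical
  site is geometric with mean of order \<open>ln n\<close>, so that \<open>N\<^sub>n / ln n\<close> is asymptotically exponential with
  rate \<open>\<pi> A\<close>; a second moment argument gives a weak law for sums over the visited sites, and \<open>V\<^sub>n\<close>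
  converges in mean to \<open>\<Gamma>(\<beta> + 1) / (\<pi> A) powr (\<beta> - 1)\<close>.

  For the local limit the characteristic functions must be dominated. When \<open>\<bar>t\<bar>\<close> is at most
  \<open>b\<^sub>n n powr (- 1/4)\<close> Jensen's inequality turns a negative moment of \<open>V\<^sub>n\<close> into a first moment of
  \<open>\<Sum>\<^sub>y N\<^sub>n y ^ q\<close> (or of the range, if \<open>\<beta> > 1\<close>), which gives an integrable bound \<open>D / (1 + t\<^sup>2)\<close>. For larger
  \<open>t\<close> the strong non-lattice condition bounds every factor away from \<open>1\<close>, and more than
  \<open>n powr (3/4)\<close> sites are visited, so the contribution is smaller than every power of \<open>n\<close>. Trapezoidal test
  functions then transfer the convergence to intervals.\<close>

section \<open>Counting visits to the origin\<close>

text \<open>The steps only have to generate the lattice, so the walk may be periodic (simple random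
  walk is) and single return probabilities may oscillate. Only their sum is used. Its Abel means are
  governed by the single frequency of the torus where the characteristic function of a step is 1,
  and nonnegativity of the summands leads back from Abel means to partial sums. As a logarithm
  varies slowly, times may change by powers of \<open>ln n\<close> at no cost; most auxiliary time
  scales exploit this.

  Local times of different sites are strongly dependent. Sums over sites are therefore rewritten as
  sums over times, by counting at each time the visits still to come to the present site. Such a
  count depends on later steps only, has the law of the visits to the origin and, cut off after o(n)
  steps, is independent of the counts at distant times.

  The derivative of x^\<beta> is unbounded near 0 for \<beta> < 1 and near infinity for \<beta> > 1,
  so the weak law is proved for tame functionals and extended by moment bounds. The exponent 1/4
  serves all \<beta> \<le> 2 because the norming grows at least like n^(1/2).\<close>

lemma measure_bind_pmf_eq_integral:
  "measure (measure_pmf (bind_pmf P K)) A = (\<integral>x. measure (measure_pmf (K x)) A \<partial>measure_pmf P)"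
proof -
  have "emeasure (measure_pmf (bind_pmf P K)) A = (\<integral>\<^sup>+x. ennreal (measure (measure_pmf (K x)) A) \<partial>measure_pmf P)"
    unfolding emeasure_bind_pmf by (simp add: measure_pmf.emeasure_eq_measure)
  also have "\<dots> = ennreal (\<integral>x. measure (measure_pmf (K x)) A \<partial>measure_pmf P)"
    by (intro nn_integral_eq_integral measure_pmf.integrable_const_bound[where B=1]) auto
  finally have "ennreal (measure (measure_pmf (bind_pmf P K)) A)
      = ennreal (\<integral>x. measure (measure_pmf (K x)) A \<partial>measure_pmf P)"
    unfolding measure_pmf.emeasure_eq_measure .
  thus ?thesis
    by (simp add: integral_nonneg_AE)
qed

text \<open>A path is encoded by its start s and the list of its steps; time 0 counts as a visit
  when s = 0. With steps drawn from \<open>replicate_pmf\<close> the Markov property becomes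
  recursion on the head of the list.\<close>

fun visits :: "'a::ab_group_add \<Rightarrow> 'a list \<Rightarrow> nat" where
  "visits s [] = of_bool (s = 0)"
| "visits s (x # xs) = of_bool (s = 0) + visits (s + x) xs"

definition vtail :: "'a::ab_group_add pmf \<Rightarrow> nat \<Rightarrow> 'a \<Rightarrow> nat \<Rightarrow> real" where
  "vtail p m s j = measure (measure_pmf (replicate_pmf m p)) {xs. j \<le> visits s xs}"

text \<open>The expected number of visits, written as the sum of its tails: the Green function
  truncated at time m. A path of m steps has at most \<open>Suc m\<close> visits, so the sum is
  complete.\<close>

definition green :: "'a::ab_group_add pmf \<Rightarrow> nat \<Rightarrow> 'a \<Rightarrow> real" where
  "green p m s = (\<Sum>j=1..Suc m. vtail p m s j)"

text \<open>The start at the origin is itself the first visit, hence the 2: this is the probability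
  of no return within m steps.\<close>

abbreviation escape :: "'a::ab_group_add pmf \<Rightarrow> nat \<Rightarrow> real" where
  "escape p m \<equiv> 1 - vtail p m 0 2"

lemma vtail_0: "vtail p 0 s j = of_bool (j \<le> of_bool (s = 0))"
  by (auto simp: vtail_def indicator_def)

lemma vtail_Suc:
  "vtail p (Suc m) s j = (\<integral>x. vtail p m (s + x) (j - of_bool (s = 0)) \<partial>measure_pmf p)"
proof -
  have "vtail p (Suc m) s j = (\<integral>x. measure (measure_pmf (map_pmf ((#) x) (replicate_pmf m p))) {xs. j \<le> visits s xs} \<partial>measure_pmf p)"
    by (simp add: vtail_def measure_bind_pmf_eq_integral map_pmf_def)
  also have "\<dots> = (\<integral>x. vtail p m (s + x) (j - of_bool (s = 0)) \<partial>measure_pmf p)"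
    unfolding vtail_def
    by (intro Bochner_Integration.integral_cong refl, subst measure_map_pmf,
        rule arg_cong[where f="measure _"]) (auto simp: le_diff_conv)
  finally show ?thesis .
qed

lemma vtail_nonneg [simp]: "0 \<le> vtail p m s j"
  and vtail_le_1 [simp]: "vtail p m s j \<le> 1"
  by (auto simp: vtail_def)

lemma vtail_zero [simp]: "vtail p m s 0 = 1"
  by (simp add: vtail_def)

lemma integrable_vtail [simp]: "integrable (measure_pmf p) (\<lambda>x. vtail q m (f x) j)"
  by (intro measure_pmf.integrable_const_bound[where B=1]) auto

lemma visits_0_pos: "visits 0 xs > 0"
  by (cases xs) auto

lemma vtail_0_1 [simp]: "vtail p m 0 (Suc 0) = 1"
  by (simp add: vtail_def Suc_le_eq visits_0_pos)

lemma visits_le: "visits s xs \<le> Suc (length xs)"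
proof (induction xs arbitrary: s)
  case (Cons x xs)
  from Cons[of "s + x"] show ?case by (auto simp: of_bool_def)
qed simp

lemma vtail_eq_0: "Suc m < j \<Longrightarrow> vtail p m s j = 0"
proof -
  assume j: "Suc m < j"
  have "\<not> j \<le> visits s xs" if "length xs = m" for xs
    using visits_le[of s xs] j that by auto
  hence "set_pmf (replicate_pmf m p) \<inter> {xs. j \<le> visits s xs} = {}"
    by (auto simp: set_replicate_pmf)
  thus ?thesis
    unfolding vtail_def by (simp add: measure_pmf_zero_iff)
qed

lemma vtail_mono_Suc: "vtail p m s j \<le> vtail p (Suc m) s j"
proof (induction m arbitrary: s j)
  case 0
  show ?case
    by (cases "j \<le> of_bool (s = 0)") (auto simp: vtail_0 vtail_Suc)
next
  case (Suc m)
  show ?case unfolding vtail_Suc[of p "Suc m" s] vtail_Suc[of p m s]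
    by (intro integral_mono integrable_vtail Suc)
qed

lemma vtail_mono: "m \<le> n \<Longrightarrow> vtail p m s j \<le> vtail p n s j"
  by (rule lift_Suc_mono_le[of "\<lambda>m. vtail p m s j"]) (auto intro: vtail_mono_Suc)

text \<open>Markov property at the first hit of the origin: after it at most m steps are left.
  Induction on m does the work of a stopping time. For j = 0 nothing has to be hit and the bound
  would fail.\<close>

lemma vtail_le_hit:
  assumes "j \<ge> 1"
  shows "vtail p m s j \<le> vtail p m s 1 * vtail p m 0 j"
proof (induction m arbitrary: s)
  case 0
  show ?case using assms by (auto simp: vtail_0)
next
  case (Suc m)
  show ?case
  proof (cases "s = 0")
    case False
    hence "vtail p (Suc m) s j = (\<integral>x. vtail p m (s + x) j \<partial>measure_pmf p)"
      by (simp add: vtail_Suc)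
    also have "\<dots> \<le> (\<integral>x. vtail p m (s + x) 1 * vtail p m 0 j \<partial>measure_pmf p)"
      by (intro integral_mono Suc) auto
    also have "\<dots> = vtail p (Suc m) s 1 * vtail p m 0 j"
      using False by (simp add: vtail_Suc)
    also have "\<dots> \<le> vtail p (Suc m) s 1 * vtail p (Suc m) 0 j"
      by (intro mult_left_mono vtail_mono) auto
    finally show ?thesis .
  qed simp
qed

text \<open>Counterpart with separate budgets: m steps for the first hit, then l further steps for
  the j visits counted from there.\<close>

lemma vtail_ge_hit: "vtail p m s 1 * vtail p l 0 j \<le> vtail p (m + l) s j"
proof (induction m arbitrary: s)
  case 0
  show ?case by (auto simp: vtail_0)
next
  case (Suc m)
  show ?case
  proof (cases "s = 0")
    case False
    hence "vtail p (Suc m) s 1 * vtail p l 0 j = (\<integral>x. vtail p m (s + x) 1 * vtail p l 0 j \<partial>measure_pmf p)"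
      by (simp add: vtail_Suc)
    also have "\<dots> \<le> (\<integral>x. vtail p (m + l) (s + x) j \<partial>measure_pmf p)"
      by (intro integral_mono Suc) auto
    also have "\<dots> = vtail p (Suc m + l) s j"
      using False by (simp add: vtail_Suc)
    finally show ?thesis .
  qed (auto intro!: vtail_mono)
qed

lemma vtail_2: "vtail p (Suc m) 0 2 = (\<integral>x. vtail p m x 1 \<partial>measure_pmf p)"
  by (simp add: vtail_Suc numeral_2_eq_2)

text \<open>Each of the j returns has to happen within the whole horizon m, so the number of returns
  is dominated by a geometric variable.\<close>

lemma vtail_le_power: "vtail p m 0 (Suc j) \<le> vtail p m 0 2 ^ j"
proof (induction j)
  case (Suc j)
  show ?case
  proof (cases m)
    case (Suc m')
    have "vtail p m 0 (Suc (Suc j)) = (\<integral>x. vtail p m' x (Suc j) \<partial>measure_pmf p)"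
      by (simp add: vtail_Suc Suc)
    also have "\<dots> \<le> (\<integral>x. vtail p m' x 1 * vtail p m' 0 (Suc j) \<partial>measure_pmf p)"
      by (intro integral_mono vtail_le_hit) auto
    also have "\<dots> = vtail p m 0 2 * vtail p m' 0 (Suc j)"
      by (simp add: Suc vtail_2)
    also have "\<dots> \<le> vtail p m 0 2 * vtail p m 0 (Suc j)"
      using Suc by (intro mult_left_mono vtail_mono) auto
    also have "\<dots> \<le> vtail p m 0 2 * vtail p m 0 2 ^ j"
      using Suc.IH by (intro mult_left_mono) auto
    finally show ?thesis by simp
  qed (simp add: vtail_0)
qed simp

text \<open>If every return is granted its own l steps, the returns become independent trials that
  fit into \<open>j * l\<close> steps.\<close>

lemma vtail_ge_power: "vtail p l 0 2 ^ j \<le> vtail p (j * l) 0 (Suc j)"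
proof (induction j)
  case (Suc j)
  show ?case
  proof (cases l)
    case (Suc l')
    have "vtail p l 0 2 ^ Suc j \<le> vtail p l 0 2 * vtail p (j * l) 0 (Suc j)"
      using Suc.IH by (auto intro: mult_left_mono)
    also have "\<dots> = (\<integral>x. vtail p l' x 1 * vtail p (j * l) 0 (Suc j) \<partial>measure_pmf p)"
      by (simp add: Suc vtail_2)
    also have "\<dots> \<le> (\<integral>x. vtail p (l' + j * l) x (Suc j) \<partial>measure_pmf p)"
      by (intro integral_mono vtail_ge_hit) auto
    also have "\<dots> = vtail p (Suc (l' + j * l)) 0 (Suc (Suc j))"
      by (simp add: vtail_Suc)
    also have "Suc (l' + j * l) = Suc j * l" by (simp add: Suc)
    finally show ?thesis .
  qed (simp add: vtail_0)
qed simp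

text \<open>The dominating geometric variable has mean \<open>1 / escape\<close>, and cutting its
  series after \<open>Suc m\<close> terms only lowers it.\<close>

lemma escape_times_green: "escape p m * green p m 0 \<le> 1"
proof -
  have "green p m 0 = (\<Sum>j<Suc m. vtail p m 0 (Suc j))"
    unfolding green_def by (rule sum.reindex_bij_witness[of _ Suc "\<lambda>j. j - 1"]) auto
  also have "\<dots> \<le> (\<Sum>j<Suc m. vtail p m 0 2 ^ j)"
    by (intro sum_mono vtail_le_power)
  finally have "escape p m * green p m 0 \<le> escape p m * (\<Sum>j<Suc m. vtail p m 0 2 ^ j)"
    by (intro mult_left_mono) auto
  also have "\<dots> = 1 - vtail p m 0 2 ^ Suc m"
    by (simp only: one_diff_power_eq[symmetric])
  finally show ?thesis
    by (smt (verit) vtail_nonneg zero_le_power)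
qed

lemma green_ge_power_sum: "(\<Sum>i<j. vtail p l 0 2 ^ i) \<le> green p (j * l) 0"
proof (cases "l = 0")
  case True
  have "(\<Sum>i<j. vtail p l 0 2 ^ i) \<le> 1"
    using True by (cases j) (simp_all add: vtail_0 sum.lessThan_Suc_shift del: sum.lessThan_Suc)
  thus ?thesis using True by (simp add: green_def)
next
  case False
  have "(\<Sum>i<j. vtail p l 0 2 ^ i) \<le> (\<Sum>i<j. vtail p (j * l) 0 (Suc i))"
  proof (intro sum_mono)
    fix i assume "i \<in> {..<j}"
    hence "vtail p (i * l) 0 (Suc i) \<le> vtail p (j * l) 0 (Suc i)"
      by (intro vtail_mono) auto
    thus "vtail p l 0 2 ^ i \<le> vtail p (j * l) 0 (Suc i)"
      using vtail_ge_power[of p l i] by simp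
  qed
  also have "\<dots> \<le> (\<Sum>i<Suc (j * l). vtail p (j * l) 0 (Suc i))"
  proof (rule sum_mono2)
    have "j \<le> j * l" using False by simp
    thus "{..<j} \<subseteq> {..<Suc (j * l)}" by (intro lessThan_subset_iff[THEN iffD2]) linarith
  qed auto
  also have "\<dots> = green p (j * l) 0"
    unfolding green_def by (rule sum.reindex_bij_witness[of _ "\<lambda>j. j - 1" Suc]) auto
  finally show ?thesis .
qed

text \<open>Reverse of \<open>escape_times_green\<close> with the horizon stretched by j. The
  truncated geometric series misses \<open>r ^ j\<close>, and j times this power is at most the
  series itself, hence at most the Green function.\<close>

lemma escape_ge:
  assumes "j > 0"
  shows "escape p l * green p (j * l) 0 \<ge> 1 - green p (j * l) 0 / j"
proof -
  define r where "r = vtail p l 0 2"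
  have r: "0 \<le> r" "r \<le> 1" by (auto simp: r_def)
  have S: "(\<Sum>i<j. r ^ i) \<le> green p (j * l) 0"
    unfolding r_def by (rule green_ge_power_sum)
  have "real j * r ^ j = (\<Sum>i<j. r ^ j)" by simp
  also have "\<dots> \<le> (\<Sum>i<j. r ^ i)" using r by (intro sum_mono power_decreasing) auto
  also note S
  finally have "r ^ j \<le> green p (j * l) 0 / j"
    using assms by (simp add: field_simps)
  moreover have "1 - r ^ j = (1 - r) * (\<Sum>i<j. r ^ i)" by (rule one_diff_power_eq)
  moreover have "\<dots> \<le> (1 - r) * green p (j * l) 0" using r S by (intro mult_left_mono) auto
  ultimately show ?thesis by (simp add: r_def)
qed

lemma green_0: "green p 0 s = of_bool (s = 0)"
  by (simp add: green_def vtail_0)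

lemma green_Suc: "green p (Suc m) s = of_bool (s = 0) + (\<integral>x. green p m (s + x) \<partial>measure_pmf p)"
proof (cases "s = 0")
  case True
  have "green p (Suc m) s = (\<Sum>j=1..Suc (Suc m). \<integral>x. vtail p m x (j - 1) \<partial>measure_pmf p)"
    by (simp add: green_def vtail_Suc True del: sum.cl_ivl_Suc)
  also have "\<dots> = (\<Sum>j=0..Suc m. \<integral>x. vtail p m x j \<partial>measure_pmf p)"
    by (rule sum.reindex_bij_witness[of _ Suc "\<lambda>j. j - 1"]) auto
  also have "\<dots> = 1 + (\<Sum>j=1..Suc m. \<integral>x. vtail p m x j \<partial>measure_pmf p)"
    by (subst sum.atLeast_Suc_atMost) auto
  finally show ?thesis using True by (simp add: green_def)
next
  case False
  thus ?thesis
    by (simp add: green_def vtail_Suc vtail_eq_0)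
qed

lemma green_mono: "m \<le> n \<Longrightarrow> green p m s \<le> green p n s"
  unfolding green_def by (intro sum_mono2[THEN order.trans, rotated 3, OF sum_mono]) (auto intro: vtail_mono)

lemma green_nonneg: "0 \<le> green p m s"
  by (simp add: green_def sum_nonneg)

lemma green_ge_1: "1 \<le> green p m 0"
proof -
  have "1 = green p 0 0" by (simp add: green_0)
  also have "\<dots> \<le> green p m 0" by (rule green_mono) simp
  finally show ?thesis .
qed

lemma escape_asymp:
  assumes lam: "lam > 0"
    and G: "(\<lambda>n. green p n 0 / ln (real n)) \<longlonglongrightarrow> 1 / lam"
  shows "(\<lambda>n. escape p n * ln (real n)) \<longlonglongrightarrow> lam"
proof -
  \<comment> \<open>The square of the logarithm is large against the Green function, so that
    \<open>H l / j l\<close> vanishes, and yet \<open>ln (j l * l)\<close> is equivalent to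
    \<open>ln l\<close>.\<close>
  define j where "j = (\<lambda>l::nat. nat \<lceil>(ln (real l))\<^sup>2\<rceil>)"
  define H where "H = (\<lambda>l. green p (j l * l) 0)"
  have jl: "filterlim (\<lambda>l. j l * l) at_top sequentially" unfolding j_def by real_asymp
  have "(\<lambda>l. ln (real (j l * l)) / ln (real l)) \<longlonglongrightarrow> 1"
    unfolding j_def by real_asymp
  from tendsto_mult[OF filterlim_compose[OF G jl] this]
  have "(\<lambda>l. green p (j l * l) 0 / ln (real (j l * l)) * (ln (real (j l * l)) / ln (real l))) \<longlonglongrightarrow> 1 / lam"
    by simp
  moreover have "\<forall>\<^sub>F l in sequentially. ln (real (j l * l)) > 0"
    unfolding j_def by real_asymp
  ultimately have HL: "(\<lambda>l. H l / ln (real l)) \<longlonglongrightarrow> 1 / lam"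
    by (elim Lim_transform_eventually eventually_mono) (auto simp: H_def)
  have evln: "\<forall>\<^sub>F l in sequentially. ln (real l) > 0" by real_asymp
  have evj: "\<forall>\<^sub>F l in sequentially. j l > 0" unfolding j_def by real_asymp
  have "(\<lambda>l. ln (real l) / real (j l)) \<longlonglongrightarrow> 0" unfolding j_def by real_asymp
  from tendsto_mult[OF HL this] have "(\<lambda>l. H l / ln (real l) * (ln (real l) / real (j l))) \<longlonglongrightarrow> 0" by simp
  hence Hj: "(\<lambda>l. H l / real (j l)) \<longlonglongrightarrow> 0"
    by (rule Lim_transform_eventually) (use evln in eventually_elim, auto)
  have lower: "(\<lambda>l. (1 - H l / real (j l)) / (H l / ln (real l))) \<longlonglongrightarrow> (1 - 0) / (1 / lam)"
    by (intro tendsto_intros Hj HL) (use lam in auto)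
  have upper: "(\<lambda>l. 1 / (green p l 0 / ln (real l))) \<longlonglongrightarrow> 1 / (1 / lam)"
    by (intro tendsto_intros G) (use lam in auto)
  show ?thesis
  proof (rule tendsto_sandwich)
    show "\<forall>\<^sub>F l in sequentially. (1 - H l / real (j l)) / (H l / ln (real l)) \<le> escape p l * ln (real l)"
      using evln evj
    proof eventually_elim
      case (elim l)
      have "H l > 0" unfolding H_def using green_ge_1[of p "j l * l"] by linarith
      moreover have "1 - H l / real (j l) \<le> escape p l * H l"
        unfolding H_def using escape_ge[OF elim(2)] .
      ultimately have "(1 - H l / real (j l)) * (ln (real l) / H l) \<le> escape p l * H l * (ln (real l) / H l)"
        using elim by (intro mult_right_mono) auto
      also have "\<dots> = escape p l * ln (real l)" using \<open>H l > 0\<close> by simp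
      finally show ?case by simp
    qed
    show "\<forall>\<^sub>F l in sequentially. escape p l * ln (real l) \<le> 1 / (green p l 0 / ln (real l))"
      using evln
    proof eventually_elim
      case (elim l)
      have "green p l 0 > 0" using green_ge_1[of p l] by linarith
      hence "escape p l * ln (real l) = escape p l * green p l 0 * (ln (real l) / green p l 0)" by simp
      also have "\<dots> \<le> 1 * (ln (real l) / green p l 0)"
        using elim escape_times_green[of p l] \<open>green p l 0 > 0\<close> by (intro mult_right_mono) auto
      finally show ?case by simp
    qed
    show "(\<lambda>l. (1 - H l / real (j l)) / (H l / ln (real l))) \<longlonglongrightarrow> lam" using lower by simp
    show "(\<lambda>l. 1 / (green p l 0 / ln (real l))) \<longlonglongrightarrow> lam" using upper by simp
  qed
qed

text \<open>The tail lies between the j-th powers of the return probabilities for the horizons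
  \<open>m div j\<close> and \<open>m\<close>. The logarithms of both horizons are equivalent to L,
  and (1 - lam / L)^j tends to exp (- lam s) when j / L tends to s.\<close>

lemma vtail_asymp:
  fixes m j :: "nat \<Rightarrow> nat" and L :: "nat \<Rightarrow> real"
  assumes lam: "lam > 0"
    and esc: "(\<lambda>n. escape p n * ln (real n)) \<longlonglongrightarrow> lam"
    and m: "filterlim (\<lambda>n. m n div j n) at_top sequentially"
    and mL: "(\<lambda>n. ln (real (m n)) / L n) \<longlonglongrightarrow> 1"
    and mjL: "(\<lambda>n. ln (real (m n div j n)) / L n) \<longlonglongrightarrow> 1"
    and L: "filterlim L at_top sequentially"
    and jL: "(\<lambda>n. real (j n) / L n) \<longlonglongrightarrow> s"
  shows "(\<lambda>n. vtail p (m n) 0 (Suc (j n))) \<longlonglongrightarrow> exp (- lam * s)"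
proof -
  \<comment> \<open>Stated for an arbitrary horizon r because it is applied to both ends of the
    sandwich.\<close>
  have key: "(\<lambda>n. vtail p (r n) 0 2 ^ j n) \<longlonglongrightarrow> exp (- lam * s)"
    if r: "filterlim r at_top sequentially" and rL: "(\<lambda>n. ln (real (r n)) / L n) \<longlonglongrightarrow> 1" for r
  proof -
    define q where "q = (\<lambda>n. escape p (r n))"
    have Lpos: "\<forall>\<^sub>F n in sequentially. L n > 0" using L by (simp add: filterlim_at_top_dense)
    have rpos: "\<forall>\<^sub>F n in sequentially. ln (real (r n)) > 0"
      by (rule eventually_compose_filterlim[OF _ r]) real_asymp
    have "(\<lambda>n. q n * ln (real (r n)) / (ln (real (r n)) / L n)) \<longlonglongrightarrow> lam / 1"
      unfolding q_def by (intro tendsto_intros rL filterlim_compose[OF esc r]) auto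
    hence "(\<lambda>n. q n * ln (real (r n)) / (ln (real (r n)) / L n)) \<longlonglongrightarrow> lam" by simp
    hence qL: "(\<lambda>n. q n * L n) \<longlonglongrightarrow> lam"
      by (rule Lim_transform_eventually) (use Lpos rpos in eventually_elim, auto)
    have "(\<lambda>n. q n * L n * (real (j n) / L n)) \<longlonglongrightarrow> lam * s"
      by (intro tendsto_intros qL jL)
    hence qj: "(\<lambda>n. q n * real (j n)) \<longlonglongrightarrow> lam * s"
      by (rule Lim_transform_eventually) (use Lpos in eventually_elim, auto)
    have "(\<lambda>n. q n * L n * (1 / L n)) \<longlonglongrightarrow> lam * 0"
      by (intro tendsto_intros qL tendsto_divide_0[OF tendsto_const] filterlim_at_top_imp_at_infinity L)
    hence "(\<lambda>n. q n * L n * (1 / L n)) \<longlonglongrightarrow> 0" by simp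
    hence q0: "q \<longlonglongrightarrow> 0"
      by (rule Lim_transform_eventually) (use Lpos in eventually_elim, auto)
    have qpos: "\<forall>\<^sub>F n in sequentially. q n > 0"
    proof -
      have "\<forall>\<^sub>F n in sequentially. q n * L n > 0"
        using order_tendstoD(1)[OF qL lam] .
      thus ?thesis using Lpos by eventually_elim (simp add: zero_less_mult_iff)
    qed
    have "filterlim q (at_right 0) sequentially"
      using q0 qpos by (simp add: filterlim_at_right_to_0 tendsto_imp_filterlim_at_right)
    moreover have "((\<lambda>x::real. ln (1 - x) / x) \<longlongrightarrow> -1) (at_right 0)" by real_asymp
    ultimately have lnq: "(\<lambda>n. ln (1 - q n) / q n) \<longlonglongrightarrow> -1"
      by (rule filterlim_compose[rotated])
    have lim: "(\<lambda>n. exp (ln (1 - q n) / q n * (q n * real (j n)))) \<longlonglongrightarrow> exp (- 1 * (lam * s))"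
      by (intro tendsto_intros lnq qj)
    have "\<forall>\<^sub>F n in sequentially. q n < 1" using order_tendstoD(2)[OF q0, of 1] by simp
    with qpos have "\<forall>\<^sub>F n in sequentially. exp (ln (1 - q n) / q n * (q n * real (j n))) = vtail p (r n) 0 2 ^ j n"
    proof eventually_elim
      case q: (elim n)
      have "exp (ln (1 - q n) / q n * (q n * real (j n))) = exp (real (j n) * ln (1 - q n))"
        using q by (simp add: field_simps)
      also have "\<dots> = (1 - q n) ^ j n" using q by (subst exp_of_nat_mult) auto
      finally show "exp (ln (1 - q n) / q n * (q n * real (j n))) = vtail p (r n) 0 2 ^ j n"
        by (simp add: q_def)
    qed
    from Lim_transform_eventually[OF lim this] show ?thesis by simp
  qed
  have m': "filterlim m at_top sequentially"
    by (rule filterlim_at_top_mono[OF m]) auto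
  show ?thesis
  proof (rule tendsto_sandwich[OF _ _ key[OF m mjL] key[OF m' mL]])
    show "\<forall>\<^sub>F n in sequentially. vtail p (m n div j n) 0 2 ^ j n \<le> vtail p (m n) 0 (Suc (j n))"
      by (intro always_eventually allI order.trans[OF vtail_ge_power] vtail_mono) auto
    show "\<forall>\<^sub>F n in sequentially. vtail p (m n) 0 (Suc (j n)) \<le> vtail p (m n) 0 2 ^ j n"
      by (intro always_eventually allI vtail_le_power)
  qed
qed

section \<open>The Green function of a lattice walk\<close>

definition emb :: "int ^ 'd \<Rightarrow> real ^ 'd" where
  "emb x = (\<chi> i. real_of_int (x $ i))"

definition lchar :: "(int ^ 'd) pmf \<Rightarrow> real ^ 'd \<Rightarrow> complex" where
  "lchar p \<theta> = (\<integral>x. iexp (\<theta> \<bullet> emb x) \<partial>measure_pmf p)"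

abbreviation torus_box :: "(real ^ 'd) set" where
  "torus_box \<equiv> cbox (\<chi> i. - pi) (\<chi> i. pi)"

abbreviation torus :: "(real ^ 'd) measure" where
  "torus \<equiv> restrict_space lborel torus_box"

lemma emb_add: "emb (x + y) = emb x + emb y"
  by (simp add: emb_def vec_eq_iff)

lemma emb_0 [simp]: "emb 0 = 0"
  by (simp add: emb_def vec_eq_iff)

lemma emeasure_torus: "emeasure torus (torus_box :: (real ^ 'd) set) = ennreal ((2 * pi) ^ CARD('d))"
proof -
  have "emeasure lborel (torus_box :: (real ^ 'd) set) = ennreal (\<Prod>b\<in>Basis. ((\<chi> i. pi) - (\<chi> i. - pi) :: real ^ 'd) \<bullet> b)"
    by (rule emeasure_lborel_cbox) (auto simp: Basis_vec_def inner_axis)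
  also have "(\<Prod>b\<in>Basis. ((\<chi> i. pi) - (\<chi> i. - pi) :: real ^ 'd) \<bullet> b) = (\<Prod>b\<in>(Basis :: (real ^ 'd) set). 2 * pi)"
    by (intro prod.cong) (auto simp: Basis_vec_def inner_axis)
  finally show ?thesis
    by (simp add: emeasure_restrict_space)
qed

lemma finite_measure_torus: "finite_measure torus"
  by standard (simp add: space_restrict_space emeasure_torus del: ennreal_power)

lemma measure_torus: "measure torus (torus_box :: (real ^ 'd) set) = (2 * pi) ^ CARD('d)"
  unfolding measure_def emeasure_torus by (rule enn2real_ennreal) simp

lemma integrable_torus_bounded:
  fixes f :: "real ^ 'd \<Rightarrow> 'b::{banach, second_countable_topology}"
  assumes "f \<in> borel_measurable borel" "\<And>\<theta>. \<theta> \<in> torus_box \<Longrightarrow> norm (f \<theta>) \<le> B"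
  shows "integrable torus f"
proof -
  interpret finite_measure "torus :: (real ^ 'd) measure" by (rule finite_measure_torus)
  show ?thesis
    using assms
    by (intro integrable_const_bound[where B=B] measurable_restrict_space1)
       (auto simp: space_restrict_space)
qed

lemma integral_torus_bound:
  fixes f :: "real ^ 'd \<Rightarrow> complex"
  assumes "f \<in> borel_measurable borel" "\<And>\<theta>. \<theta> \<in> torus_box \<Longrightarrow> norm (f \<theta>) \<le> B"
  shows "norm (\<integral>\<theta>. f \<theta> \<partial>torus) \<le> B * (2 * pi) ^ CARD('d)"
proof -
  interpret finite_measure "torus :: (real ^ 'd) measure" by (rule finite_measure_torus)
  have "norm (\<integral>\<theta>. f \<theta> \<partial>torus) \<le> (\<integral>\<theta>. norm (f \<theta>) \<partial>torus)"
    by (rule integral_norm_bound)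
  also have "\<dots> \<le> (\<integral>\<theta>. B \<partial>(torus :: (real ^ 'd) measure))"
    by (intro integral_mono integrable_norm integrable_torus_bounded[OF assms] integrable_const)
      (auto simp: space_restrict_space intro: assms)
  also have "\<dots> = B * (2 * pi) ^ CARD('d)"
    by (simp add: space_restrict_space measure_torus)
  finally show ?thesis .
qed

lemma integral_lborel_prod:
  fixes f :: "'b::euclidean_space \<Rightarrow> real \<Rightarrow> complex"
  assumes int: "\<And>b. b \<in> Basis \<Longrightarrow> integrable lborel (f b)"
  shows "(\<integral>x. (\<Prod>b\<in>Basis. f b (x \<bullet> b)) \<partial>(lborel :: 'b measure)) = (\<Prod>b\<in>Basis. integral\<^sup>L lborel (f b))"
proof -
  interpret product_sigma_finite "\<lambda>_::'b. lborel :: real measure" by standard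
  have [measurable]: "\<And>b. b \<in> Basis \<Longrightarrow> f b \<in> borel_measurable borel"
    using int by (auto dest: borel_measurable_integrable)
  have "(\<integral>x. (\<Prod>b\<in>Basis. f b (x \<bullet> b)) \<partial>(lborel :: 'b measure))
    = (\<integral>y. (\<Prod>b\<in>Basis. f b ((\<Sum>b'\<in>Basis. y b' *\<^sub>R b') \<bullet> b)) \<partial>(\<Pi>\<^sub>M b\<in>Basis. lborel))"
    by (subst lborel_eq, subst integral_distr) auto
  also have "\<dots> = (\<integral>y. (\<Prod>b\<in>(Basis :: 'b set). f b (y b)) \<partial>(\<Pi>\<^sub>M b\<in>Basis. lborel))"
    by (intro Bochner_Integration.integral_cong prod.cong refl) simp
  also have "\<dots> = (\<Prod>b\<in>Basis. integral\<^sup>L lborel (f b))"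
    by (rule product_integral_prod) (auto intro: int)
  finally show ?thesis .
qed

lemma integral_iexp_period:
  fixes k :: int
  shows "integrable lborel (\<lambda>x. indicator {-pi..pi} x *\<^sub>R iexp (x * of_int k))"
    and "(\<integral>x. indicator {-pi..pi} x *\<^sub>R iexp (x * of_int k) \<partial>lborel) = (if k = 0 then 2 * pi else 0)"
proof -
  show int: "integrable lborel (\<lambda>x. indicator {-pi..pi} x *\<^sub>R iexp (x * of_int k))"
    by (rule borel_integrable_atLeastAtMost'[unfolded set_integrable_def]) (intro continuous_intros)
  show "(\<integral>x. indicator {-pi..pi} x *\<^sub>R iexp (x * of_int k) \<partial>lborel) = (if k = 0 then 2 * pi else 0)"
  proof (cases "k = 0")
    case False
    define F where "F = (\<lambda>x::real. iexp (x * of_int k) / (\<i> * of_int k))"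
    have "(\<integral>x. indicator {-pi..pi} x *\<^sub>R iexp (x * of_int k) \<partial>lborel) = F pi - F (-pi)"
    proof (rule integral_FTC_Icc)
      show "(F has_vector_derivative iexp (x * of_int k)) (at x within {-pi..pi})" for x
      proof -
        have "((\<lambda>z. exp (\<i> * (z * of_int k)) / (\<i> * of_int k)) has_field_derivative iexp (x * of_int k)) (at (of_real x))"
          using False by (auto intro!: derivative_eq_intros) (simp add: complex_eq_iff)
        from has_vector_derivative_real_field[OF this] show ?thesis by (simp add: F_def)
      qed
    qed (auto intro!: continuous_intros)
    also have "F pi = F (-pi)"
    proof -
      have "iexp (pi * of_int k) = iexp (- pi * of_int k) * exp (2 * of_int k * of_real pi * \<i>)"
        unfolding exp_add[symmetric] by (rule arg_cong[where f=exp]) (simp add: algebra_simps)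
      also have "exp (2 * of_int k * of_real pi * \<i>) = 1"
        using exp_integer_2pi[of "of_int k"] by simp
      finally have "iexp (pi * of_int k) = iexp (- pi * of_int k)" by (simp only: mult_1_right)
      thus ?thesis unfolding F_def by (simp only:)
    qed
    finally show ?thesis using False by simp
  qed (simp add: scaleR_conv_of_real)
qed

text \<open>Orthogonality of the characters of the lattice. The integral factorises over the
  coordinates, and a coordinate in which s does not vanish contributes a factor 0.\<close>

lemma integral_torus_iexp:
  fixes s :: "int ^ 'd"
  shows "(\<integral>\<theta>. iexp (\<theta> \<bullet> emb s) \<partial>torus) = of_bool (s = 0) * (2 * pi) ^ CARD('d)"
proof -
  define k where "k = (\<lambda>b::real ^ 'd. \<lfloor>emb s \<bullet> b\<rfloor>)"
  have k: "emb s \<bullet> b = of_int (k b)" if "b \<in> Basis" for b :: "real ^ 'd"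
    using that by (auto simp: Basis_vec_def k_def inner_axis emb_def)
  have "(\<integral>\<theta>. iexp (\<theta> \<bullet> emb s) \<partial>torus) = (\<integral>\<theta>. indicator torus_box \<theta> *\<^sub>R iexp (\<theta> \<bullet> emb s) \<partial>lborel)"
    by (subst integral_restrict_space) auto
  also have "\<dots> = (\<integral>\<theta>. (\<Prod>b\<in>Basis. indicator {-pi..pi} (\<theta> \<bullet> b) *\<^sub>R iexp ((\<theta> \<bullet> b) * of_int (k b))) \<partial>(lborel :: (real ^ 'd) measure))"
  proof (intro Bochner_Integration.integral_cong refl)
    fix \<theta> :: "real ^ 'd"
    have "\<theta> \<bullet> emb s = (\<Sum>b\<in>Basis. (\<theta> \<bullet> b) * of_int (k b))"
      by (subst euclidean_inner) (auto intro!: sum.cong simp: k)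
    hence "iexp (\<theta> \<bullet> emb s) = (\<Prod>b\<in>Basis. iexp ((\<theta> \<bullet> b) * of_int (k b)))"
      by (simp add: sum_distrib_left exp_sum)
    moreover have "(indicator torus_box \<theta> :: real) = (\<Prod>b\<in>Basis. indicator {-pi..pi} (\<theta> \<bullet> b))"
    proof (cases "\<theta> \<in> torus_box")
      case True
      have "(\<Prod>b\<in>Basis. indicator {-pi..pi} (\<theta> \<bullet> b)) = (1 :: real)"
        by (rule prod.neutral) (use True in \<open>auto simp: mem_box Basis_vec_def inner_axis\<close>)
      thus ?thesis using True by simp
    next
      case False
      have const: "(\<chi> i. c) \<bullet> b = c" if "b \<in> Basis" for b :: "real ^ 'd" and c :: real
        using that by (auto simp: Basis_vec_def inner_axis)
      from False obtain b where "b \<in> Basis" "\<theta> \<bullet> b \<notin> {-pi..pi}"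
        by (auto simp: mem_box const)
      thus ?thesis using False by (auto intro!: prod_zero[symmetric] bexI[of _ b])
    qed
    ultimately show "indicator torus_box \<theta> *\<^sub>R iexp (\<theta> \<bullet> emb s)
        = (\<Prod>b\<in>Basis. indicator {-pi..pi} (\<theta> \<bullet> b) *\<^sub>R iexp ((\<theta> \<bullet> b) * of_int (k b)))"
      by (simp add: scaleR_conv_of_real prod.distrib)
  qed
  also have "\<dots> = (\<Prod>b\<in>(Basis :: (real ^ 'd) set). if k b = 0 then 2 * pi else 0)"
    unfolding integral_lborel_prod[of "\<lambda>b x. indicator {-pi..pi} x *\<^sub>R iexp (x * of_int (k b))", OF integral_iexp_period(1)]
      integral_iexp_period(2) by (simp only: of_real_prod)
  also have "\<dots> = of_bool (s = 0) * (2 * pi) ^ CARD('d)"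
  proof (cases "s = 0")
    case True
    thus ?thesis by (simp add: k_def)
  next
    case False
    then obtain i where i: "s $ i \<noteq> 0" by (auto simp: vec_eq_iff)
    hence "k (axis i 1) \<noteq> 0" by (simp add: k_def inner_axis emb_def)
    hence "(\<Prod>b\<in>(Basis :: (real ^ 'd) set). if k b = 0 then 2 * pi else 0) = 0"
      by (intro prod_zero) (auto simp: Basis_vec_def)
    thus ?thesis using False by simp
  qed
  finally show ?thesis by simp
qed

section \<open>Fourier formula for the Green function\<close>

lemma continuous_lchar:
  fixes p :: "(int ^ 'd) pmf"
  shows "continuous_on UNIV (lchar p)"
  unfolding continuous_on_eq_continuous_at[OF open_UNIV]
proof
  fix \<theta> :: "real ^ 'd"
  show "isCont (lchar p) \<theta>"
    unfolding continuous_at_sequentially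
  proof safe
    fix u assume u: "u \<longlonglongrightarrow> \<theta>"
    show "(lchar p \<circ> u) \<longlonglongrightarrow> lchar p \<theta>"
      unfolding lchar_def comp_def
      by (rule integral_dominated_convergence[where w="\<lambda>_. 1"])
         (auto intro!: AE_I2 tendsto_intros u)
  qed
qed

lemma norm_lchar_le: "norm (lchar p \<theta>) \<le> 1"
proof -
  have "norm (lchar p \<theta>) \<le> (\<integral>x. norm (iexp (\<theta> \<bullet> emb x)) \<partial>measure_pmf p)"
    unfolding lchar_def by (rule integral_norm_bound)
  thus ?thesis by simp
qed

lemma borel_measurable_lchar [measurable]: "lchar p \<in> borel_measurable borel"
  by (rule borel_measurable_continuous_onI[OF continuous_lchar])

text \<open>A first step on the probabilistic side is one more factor \<open>lchar\<close> on the
  Fourier side. The start s stays arbitrary in the induction because the first step moves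
  it.\<close>

lemma green_eq_integral:
  fixes p :: "(int ^ 'd) pmf"
  shows "(2 * pi) ^ CARD('d) * green p m s = (\<integral>\<theta>. iexp (\<theta> \<bullet> emb s) * (\<Sum>k\<le>m. lchar p \<theta> ^ k) \<partial>torus)"
proof (induction m arbitrary: s)
  case 0
  show ?case by (simp add: green_0 integral_torus_iexp)
next
  case (Suc m)
  interpret T: finite_measure "torus :: (real ^ 'd) measure" by (rule finite_measure_torus)
  interpret P: pair_sigma_finite "measure_pmf p" "torus :: (real ^ 'd) measure" by standard
  interpret PF: finite_measure "measure_pmf p \<Otimes>\<^sub>M (torus :: (real ^ 'd) measure)"
    by (rule finite_measure_pair_measure) (auto intro: measure_pmf.finite_measure_axioms finite_measure_torus)
  define K where "K = (\<lambda>\<theta>. \<Sum>k\<le>m. lchar p \<theta> ^ k)"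
  have [measurable]: "K \<in> borel_measurable borel" unfolding K_def by measurable
  have K_le: "norm (K \<theta>) \<le> Suc m" for \<theta>
  proof -
    have "norm (K \<theta>) \<le> (\<Sum>k\<le>m. norm (lchar p \<theta> ^ k))" unfolding K_def by (rule norm_sum)
    also have "\<dots> \<le> (\<Sum>k\<le>m. 1)"
      by (intro sum_mono) (auto simp: norm_power intro!: power_le_one norm_lchar_le)
    finally show ?thesis by simp
  qed
  have KS: "(\<Sum>k\<le>Suc m. lchar p \<theta> ^ k) = 1 + lchar p \<theta> * K \<theta>" for \<theta>
    unfolding K_def by (subst sum.atMost_Suc_shift) (simp add: sum_distrib_left)
  have meas: "(\<lambda>x. x \<bullet> emb s) \<in> borel_measurable borel" for s :: "int ^ 'd" by measurable
  have [measurable]: "(\<lambda>z. iexp (snd z \<bullet> emb (s + fst z)) * K (snd z)) \<in> borel_measurable (measure_pmf p \<Otimes>\<^sub>M torus)"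
  proof -
    have [measurable]: "snd \<in> measurable (measure_pmf p \<Otimes>\<^sub>M (torus :: (real ^ 'd) measure)) borel"
      by (rule measurable_compose[OF measurable_snd measurable_restrict_space1]) simp
    have [measurable]: "(\<lambda>z. emb (s + fst z)) \<in> measurable (measure_pmf p \<Otimes>\<^sub>M (torus :: (real ^ 'd) measure)) borel"
      by (rule measurable_compose[OF measurable_fst]) simp
    show ?thesis by measurable
  qed
  have int: "integrable (measure_pmf p \<Otimes>\<^sub>M torus) (\<lambda>z. iexp (snd z \<bullet> emb (s + fst z)) * K (snd z))"
    by (rule PF.integrable_const_bound[where B="Suc m"]) (auto simp: norm_mult intro!: AE_I2 K_le[simplified])
  have "(\<integral>\<theta>. iexp (\<theta> \<bullet> emb s) * (\<Sum>k\<le>Suc m. lchar p \<theta> ^ k) \<partial>torus)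
     = (\<integral>\<theta>. iexp (\<theta> \<bullet> emb s) + (\<integral>x. iexp (\<theta> \<bullet> emb (s + x)) * K \<theta> \<partial>measure_pmf p) \<partial>torus)"
  proof (intro Bochner_Integration.integral_cong refl)
    fix \<theta> :: "real ^ 'd"
    have "(\<integral>x. iexp (\<theta> \<bullet> emb (s + x)) * K \<theta> \<partial>measure_pmf p) = iexp (\<theta> \<bullet> emb s) * lchar p \<theta> * K \<theta>"
    proof -
      have "(\<lambda>x. iexp (\<theta> \<bullet> emb (s + x)) * K \<theta>) = (\<lambda>x. iexp (\<theta> \<bullet> emb s) * K \<theta> * iexp (\<theta> \<bullet> emb x))"
        by (simp add: fun_eq_iff emb_add inner_add_right exp_add distrib_left)
      thus ?thesis by (simp add: lchar_def)
    qed
    thus "iexp (\<theta> \<bullet> emb s) * (\<Sum>k\<le>Suc m. lchar p \<theta> ^ k)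
      = iexp (\<theta> \<bullet> emb s) + (\<integral>x. iexp (\<theta> \<bullet> emb (s + x)) * K \<theta> \<partial>measure_pmf p)"
      by (simp only: KS) (simp add: algebra_simps)
  qed
  also have "\<dots> = (\<integral>\<theta>. iexp (\<theta> \<bullet> emb s) \<partial>torus) + (\<integral>\<theta>. (\<integral>x. iexp (\<theta> \<bullet> emb (s + x)) * K \<theta> \<partial>measure_pmf p) \<partial>torus)"
  proof (rule Bochner_Integration.integral_add)
    show "integrable torus (\<lambda>\<theta>::real^'d. iexp (\<theta> \<bullet> emb s))"
      by (rule integrable_torus_bounded[where B=1]) auto
    show "integrable torus (\<lambda>\<theta>. \<integral>x. iexp (\<theta> \<bullet> emb (s + x)) * K \<theta> \<partial>measure_pmf p)"
      using P.integrable_snd[of "\<lambda>x \<theta>. iexp (\<theta> \<bullet> emb (s + x)) * K \<theta>"] int by (simp add: case_prod_beta')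
  qed
  also have "(\<integral>\<theta>. (\<integral>x. iexp (\<theta> \<bullet> emb (s + x)) * K \<theta> \<partial>measure_pmf p) \<partial>torus)
     = (\<integral>x. (\<integral>\<theta>. iexp (\<theta> \<bullet> emb (s + x)) * K \<theta> \<partial>torus) \<partial>measure_pmf p)"
    using P.Fubini_integral[of "\<lambda>x \<theta>. iexp (\<theta> \<bullet> emb (s + x)) * K \<theta>"] int by (simp add: case_prod_beta')
  also have "\<dots> = (\<integral>x. complex_of_real ((2 * pi) ^ CARD('d) * green p m (s + x)) \<partial>measure_pmf p)"
    by (simp add: K_def Suc[symmetric])
  also have "\<dots> = (2 * pi) ^ CARD('d) * (\<integral>x. green p m (s + x) \<partial>measure_pmf p)"
    by (subst integral_complex_of_real) simp
  finally show ?case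
    by (simp add: integral_torus_iexp green_Suc algebra_simps of_bool_def)
qed

section \<open>Abel sums of the return probabilities\<close>

definition return_prob :: "(int ^ 'd) pmf \<Rightarrow> nat \<Rightarrow> real" where
  "return_prob p k = Re (\<integral>\<theta>. lchar p \<theta> ^ k \<partial>torus) / (2 * pi) ^ CARD('d)"

text \<open>The sum of (1 - \<epsilon>)^k times the k-th return probability, carried out under the
  integral as a geometric series. The damping keeps the denominator at distance at least \<epsilon>
  from 0.\<close>

definition abel_green :: "(int ^ 'd) pmf \<Rightarrow> real \<Rightarrow> real" where
  "abel_green p \<epsilon> = Re (\<integral>\<theta>. 1 / (1 - of_real (1 - \<epsilon>) * lchar p \<theta>) \<partial>torus) / (2 * pi) ^ CARD('d)"

lemma norm_lchar_power_le: "norm (lchar p \<theta> ^ k) \<le> 1"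
  by (auto simp: norm_power intro!: power_le_one norm_lchar_le)

lemma integrable_lchar_power: "integrable torus (\<lambda>\<theta>. lchar p \<theta> ^ k)"
  by (rule integrable_torus_bounded[where B=1]) (auto simp: norm_lchar_power_le)

lemma green_eq_sum:
  fixes p :: "(int ^ 'd) pmf"
  shows "green p m 0 = (\<Sum>k\<le>m. return_prob p k)"
proof -
  have "complex_of_real ((2 * pi) ^ CARD('d) * green p m 0) = (\<Sum>k\<le>m. \<integral>\<theta>. lchar p \<theta> ^ k \<partial>torus)"
    unfolding green_eq_integral using integrable_lchar_power[of p]
    by (simp add: emb_def zero_vec_def[symmetric] integral_sum)
  from arg_cong[OF this, of Re] have "(2 * pi) ^ CARD('d) * green p m 0 = (\<Sum>k\<le>m. Re (\<integral>\<theta>. lchar p \<theta> ^ k \<partial>torus))"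
    by simp
  thus ?thesis
    by (simp add: return_prob_def sum_divide_distrib[symmetric] field_simps)
qed

text \<open>The defining integral does not display its sign. It comes from the probabilistic side:
  the return probabilities are the increments of \<open>green\<close>, which is monotone in
  time.\<close>

lemma return_prob_nonneg: "0 \<le> return_prob p k"
proof (cases k)
  case 0
  have "green p 0 0 = return_prob p 0" by (simp add: green_eq_sum)
  thus ?thesis using 0 green_nonneg[of p 0 0] by simp
next
  case (Suc m)
  have "green p (Suc m) 0 = green p m 0 + return_prob p k" by (simp add: green_eq_sum Suc)
  thus ?thesis using green_mono[of m "Suc m" p 0] by simp
qed

lemma norm_one_minus_lchar_ge:
  assumes "0 \<le> r" "r < 1"
  shows "norm (1 - of_real r * lchar p \<theta>) \<ge> 1 - r"
proof -
  have "norm (of_real r * lchar p \<theta>) \<le> r"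
    using norm_lchar_le[of p \<theta>] assms by (simp add: norm_mult mult_left_le)
  moreover have "norm (1 :: complex) - norm (of_real r * lchar p \<theta>) \<le> norm (1 - of_real r * lchar p \<theta>)"
    by (rule norm_triangle_ineq2)
  ultimately show ?thesis by simp
qed

text \<open>Tail of the geometric series under the integral, with a denominator of modulus at least
  \<epsilon>.\<close>

lemma abel_partial_sum:
  fixes p :: "(int ^ 'd) pmf"
  assumes "0 < \<epsilon>" "\<epsilon> < 1"
  shows "\<bar>(\<Sum>k\<le>n. (1 - \<epsilon>) ^ k * return_prob p k) - abel_green p \<epsilon>\<bar> \<le> (1 - \<epsilon>) ^ Suc n / \<epsilon>"
proof -
  define r where "r = 1 - \<epsilon>"
  have r: "0 < r" "r < 1" using assms by (auto simp: r_def)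
  define D where "D = (\<lambda>\<theta>. 1 - of_real r * lchar p \<theta>)"
  have D: "norm (D \<theta>) \<ge> \<epsilon>" for \<theta>
    using norm_one_minus_lchar_ge[of r p \<theta>] r by (simp add: D_def r_def)
  have D0: "D \<theta> \<noteq> 0" for \<theta> using D[of \<theta>] assms by auto
  have [measurable]: "D \<in> borel_measurable borel" unfolding D_def by measurable
  have eq: "(\<Sum>k\<le>n. of_real (r ^ k) * lchar p \<theta> ^ k) - 1 / D \<theta> = - ((of_real r * lchar p \<theta>) ^ Suc n / D \<theta>)" for \<theta>
  proof -
    have "1 - (of_real r * lchar p \<theta>) ^ Suc n = D \<theta> * (\<Sum>k\<le>n. (of_real r * lchar p \<theta>) ^ k)"
      unfolding D_def one_diff_power_eq lessThan_Suc_atMost ..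
    hence "(\<Sum>k\<le>n. (of_real r * lchar p \<theta>) ^ k) = (1 - (of_real r * lchar p \<theta>) ^ Suc n) / D \<theta>"
      using D0[of \<theta>] by (simp add: field_simps)
    thus ?thesis by (simp add: power_mult_distrib diff_divide_distrib)
  qed
  have "(\<Sum>k\<le>n. of_real (r ^ k) * (\<integral>\<theta>. lchar p \<theta> ^ k \<partial>torus)) = (\<integral>\<theta>. (\<Sum>k\<le>n. of_real (r ^ k) * lchar p \<theta> ^ k) \<partial>torus)"
    using integrable_lchar_power[of p] by (simp add: integral_sum)
  moreover have "integrable torus (\<lambda>\<theta>. 1 / D \<theta>)"
    using D assms by (intro integrable_torus_bounded[where B="1 / \<epsilon>"]) (auto simp: norm_divide intro!: divide_left_mono mult_pos_pos order.strict_trans2[OF _ D])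
  ultimately have "(\<Sum>k\<le>n. of_real (r ^ k) * (\<integral>\<theta>. lchar p \<theta> ^ k \<partial>torus)) - (\<integral>\<theta>. 1 / D \<theta> \<partial>torus)
    = (\<integral>\<theta>. - ((of_real r * lchar p \<theta>) ^ Suc n / D \<theta>) \<partial>torus)"
    unfolding eq[symmetric] using integrable_lchar_power[of p]
    by (subst Bochner_Integration.integral_diff) auto
  also have "norm \<dots> \<le> r ^ Suc n / \<epsilon> * (2 * pi) ^ CARD('d)"
  proof (rule integral_torus_bound)
    fix \<theta> :: "real ^ 'd"
    have "norm ((of_real r * lchar p \<theta>) ^ Suc n) \<le> r ^ Suc n"
      using mult_left_mono[OF norm_lchar_power_le[of p \<theta> "Suc n"], of "r ^ Suc n"] r
      by (simp only: power_mult_distrib norm_mult norm_power norm_of_real) simp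
    thus "norm (- ((of_real r * lchar p \<theta>) ^ Suc n / D \<theta>)) \<le> r ^ Suc n / \<epsilon>"
      unfolding norm_minus_cancel norm_divide using D assms r by (intro frac_le) auto
  qed measurable
  finally have "\<bar>Re ((\<Sum>k\<le>n. of_real (r ^ k) * (\<integral>\<theta>. lchar p \<theta> ^ k \<partial>torus)) - (\<integral>\<theta>. 1 / D \<theta> \<partial>torus))\<bar> \<le> r ^ Suc n / \<epsilon> * (2 * pi) ^ CARD('d)"
    by (rule order.trans[OF abs_Re_le_cmod])
  moreover have "Re ((\<Sum>k\<le>n. of_real (r ^ k) * (\<integral>\<theta>. lchar p \<theta> ^ k \<partial>torus)) - (\<integral>\<theta>. 1 / D \<theta> \<partial>torus))
     = ((\<Sum>k\<le>n. r ^ k * return_prob p k) - abel_green p \<epsilon>) * (2 * pi) ^ CARD('d)"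
    by (simp add: return_prob_def abel_green_def r_def D_def left_diff_distrib sum_distrib_right flip: of_real_power)
  ultimately have "\<bar>(\<Sum>k\<le>n. r ^ k * return_prob p k) - abel_green p \<epsilon>\<bar> * (2 * pi) ^ CARD('d) \<le> r ^ Suc n / \<epsilon> * (2 * pi) ^ CARD('d)"
    by (simp only: abs_mult abs_of_pos[of "(2 * pi) ^ CARD('d)"] zero_less_power pi_gt_zero zero_less_mult_iff) simp
  thus ?thesis
    unfolding r_def by (rule mult_right_le_imp_le) simp
qed

text \<open>An elementary Tauberian argument: the terms are nonnegative and the growth is
  logarithmic, so the damping may differ from 1 / n by powers of \<open>ln n\<close> without
  changing \<open>ln (1 / \<epsilon>)\<close> to first order.\<close>

lemma green_asymp_of_abel:
  fixes p :: "(int ^ 'd) pmf"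
  assumes A: "((\<lambda>\<epsilon>. abel_green p \<epsilon> / ln (1 / \<epsilon>)) \<longlongrightarrow> L) (at_right 0)"
  shows "(\<lambda>n. green p n 0 / ln (real n)) \<longlonglongrightarrow> L"
proof (rule tendsto_sandwich)
  \<comment> \<open>With u the damping is invisible up to time n, (1 - u)^n tends to 1, which gives
    the upper bound. With v the terms beyond n are negligible, since (1 - v)^n is about exp (- (ln
    n)^2), which gives the lower bound.\<close>
  define u where "u = (\<lambda>n::nat. 1 / (real n * ln (real n)))"
  define v where "v = (\<lambda>n::nat. (ln (real n))\<^sup>2 / real n)"
  have u: "filterlim u (at_right 0) sequentially" unfolding u_def by real_asymp
  have v: "filterlim v (at_right 0) sequentially" unfolding v_def by real_asymp
  have Au: "(\<lambda>n. abel_green p (u n) / ln (1 / u n)) \<longlonglongrightarrow> L"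
    by (rule filterlim_compose[OF A u])
  have Av: "(\<lambda>n. abel_green p (v n) / ln (1 / v n)) \<longlonglongrightarrow> L"
    by (rule filterlim_compose[OF A v])
  have ulim: "(\<lambda>n. ln (1 / u n) / ln (real n)) \<longlonglongrightarrow> 1" unfolding u_def by real_asymp
  have vlim: "(\<lambda>n. ln (1 / v n) / ln (real n)) \<longlonglongrightarrow> 1" unfolding v_def by real_asymp
  have upow: "(\<lambda>n. exp (real n * ln (1 - u n))) \<longlonglongrightarrow> 1" unfolding u_def by real_asymp
  have verr: "(\<lambda>n. (exp (real n * ln (1 - v n)) / v n + exp (real n * ln (1 - v n)) / v n) / ln (real n)) \<longlonglongrightarrow> 0"
    unfolding v_def by real_asymp
  have ev: "\<forall>\<^sub>F n in sequentially. 0 < u n \<and> u n < 1 \<and> 0 < v n \<and> v n < 1 \<and> ln (real n) > 0 \<and> ln (1 / u n) > 0 \<and> ln (1 / v n) > 0 \<and> n > 0"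
    unfolding u_def v_def by (intro eventually_conj) real_asymp+
  have pw: "(1 - e) ^ n = exp (real n * ln (1 - e))" if "e < 1" for e :: real and n
    using that by (subst exp_of_nat_mult) simp
  show "(\<lambda>n. abel_green p (v n) / ln (1 / v n) * (ln (1 / v n) / ln (real n))
      - (exp (real n * ln (1 - v n)) / v n + exp (real n * ln (1 - v n)) / v n) / ln (real n)) \<longlonglongrightarrow> L"
    using tendsto_diff[OF tendsto_mult[OF Av vlim] verr] by simp
  show "(\<lambda>n. abel_green p (u n) / ln (1 / u n) * (ln (1 / u n) / ln (real n)) / exp (real n * ln (1 - u n))) \<longlonglongrightarrow> L"
    using tendsto_divide[OF tendsto_mult[OF Au ulim] upow] by simp
  show "\<forall>\<^sub>F n in sequentially. abel_green p (v n) / ln (1 / v n) * (ln (1 / v n) / ln (real n))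
      - (exp (real n * ln (1 - v n)) / v n + exp (real n * ln (1 - v n)) / v n) / ln (real n) \<le> green p n 0 / ln (real n)"
    using ev
  proof eventually_elim
    case (elim n)
    have "abel_green p (v n) - (1 - v n) ^ Suc n / v n \<le> (\<Sum>k\<le>n. (1 - v n) ^ k * return_prob p k)"
      using abel_partial_sum[of "v n" p n] elim by linarith
    also have "\<dots> \<le> green p n 0"
      unfolding green_eq_sum using elim
      by (intro sum_mono mult_left_le_one_le) (auto simp: return_prob_nonneg intro!: power_le_one)
    finally have "abel_green p (v n) - (1 - v n) ^ Suc n / v n \<le> green p n 0" .
    moreover have "(1 - v n) ^ Suc n / v n \<le> (1 - v n) ^ n / v n"
      using elim by (intro divide_right_mono power_decreasing) auto
    moreover have "0 \<le> (1 - v n) ^ n / v n" using elim by simp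
    ultimately have "abel_green p (v n) - ((1 - v n) ^ n / v n + (1 - v n) ^ n / v n) \<le> green p n 0"
      by linarith
    hence "(abel_green p (v n) - ((1 - v n) ^ n / v n + (1 - v n) ^ n / v n)) / ln (real n) \<le> green p n 0 / ln (real n)"
      using elim by (intro divide_right_mono) auto
    thus ?case using elim by (simp add: pw diff_divide_distrib)
  qed
  show "\<forall>\<^sub>F n in sequentially. green p n 0 / ln (real n) \<le> abel_green p (u n) / ln (1 / u n) * (ln (1 / u n) / ln (real n)) / exp (real n * ln (1 - u n))"
    using ev
  proof eventually_elim
    case (elim n)
    have lim: "(\<lambda>N. (\<Sum>k\<le>N. (1 - u n) ^ k * return_prob p k)) \<longlonglongrightarrow> abel_green p (u n)"
    proof (rule LIM_zero_cancel, rule Lim_null_comparison)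
      show "\<forall>\<^sub>F N in sequentially. norm ((\<Sum>k\<le>N. (1 - u n) ^ k * return_prob p k) - abel_green p (u n)) \<le> (1 - u n) ^ Suc N / u n"
        using abel_partial_sum[of "u n" p] elim by auto
      have "(\<lambda>N. (1 - u n) ^ Suc N) \<longlonglongrightarrow> 0"
        by (rule LIMSEQ_Suc, rule LIMSEQ_realpow_zero) (use elim in auto)
      from tendsto_divide[OF this tendsto_const, of "u n"] elim
      show "(\<lambda>N. (1 - u n) ^ Suc N / u n) \<longlonglongrightarrow> 0" by simp
    qed
    have "(1 - u n) ^ n * green p n 0 = (\<Sum>k\<le>n. (1 - u n) ^ n * return_prob p k)"
      by (simp add: green_eq_sum sum_distrib_left)
    also have "\<dots> \<le> (\<Sum>k\<le>n. (1 - u n) ^ k * return_prob p k)"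
      using elim by (intro sum_mono mult_right_mono power_decreasing) (auto simp: return_prob_nonneg)
    also have "\<dots> \<le> abel_green p (u n)"
      using elim by (intro incseq_le[OF _ lim] incseq_SucI) (auto simp: return_prob_nonneg)
    finally have "green p n 0 \<le> abel_green p (u n) / (1 - u n) ^ n"
      using elim by (simp add: field_simps)
    hence "green p n 0 / ln (real n) \<le> abel_green p (u n) / (1 - u n) ^ n / ln (real n)"
      using elim by (intro divide_right_mono) auto
    thus ?case using elim by (simp add: pw field_simps)
  qed
qed

text \<open>The image of Lebesgue measure under q has constant density c on [0, \<delta>], so the
  integral is that of c / (\<epsilon> + r) over r. Linear growth of the sublevel volumes is what a
  quadratic form in the plane and a multiple of the norm on the line have in common; it is the
  source of the logarithm.\<close>

lemma integral_radial:
  fixes q :: "'b::euclidean_space \<Rightarrow> real"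
  assumes q [measurable]: "q \<in> borel_measurable borel" and q0: "\<And>\<theta>. 0 \<le> q \<theta>"
    and vol: "\<And>r. 0 \<le> r \<Longrightarrow> emeasure lborel {\<theta>. q \<theta> \<le> r} = ennreal (c * r)"
    and c: "c > 0" and \<delta>: "\<delta> > 0" and \<epsilon>: "\<epsilon> > 0"
  shows "integrable (restrict_space lborel {\<theta>. q \<theta> \<le> \<delta>}) (\<lambda>\<theta>. 1 / (\<epsilon> + q \<theta>))"
    and "(\<integral>\<theta>. 1 / (\<epsilon> + q \<theta>) \<partial>restrict_space lborel {\<theta>. q \<theta> \<le> \<delta>}) = c * ln ((\<epsilon> + \<delta>) / \<epsilon>)"
proof -
  let ?R = "restrict_space lborel {\<theta>. q \<theta> \<le> \<delta>}"
  have meas: "{\<theta>. q \<theta> \<le> r} \<in> sets borel" for r by measurable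
  have qR [measurable]: "q \<in> measurable ?R borel" by (rule measurable_restrict_space1) simp
  have eq: "distr ?R borel q = density lborel (\<lambda>x. ennreal (c * indicator {0..\<delta>} x))"
  proof (rule measure_eqI_lessThan)
    have 1: "emeasure (distr ?R borel q) {x<..} = ennreal (c * (if x < 0 then \<delta> else if x \<le> \<delta> then \<delta> - x else 0))" for x
    proof -
      have "emeasure (distr ?R borel q) {x<..} = emeasure ?R (q -` {x<..} \<inter> space ?R)"
        by (rule emeasure_distr) auto
      also have "q -` {x<..} \<inter> space ?R = {\<theta>. q \<theta> \<le> \<delta>} - {\<theta>. q \<theta> \<le> x}"
        by (auto simp: space_restrict_space)
      also have "emeasure ?R \<dots> = emeasure lborel ({\<theta>. q \<theta> \<le> \<delta>} - {\<theta>. q \<theta> \<le> x})"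
        by (rule emeasure_restrict_space) auto
      also have "\<dots> = ennreal (c * (if x < 0 then \<delta> else if x \<le> \<delta> then \<delta> - x else 0))"
      proof -
        consider "x < 0" | "0 \<le> x" "x \<le> \<delta>" | "\<delta> < x" by linarith
        thus ?thesis
        proof cases
          case 1
          hence "{\<theta>. q \<theta> \<le> x} = {}" using q0 by (auto simp: not_le intro: order.strict_trans2)
          thus ?thesis using 1 vol[of \<delta>] \<delta> by simp
        next
          case 2
          have "emeasure lborel ({\<theta>. q \<theta> \<le> \<delta>} - {\<theta>. q \<theta> \<le> x}) = emeasure lborel {\<theta>. q \<theta> \<le> \<delta>} - emeasure lborel {\<theta>. q \<theta> \<le> x}"
            using 2 vol[of x] meas by (intro emeasure_Diff) auto
          thus ?thesis using 2 vol[of x] vol[of \<delta>] \<delta> c by (simp add: ennreal_minus right_diff_distrib)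
        next
          case 3
          hence empty: "{\<theta>. q \<theta> \<le> \<delta>} - {\<theta>. q \<theta> \<le> x} = {}" by auto
          show ?thesis unfolding empty using 3 \<delta> by simp
        qed
      qed
      finally show ?thesis .
    qed
    have 2: "emeasure (density lborel (\<lambda>x. ennreal (c * indicator {0..\<delta>} x))) {x<..} = ennreal (c * (if x < 0 then \<delta> else if x \<le> \<delta> then \<delta> - x else 0))" for x
    proof -
      have "emeasure (density lborel (\<lambda>x. ennreal (c * indicator {0..\<delta>} x))) {x<..}
        = (\<integral>\<^sup>+y. ennreal c * indicator ({0..\<delta>} \<inter> {x<..}) y \<partial>lborel)"
        using c by (subst emeasure_density) (auto intro!: nn_integral_cong simp: indicator_def)
      also have "\<dots> = ennreal c * emeasure lborel ({0..\<delta>} \<inter> {x<..})"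
        by (subst nn_integral_cmult_indicator) auto
      also have "{0..\<delta>} \<inter> {x<..} = (if x < 0 then {0..\<delta>} else if x \<le> \<delta> then {x<..\<delta>} else {})"
        using \<delta> by auto
      finally show ?thesis using c \<delta> by (simp add: ennreal_mult)
    qed
    show "emeasure (distr ?R borel q) {x<..} < \<infinity>" for x unfolding 1 by simp
    show "emeasure (distr ?R borel q) {x<..} = emeasure (density lborel (\<lambda>x. ennreal (c * indicator {0..\<delta>} x))) {x<..}" for x
      unfolding 1 2 ..
  qed auto
  have hbi: "has_bochner_integral lborel (\<lambda>x. 1 / (\<epsilon> + x) * indicator {0..\<delta>} x) (ln (\<epsilon> + \<delta>) - ln (\<epsilon> + 0))"
    using \<epsilon> \<delta> by (intro has_bochner_integral_FTC_Icc_real) (auto intro!: derivative_eq_intros continuous_intros)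
  hence hb: "integrable lborel (\<lambda>x. c * indicator {0..\<delta>} x * (1 / (\<epsilon> + x)))"
    "(\<integral>x. c * indicator {0..\<delta>} x * (1 / (\<epsilon> + x)) \<partial>lborel) = c * ln ((\<epsilon> + \<delta>) / \<epsilon>)"
    using has_bochner_integral_mult_right[OF hbi, of c] \<epsilon> \<delta>
    by (auto simp: has_bochner_integral_iff ln_div mult_ac)
  have "integrable (distr ?R borel q) (\<lambda>x. 1 / (\<epsilon> + x))"
    unfolding eq using hb(1) c by (subst integrable_density) auto
  thus "integrable ?R (\<lambda>\<theta>. 1 / (\<epsilon> + q \<theta>))"
    by (subst (asm) integrable_distr_eq) auto
  have "(\<integral>\<theta>. 1 / (\<epsilon> + q \<theta>) \<partial>?R) = (\<integral>x. 1 / (\<epsilon> + x) \<partial>distr ?R borel q)"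
    by (subst integral_distr) auto
  also have "\<dots> = c * ln ((\<epsilon> + \<delta>) / \<epsilon>)"
    unfolding eq using hb(2) c by (subst integral_density) auto
  finally show "(\<integral>\<theta>. 1 / (\<epsilon> + q \<theta>) \<partial>?R) = c * ln ((\<epsilon> + \<delta>) / \<epsilon>)" .
qed

lemma integral_restrict_subset:
  fixes f :: "'b::euclidean_space \<Rightarrow> complex"
  assumes S: "S \<subseteq> T" "S \<in> sets borel" "T \<in> sets borel"
  shows "(\<integral>\<theta>. indicator S \<theta> *\<^sub>R f \<theta> \<partial>restrict_space lborel T) = (\<integral>\<theta>. f \<theta> \<partial>restrict_space lborel S)"
proof -
  have "(\<integral>\<theta>. indicator S \<theta> *\<^sub>R f \<theta> \<partial>restrict_space lborel T) = (\<integral>\<theta>. indicator T \<theta> *\<^sub>R indicator S \<theta> *\<^sub>R f \<theta> \<partial>lborel)"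
    using S by (subst integral_restrict_space) auto
  also have "\<dots> = (\<integral>\<theta>. indicator S \<theta> *\<^sub>R f \<theta> \<partial>lborel)"
    using S by (intro Bochner_Integration.integral_cong) (auto simp: indicator_def)
  also have "\<dots> = (\<integral>\<theta>. f \<theta> \<partial>restrict_space lborel S)"
    using S by (subst integral_restrict_space) auto
  finally show ?thesis .
qed

text \<open>On \<open>S\<close> the integrand is compared with 1 / (\<epsilon> + q), whose integral
  is explicit; on the rest of the torus it is bounded independently of \<epsilon>, which gives the
  constant B. A relative error \<eta> in the expansion of \<open>lchar\<close> remains a relative
  error of the integral.\<close>

lemma abel_local_bound:
  fixes p :: "(int ^ 'd) pmf" and q :: "real ^ 'd \<Rightarrow> real"
  assumes q: "continuous_on UNIV q" and q0: "\<And>\<theta>. 0 \<le> q \<theta>"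
    and vol: "\<And>r. 0 \<le> r \<Longrightarrow> emeasure lborel {\<theta>. q \<theta> \<le> r} = ennreal (c * r)" and c: "c > 0"
    and sub: "\<delta> > 0" "{\<theta>. q \<theta> \<le> \<delta>} \<subseteq> torus_box"
    and loc: "\<And>\<theta>. q \<theta> \<le> \<delta> \<Longrightarrow> norm (1 - lchar p \<theta> - q \<theta>) \<le> \<eta> * q \<theta>" and \<eta>: "0 < \<eta>" "\<eta> < 1 / 4"
    and one: "\<And>\<theta>. \<theta> \<in> torus_box \<Longrightarrow> q \<theta> > 0 \<Longrightarrow> lchar p \<theta> \<noteq> 1"
  obtains B where "\<And>\<epsilon>. 0 < \<epsilon> \<Longrightarrow> \<epsilon> < 1 / 4 \<Longrightarrow>
    \<bar>abel_green p \<epsilon> * (2 * pi) ^ CARD('d) - c * ln ((\<epsilon> + \<delta>) / \<epsilon>)\<bar> \<le> 2 * (\<eta> + \<epsilon>) * (c * ln ((\<epsilon> + \<delta>) / \<epsilon>)) + B"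
proof -
  have [measurable]: "q \<in> borel_measurable borel" by (rule borel_measurable_continuous_onI[OF q])
  define S where "S = {\<theta>. q \<theta> \<le> \<delta>}"
  have S [measurable]: "S \<in> sets borel" unfolding S_def by measurable
  define K where "K = torus_box \<inter> {\<theta>. \<delta> \<le> q \<theta>}"
  have "closed {\<theta>. \<delta> \<le> q \<theta>}" by (rule closed_Collect_le) (auto intro: q)
  hence K: "compact K" unfolding K_def by (intro compact_Int_closed compact_cbox)
  \<comment> \<open>The damping factor is taken as a further compact variable, so that m does not
    depend on \<epsilon>. At factor 1 the modulus is positive by \<open>one\<close>, below 1 by the
    distance of the factor from 1.\<close>
  have "\<exists>m>0. \<forall>z\<in>{0..1} \<times> K. m \<le> norm (1 - of_real (fst z) * lchar p (snd z))"
  proof (cases "K = {}")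
    case False
    have "compact ({0..1::real} \<times> K)" by (intro compact_Times K compact_Icc)
    moreover have "continuous_on ({0..1::real} \<times> K) (\<lambda>z. norm (1 - of_real (fst z) * lchar p (snd z)))"
      by (intro continuous_intros continuous_on_compose2[OF continuous_lchar]) auto
    moreover have "{0..1::real} \<times> K \<noteq> {}" using False by auto
    ultimately have "\<exists>z\<in>{0..1} \<times> K. \<forall>w\<in>{0..1} \<times> K.
        norm (1 - of_real (fst z) * lchar p (snd z)) \<le> norm (1 - of_real (fst w) * lchar p (snd w))"
      by (intro continuous_attains_inf)
    then obtain z where z: "z \<in> {0..1} \<times> K" "\<And>w. w \<in> {0..1} \<times> K \<Longrightarrow>
        norm (1 - of_real (fst z) * lchar p (snd z)) \<le> norm (1 - of_real (fst w) * lchar p (snd w))"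
      by blast
    have "norm (1 - of_real (fst z) * lchar p (snd z)) > 0"
    proof (cases "fst z = 1")
      case True
      thus ?thesis using one[of "snd z"] z(1) sub(1) by (auto simp: K_def)
    next
      case False
      hence "0 \<le> fst z" "fst z < 1" using z(1) by auto
      thus ?thesis using norm_one_minus_lchar_ge[of "fst z" p "snd z"] by linarith
    qed
    thus ?thesis using z(2) by (intro exI[of _ "norm (1 - of_real (fst z) * lchar p (snd z))"]) blast
  qed (auto intro: exI[of _ 1])
  then obtain m where m: "m > 0" "\<And>r \<theta>. 0 \<le> r \<Longrightarrow> r \<le> 1 \<Longrightarrow> \<theta> \<in> K \<Longrightarrow> m \<le> norm (1 - of_real r * lchar p \<theta>)"
    by fastforce
  show ?thesis
  proof (rule that[of "1 / m * (2 * pi) ^ CARD('d)"])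
    fix \<epsilon> :: real assume \<epsilon>: "0 < \<epsilon>" "\<epsilon> < 1 / 4"
    define D where "D = (\<lambda>\<theta>. 1 - of_real (1 - \<epsilon>) * lchar p \<theta>)"
    have [measurable]: "D \<in> borel_measurable borel" unfolding D_def by measurable
    have De: "norm (D \<theta>) \<ge> \<epsilon>" for \<theta>
      using norm_one_minus_lchar_ge[of "1 - \<epsilon>" p \<theta>] \<epsilon> by (simp add: D_def)
    have D0: "D \<theta> \<noteq> 0" for \<theta> using De[of \<theta>] \<epsilon> by auto
    have invD: "norm (1 / D \<theta>) \<le> 1 / \<epsilon>" for \<theta>
      using De[of \<theta>] \<epsilon> by (simp add: norm_divide divide_simps D0)
    have near: "norm (D \<theta> - of_real (\<epsilon> + q \<theta>)) \<le> (\<eta> + \<epsilon>) * (\<epsilon> + q \<theta>)" if "\<theta> \<in> S" for \<theta>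
    proof -
      have "D \<theta> - of_real (\<epsilon> + q \<theta>) = of_real (1 - \<epsilon>) * (1 - lchar p \<theta> - q \<theta>) - of_real (\<epsilon> * q \<theta>)"
        by (simp add: D_def algebra_simps)
      also have "norm \<dots> \<le> norm (of_real (1 - \<epsilon>) * (1 - lchar p \<theta> - q \<theta>)) + norm (of_real (\<epsilon> * q \<theta>) :: complex)"
        by (rule norm_triangle_ineq4)
      also have "norm (of_real (1 - \<epsilon>) * (1 - lchar p \<theta> - q \<theta>)) \<le> 1 * (\<eta> * q \<theta>)"
        unfolding norm_mult using that \<epsilon> q0[of \<theta>] \<eta> by (intro mult_mono loc) (auto simp: S_def simp del: of_real_diff)
      also have "norm (of_real (\<epsilon> * q \<theta>) :: complex) = \<epsilon> * q \<theta>" using \<epsilon> q0[of \<theta>] by (simp add: norm_mult)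
      finally have "norm (D \<theta> - of_real (\<epsilon> + q \<theta>)) \<le> (\<eta> + \<epsilon>) * q \<theta>" by (simp add: algebra_simps)
      also have "\<dots> \<le> (\<eta> + \<epsilon>) * (\<epsilon> + q \<theta>)" using \<epsilon> \<eta> by (intro mult_left_mono) auto
      finally show ?thesis .
    qed
    have inv: "norm (1 / D \<theta> - of_real (1 / (\<epsilon> + q \<theta>))) \<le> 2 * (\<eta> + \<epsilon>) * (1 / (\<epsilon> + q \<theta>))" if "\<theta> \<in> S" for \<theta>
    proof -
      have pos: "\<epsilon> + q \<theta> > 0" using \<epsilon> q0[of \<theta>] by linarith
      \<comment> \<open>Both \<eta> and \<epsilon> are below 1/4, so the approximation error is at
        most half of \<epsilon> + q and the modulus of D is at least the other half.\<close>
      have "(\<eta> + \<epsilon>) * (\<epsilon> + q \<theta>) \<le> 1 / 2 * (\<epsilon> + q \<theta>)" using \<epsilon> \<eta> pos by (intro mult_right_mono) auto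
      moreover have "norm (of_real (\<epsilon> + q \<theta>) :: complex) - norm (D \<theta>) \<le> norm (D \<theta> - of_real (\<epsilon> + q \<theta>))"
        by (metis norm_minus_commute norm_triangle_ineq2)
      moreover have "norm (of_real (\<epsilon> + q \<theta>) :: complex) = \<epsilon> + q \<theta>" using pos by (simp only: norm_of_real abs_of_pos)
      ultimately have "\<epsilon> + q \<theta> - norm (D \<theta>) \<le> 1 / 2 * (\<epsilon> + q \<theta>)" using near[OF that] by (metis order.trans)
      hence Dge: "norm (D \<theta>) \<ge> (\<epsilon> + q \<theta>) / 2" by (simp add: field_simps)
      have "1 / D \<theta> - of_real (1 / (\<epsilon> + q \<theta>)) = - (D \<theta> - of_real (\<epsilon> + q \<theta>)) / (D \<theta> * of_real (\<epsilon> + q \<theta>))"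
        using D0[of \<theta>] pos by (simp add: field_simps del: of_real_add)
      also have "norm \<dots> = norm (D \<theta> - of_real (\<epsilon> + q \<theta>)) / (norm (D \<theta>) * (\<epsilon> + q \<theta>))"
        using pos by (simp only: norm_divide norm_minus_cancel norm_mult norm_of_real abs_of_pos)
      also have "\<dots> \<le> ((\<eta> + \<epsilon>) * (\<epsilon> + q \<theta>)) / ((\<epsilon> + q \<theta>) / 2 * (\<epsilon> + q \<theta>))"
          using near[OF that] Dge pos \<eta> \<epsilon> by (intro frac_le mult_right_mono mult_pos_pos mult_nonneg_nonneg) auto
      also have "\<dots> = 2 * (\<eta> + \<epsilon>) * (1 / (\<epsilon> + q \<theta>))" using pos by (simp add: divide_simps)
      finally show ?thesis .
    qed
    let ?R = "restrict_space lborel S"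
    have rad: "integrable ?R (\<lambda>\<theta>. 1 / (\<epsilon> + q \<theta>))" "(\<integral>\<theta>. 1 / (\<epsilon> + q \<theta>) \<partial>?R) = c * ln ((\<epsilon> + \<delta>) / \<epsilon>)"
      unfolding S_def by (rule integral_radial[of q c \<delta> \<epsilon>]; use q0 vol c sub \<epsilon> in simp)+
    have radc: "integrable ?R (\<lambda>\<theta>. complex_of_real (1 / (\<epsilon> + q \<theta>)))" using rad(1) by (simp only: integrable_of_real)
    have DR: "integrable ?R (\<lambda>\<theta>. 1 / D \<theta>)"
    proof (rule Bochner_Integration.integrable_bound)
      show "integrable ?R (\<lambda>\<theta>. 2 * (\<eta> + \<epsilon>) * (1 / (\<epsilon> + q \<theta>)) + 1 / (\<epsilon> + q \<theta>))"
        by (intro Bochner_Integration.integrable_add integrable_mult_right rad(1))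
      show "AE \<theta> in ?R. norm (1 / D \<theta>) \<le> norm (2 * (\<eta> + \<epsilon>) * (1 / (\<epsilon> + q \<theta>)) + 1 / (\<epsilon> + q \<theta>))"
      proof (rule AE_I2)
        fix \<theta> assume "\<theta> \<in> space ?R"
        hence "\<theta> \<in> S" by (simp add: space_restrict_space)
        have pos: "\<epsilon> + q \<theta> > 0" using \<epsilon> q0[of \<theta>] by linarith
        have "norm (1 / D \<theta>) \<le> norm (1 / D \<theta> - of_real (1 / (\<epsilon> + q \<theta>))) + norm (of_real (1 / (\<epsilon> + q \<theta>)) :: complex)"
          by (metis diff_add_cancel norm_triangle_ineq)
        also have "norm (of_real (1 / (\<epsilon> + q \<theta>)) :: complex) = 1 / (\<epsilon> + q \<theta>)" using pos by (simp only: norm_of_real) simp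
        finally show "norm (1 / D \<theta>) \<le> norm (2 * (\<eta> + \<epsilon>) * (1 / (\<epsilon> + q \<theta>)) + 1 / (\<epsilon> + q \<theta>))"
          using inv[OF \<open>\<theta> \<in> S\<close>] by simp
      qed
    qed (rule measurable_restrict_space1, simp)
    have "norm ((\<integral>\<theta>. 1 / D \<theta> \<partial>?R) - of_real (c * ln ((\<epsilon> + \<delta>) / \<epsilon>))) = norm (\<integral>\<theta>. 1 / D \<theta> - of_real (1 / (\<epsilon> + q \<theta>)) \<partial>?R)"
      by (subst Bochner_Integration.integral_diff[OF DR radc], subst integral_complex_of_real, subst rad(2)) (rule refl)
    also have "\<dots> \<le> (\<integral>\<theta>. norm (1 / D \<theta> - of_real (1 / (\<epsilon> + q \<theta>))) \<partial>?R)" by (rule integral_norm_bound)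
    also have "\<dots> \<le> (\<integral>\<theta>. 2 * (\<eta> + \<epsilon>) * (1 / (\<epsilon> + q \<theta>)) \<partial>?R)"
      by (intro integral_mono integrable_norm Bochner_Integration.integrable_diff DR radc integrable_mult_right rad(1) inv)
         (simp add: space_restrict_space)
    also have "\<dots> = 2 * (\<eta> + \<epsilon>) * (c * ln ((\<epsilon> + \<delta>) / \<epsilon>))" by (subst integral_mult_right_zero) (simp only: rad(2))
    finally have 1: "norm ((\<integral>\<theta>. 1 / D \<theta> \<partial>?R) - of_real (c * ln ((\<epsilon> + \<delta>) / \<epsilon>))) \<le> 2 * (\<eta> + \<epsilon>) * (c * ln ((\<epsilon> + \<delta>) / \<epsilon>))" .
    have 2: "norm (\<integral>\<theta>. indicator (- S) \<theta> *\<^sub>R (1 / D \<theta>) \<partial>torus) \<le> 1 / m * (2 * pi) ^ CARD('d)"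
    proof (rule integral_torus_bound)
      fix \<theta> :: "real ^ 'd" assume \<theta>: "\<theta> \<in> torus_box"
      show "norm (indicator (- S) \<theta> *\<^sub>R (1 / D \<theta>)) \<le> 1 / m"
      proof (cases "\<theta> \<in> S")
        case False
        hence "\<theta> \<in> K" using \<theta> by (auto simp: K_def S_def)
        from m(2)[OF _ _ this, of "1 - \<epsilon>"] \<epsilon> have "m \<le> norm (D \<theta>)" by (simp add: D_def)
        thus ?thesis using m(1) False by (auto simp: norm_divide intro!: divide_left_mono mult_pos_pos)
      qed (use m(1) in auto)
    qed measurable
    have "(\<integral>\<theta>. 1 / D \<theta> \<partial>torus) = (\<integral>\<theta>. indicator S \<theta> *\<^sub>R (1 / D \<theta>) + indicator (- S) \<theta> *\<^sub>R (1 / D \<theta>) \<partial>torus)"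
      by (intro Bochner_Integration.integral_cong) (auto simp: indicator_def)
    also have "\<dots> = (\<integral>\<theta>. indicator S \<theta> *\<^sub>R (1 / D \<theta>) \<partial>torus) + (\<integral>\<theta>. indicator (- S) \<theta> *\<^sub>R (1 / D \<theta>) \<partial>torus)"
      using invD \<epsilon>
      by (intro Bochner_Integration.integral_add integrable_torus_bounded[where B="1 / \<epsilon>"]) (auto simp: indicator_def)
    also have "(\<integral>\<theta>. indicator S \<theta> *\<^sub>R (1 / D \<theta>) \<partial>torus) = (\<integral>\<theta>. 1 / D \<theta> \<partial>?R)"
      using sub by (intro integral_restrict_subset) (auto simp: S_def)
    finally have "(\<integral>\<theta>. 1 / D \<theta> \<partial>torus) - of_real (c * ln ((\<epsilon> + \<delta>) / \<epsilon>))
      = ((\<integral>\<theta>. 1 / D \<theta> \<partial>?R) - of_real (c * ln ((\<epsilon> + \<delta>) / \<epsilon>))) + (\<integral>\<theta>. indicator (- S) \<theta> *\<^sub>R (1 / D \<theta>) \<partial>torus)"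
      by simp
    hence "norm ((\<integral>\<theta>. 1 / D \<theta> \<partial>torus) - of_real (c * ln ((\<epsilon> + \<delta>) / \<epsilon>))) \<le> 2 * (\<eta> + \<epsilon>) * (c * ln ((\<epsilon> + \<delta>) / \<epsilon>)) + 1 / m * (2 * pi) ^ CARD('d)"
      by (simp only:) (rule norm_triangle_le[OF add_mono[OF 1 2]])
    hence "\<bar>Re ((\<integral>\<theta>. 1 / D \<theta> \<partial>torus) - of_real (c * ln ((\<epsilon> + \<delta>) / \<epsilon>)))\<bar> \<le> 2 * (\<eta> + \<epsilon>) * (c * ln ((\<epsilon> + \<delta>) / \<epsilon>)) + 1 / m * (2 * pi) ^ CARD('d)"
      by (rule order.trans[OF abs_Re_le_cmod])
    thus "\<bar>abel_green p \<epsilon> * (2 * pi) ^ CARD('d) - c * ln ((\<epsilon> + \<delta>) / \<epsilon>)\<bar> \<le> 2 * (\<eta> + \<epsilon>) * (c * ln ((\<epsilon> + \<delta>) / \<epsilon>)) + 1 / m * (2 * pi) ^ CARD('d)"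
      unfolding abel_green_def D_def by simp
  qed
qed

text \<open>For fixed \<eta> the normalised error does not vanish but is of order \<eta>, so \<eta>
  and with it \<delta> are chosen from the target accuracy; after that B / ln (1 / \<epsilon>) tends
  to 0.\<close>

lemma green_asymp_local:
  fixes p :: "(int ^ 'd) pmf" and q :: "real ^ 'd \<Rightarrow> real"
  assumes q: "continuous_on UNIV q" and q0: "\<And>\<theta>. 0 \<le> q \<theta>"
    and vol: "\<And>r. 0 \<le> r \<Longrightarrow> emeasure lborel {\<theta>. q \<theta> \<le> r} = ennreal (c * r)" and c: "c > 0"
    and sub: "\<delta>\<^sub>0 > 0" "{\<theta>. q \<theta> \<le> \<delta>\<^sub>0} \<subseteq> torus_box"
    and loc: "\<And>\<eta>. \<eta> > 0 \<Longrightarrow> \<exists>\<delta>>0. \<forall>\<theta>. q \<theta> \<le> \<delta> \<longrightarrow> norm (1 - lchar p \<theta> - q \<theta>) \<le> \<eta> * q \<theta>"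
    and one: "\<And>\<theta>. \<theta> \<in> torus_box \<Longrightarrow> q \<theta> > 0 \<Longrightarrow> lchar p \<theta> \<noteq> 1"
  shows "(\<lambda>n. green p n 0 / ln (real n)) \<longlonglongrightarrow> c / (2 * pi) ^ CARD('d)"
proof (rule green_asymp_of_abel)
  define W where "W = (2 * pi) ^ CARD('d)"
  have W: "W > 0" by (simp add: W_def)
  have "((\<lambda>\<epsilon>. abel_green p \<epsilon> * W / ln (1 / \<epsilon>)) \<longlongrightarrow> c) (at_right 0)"
  proof (rule tendstoI)
    fix e :: real assume e: "e > 0"
    \<comment> \<open>The limiting error is 2 \<eta> c, which this choice keeps at or below e /
      2.\<close>
    define \<eta> where "\<eta> = min (1 / 8) (e / (4 * c))"
    have \<eta>: "0 < \<eta>" "\<eta> < 1 / 4" using e c by (auto simp: \<eta>_def)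
    obtain \<delta>1 where \<delta>1: "\<delta>1 > 0" "\<And>\<theta>. q \<theta> \<le> \<delta>1 \<Longrightarrow> norm (1 - lchar p \<theta> - q \<theta>) \<le> \<eta> * q \<theta>"
      using loc[OF \<eta>(1)] by blast
    define \<delta> where "\<delta> = min \<delta>\<^sub>0 \<delta>1"
    have \<delta>: "\<delta> > 0" "{\<theta>. q \<theta> \<le> \<delta>} \<subseteq> torus_box" "\<And>\<theta>. q \<theta> \<le> \<delta> \<Longrightarrow> norm (1 - lchar p \<theta> - q \<theta>) \<le> \<eta> * q \<theta>"
      using \<delta>1 sub by (auto simp: \<delta>_def)
    from abel_local_bound[OF q q0 vol c \<delta>(1,2,3) \<eta> one] obtain B where
      B: "\<And>\<epsilon>. 0 < \<epsilon> \<Longrightarrow> \<epsilon> < 1 / 4 \<Longrightarrow>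
        \<bar>abel_green p \<epsilon> * W - c * ln ((\<epsilon> + \<delta>) / \<epsilon>)\<bar> \<le> 2 * (\<eta> + \<epsilon>) * (c * ln ((\<epsilon> + \<delta>) / \<epsilon>)) + B"
      unfolding W_def by blast
    define L where "L = (\<lambda>\<epsilon>::real. ln ((\<epsilon> + \<delta>) / \<epsilon>) / ln (1 / \<epsilon>))"
    have L: "(L \<longlongrightarrow> 1) (at_right 0)" unfolding L_def using \<delta>(1) by real_asymp
    have "((\<lambda>\<epsilon>. \<bar>c * L \<epsilon> - c\<bar> + (2 * (\<eta> + \<epsilon>) * (c * L \<epsilon>) + B / ln (1 / \<epsilon>))) \<longlongrightarrow> \<bar>c * 1 - c\<bar> + (2 * (\<eta> + 0) * (c * 1) + 0)) (at_right 0)"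
    proof (intro tendsto_intros L)
      show "((\<lambda>\<epsilon>. B / ln (1 / \<epsilon>)) \<longlongrightarrow> 0) (at_right 0)" by real_asymp
    qed
    moreover have "\<bar>c * 1 - c\<bar> + (2 * (\<eta> + 0) * (c * 1) + 0) < e"
    proof -
      have "\<eta> * c \<le> e / 4" using c unfolding \<eta>_def by (auto simp: min_def field_simps)
      thus ?thesis using e by simp
    qed
    ultimately have "\<forall>\<^sub>F \<epsilon> in at_right 0. \<bar>c * L \<epsilon> - c\<bar> + (2 * (\<eta> + \<epsilon>) * (c * L \<epsilon>) + B / ln (1 / \<epsilon>)) < e"
      by (rule order_tendstoD(2))
    moreover have "\<forall>\<^sub>F \<epsilon> in at_right (0::real). 0 < \<epsilon> \<and> \<epsilon> < 1 / 4"
      by (rule eventually_at_rightI[of 0 "1/4"]) auto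
    ultimately show "\<forall>\<^sub>F \<epsilon> in at_right 0. dist (abel_green p \<epsilon> * W / ln (1 / \<epsilon>)) c < e"
    proof eventually_elim
      case (elim \<epsilon>)
      have ln: "ln (1 / \<epsilon>) > 0" using elim by (intro ln_gt_zero) auto
      have "\<bar>(abel_green p \<epsilon> * W - c * ln ((\<epsilon> + \<delta>) / \<epsilon>)) / ln (1 / \<epsilon>)\<bar> \<le> (2 * (\<eta> + \<epsilon>) * (c * ln ((\<epsilon> + \<delta>) / \<epsilon>)) + B) / ln (1 / \<epsilon>)"
        using B[of \<epsilon>] elim ln by (simp only: abs_divide abs_of_pos) (intro divide_right_mono, auto)
      hence "\<bar>abel_green p \<epsilon> * W / ln (1 / \<epsilon>) - c * L \<epsilon>\<bar> \<le> 2 * (\<eta> + \<epsilon>) * (c * L \<epsilon>) + B / ln (1 / \<epsilon>)"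
        by (simp add: L_def diff_divide_distrib add_divide_distrib)
      thus ?case using elim by (simp add: dist_real_def)
    qed
  qed
  from tendsto_divide[OF this tendsto_const, of W] W
  show "((\<lambda>\<epsilon>. abel_green p \<epsilon> / ln (1 / \<epsilon>)) \<longlongrightarrow> c / (2 * pi) ^ CARD('d)) (at_right 0)"
    unfolding W_def[symmetric] by simp
qed

section \<open>Planar and Cauchy walks\<close>

text \<open>Equality forces cos (\<theta> . x) = 1 on the support of p. The lattice points with this
  property form a subgroup, hence are all of the lattice; the unit vectors then make every
  coordinate of \<theta> a multiple of 2 pi, and the box leaves only 0.\<close>

lemma lchar_ne_1:
  fixes p :: "(int ^ 'd) pmf"
  assumes span: "\<And>H. 0 \<in> H \<Longrightarrow> (\<And>x y. x \<in> H \<Longrightarrow> y \<in> H \<Longrightarrow> x - y \<in> H) \<Longrightarrow> set_pmf p \<subseteq> H \<Longrightarrow> H = UNIV"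
    and \<theta>: "\<theta> \<in> torus_box" "\<theta> \<noteq> 0"
  shows "lchar p \<theta> \<noteq> 1"
proof
  assume one: "lchar p \<theta> = 1"
  have int: "integrable (measure_pmf p) (\<lambda>x. iexp (\<theta> \<bullet> emb x))"
    by (rule measure_pmf.integrable_const_bound[where B=1]) auto
  have "Re (lchar p \<theta>) = (\<integral>x. Re (iexp (\<theta> \<bullet> emb x)) \<partial>measure_pmf p)"
    unfolding lchar_def using int by simp
  hence "(\<integral>x. cos (\<theta> \<bullet> emb x) \<partial>measure_pmf p) = 1" using one by (simp add: Re_exp)
  moreover have intc: "integrable (measure_pmf p) (\<lambda>x. cos (\<theta> \<bullet> emb x))"
    by (rule measure_pmf.integrable_const_bound[where B=1]) auto
  ultimately have "(\<integral>x. 1 - cos (\<theta> \<bullet> emb x) \<partial>measure_pmf p) = 0" by simp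
  hence "AE x in measure_pmf p. 1 - cos (\<theta> \<bullet> emb x) = 0"
    by (subst (asm) integral_nonneg_eq_0_iff_AE) (use intc in auto)
  hence cos1: "cos (\<theta> \<bullet> emb x) = 1" if "x \<in> set_pmf p" for x
    using that by (auto simp: AE_measure_pmf_iff)
  define H where "H = {x. cos (\<theta> \<bullet> emb x) = 1}"
  have emb_diff: "emb (x - y) = emb x - emb y" for x y :: "int ^ 'd"
    by (simp add: emb_def vec_eq_iff)
  have "H = UNIV"
  proof (rule span)
    fix x y assume "x \<in> H" "y \<in> H"
    hence c: "cos (\<theta> \<bullet> emb x) = 1" "cos (\<theta> \<bullet> emb y) = 1" by (auto simp: H_def)
    hence "sin (\<theta> \<bullet> emb x) = 0" by (simp add: cos_one_sin_zero)
    thus "x - y \<in> H" using c by (simp add: H_def emb_diff inner_diff_right cos_diff)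
  qed (auto simp: H_def cos1)
  have "\<theta> $ i = 0" for i
  proof -
    have "axis i 1 \<in> H" using \<open>H = UNIV\<close> by simp
    hence "cos (\<theta> $ i) = 1"
    proof -
      have "emb (axis i 1) = axis i 1" by (simp add: emb_def axis_def vec_eq_iff)
      thus ?thesis using \<open>axis i 1 \<in> H\<close> by (simp add: H_def inner_axis)
    qed
    then obtain k :: int where k: "\<theta> $ i = of_int k * (2 * pi)" by (auto simp: cos_one_2pi_int mult_ac)
    have "\<bar>\<theta> $ i\<bar> \<le> pi" proof -
      have "- pi \<le> \<theta> $ i \<and> \<theta> $ i \<le> pi" using \<theta>(1) unfolding mem_box_cart vec_lambda_beta by blast
      thus ?thesis by linarith
    qed
    hence "\<bar>of_int k :: real\<bar> * (2 * pi) \<le> pi" using k by (simp add: abs_mult)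
    hence "\<bar>of_int k :: real\<bar> < 1" using pi_gt_zero by (smt (verit) mult_le_cancel_right1)
    hence "k = 0" by linarith
    thus ?thesis using k by simp
  qed
  thus False using \<theta>(2) by (simp add: vec_eq_iff)
qed

lemma norm_le_in_torus_box: "norm \<theta> \<le> pi \<Longrightarrow> \<theta> \<in> torus_box"
proof -
  assume "norm \<theta> \<le> pi"
  hence "\<bar>\<theta> $ i\<bar> \<le> pi" for i by (rule order.trans[OF component_le_norm_cart])
  hence "- pi \<le> \<theta> $ i \<and> \<theta> $ i \<le> pi" for i by (simp only: abs_le_iff) (metis minus_le_iff)
  thus ?thesis unfolding mem_box_cart vec_lambda_beta by blast
qed

text \<open>No third moment is available. The Taylor remainder is bounded by the smaller of the
  square and the cube; for \<open>norm \<theta>\<close> at most \<delta> this is (norm \<theta>)^2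
  times the truncated weight w, whose mean vanishes with \<delta> by dominated convergence against
  the second moment.\<close>

lemma norm_lchar_taylor:
  fixes p :: "(int ^ 'd) pmf"
  assumes sq: "integrable (measure_pmf p) (\<lambda>x. (norm (emb x))\<^sup>2)"
    and mean: "\<And>\<theta>. (\<integral>x. \<theta> \<bullet> emb x \<partial>measure_pmf p) = 0"
    and e: "e > 0"
  obtains \<delta> where "\<delta> > 0" "\<And>\<theta>. norm \<theta> \<le> \<delta> \<Longrightarrow>
    norm (1 - lchar p \<theta> - of_real ((\<integral>x. (\<theta> \<bullet> emb x)\<^sup>2 \<partial>measure_pmf p) / 2)) \<le> e * (norm \<theta>)\<^sup>2"
proof -
  define w where "w = (\<lambda>t x. min ((norm (emb (x :: int ^ 'd)))\<^sup>2) (t * norm (emb x) ^ 3))"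
  have inner_sq: "integrable (measure_pmf p) (\<lambda>x. (\<theta> \<bullet> emb x)\<^sup>2)" for \<theta> :: "real ^ 'd"
  proof (rule Bochner_Integration.integrable_bound)
    show "integrable (measure_pmf p) (\<lambda>x. (norm \<theta>)\<^sup>2 * (norm (emb x))\<^sup>2)" using sq by simp
    show "AE x in measure_pmf p. norm ((\<theta> \<bullet> emb x)\<^sup>2) \<le> norm ((norm \<theta>)\<^sup>2 * (norm (emb x))\<^sup>2)"
      using Cauchy_Schwarz_ineq2[of \<theta>] by (intro AE_I2) (simp flip: power_mult_distrib add: abs_le_square_iff[symmetric])
  qed simp
  have inner_1: "integrable (measure_pmf p) (\<lambda>x. \<theta> \<bullet> emb x)" for \<theta> :: "real ^ 'd"
    by (rule measure_pmf.square_integrable_imp_integrable[OF _ inner_sq]) simp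
  have wb: "\<bar>w t x\<bar> \<le> (norm (emb x))\<^sup>2" if "t \<ge> 0" for t x
    using that by (auto simp: w_def abs_le_iff min_def)
  have wint: "integrable (measure_pmf p) (w t)" if "t \<ge> 0" for t
    by (rule Bochner_Integration.integrable_bound[OF sq]) (use that wb[of t] in auto)
  have "(\<lambda>n. \<integral>x. w (1 / real (Suc n)) x \<partial>measure_pmf p) \<longlonglongrightarrow> (\<integral>x. 0 \<partial>measure_pmf p)"
  proof (rule integral_dominated_convergence)
    show "integrable (measure_pmf p) (\<lambda>x. (norm (emb x))\<^sup>2)" by (rule sq)
    show "AE x in measure_pmf p. norm (w (1 / real (Suc n)) x) \<le> (norm (emb x))\<^sup>2" for n
      by (rule AE_I2) (simp add: wb)
    show "AE x in measure_pmf p. (\<lambda>n. w (1 / real (Suc n)) x) \<longlonglongrightarrow> 0"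
    proof (rule AE_I2)
      fix x :: "int ^ 'd"
      have "(\<lambda>n. w (1 / real (Suc n)) x) \<longlonglongrightarrow> min ((norm (emb x))\<^sup>2) (0 * norm (emb x) ^ 3)"
        unfolding w_def by (intro tendsto_intros LIMSEQ_Suc[OF lim_1_over_n])
      thus "(\<lambda>n. w (1 / real (Suc n)) x) \<longlonglongrightarrow> 0" by simp
    qed
  qed auto
  hence "\<forall>\<^sub>F n in sequentially. (\<integral>x. w (1 / real (Suc n)) x \<partial>measure_pmf p) < e"
    using e by (intro order_tendstoD(2)) auto
  then obtain n where n: "(\<integral>x. w (1 / real (Suc n)) x \<partial>measure_pmf p) < e"
    by (auto simp: eventually_sequentially)
  define \<delta> where "\<delta> = 1 / real (Suc n)"
  have \<delta>: "\<delta> > 0" "(\<integral>x. w \<delta> x \<partial>measure_pmf p) < e"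
    using n by (auto simp: \<delta>_def)
  show ?thesis
  proof (rule that[OF \<delta>(1)])
    fix \<theta> :: "real ^ 'd" assume \<theta>: "norm \<theta> \<le> \<delta>"
    define E where "E = (\<lambda>x. iexp (\<theta> \<bullet> emb x) - 1 - \<i> * of_real (\<theta> \<bullet> emb x) + of_real ((\<theta> \<bullet> emb x)\<^sup>2 / 2))"
    have E: "norm (E x) \<le> (norm \<theta>)\<^sup>2 * w \<delta> x" for x
    proof -
      define y where "y = \<theta> \<bullet> emb x"
      have y: "\<bar>y\<bar> \<le> norm \<theta> * norm (emb x)" unfolding y_def by (rule Cauchy_Schwarz_ineq2)
      have sum: "(\<Sum>k\<le>2. (\<i> * complex_of_real y) ^ k / fact k) = 1 + \<i> * of_real y - of_real (y\<^sup>2 / 2)"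
        by (simp add: numeral_2_eq_2 power2_eq_square complex_eq_iff)
      have "norm (E x) = norm (iexp y - (\<Sum>k\<le>2. (\<i> * complex_of_real y) ^ k / fact k))"
        unfolding sum E_def y_def[symmetric] by (rule arg_cong[where f=norm]) simp
      moreover have "norm (iexp y - (\<Sum>k\<le>2. (\<i> * complex_of_real y) ^ k / fact k)) \<le> \<bar>y\<bar> ^ 3"
      proof -
        have "norm (iexp y - (\<Sum>k\<le>2. (\<i> * complex_of_real y) ^ k / fact k)) \<le> \<bar>y\<bar> ^ 3 / fact 3"
          using iexp_approx1[of y 2] by (simp only: Suc_numeral Num.BitM.simps numeral_3_eq_3 numeral_2_eq_2)
        also have "\<dots> \<le> \<bar>y\<bar> ^ 3 / 1" by (intro divide_left_mono) (auto simp: fact_numeral)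
        finally show ?thesis by simp
      qed
      moreover have "norm (iexp y - (\<Sum>k\<le>2. (\<i> * complex_of_real y) ^ k / fact k)) \<le> \<bar>y\<bar>\<^sup>2"
        using iexp_approx2[of y 2] by (simp add: fact_numeral)
      moreover have "\<bar>y\<bar>\<^sup>2 \<le> (norm \<theta>)\<^sup>2 * (norm (emb x))\<^sup>2"
        using power_mono[OF y, of 2] by (simp add: power_mult_distrib)
      moreover have "\<bar>y\<bar> ^ 3 \<le> (norm \<theta>)\<^sup>2 * (\<delta> * norm (emb x) ^ 3)"
      proof -
        have "\<bar>y\<bar> ^ 3 \<le> (norm \<theta> * norm (emb x)) ^ 3" using y by (intro power_mono) auto
        also have "\<dots> = (norm \<theta>)\<^sup>2 * (norm \<theta> * norm (emb x) ^ 3)" by (simp add: power_mult_distrib eval_nat_numeral)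
        also have "\<dots> \<le> (norm \<theta>)\<^sup>2 * (\<delta> * norm (emb x) ^ 3)" using \<theta> by (intro mult_left_mono mult_right_mono) auto
        finally show ?thesis .
      qed
      ultimately show ?thesis by (auto simp: w_def min_def)
    qed
    have i1: "integrable (measure_pmf p) (\<lambda>x. iexp (\<theta> \<bullet> emb x))"
      by (rule measure_pmf.integrable_const_bound[where B=1]) auto
    have i2: "integrable (measure_pmf p) (\<lambda>x. \<i> * complex_of_real (\<theta> \<bullet> emb x))" using inner_1 by simp
    have i3: "integrable (measure_pmf p) (\<lambda>x. complex_of_real ((\<theta> \<bullet> emb x)\<^sup>2 / 2))"
      using inner_sq[of \<theta>] by (intro integrable_of_real) simp
    have "(\<integral>x. E x \<partial>measure_pmf p) = lchar p \<theta> - 1 - \<i> * of_real (\<integral>x. \<theta> \<bullet> emb x \<partial>measure_pmf p) + of_real (\<integral>x. (\<theta> \<bullet> emb x)\<^sup>2 / 2 \<partial>measure_pmf p)"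
      unfolding E_def using i1 i2 i3
      by (subst Bochner_Integration.integral_add, simp, simp, subst Bochner_Integration.integral_diff, simp, simp,
          subst Bochner_Integration.integral_diff, simp, simp) (simp add: lchar_def del: of_real_divide)
    hence "1 - lchar p \<theta> - of_real ((\<integral>x. (\<theta> \<bullet> emb x)\<^sup>2 \<partial>measure_pmf p) / 2) = - (\<integral>x. E x \<partial>measure_pmf p)"
      by (simp add: mean)
    also have "norm \<dots> \<le> (\<integral>x. norm (E x) \<partial>measure_pmf p)" by simp
    also have "\<dots> \<le> (\<integral>x. (norm \<theta>)\<^sup>2 * w \<delta> x \<partial>measure_pmf p)"
    proof (intro integral_mono E)
      show "integrable (measure_pmf p) (\<lambda>x. norm (E x))"
        unfolding E_def by (intro integrable_norm Bochner_Integration.integrable_add Bochner_Integration.integrable_diff i1 i2 i3) simp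
      show "integrable (measure_pmf p) (\<lambda>x. (norm \<theta>)\<^sup>2 * w \<delta> x)" using wint[of \<delta>] \<delta> by simp
    qed
    also have "\<dots> = (norm \<theta>)\<^sup>2 * (\<integral>x. w \<delta> x \<partial>measure_pmf p)" by simp
    also have "\<dots> \<le> (norm \<theta>)\<^sup>2 * e" using \<delta> by (intro mult_left_mono) auto
    finally show "norm (1 - lchar p \<theta> - of_real ((\<integral>x. (\<theta> \<bullet> emb x)\<^sup>2 \<partial>measure_pmf p) / 2)) \<le> e * (norm \<theta>)\<^sup>2"
      by (simp add: mult.commute)
  qed
qed

text \<open>The Cholesky factor of a two by two form. Its triangular shape is what allows areas to
  be computed by two one-dimensional substitutions.\<close>

lemma gram_factor_2:
  fixes S :: "real ^ 'd ^ 'd"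
  assumes card: "CARD('d) = 2"
    and sym: "\<And>k l. S $ k $ l = S $ l $ k"
    and psd: "\<And>\<theta>. \<theta> \<bullet> (S *v \<theta>) \<ge> 0"
    and inv: "invertible S"
  obtains B :: "real ^ 'd ^ 'd" and i j where "S = transpose B ** B" "UNIV = {i, j}" "i \<noteq> j" "B $ j $ i = 0"
proof -
  obtain i j :: 'd where ij: "UNIV = {i, j}" "i \<noteq> j"
    using card by (auto simp: card_2_iff)
  have sum2: "(\<Sum>k\<in>UNIV. f k) = f i + f j" for f :: "'d \<Rightarrow> real"
    unfolding ij(1) using ij(2) by simp
  have two: "k = i \<or> k = j" for k
    using ij(1) by (metis UNIV_I insertE singletonD)
  define a b c where "a = S $ i $ i" and "b = S $ i $ j" and "c = S $ j $ j"
  have Sji: "S $ j $ i = b" using sym by (simp add: b_def)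
  have quad: "0 \<le> a * x\<^sup>2 + 2 * b * x * y + c * y\<^sup>2" for x y
    using psd[of "\<chi> k. if k = i then x else y"] ij(2) Sji
    by (simp add: inner_vec_def matrix_vector_mult_def sum2 a_def b_def c_def power2_eq_square algebra_simps)
  have a0: "a \<ge> 0" using quad[of 1 0] by simp
  have "a \<noteq> 0"
  proof
    assume "a = 0"
    have "b = 0"
    proof (rule ccontr)
      assume "b \<noteq> 0"
      \<comment> \<open>With a = 0 and b nonzero the form takes the value -1 at this point.\<close>
      have "0 \<le> 2 * b * (- (c + 1) / (2 * b)) * 1 + c" using quad[of "- (c + 1) / (2 * b)" 1] \<open>a = 0\<close> by simp
      thus False using \<open>b \<noteq> 0\<close> by simp
    qed
    have "row i S $ k = 0" for k
      using \<open>a = 0\<close> \<open>b = 0\<close> two[of k] by (auto simp: row_def a_def b_def)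
    hence "row i S = 0" by (simp add: vec_eq_iff)
    hence "det S = 0" by (rule det_zero_row)
    thus False using inv by (simp add: invertible_det_nz)
  qed
  hence a: "a > 0" using a0 by simp
  have d: "c - b\<^sup>2 / a \<ge> 0"
    using quad[of "- b / a" 1] a by (simp add: power2_eq_square field_simps)
  define B :: "real ^ 'd ^ 'd" where
    "B = (\<chi> k l. if k = i then (if l = i then sqrt a else b / sqrt a) else (if l = i then 0 else sqrt (c - b\<^sup>2 / a)))"
  have ent: "B $ i $ i = sqrt a" "B $ i $ j = b / sqrt a" "B $ j $ i = 0" "B $ j $ j = sqrt (c - b\<^sup>2 / a)"
    using ij(2) by (simp_all add: B_def)
  have prod: "(transpose B ** B) $ k $ l = B $ i $ k * B $ i $ l + B $ j $ k * B $ j $ l" for k l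
    by (simp add: matrix_matrix_mult_def transpose_def sum2)
  have sq: "sqrt a * sqrt a = a" "sqrt (c - b\<^sup>2 / a) * sqrt (c - b\<^sup>2 / a) = c - b\<^sup>2 / a"
    using a d by simp_all
  have frac: "b / sqrt a * (b / sqrt a) = b\<^sup>2 / a" "sqrt a * (b / sqrt a) = b" "b / sqrt a * sqrt a = b"
    using a by (simp_all add: power2_eq_square)
  have "S $ i $ i = (transpose B ** B) $ i $ i" "S $ i $ j = (transpose B ** B) $ i $ j"
    "S $ j $ i = (transpose B ** B) $ j $ i" "S $ j $ j = (transpose B ** B) $ j $ j"
    unfolding prod ent sq frac Sji by (simp_all add: a_def b_def c_def)
  hence "S $ k $ l = (transpose B ** B) $ k $ l" for k l
    using two[of k] two[of l] by metis
  hence "S = transpose B ** B" by (simp add: vec_eq_iff)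
  moreover have "B $ j $ i = 0" using ij(2) by (simp add: B_def)
  ultimately show ?thesis using that ij by blast
qed

section \<open>Areas of ellipses\<close>

lemma det_card_2:
  fixes B :: "real ^ 'd ^ 'd"
  assumes ij: "UNIV = {i, j}" "i \<noteq> j"
  shows "det B = B $ i $ i * B $ j $ j - B $ i $ j * B $ j $ i"
proof -
  have f12: "finite {j}" "i \<notin> {j}" using ij by auto
  show ?thesis
    unfolding det_def ij(1)
    unfolding sum_over_permutations_insert[OF f12]
    unfolding permutes_sing
    using ij(2) by (simp add: sign_swap_id sign_id swap_id_eq)
qed

text \<open>Vectors over an abstract index type with two elements are transported to pairs, where
  iterated integration in each coordinate is available.\<close>

lemma lborel_vec_2:
  assumes ij: "UNIV = {i :: 'd::finite, j}" "i \<noteq> j"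
  shows "(lborel :: (real \<times> real) measure) = distr (lborel :: (real ^ 'd) measure) borel (\<lambda>\<theta>. (\<theta> $ i, \<theta> $ j))"
proof (rule lborel_eqI)
  fix l u :: "real \<times> real"
  assume lu: "\<And>b. b \<in> Basis \<Longrightarrow> l \<bullet> b \<le> u \<bullet> b"
  have le: "fst l \<le> fst u" "snd l \<le> snd u"
    using lu[of "(1, 0)"] lu[of "(0, 1)"] by (auto simp: Basis_prod_def inner_prod_def)
  define l' u' :: "real ^ 'd" where "l' = (\<chi> k. if k = i then fst l else snd l)" and "u' = (\<chi> k. if k = i then fst u else snd u)"
  have two: "k = i \<or> k = j" for k using ij(1) by (metis UNIV_I insertE singletonD)
  have "(\<lambda>\<theta>. (\<theta> $ i, \<theta> $ j)) -` box l u = box l' u'"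
  proof safe
    fix \<theta> :: "real ^ 'd" assume "(\<theta> $ i, \<theta> $ j) \<in> box l u"
    hence "fst l < \<theta> $ i" "\<theta> $ i < fst u" "snd l < \<theta> $ j" "\<theta> $ j < snd u"
      by (auto simp: mem_box Basis_prod_def inner_prod_def)
    thus "\<theta> \<in> box l' u'" using two ij(2) by (auto simp: mem_box_cart l'_def u'_def)
  next
    fix \<theta> :: "real ^ 'd" assume "\<theta> \<in> box l' u'"
    hence "l' $ k < \<theta> $ k \<and> \<theta> $ k < u' $ k" for k by (simp add: mem_box_cart)
    from this[of i] this[of j] show "\<theta> \<in> (\<lambda>\<theta>. (\<theta> $ i, \<theta> $ j)) -` box l u" using ij(2)
      by (auto simp: mem_box Basis_prod_def inner_prod_def l'_def u'_def)
  qed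
  hence "emeasure (distr (lborel :: (real ^ 'd) measure) borel (\<lambda>\<theta>. (\<theta> $ i, \<theta> $ j))) (box l u) = emeasure lborel (box l' u')"
    by (subst emeasure_distr) (auto intro!: borel_measurable_Pair)
  also have "\<dots> = ennreal (\<Prod>b\<in>Basis. (u' - l') \<bullet> b)"
    using le by (intro emeasure_lborel_box) (auto simp: Basis_vec_def inner_axis l'_def u'_def)
  also have "(\<Prod>b\<in>Basis. (u' - l') \<bullet> b) = (\<Prod>k\<in>UNIV. u' $ k - l' $ k)"
  proof -
    have basis: "(Basis :: (real ^ 'd) set) = (\<lambda>k. axis k 1) ` UNIV" by (auto simp: Basis_vec_def)
    have "inj (\<lambda>k :: 'd. axis k (1::real))" by (auto simp: inj_def axis_eq_axis)
    thus ?thesis unfolding basis by (subst prod.reindex) (simp_all add: inner_axis)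
  qed
  also have "\<dots> = (fst u - fst l) * (snd u - snd l)"
    unfolding ij(1) using ij(2) by (simp add: l'_def u'_def)
  also have "\<dots> = (\<Prod>b\<in>Basis. (u - l) \<bullet> b)"
    by (simp add: Basis_prod_def prod.union_disjoint inner_prod_def)
  finally show "emeasure (distr (lborel :: (real ^ 'd) measure) borel (\<lambda>\<theta>. (\<theta> $ i, \<theta> $ j))) (box l u) = (\<Prod>b\<in>Basis. (u - l) \<bullet> b)" .
qed simp

text \<open>In the coordinates of the triangular B the ellipse becomes the disc of radius sqrt (2
  r): the second coordinate is scaled by \<kappa>, then for fixed y the first one is scaled by
  \<alpha> and shifted by \<beta> y. The product of the two scale factors is the
  determinant.\<close>

lemma emeasure_ellipse:
  fixes B :: "real ^ 'd ^ 'd"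
  assumes ij: "UNIV = {i, j}" "i \<noteq> j" and tri: "B $ j $ i = 0" and B: "det B \<noteq> 0" and r: "0 \<le> r"
  shows "emeasure lborel {\<theta>. (norm (B *v \<theta>))\<^sup>2 / 2 \<le> r} = ennreal (2 * pi / \<bar>det B\<bar> * r)"
proof -
  define \<alpha> \<beta> \<kappa> where "\<alpha> = B $ i $ i" and "\<beta> = B $ i $ j" and "\<kappa> = B $ j $ j"
  have det: "det B = \<alpha> * \<kappa>" by (simp add: det_card_2[OF ij] tri \<alpha>_def \<kappa>_def)
  have ak: "\<alpha> \<noteq> 0" "\<kappa> \<noteq> 0" using B det by auto
  have sum2: "(\<Sum>k\<in>UNIV. f k) = f i + f j" for f :: "'d \<Rightarrow> real"
    unfolding ij(1) using ij(2) by simp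
  have norm_eq: "(norm (B *v \<theta>))\<^sup>2 = (\<alpha> * \<theta> $ i + \<beta> * \<theta> $ j)\<^sup>2 + (\<kappa> * \<theta> $ j)\<^sup>2" for \<theta>
    unfolding power2_norm_eq_inner
    by (simp add: inner_vec_def matrix_vector_mult_def sum2 tri \<alpha>_def \<beta>_def \<kappa>_def power2_eq_square)
  define E where "E = {z::real\<times>real. (\<alpha> * fst z + \<beta> * snd z)\<^sup>2 + (\<kappa> * snd z)\<^sup>2 \<le> 2 * r}"
  define D where "D = {z::real\<times>real. (fst z)\<^sup>2 + (snd z)\<^sup>2 \<le> 2 * r}"
  have E_meas: "E \<in> sets borel" unfolding E_def
    by (intro borel_closed closed_Collect_le continuous_intros)
  have D_meas: "D \<in> sets borel" unfolding D_def
    by (intro borel_closed closed_Collect_le continuous_intros)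
  have "{\<theta>. (norm (B *v \<theta>))\<^sup>2 / 2 \<le> r} = (\<lambda>\<theta>. (\<theta> $ i, \<theta> $ j)) -` E"
    by (auto simp: norm_eq E_def)
  hence "emeasure lborel {\<theta>. (norm (B *v \<theta>))\<^sup>2 / 2 \<le> r} = emeasure lborel E"
    unfolding lborel_vec_2[OF ij] using E_meas by (subst emeasure_distr) (auto intro!: borel_measurable_Pair)
  moreover have "emeasure lborel D = ennreal \<bar>\<kappa>\<bar> * (ennreal \<bar>\<alpha>\<bar> * emeasure lborel E)"
  proof -
    have sec: "emeasure lborel F = (\<integral>\<^sup>+y. \<integral>\<^sup>+x. indicator F (x, y) \<partial>lborel \<partial>lborel)" if "F \<in> sets borel" for F :: "(real \<times> real) set"
    proof -
      have F: "F \<in> sets (lborel \<Otimes>\<^sub>M lborel)" using that by (simp only: lborel_prod sets_lborel)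
      have "emeasure lborel F = (\<integral>\<^sup>+z. indicator F z \<partial>(lborel \<Otimes>\<^sub>M lborel))"
        unfolding lborel_prod using that by simp
      also have "\<dots> = (\<integral>\<^sup>+y. \<integral>\<^sup>+x. indicator F (x, y) \<partial>lborel \<partial>lborel)"
        using F by (subst lborel_pair.nn_integral_snd[symmetric]) auto
      finally show ?thesis .
    qed
    have D_sec: "(\<lambda>x. indicator D (x, y) :: ennreal) \<in> borel_measurable borel" for y
      using D_meas by (intro measurable_compose[OF borel_measurable_Pair borel_measurable_indicator]) auto
    have E_sec: "(\<lambda>x. indicator E (x, y) :: ennreal) \<in> borel_measurable borel" for y
      using E_meas by (intro measurable_compose[OF borel_measurable_Pair borel_measurable_indicator]) auto
    have D_snd: "(\<lambda>y. \<integral>\<^sup>+x. indicator D (x, y) \<partial>lborel) \<in> borel_measurable (borel :: real measure)"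
    proof -
      have "(\<lambda>z. (snd z, fst z)) \<in> measurable (borel \<Otimes>\<^sub>M (lborel :: real measure)) (borel :: (real \<times> real) measure)"
        by (rule borel_measurable_Pair) measurable
      from measurable_compose[OF this borel_measurable_indicator[OF D_meas]]
      have "(\<lambda>(y, x). indicator D (x, y) :: ennreal) \<in> borel_measurable (borel \<Otimes>\<^sub>M lborel)"
        by (simp only: case_prod_beta')
      from lborel.borel_measurable_nn_integral[OF this] show ?thesis .
    qed
    have E_snd: "(\<lambda>y. \<integral>\<^sup>+x. indicator E (x, y) \<partial>lborel) \<in> borel_measurable (borel :: real measure)"
    proof -
      have "(\<lambda>z. (snd z, fst z)) \<in> measurable (borel \<Otimes>\<^sub>M (lborel :: real measure)) (borel :: (real \<times> real) measure)"
        by (rule borel_measurable_Pair) measurable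
      from measurable_compose[OF this borel_measurable_indicator[OF E_meas]]
      have "(\<lambda>(y, x). indicator E (x, y) :: ennreal) \<in> borel_measurable (borel \<Otimes>\<^sub>M lborel)"
        by (simp only: case_prod_beta')
      from lborel.borel_measurable_nn_integral[OF this] show ?thesis .
    qed
    have "emeasure lborel D = ennreal \<bar>\<kappa>\<bar> * (\<integral>\<^sup>+y. \<integral>\<^sup>+x. indicator D (x, 0 + \<kappa> * y) \<partial>lborel \<partial>lborel)"
      unfolding sec[OF D_meas] by (rule nn_integral_real_affine[OF D_snd ak(2)])
    also have "(\<lambda>y. \<integral>\<^sup>+x. indicator D (x, 0 + \<kappa> * y) \<partial>lborel) = (\<lambda>y. ennreal \<bar>\<alpha>\<bar> * (\<integral>\<^sup>+x. indicator E (x, y) \<partial>lborel))"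
    proof
      fix y
      have "(\<integral>\<^sup>+x. indicator D (x, 0 + \<kappa> * y) \<partial>lborel) = ennreal \<bar>\<alpha>\<bar> * (\<integral>\<^sup>+x. indicator D (\<beta> * y + \<alpha> * x, 0 + \<kappa> * y) \<partial>lborel)"
        by (rule nn_integral_real_affine[OF D_sec ak(1)])
      also have "(\<lambda>x. indicator D (\<beta> * y + \<alpha> * x, 0 + \<kappa> * y) :: ennreal) = (\<lambda>x. indicator E (x, y))"
        by (auto simp: indicator_def D_def E_def add.commute)
      finally show "(\<integral>\<^sup>+x. indicator D (x, 0 + \<kappa> * y) \<partial>lborel) = ennreal \<bar>\<alpha>\<bar> * (\<integral>\<^sup>+x. indicator E (x, y) \<partial>lborel)" .
    qed
    also have "(\<integral>\<^sup>+y. ennreal \<bar>\<alpha>\<bar> * (\<integral>\<^sup>+x. indicator E (x, y) \<partial>lborel) \<partial>lborel) = ennreal \<bar>\<alpha>\<bar> * emeasure lborel E"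
      unfolding sec[OF E_meas] by (rule nn_integral_cmult) (use E_snd in simp)
    finally show ?thesis .
  qed
  moreover have "emeasure lborel D = ennreal (2 * pi * r)"
  proof -
    have "D = cball 0 (sqrt (2 * r))"
      using r by (auto simp: D_def norm_Pair real_sqrt_le_iff)
    thus ?thesis using emeasure_cball[of "sqrt (2 * r)" "0 :: real \<times> real"] r by (simp add: unit_ball_vol_2 mult_ac)
  qed
  ultimately have "ennreal (2 * pi * r) = ennreal \<bar>det B\<bar> * emeasure lborel {\<theta>. (norm (B *v \<theta>))\<^sup>2 / 2 \<le> r}"
    by (simp add: det abs_mult ennreal_mult mult_ac)
  hence "ennreal (1 / \<bar>det B\<bar>) * ennreal (2 * pi * r) = ennreal (1 / \<bar>det B\<bar>) * ennreal \<bar>det B\<bar> * emeasure lborel {\<theta>. (norm (B *v \<theta>))\<^sup>2 / 2 \<le> r}"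
    by (simp only: mult.assoc)
  thus ?thesis using B r by (simp add: ennreal_mult[symmetric] del: ennreal_mult')
qed

text \<open>Half the covariance form, |B \<theta>|^2 / 2, has sublevel sets of area 2 pi r / |det
  B|. Division by (2 pi)^2 gives 1 / (2 pi |det B|), and A = 2 |det B|. Positive definiteness makes
  q comparable with the squared norm, so that the Taylor error is relative to q.\<close>

lemma green_asymp_planar:
  fixes p :: "(int ^ 'd) pmf"
  assumes card: "CARD('d) = 2"
    and sq: "\<And>i. integrable (measure_pmf p) (\<lambda>x. (real_of_int (x $ i))\<^sup>2)"
    and mean: "\<And>i. (\<integral>x. real_of_int (x $ i) \<partial>measure_pmf p) = 0"
    and inv: "invertible (variance_matrix (measure_pmf p) (\<lambda>x. x))"
    and span: "\<And>H. 0 \<in> H \<Longrightarrow> (\<And>x y. x \<in> H \<Longrightarrow> y \<in> H \<Longrightarrow> x - y \<in> H) \<Longrightarrow> set_pmf p \<subseteq> H \<Longrightarrow> H = UNIV"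
    and A: "A = 2 * sqrt (det (variance_matrix (measure_pmf p) (\<lambda>x. x)))"
  shows "A > 0" and "(\<lambda>n. green p n 0 / ln (real n)) \<longlonglongrightarrow> 1 / (pi * A)"
proof -
  define S where "S = variance_matrix (measure_pmf p) (\<lambda>x. x)"
  have S: "S $ k $ l = (\<integral>x. real_of_int (x $ k) * real_of_int (x $ l) \<partial>measure_pmf p)" for k l
    by (simp add: S_def variance_matrix_def mean)
  have int1: "integrable (measure_pmf p) (\<lambda>x. real_of_int (x $ i))" for i
    by (rule measure_pmf.square_integrable_imp_integrable[OF _ sq]) simp
  have int2: "integrable (measure_pmf p) (\<lambda>x. real_of_int (x $ k) * real_of_int (x $ l))" for k l
  proof (rule Bochner_Integration.integrable_bound)
    show "integrable (measure_pmf p) (\<lambda>x. (real_of_int (x $ k))\<^sup>2 + (real_of_int (x $ l))\<^sup>2)"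
      using sq by simp
    have "\<bar>u * v\<bar> \<le> u\<^sup>2 + v\<^sup>2" for u v :: real
    proof -
      have "2 * (\<bar>u\<bar> * \<bar>v\<bar>) \<le> u\<^sup>2 + v\<^sup>2" using sum_squares_bound[of "\<bar>u\<bar>" "\<bar>v\<bar>"] by simp
      moreover have "0 \<le> \<bar>u\<bar> * \<bar>v\<bar>" by simp
      ultimately show ?thesis unfolding abs_mult by linarith
    qed
    thus "AE x in measure_pmf p. norm (real_of_int (x $ k) * real_of_int (x $ l)) \<le> norm ((real_of_int (x $ k))\<^sup>2 + (real_of_int (x $ l))\<^sup>2)"
      by (intro AE_I2) simp
  qed simp
  have quad: "\<theta> \<bullet> (S *v \<theta>) = (\<integral>x. (\<theta> \<bullet> emb x)\<^sup>2 \<partial>measure_pmf p)" for \<theta>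
  proof -
    have "\<theta> \<bullet> (S *v \<theta>) = (\<Sum>k\<in>UNIV. \<Sum>l\<in>UNIV. \<integral>x. (\<theta> $ k * \<theta> $ l) * (real_of_int (x $ k) * real_of_int (x $ l)) \<partial>measure_pmf p)"
      by (simp add: inner_vec_def matrix_vector_mult_def S sum_distrib_left mult_ac)
    also have "\<dots> = (\<integral>x. (\<Sum>k\<in>UNIV. \<Sum>l\<in>UNIV. (\<theta> $ k * \<theta> $ l) * (real_of_int (x $ k) * real_of_int (x $ l))) \<partial>measure_pmf p)"
      using int2 by (simp add: integral_sum)
    also have "\<dots> = (\<integral>x. (\<theta> \<bullet> emb x)\<^sup>2 \<partial>measure_pmf p)"
      by (intro Bochner_Integration.integral_cong refl)
         (simp add: inner_vec_def emb_def power2_eq_square sum_product mult_ac)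
    finally show ?thesis .
  qed
  have sym: "S $ k $ l = S $ l $ k" for k l by (simp add: S mult.commute)
  have psd: "\<theta> \<bullet> (S *v \<theta>) \<ge> 0" for \<theta> unfolding quad by simp
  have invS: "invertible S" unfolding S_def by (rule inv)
  obtain B :: "real ^ 'd ^ 'd" and i j where B: "S = transpose B ** B"
    and ij: "UNIV = {i, j}" "i \<noteq> j" and tri: "B $ j $ i = 0"
    by (rule gram_factor_2[OF card sym psd invS])
  have "det S \<noteq> 0" using inv by (simp add: S_def invertible_det_nz)
  hence detB: "det B \<noteq> 0" by (simp add: B det_mul)
  have "det S = (det B)\<^sup>2" by (simp add: B det_mul det_transpose power2_eq_square)
  hence A': "A = 2 * \<bar>det B\<bar>" using A by (simp add: S_def)
  thus "A > 0" using detB by simp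
  have quadB: "\<theta> \<bullet> (S *v \<theta>) = (norm (B *v \<theta>))\<^sup>2" for \<theta>
    by (simp only: B matrix_vector_mul_assoc[symmetric] transpose_matrix_vector inner_commute[of \<theta>] dot_lmul_matrix power2_norm_eq_inner)
  define q where "q = (\<lambda>\<theta>. (norm (B *v \<theta>))\<^sup>2 / 2)"
  have q_eq: "q \<theta> = (\<integral>x. (\<theta> \<bullet> emb x)\<^sup>2 \<partial>measure_pmf p) / 2" for \<theta>
    by (simp add: q_def quadB[symmetric] quad)
  have "inj ((*v) B)" using detB by (intro inj_matrix_vector_mult) (simp add: invertible_det_nz)
  from linear_inj_bounded_below_pos[OF matrix_vector_mul_linear this]
  obtain m where m: "m > 0" "\<And>\<theta>. m * norm \<theta> \<le> norm (B *v \<theta>)" by blast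
  have q_ge: "m\<^sup>2 / 2 * (norm \<theta>)\<^sup>2 \<le> q \<theta>" for \<theta>
    using power_mono[OF m(2)[of \<theta>], of 2] m(1) by (simp add: q_def power_mult_distrib)
  have q_small: "norm \<theta> \<le> \<delta>" if "q \<theta> \<le> m\<^sup>2 / 2 * \<delta>\<^sup>2" "\<delta> > 0" for \<theta> \<delta>
  proof -
    have "m\<^sup>2 / 2 * (norm \<theta>)\<^sup>2 \<le> m\<^sup>2 / 2 * \<delta>\<^sup>2" using q_ge[of \<theta>] that by linarith
    hence "(norm \<theta>)\<^sup>2 \<le> \<delta>\<^sup>2" using m(1) by simp
    thus ?thesis using that by (simp add: power_mono_iff)
  qed
  have "(\<lambda>n. green p n 0 / ln (real n)) \<longlonglongrightarrow> (2 * pi / \<bar>det B\<bar>) / (2 * pi) ^ CARD('d)"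
  proof (rule green_asymp_local[where q=q and \<delta>\<^sub>0="m\<^sup>2 / 2 * pi\<^sup>2"])
    show "continuous_on UNIV q" unfolding q_def by (intro continuous_intros) auto
    show "0 \<le> q \<theta>" for \<theta> by (simp add: q_def)
    show "emeasure lborel {\<theta>. q \<theta> \<le> r} = ennreal (2 * pi / \<bar>det B\<bar> * r)" if "0 \<le> r" for r
      unfolding q_def by (rule emeasure_ellipse[OF ij tri detB that])
    show "2 * pi / \<bar>det B\<bar> > 0" using detB by simp
    show "m\<^sup>2 / 2 * pi\<^sup>2 > 0" using m(1) by simp
    show "{\<theta>. q \<theta> \<le> m\<^sup>2 / 2 * pi\<^sup>2} \<subseteq> torus_box"
      using q_small[of _ pi] norm_le_in_torus_box by auto
    show "lchar p \<theta> \<noteq> 1" if "\<theta> \<in> torus_box" "q \<theta> > 0" for \<theta>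
    proof (rule lchar_ne_1[OF span that(1)])
      show "\<theta> \<noteq> 0" using that(2) by (auto simp: q_def)
    qed
    show "\<exists>\<delta>>0. \<forall>\<theta>. q \<theta> \<le> \<delta> \<longrightarrow> norm (1 - lchar p \<theta> - q \<theta>) \<le> \<eta> * q \<theta>" if "\<eta> > 0" for \<eta>
    proof -
      have "integrable (measure_pmf p) (\<lambda>x. (norm (emb x))\<^sup>2)"
        using sq by (simp add: power2_norm_eq_inner inner_vec_def emb_def power2_eq_square[symmetric])
      moreover have "(\<integral>x. \<theta> \<bullet> emb x \<partial>measure_pmf p) = 0" for \<theta> :: "real ^ 'd"
        using int1 by (simp add: inner_vec_def emb_def integral_sum mean)
      moreover have "\<eta> * (m\<^sup>2 / 2) > 0" using that m(1) by simp
      ultimately obtain \<delta> where \<delta>: "\<delta> > 0" "\<And>\<theta>. norm \<theta> \<le> \<delta> \<Longrightarrow> norm (1 - lchar p \<theta> - of_real ((\<integral>x. (\<theta> \<bullet> emb x)\<^sup>2 \<partial>measure_pmf p) / 2)) \<le> \<eta> * (m\<^sup>2 / 2) * (norm \<theta>)\<^sup>2"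
        using norm_lchar_taylor[of p "\<eta> * (m\<^sup>2 / 2)"] by blast
      show ?thesis
      proof (intro exI[of _ "m\<^sup>2 / 2 * \<delta>\<^sup>2"] conjI allI impI)
        show "m\<^sup>2 / 2 * \<delta>\<^sup>2 > 0" using m(1) \<delta>(1) by simp
        fix \<theta> assume "q \<theta> \<le> m\<^sup>2 / 2 * \<delta>\<^sup>2"
        from \<delta>(2)[OF q_small[OF this \<delta>(1)]]
        have "norm (1 - lchar p \<theta> - q \<theta>) \<le> \<eta> * (m\<^sup>2 / 2 * (norm \<theta>)\<^sup>2)" by (simp add: q_eq mult_ac)
        also have "\<dots> \<le> \<eta> * q \<theta>" using that by (intro mult_left_mono q_ge) auto
        finally show "norm (1 - lchar p \<theta> - q \<theta>) \<le> \<eta> * q \<theta>" .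
      qed
    qed
  qed
  moreover have "(2 * pi / \<bar>det B\<bar>) / (2 * pi) ^ CARD('d) = 1 / (pi * A)"
    using detB by (simp add: card A' power2_eq_square field_simps)
  ultimately show "(\<lambda>n. green p n 0 / ln (real n)) \<longlonglongrightarrow> 1 / (pi * A)" by simp
qed

text \<open>On the line the sublevel sets of A |\<theta>| are intervals of length 2 r / A, again
  linear in r, and division by 2 pi gives the same constant 1 / (pi A).\<close>

lemma green_asymp_cauchy:
  fixes p :: "(int ^ 'd) pmf"
  assumes card: "CARD('d) = 1" and A: "A > 0"
    and loc: "\<And>\<eta>. \<eta> > 0 \<Longrightarrow> \<exists>\<delta>>0. \<forall>\<theta>. norm \<theta> \<le> \<delta> \<longrightarrow> norm (1 - lchar p \<theta> - A * norm \<theta>) \<le> \<eta> * norm \<theta>"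
    and span: "\<And>H. 0 \<in> H \<Longrightarrow> (\<And>x y. x \<in> H \<Longrightarrow> y \<in> H \<Longrightarrow> x - y \<in> H) \<Longrightarrow> set_pmf p \<subseteq> H \<Longrightarrow> H = UNIV"
  shows "(\<lambda>n. green p n 0 / ln (real n)) \<longlonglongrightarrow> 1 / (pi * A)"
proof -
  have "(\<lambda>n. green p n 0 / ln (real n)) \<longlonglongrightarrow> (2 / A) / (2 * pi) ^ CARD('d)"
  proof (rule green_asymp_local[where q="\<lambda>\<theta>. A * norm \<theta>" and \<delta>\<^sub>0="A * pi"])
    show "emeasure lborel {\<theta>::real^'d. A * norm \<theta> \<le> r} = ennreal (2 / A * r)" if "0 \<le> r" for r
    proof -
      have "{\<theta>::real^'d. A * norm \<theta> \<le> r} = cball 0 (r / A)" using A by (auto simp: field_simps)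
      thus ?thesis using emeasure_cball[of "r / A" "0 :: real ^ 'd"] that A card by simp
    qed
    show "{\<theta>::real^'d. A * norm \<theta> \<le> A * pi} \<subseteq> torus_box" using A norm_le_in_torus_box by auto
    show "lchar p \<theta> \<noteq> 1" if "\<theta> \<in> torus_box" "A * norm \<theta> > 0" for \<theta>
      using that by (intro lchar_ne_1[OF span that(1)]) auto
    show "\<exists>\<delta>>0. \<forall>\<theta>. A * norm \<theta> \<le> \<delta> \<longrightarrow> norm (1 - lchar p \<theta> - (A * norm \<theta>)) \<le> \<eta> * (A * norm \<theta>)" if "\<eta> > 0" for \<eta>
    proof -
      obtain \<delta> where "\<delta> > 0" "\<And>\<theta>. norm \<theta> \<le> \<delta> \<Longrightarrow> norm (1 - lchar p \<theta> - A * norm \<theta>) \<le> \<eta> * A * norm \<theta>"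
        using loc[of "\<eta> * A"] \<open>\<eta> > 0\<close> A by auto
      thus ?thesis using A by (intro exI[of _ "A * \<delta>"]) (auto simp: mult_ac)
    qed
  qed (use A in \<open>auto intro!: continuous_intros\<close>)
  moreover have "(2 / A) / (2 * pi) ^ CARD('d) = 1 / (pi * A)" using A by (simp add: card field_simps)
  ultimately show ?thesis by simp
qed

section \<open>Expansion of characteristic functions at the origin\<close>

lemma norm_iexp_diff_le: "norm (iexp a - iexp b) \<le> \<bar>a - b\<bar>"
proof -
  have "iexp a - iexp b = iexp b * (iexp (a - b) - 1)"
    by (simp add: algebra_simps flip: exp_add)
  also have "norm \<dots> = norm (iexp (a - b) - 1)" by (simp only: norm_mult norm_exp_i_times mult_1)
  also have "\<dots> \<le> \<bar>a - b\<bar>" using iexp_approx1[of "a - b" 0] by simp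
  finally show ?thesis .
qed

text \<open>In a Skorohod coupling the two exponentials differ by at most min 2 |Y_n - Y| for all
  |t| \<le> 1 at once. Uniformity in t, and not only pointwise convergence, is what later permits
  following the logarithm continuously from 0.\<close>

lemma weak_conv_char_uniform:
  fixes \<mu> :: "nat \<Rightarrow> real measure"
  assumes "\<And>n. real_distribution (\<mu> n)" "real_distribution \<nu>" "weak_conv_m \<mu> \<nu>" "e > 0"
  shows "\<forall>\<^sub>F n in sequentially. \<forall>t. \<bar>t\<bar> \<le> 1 \<longrightarrow> norm (char (\<mu> n) t - char \<nu> t) < e"
proof -
  from Skorohod[OF assms(1-3)] obtain \<Omega> :: "real measure" and Yn :: "nat \<Rightarrow> real \<Rightarrow> real" and Y :: "real \<Rightarrow> real" where
    Y: "prob_space \<Omega>" "\<And>n. Yn n \<in> measurable \<Omega> borel" "\<And>n. distr \<Omega> borel (Yn n) = \<mu> n"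
    "Y \<in> measurable \<Omega> lborel" "distr \<Omega> borel Y = \<nu>" "\<And>x. x \<in> space \<Omega> \<Longrightarrow> (\<lambda>n. Yn n x) \<longlonglongrightarrow> Y x"
    by blast
  interpret prob_space \<Omega> by fact
  note [measurable] = Y(2)
  have [measurable]: "Y \<in> borel_measurable \<Omega>" using Y(4) by simp
  have "(\<lambda>n. \<integral>x. min 2 \<bar>Yn n x - Y x\<bar> \<partial>\<Omega>) \<longlonglongrightarrow> (\<integral>x. 0 \<partial>\<Omega>)"
  proof (rule integral_dominated_convergence[where w="\<lambda>_. 2"])
    show "AE x in \<Omega>. (\<lambda>n. min 2 \<bar>Yn n x - Y x\<bar>) \<longlonglongrightarrow> 0"
    proof (rule AE_I2)
      fix x assume "x \<in> space \<Omega>"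
      hence "(\<lambda>n. min 2 \<bar>Yn n x - Y x\<bar>) \<longlonglongrightarrow> min 2 \<bar>Y x - Y x\<bar>"
        by (intro tendsto_intros Y(6))
      thus "(\<lambda>n. min 2 \<bar>Yn n x - Y x\<bar>) \<longlonglongrightarrow> 0" by simp
    qed
  qed (auto intro!: AE_I2)
  hence "\<forall>\<^sub>F n in sequentially. (\<integral>x. min 2 \<bar>Yn n x - Y x\<bar> \<partial>\<Omega>) < e"
    using assms(4) by (intro order_tendstoD(2)) auto
  thus ?thesis
  proof eventually_elim
    case (elim n)
    show ?case
    proof (intro allI impI)
      fix t :: real assume t: "\<bar>t\<bar> \<le> 1"
      have int: "integrable \<Omega> (\<lambda>x. iexp (t * f x))" if "f \<in> borel_measurable \<Omega>" for f
        using that by (intro integrable_const_bound[where B=1]) auto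
      have "char (\<mu> n) t - char \<nu> t = (\<integral>x. iexp (t * Yn n x) - iexp (t * Y x) \<partial>\<Omega>)"
      proof -
        have c1: "char (\<mu> n) t = (\<integral>x. iexp (t * Yn n x) \<partial>\<Omega>)"
          unfolding Y(3)[symmetric] char_def by (subst integral_distr) auto
        have c2: "char \<nu> t = (\<integral>x. iexp (t * Y x) \<partial>\<Omega>)"
          unfolding Y(5)[symmetric] char_def by (subst integral_distr) auto
        show ?thesis unfolding c1 c2
          by (rule Bochner_Integration.integral_diff[symmetric]) (rule int, measurable)+
      qed
      also have "norm \<dots> \<le> (\<integral>x. norm (iexp (t * Yn n x) - iexp (t * Y x)) \<partial>\<Omega>)"
        by (rule integral_norm_bound)
      also have "\<dots> \<le> (\<integral>x. min 2 \<bar>Yn n x - Y x\<bar> \<partial>\<Omega>)"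
      proof (rule integral_mono)
        show "integrable \<Omega> (\<lambda>x. min 2 \<bar>Yn n x - Y x\<bar>)"
          by (rule integrable_const_bound[where B=2]) auto
        fix x
        have "norm (iexp (t * Yn n x) - iexp (t * Y x)) \<le> \<bar>t * Yn n x - t * Y x\<bar>" by (rule norm_iexp_diff_le)
        also have "\<dots> = \<bar>t\<bar> * \<bar>Yn n x - Y x\<bar>" by (simp add: abs_mult[symmetric] right_diff_distrib)
        also have "\<dots> \<le> 1 * \<bar>Yn n x - Y x\<bar>" using t by (intro mult_right_mono) auto
        finally have "norm (iexp (t * Yn n x) - iexp (t * Y x)) \<le> \<bar>Yn n x - Y x\<bar>" by simp
        moreover have "norm (iexp (t * Yn n x) - iexp (t * Y x)) \<le> 1 + 1"
          by (rule order.trans[OF norm_triangle_ineq4]) (simp only: norm_exp_i_times order_refl)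
        ultimately show "norm (iexp (t * Yn n x) - iexp (t * Y x)) \<le> min 2 \<bar>Yn n x - Y x\<bar>" by simp
      next
        show "integrable \<Omega> (\<lambda>x. norm (iexp (t * Yn n x) - iexp (t * Y x)))"
          by (intro integrable_norm Bochner_Integration.integrable_diff int) measurable
      qed
      also note elim
      finally show "norm (char (\<mu> n) t - char \<nu> t) < e" .
    qed
  qed
qed

text \<open>Both sides exponentiate to the same number, so they differ by a multiple of 2 pi i; the
  difference is continuous on an interval, hence constant, and vanishes at 0.\<close>

lemma log_power_eq:
  fixes \<phi> :: "real \<Rightarrow> complex"
  assumes cont: "continuous_on {-V..V} \<phi>" and V: "0 \<le> V" and \<phi>0: "\<phi> 0 = 1"
    and near: "\<And>v. \<bar>v\<bar> \<le> V \<Longrightarrow> norm (\<phi> v - 1) < 1" "\<And>v. \<bar>v\<bar> \<le> V \<Longrightarrow> norm (\<phi> v ^ n - 1) < 1"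
    and v: "\<bar>v\<bar> \<le> V"
  shows "of_nat n * Ln (\<phi> v) = Ln (\<phi> v ^ n)"
proof -
  have nonneg: "z \<notin> \<real>\<^sub>\<le>\<^sub>0" if "norm (z - 1) < 1" for z :: complex
  proof
    assume "z \<in> \<real>\<^sub>\<le>\<^sub>0"
    then obtain x where x: "z = of_real x" "x \<le> 0" by (auto simp: nonpos_Reals_def)
    hence "z - 1 = of_real (x - 1)" by simp
    hence "norm (z - 1) = \<bar>x - 1\<bar>" by (simp only: norm_of_real)
    thus False using that x by simp
  qed
  define f where "f = (\<lambda>v. of_nat n * Ln (\<phi> v) - Ln (\<phi> v ^ n))"
  have "continuous_on {-V..V} f"
    unfolding f_def using near by (intro continuous_intros cont nonneg) auto
  moreover have ex: "\<exists>k::int. f v = of_int (2 * k) * pi * \<i>" if "v \<in> {-V..V}" for v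
  proof -
    have "\<phi> v \<noteq> 0" using near(1)[of v] that by (auto simp: abs_le_iff)
    hence "exp (f v) = 1"
      by (simp add: f_def exp_diff exp_of_nat_mult)
    then obtain k :: int where "Im (f v) = of_int (2 * k) * pi" "Re (f v) = 0"
      by (auto simp: exp_eq_1)
    thus ?thesis by (intro exI[of _ k]) (auto simp: complex_eq_iff)
  qed
  have "f constant_on {-V..V}"
  proof (rule continuous_discrete_range_constant)
    show "continuous_on {-V..V} f" by fact
    fix x assume x: "x \<in> {-V..V}"
    show "\<exists>e>0. \<forall>y. y \<in> {-V..V} \<and> f y \<noteq> f x \<longrightarrow> e \<le> norm (f y - f x)"
    proof (intro exI[of _ 1] conjI allI impI)
      fix y assume y: "y \<in> {-V..V} \<and> f y \<noteq> f x"
      obtain k l :: int where k: "f x = of_int (2 * k) * pi * \<i>" and l: "f y = of_int (2 * l) * pi * \<i>"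
        using ex[OF x] ex[of y] y by blast
      have "l \<noteq> k" using k l y by auto
      have "f y - f x = of_real (of_int (2 * (l - k)) * pi) * \<i>" by (simp add: k l algebra_simps)
      hence "norm (f y - f x) = \<bar>of_int (2 * (l - k))\<bar> * pi" by (simp only: norm_mult norm_of_real abs_mult) simp
      moreover have "\<bar>of_int (2 * (l - k)) :: real\<bar> \<ge> 1"
      proof -
        have "1 \<le> \<bar>2 * (l - k)\<bar>" using \<open>l \<noteq> k\<close> by presburger
        hence "real_of_int 1 \<le> real_of_int \<bar>2 * (l - k)\<bar>" by (simp only: of_int_le_iff)
        thus ?thesis by simp
      qed
      moreover have "pi \<ge> 1" using pi_gt3 by simp
      ultimately show "1 \<le> norm (f y - f x)" using mult_mono[of 1 _ 1 pi] by simp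
    qed simp
  qed auto
  then obtain c where c: "\<And>v. v \<in> {-V..V} \<Longrightarrow> f v = c" by (auto simp: constant_on_def)
  have "f v = f 0" using c[of v] c[of 0] v V by (auto simp: abs_le_iff)
  thus ?thesis by (simp add: f_def \<phi>0)
qed

text \<open>The hypothesis controls n-th powers at arguments t n^(-1/\<beta>) only. For a given
  small v take n with n |v|^\<beta> near a fixed s, compare the logarithms of the n-th powers and
  divide by n: an absolute error of order s becomes an error relative to |v|^\<beta>.\<close>

lemma log_expansion:
  fixes \<phi> :: "real \<Rightarrow> complex" and \<zeta> :: "real \<Rightarrow> complex"
  assumes cont: "continuous_on UNIV \<phi>" and \<phi>0: "\<phi> 0 = 1" and \<beta>: "\<beta> > 0"
    and conv: "\<And>e. e > 0 \<Longrightarrow> \<forall>\<^sub>F n in sequentially. \<forall>t. \<bar>t\<bar> \<le> 1 \<longrightarrow>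
      norm (\<phi> (t * real n powr (- 1 / \<beta>)) ^ n - exp (- (of_real (\<bar>t\<bar> powr \<beta>) * \<zeta> (sgn t)))) < e"
    and e: "e > 0"
  obtains \<delta> where "\<delta> > 0" "\<And>v. \<bar>v\<bar> \<le> \<delta> \<Longrightarrow> \<exists>r. norm r \<le> e \<and> \<phi> v = exp (- (of_real (\<bar>v\<bar> powr \<beta>) * (\<zeta> (sgn v) + r)))"
proof -
  define w where "w = (\<lambda>t. of_real (\<bar>t\<bar> powr \<beta>) * \<zeta> (sgn t))"
  define Z where "Z = 1 + norm (\<zeta> 1) + norm (\<zeta> (-1)) + norm (\<zeta> 0)"
  have Z: "Z \<ge> 1" by (simp add: Z_def)
  have w_le: "norm (w t) \<le> \<bar>t\<bar> powr \<beta> * Z" for t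
  proof -
    have "norm (\<zeta> (sgn t)) \<le> Z" by (auto simp: Z_def sgn_if add_increasing add_increasing2)
    thus ?thesis unfolding w_def norm_mult norm_of_real by (intro mult_mono) auto
  qed
  have "\<exists>d>0. \<forall>z::complex. dist z 0 < d \<longrightarrow> dist (exp z) (exp 0) < 1 / 4"
    using isCont_exp[of "0::complex"] by (auto simp only: continuous_at_eps_delta)
  then obtain \<rho> where \<rho>: "\<rho> > 0" "\<And>z::complex. norm z < \<rho> \<Longrightarrow> norm (exp z - 1) < 1 / 4"
    by (auto simp: dist_norm)
  \<comment> \<open>For |t| \<le> \<tau> the modulus of w t is then at most s Z, half of the smaller
    of \<rho> and 1. So exp (- w t) stays within 1/4 of 1 and the principal logarithm inverts
    it.\<close>
  define s where "s = min \<rho> 1 / (2 * Z)"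
  have s: "0 < s" "s < 1" "s * Z < \<rho>" "s * Z < 1" using \<rho>(1) Z by (auto simp: s_def field_simps min_def)
  define \<tau> where "\<tau> = s powr (1 / \<beta>)"
  have \<tau>: "0 < \<tau>" "\<tau> \<le> 1" "\<tau> powr \<beta> = s"
    using s \<beta> by (auto simp: \<tau>_def powr_powr intro!: powr_le1)
  have w_small: "norm (w t) < \<rho>" "norm (w t) < 1" if "\<bar>t\<bar> \<le> \<tau>" for t
  proof -
    have "\<bar>t\<bar> powr \<beta> * Z \<le> s * Z"
      unfolding \<tau>(3)[symmetric] using that \<beta> Z by (intro mult_right_mono powr_mono2) auto
    thus "norm (w t) < \<rho>" "norm (w t) < 1" using w_le[of t] s by linarith+
  qed
  have expw: "norm (exp (- w t) - 1) < 1 / 4" if "\<bar>t\<bar> \<le> \<tau>" for t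
    using w_small[OF that] by (intro \<rho>) auto
  have Lnw: "Ln (exp (- w t)) = - w t" if "\<bar>t\<bar> \<le> \<tau>" for t
  proof -
    have "\<bar>Im (- w t)\<bar> < pi" using abs_Im_le_cmod[of "- w t"] w_small[OF that] pi_gt3 by simp
    thus ?thesis by (intro Ln_exp) (auto simp: abs_less_iff)
  qed
  \<comment> \<open>The n chosen below satisfies n |v|^\<beta> \<ge> s / 2, so an error e' in the
    logarithm of the power becomes at most e after division.\<close>
  define e' where "e' = e * s / 2"
  have e': "e' > 0" using e s by (simp add: e'_def)
  have "z \<notin> \<real>\<^sub>\<le>\<^sub>0" if "z \<in> cball 1 (3/4)" for z :: complex
  proof
    assume "z \<in> \<real>\<^sub>\<le>\<^sub>0"
    then obtain x where x: "z = of_real x" "x \<le> 0" by (auto simp: nonpos_Reals_def)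
    hence "1 - z = of_real (1 - x)" by simp
    hence "dist 1 z = \<bar>1 - x\<bar>" by (simp only: norm_of_real dist_norm)
    thus False using that x by simp
  qed
  hence "continuous_on (cball 1 (3/4)) Ln" by (intro continuous_intros) auto
  from compact_uniformly_continuous[OF this compact_cball] e' obtain d where
    d: "d > 0" "\<And>x y. x \<in> cball 1 (3/4) \<Longrightarrow> y \<in> cball 1 (3/4) \<Longrightarrow> dist y x < d \<Longrightarrow> dist (Ln y) (Ln x) < e'"
    unfolding uniformly_continuous_on_def by metis
  have "isCont \<phi> 0" using cont by (simp add: continuous_on_eq_continuous_at)
  hence "\<exists>d>0. \<forall>v. dist v 0 < d \<longrightarrow> dist (\<phi> v) (\<phi> 0) < 1 / 2"
    unfolding continuous_at_eps_delta by (elim allE[of _ "1 / 2"]) simp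
  then obtain \<delta>0 where \<delta>0: "\<delta>0 > 0" "\<And>v. \<bar>v\<bar> < \<delta>0 \<Longrightarrow> norm (\<phi> v - 1) < 1 / 2"
    by (auto simp: dist_norm \<phi>0)
  have "(\<lambda>n. \<tau> * real n powr (- 1 / \<beta>)) \<longlonglongrightarrow> 0" using \<beta> by real_asymp
  hence "\<forall>\<^sub>F n in sequentially. \<tau> * real n powr (- 1 / \<beta>) < \<delta>0" using \<delta>0(1) by (intro order_tendstoD(2)) auto
  moreover have "\<forall>\<^sub>F n in sequentially. \<forall>t. \<bar>t\<bar> \<le> 1 \<longrightarrow> norm (\<phi> (t * real n powr (- 1 / \<beta>)) ^ n - exp (- w t)) < min d (1/4)"
    unfolding w_def by (rule conv) (use d(1) in auto)
  ultimately have "\<forall>\<^sub>F n in sequentially. \<tau> * real n powr (- 1 / \<beta>) < \<delta>0 \<and> (\<forall>t. \<bar>t\<bar> \<le> 1 \<longrightarrow> norm (\<phi> (t * real n powr (- 1 / \<beta>)) ^ n - exp (- w t)) < min d (1/4))"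
    by eventually_elim auto
  then obtain N where N: "\<And>n. n \<ge> N \<Longrightarrow> \<tau> * real n powr (- 1 / \<beta>) < \<delta>0"
    "\<And>n t. n \<ge> N \<Longrightarrow> \<bar>t\<bar> \<le> 1 \<Longrightarrow> norm (\<phi> (t * real n powr (- 1 / \<beta>)) ^ n - exp (- w t)) < min d (1/4)"
    unfolding eventually_sequentially by blast
  \<comment> \<open>The offset 2 absorbs the rounding in n: every |v| \<le> \<delta> leads to an n
    that exceeds N and is at least 1.\<close>
  define \<delta> where "\<delta> = \<tau> * real (N + 2) powr (- 1 / \<beta>)"
  show ?thesis
  proof (rule that[of \<delta>])
    show "\<delta> > 0" using \<tau> by (simp add: \<delta>_def)
    fix v assume v: "\<bar>v\<bar> \<le> \<delta>"
    show "\<exists>r. norm r \<le> e \<and> \<phi> v = exp (- (of_real (\<bar>v\<bar> powr \<beta>) * (\<zeta> (sgn v) + r)))"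
    proof (cases "v = 0")
      case True
      thus ?thesis using e \<phi>0 by (intro exI[of _ 0]) auto
    next
      case False
      \<comment> \<open>The largest n for which v n^(1/\<beta>) still lies in the range |t| \<le>
        \<tau>.\<close>
      define n where "n = nat \<lfloor>(\<tau> / \<bar>v\<bar>) powr \<beta>\<rfloor>"
      have pow: "(\<tau> / \<bar>v\<bar>) powr \<beta> = s / \<bar>v\<bar> powr \<beta>"
        using \<tau> False by (simp add: powr_divide)
      have big: "real (N + 2) \<le> (\<tau> / \<bar>v\<bar>) powr \<beta>"
      proof -
        have "real (N + 2) powr (1 / \<beta>) \<le> \<tau> / \<bar>v\<bar>"
          using v False \<tau> by (simp add: \<delta>_def powr_minus field_simps)
        hence "(real (N + 2) powr (1 / \<beta>)) powr \<beta> \<le> (\<tau> / \<bar>v\<bar>) powr \<beta>"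
          using \<beta> by (intro powr_mono2) auto
        thus ?thesis using \<beta> by (simp add: powr_powr)
      qed
      have n_le: "real n \<le> (\<tau> / \<bar>v\<bar>) powr \<beta>" unfolding n_def by simp
      have n_gt: "(\<tau> / \<bar>v\<bar>) powr \<beta> < real n + 1" unfolding n_def by linarith
      have nN: "n > N" "n \<ge> 1" using big n_gt by linarith+
      define V where "V = \<tau> * real n powr (- 1 / \<beta>)"
      have vV: "\<bar>v\<bar> \<le> V"
      proof -
        have "real n powr (1 / \<beta>) \<le> ((\<tau> / \<bar>v\<bar>) powr \<beta>) powr (1 / \<beta>)"
          using \<beta> n_le by (intro powr_mono2) auto
        also have "\<dots> = \<tau> / \<bar>v\<bar>" using \<beta> \<tau> by (simp add: powr_powr)
        finally show ?thesis using False nN \<tau> by (simp add: V_def powr_minus field_simps)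
      qed
      have scale: "u = (u * real n powr (1 / \<beta>)) * real n powr (- 1 / \<beta>)" for u
        using nN by (simp add: powr_minus)
      have le\<tau>: "\<bar>u * real n powr (1 / \<beta>)\<bar> \<le> \<tau>" if "\<bar>u\<bar> \<le> V" for u
      proof -
        have "\<bar>u\<bar> * real n powr (1 / \<beta>) \<le> V * real n powr (1 / \<beta>)" using that by (intro mult_right_mono) auto
        also have "\<dots> = \<tau>" using nN by (simp add: V_def powr_minus)
        finally show ?thesis by (simp add: abs_mult)
      qed
      have close: "norm (\<phi> u ^ n - exp (- w (u * real n powr (1 / \<beta>)))) < min d (1/4)" if "\<bar>u\<bar> \<le> V" for u
      proof -
        have "\<bar>u * real n powr (1 / \<beta>)\<bar> \<le> 1" using le\<tau>[OF that] \<tau> by linarith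
        from N(2)[OF less_imp_le[OF nN(1)] this] show ?thesis unfolding scale[symmetric] .
      qed
      have near1: "norm (\<phi> u ^ n - 1) < 1 / 2" if "\<bar>u\<bar> \<le> V" for u
        using norm_triangle_lt[of "\<phi> u ^ n - exp (- w (u * real n powr (1 / \<beta>)))" "exp (- w (u * real n powr (1 / \<beta>))) - 1" "1/2"]
          close[OF that] expw[OF le\<tau>[OF that]] by simp
      have "of_nat n * Ln (\<phi> v) = Ln (\<phi> v ^ n)"
      proof (rule log_power_eq[where V=V])
        show "continuous_on {-V..V} \<phi>" using cont by (rule continuous_on_subset) auto
        show "norm (\<phi> u - 1) < 1" if "\<bar>u\<bar> \<le> V" for u
          using \<delta>0(2)[of u] N(1)[of n] nN that by (force simp: V_def)
        show "norm (\<phi> u ^ n - 1) < 1" if "\<bar>u\<bar> \<le> V" for u using near1[OF that] by linarith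
      qed (use vV \<phi>0 in auto)
      moreover have "dist (Ln (\<phi> v ^ n)) (Ln (exp (- w (v * real n powr (1 / \<beta>))))) < e'"
        using close[OF vV] near1[OF vV] expw[OF le\<tau>[OF vV]] norm_minus_commute
        by (intro d(2)) (auto simp: dist_norm norm_minus_commute)
      moreover have "w (v * real n powr (1 / \<beta>)) = of_nat n * w v"
      proof -
        have "sgn (v * real n powr (1 / \<beta>)) = sgn v" using nN by (simp add: sgn_mult)
        moreover have "\<bar>v * real n powr (1 / \<beta>)\<bar> powr \<beta> = \<bar>v\<bar> powr \<beta> * real n"
          using \<beta> by (simp add: abs_mult powr_mult powr_powr)
        ultimately show ?thesis by (simp add: w_def)
      qed
      ultimately have "norm (of_nat n * (Ln (\<phi> v) + w v)) < e'"
        using Lnw[OF le\<tau>[OF vV]] by (simp add: dist_norm algebra_simps)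
      hence bd: "norm (Ln (\<phi> v) + w v) < e' / n"
        using nN by (simp add: norm_mult pos_less_divide_eq mult.commute)
      define r where "r = - (Ln (\<phi> v) + w v) / of_real (\<bar>v\<bar> powr \<beta>)"
      have vp: "\<bar>v\<bar> powr \<beta> > 0" using False by simp
      have "norm r = norm (Ln (\<phi> v) + w v) / \<bar>v\<bar> powr \<beta>" unfolding r_def norm_divide norm_minus_cancel by simp
      also have "\<dots> \<le> (e' / n) / \<bar>v\<bar> powr \<beta>" using bd by (intro divide_right_mono) auto
      also have "\<dots> \<le> e"
      proof -
        have "s / \<bar>v\<bar> powr \<beta> \<le> 2 * real n" using n_gt nN unfolding pow by linarith
        hence "s \<le> 2 * real n * \<bar>v\<bar> powr \<beta>" using vp by (simp add: field_simps)
        hence "e * s \<le> e * (2 * real n * \<bar>v\<bar> powr \<beta>)" using e by (intro mult_left_mono) auto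
        thus ?thesis using nN vp by (simp add: e'_def field_simps)
      qed
      finally have "norm r \<le> e" .
      moreover have "\<phi> v = exp (- (of_real (\<bar>v\<bar> powr \<beta>) * (\<zeta> (sgn v) + r)))"
      proof -
        have "\<bar>v\<bar> < \<delta>0" using vV N(1)[of n] nN by (auto simp: V_def)
        hence "\<phi> v \<noteq> 0" using \<delta>0(2)[of v] by auto
        moreover have "- (of_real (\<bar>v\<bar> powr \<beta>) * (\<zeta> (sgn v) + r)) = Ln (\<phi> v)"
          using vp by (simp add: r_def w_def field_simps)
        ultimately show ?thesis by simp
      qed
      ultimately show ?thesis by blast
    qed
  qed
qed


section \<open>The characteristic function of the scenery\<close>

lemma char_distr_sum_PiM:
  assumes "real_distribution \<nu>"
  shows "char (distr (Pi\<^sub>M {..<n::nat} (\<lambda>_. \<nu>)) borel (\<lambda>x. c * (\<Sum>k<n. x k))) t = char \<nu> (t * c) ^ n"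
proof -
  interpret \<nu>: real_distribution \<nu> by fact
  interpret P: product_prob_space "\<lambda>_::nat. \<nu>" by standard
  have meas: "(\<lambda>x. c * (\<Sum>k<n. x k)) \<in> borel_measurable (Pi\<^sub>M {..<n} (\<lambda>_. \<nu>))"
  proof -
    have "(\<lambda>x. x k) \<in> borel_measurable (Pi\<^sub>M {..<n} (\<lambda>_. \<nu>))" if "k < n" for k
      using measurable_component_singleton[of k "{..<n}" "\<lambda>_. \<nu>"] that by simp
    thus ?thesis by (intro borel_measurable_times borel_measurable_sum) auto
  qed
  have "char (distr (Pi\<^sub>M {..<n} (\<lambda>_. \<nu>)) borel (\<lambda>x. c * (\<Sum>k<n. x k))) t
    = (\<integral>x. (\<Prod>k<n. iexp (t * c * x k)) \<partial>Pi\<^sub>M {..<n} (\<lambda>_. \<nu>))"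
    unfolding char_def using meas
    by (subst integral_distr) (auto simp: exp_sum sum_distrib_left mult_ac intro!: Bochner_Integration.integral_cong)
  also have "\<dots> = (\<Prod>k<n. \<integral>x. iexp (t * c * x) \<partial>\<nu>)"
    by (rule P.product_integral_prod) (auto intro!: \<nu>.integrable_iexp)
  also have "\<dots> = char \<nu> (t * c) ^ n" by (simp add: char_def)
  finally show ?thesis .
qed

lemma stable_char_expansion:
  assumes \<nu>: "real_distribution \<nu>" and st: "strictly_stable \<beta> A\<^sub>1 A\<^sub>2 \<mu>"
    and nda: "normal_domain_of_attraction \<nu> \<beta> \<mu>" and e: "e > 0"
  obtains \<delta> where "\<delta> > 0" "\<And>v. \<bar>v\<bar> \<le> \<delta> \<Longrightarrow> \<exists>r. norm r \<le> e \<and>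
    char \<nu> v = exp (- (of_real (\<bar>v\<bar> powr \<beta>) * (of_real A\<^sub>1 + \<i> * of_real (A\<^sub>2 * sgn v) + r)))"
proof -
  interpret \<nu>: real_distribution \<nu> by fact
  interpret P: product_prob_space "\<lambda>_::nat. \<nu>" by standard
  have \<beta>: "\<beta> > 0" and \<mu>: "real_distribution \<mu>"
    and char\<mu>: "char \<mu> u = exp (- (of_real (\<bar>u\<bar> powr \<beta>) * (of_real A\<^sub>1 + \<i> * of_real (A\<^sub>2 * sgn u))))" for u
    using st unfolding strictly_stable_def by auto
  show ?thesis
  proof (rule log_expansion[of "char \<nu>" \<beta> "\<lambda>s. of_real A\<^sub>1 + \<i> * of_real (A\<^sub>2 * s)" e])
    show "continuous_on UNIV (char \<nu>)"
      by (intro continuous_at_imp_continuous_on ballI \<nu>.isCont_char)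
    fix e' :: real assume "e' > 0"
    have "real_distribution (distr (Pi\<^sub>M {..<n} (\<lambda>_. \<nu>)) borel (\<lambda>x. real n powr (- 1 / \<beta>) * (\<Sum>k<n. x k)))" for n
    proof -
      interpret Q: prob_space "Pi\<^sub>M {..<n} (\<lambda>_. \<nu>)" by (intro prob_space_PiM \<nu>.prob_space_axioms)
      have "(\<lambda>x. x k) \<in> borel_measurable (Pi\<^sub>M {..<n} (\<lambda>_. \<nu>))" if "k < n" for k
        using measurable_component_singleton[of k "{..<n}" "\<lambda>_. \<nu>"] that by simp
      thus ?thesis by (intro Q.real_distribution_distr borel_measurable_times borel_measurable_sum) auto
    qed
    from weak_conv_char_uniform[OF this \<mu> nda[unfolded normal_domain_of_attraction_def] \<open>e' > 0\<close>]
    show "\<forall>\<^sub>F n in sequentially. \<forall>t. \<bar>t\<bar> \<le> 1 \<longrightarrow>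
      norm (char \<nu> (t * real n powr (- 1 / \<beta>)) ^ n - exp (- (of_real (\<bar>t\<bar> powr \<beta>) * (of_real A\<^sub>1 + \<i> * of_real (A\<^sub>2 * sgn t))))) < e'"
      unfolding char_distr_sum_PiM[OF \<nu>] char\<mu> .
  qed (use \<beta> e \<nu>.char_zero that in auto)
qed

lemma strongly_nonlattice_eventually:
  assumes "strongly_nonlattice \<nu>"
  obtains \<rho> K where "\<rho> < 1" "\<And>v. K \<le> \<bar>v\<bar> \<Longrightarrow> norm (char \<nu> v) < \<rho>"
proof -
  from assms obtain l where l: "Limsup at_infinity (\<lambda>u. ereal (cmod (char \<nu> u))) < ereal l" "l < 1"
    unfolding strongly_nonlattice_def using ereal_dense2 by (metis ereal_less(3) one_ereal_def)
  have "\<forall>\<^sub>F u in at_infinity. ereal (cmod (char \<nu> u)) < ereal l"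
    by (rule Limsup_lessD[OF l(1)])
  then obtain K where "\<And>u. K \<le> norm u \<Longrightarrow> cmod (char \<nu> u) < l"
    by (auto simp: eventually_at_infinity)
  thus ?thesis using that[of l K] l(2) by auto
qed

text \<open>Modulus 1 at v means that exp (i v x) is almost surely constant. Then the modulus is 1
  at all multiples of v, which are eventually in the region excluded by the non-lattice
  condition.\<close>

lemma norm_char_less_1:
  assumes \<nu>: "real_distribution \<nu>" and snl: "strongly_nonlattice \<nu>" and v: "v \<noteq> 0"
  shows "norm (char \<nu> v) < 1"
proof (rule ccontr)
  interpret \<nu>: real_distribution \<nu> by fact
  assume "\<not> norm (char \<nu> v) < 1"
  hence one: "norm (char \<nu> v) = 1" using \<nu>.cmod_char_le_1[of v] by linarith
  define c where "c = char \<nu> v"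
  have pU: "measure \<nu> UNIV = 1" using \<nu>.prob_space by simp
  have c: "c * cnj c = 1" using one by (simp add: c_def complex_norm_square[symmetric])
  have int: "integrable \<nu> (\<lambda>x. iexp (v * x))" by (rule \<nu>.integrable_iexp) simp_all
  have "(\<integral>x. Re (iexp (v * x) * cnj c) \<partial>\<nu>) = Re (\<integral>x. iexp (v * x) * cnj c \<partial>\<nu>)"
    using int by (intro integral_Re) (rule integrable_mult_left)
  also have "\<dots> = 1" using c by (simp add: c_def char_def)
  finally have "(\<integral>x. 1 - Re (iexp (v * x) * cnj c) \<partial>\<nu>) = 0"
    using int by (subst Bochner_Integration.integral_diff) (auto intro!: integrable_Re integrable_mult_left simp: pU simp del: times_complex.sel)
  moreover have le1: "Re (iexp (v * x) * cnj c) \<le> 1" for x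
  proof -
    have "norm (iexp (v * x) * cnj c) = 1" using one by (simp add: norm_mult c_def)
    thus ?thesis using complex_Re_le_cmod[of "iexp (v * x) * cnj c"] by linarith
  qed
  ultimately have "AE x in \<nu>. 1 - Re (iexp (v * x) * cnj c) = 0"
    using int by (subst (asm) integral_nonneg_eq_0_iff_AE)
      (auto intro!: Bochner_Integration.integrable_diff integrable_Re integrable_mult_left simp del: times_complex.sel)
  hence AE: "AE x in \<nu>. iexp (v * x) = c"
  proof (rule AE_mp, intro AE_I2 impI)
    fix x assume Re: "1 - Re (iexp (v * x) * cnj c) = 0"
    define z where "z = iexp (v * x) * cnj c"
    have "norm z = 1" using one by (simp add: z_def norm_mult c_def)
    hence "(Re z)\<^sup>2 + (Im z)\<^sup>2 = 1" by (simp add: cmod_def)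
    moreover have "Re z = 1" using Re by (simp add: z_def)
    ultimately have "z = 1" by (simp add: complex_eq_iff)
    hence "iexp (v * x) * (c * cnj c) = c" by (simp add: z_def mult_ac)
    thus "iexp (v * x) = c" using c by simp
  qed
  have pow: "norm (char \<nu> (of_nat k * v)) = 1" for k
  proof -
    have "char \<nu> (of_nat k * v) = (\<integral>x. c ^ k \<partial>\<nu>)" unfolding char_def
    proof (rule integral_cong_AE)
      show "AE x in \<nu>. iexp (of_nat k * v * x) = c ^ k"
        using AE
      proof eventually_elim
        case (elim x)
        have "iexp (of_nat k * v * x) = iexp (v * x) ^ k"
          by (simp add: exp_of_nat_mult[symmetric] mult_ac)
        thus ?case using elim by simp
      qed
    qed auto
    thus ?thesis using one by (simp add: pU norm_power c_def)
  qed
  obtain \<rho> K where \<rho>: "\<rho> < 1" "\<And>v. K \<le> \<bar>v\<bar> \<Longrightarrow> norm (char \<nu> v) < \<rho>"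
    using strongly_nonlattice_eventually[OF snl] by blast
  obtain k :: nat where "K / \<bar>v\<bar> \<le> real k" using real_arch_simple by blast
  hence "K \<le> \<bar>of_nat k * v\<bar>" using v by (simp add: abs_mult field_simps)
  from \<rho>(2)[OF this] \<rho>(1) pow[of k] show False by simp
qed

text \<open>Three ranges: the stable expansion near 0, compactness with modulus below 1 in between,
  the non-lattice condition far out. The truncation \<open>min \<bar>v\<bar> 1\<close> merges them
  into one bound.\<close>

lemma char_decay_bound:
  assumes \<nu>: "real_distribution \<nu>" and st: "strictly_stable \<beta> A\<^sub>1 A\<^sub>2 \<mu>"
    and nda: "normal_domain_of_attraction \<nu> \<beta> \<mu>" and snl: "strongly_nonlattice \<nu>"
  obtains c where "c > 0" "\<And>v. norm (char \<nu> v) \<le> exp (- c * min \<bar>v\<bar> 1 powr \<beta>)"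
proof -
  interpret \<nu>: real_distribution \<nu> by fact
  have \<beta>: "\<beta> > 0" and A1: "A\<^sub>1 > 0" using st unfolding strictly_stable_def by auto
  obtain \<delta> where \<delta>: "\<delta> > 0" "\<And>v. \<bar>v\<bar> \<le> \<delta> \<Longrightarrow> \<exists>r. norm r \<le> A\<^sub>1 / 2 \<and>
    char \<nu> v = exp (- (of_real (\<bar>v\<bar> powr \<beta>) * (of_real A\<^sub>1 + \<i> * of_real (A\<^sub>2 * sgn v) + r)))"
    using stable_char_expansion[OF \<nu> st nda, of "A\<^sub>1 / 2"] A1 by auto
  have small: "norm (char \<nu> v) \<le> exp (- (A\<^sub>1 / 2) * \<bar>v\<bar> powr \<beta>)" if v: "\<bar>v\<bar> \<le> \<delta>" for v
  proof -
    obtain r where r: "norm r \<le> A\<^sub>1 / 2" "char \<nu> v = exp (- (of_real (\<bar>v\<bar> powr \<beta>) * (of_real A\<^sub>1 + \<i> * of_real (A\<^sub>2 * sgn v) + r)))"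
      using \<delta>(2)[OF v] by blast
    have "norm (char \<nu> v) = exp (- (\<bar>v\<bar> powr \<beta> * (A\<^sub>1 + Re r)))" unfolding r(2) by simp
    also have "\<dots> \<le> exp (- (\<bar>v\<bar> powr \<beta> * (A\<^sub>1 / 2)))"
    proof -
      have "A\<^sub>1 / 2 \<le> A\<^sub>1 + Re r" using abs_Re_le_cmod[of r] r(1) by linarith
      hence "\<bar>v\<bar> powr \<beta> * (A\<^sub>1 / 2) \<le> \<bar>v\<bar> powr \<beta> * (A\<^sub>1 + Re r)" by (intro mult_left_mono) auto
      thus ?thesis by simp
    qed
    finally show ?thesis by (simp add: mult.commute)
  qed
  obtain \<rho> K where \<rho>: "\<rho> < 1" "\<And>v. K \<le> \<bar>v\<bar> \<Longrightarrow> norm (char \<nu> v) < \<rho>"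
    using strongly_nonlattice_eventually[OF snl] by blast
  define C where "C = {v. \<delta> \<le> \<bar>v\<bar> \<and> \<bar>v\<bar> \<le> max K \<delta>}"
  have "compact C"
  proof -
    have "C = cball 0 (max K \<delta>) \<inter> {v. \<delta> \<le> \<bar>v\<bar>}" by (auto simp: C_def)
    moreover have "closed {v::real. \<delta> \<le> \<bar>v\<bar>}" by (intro closed_Collect_le continuous_intros)
    ultimately show ?thesis by (simp add: compact_Int_closed)
  qed
  moreover have "C \<noteq> {}" using \<delta>(1) by (auto simp: C_def intro!: exI[of _ \<delta>])
  moreover have "continuous_on C (\<lambda>v. norm (char \<nu> v))"
    by (intro continuous_at_imp_continuous_on ballI continuous_norm \<nu>.isCont_char)
  ultimately obtain v0 where v0: "v0 \<in> C" "\<And>v. v \<in> C \<Longrightarrow> norm (char \<nu> v) \<le> norm (char \<nu> v0)"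
    using continuous_attains_sup by metis
  \<comment> \<open>The entry 1/2 only ensures that m is positive, so that \<open>ln m\<close> is
    meaningful.\<close>
  define m where "m = max (max (norm (char \<nu> v0)) \<rho>) (1 / 2)"
  have "v0 \<noteq> 0" using v0(1) \<delta>(1) by (auto simp: C_def)
  hence m: "0 < m" "m < 1" using norm_char_less_1[OF \<nu> snl, of v0] \<rho>(1) by (auto simp: m_def)
  have large: "norm (char \<nu> v) \<le> m" if "\<bar>v\<bar> \<ge> \<delta>" for v
  proof (cases "\<bar>v\<bar> \<le> max K \<delta>")
    case True
    hence "norm (char \<nu> v) \<le> norm (char \<nu> v0)" using that by (intro v0(2)) (auto simp: C_def)
    thus ?thesis by (simp add: m_def)
  next
    case False
    hence "norm (char \<nu> v) < \<rho>" by (intro \<rho>(2)) auto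
    thus ?thesis by (simp add: m_def)
  qed
  define c where "c = min (A\<^sub>1 / 2) (- ln m)"
  have c: "c > 0" "c \<le> A\<^sub>1 / 2" "c \<le> - ln m" using A1 m by (auto simp: c_def)
  show ?thesis
  proof (rule that[OF c(1)])
    fix v :: real
    show "norm (char \<nu> v) \<le> exp (- c * min \<bar>v\<bar> 1 powr \<beta>)"
    proof (cases "\<bar>v\<bar> \<le> \<delta>")
      case True
      have "c * min \<bar>v\<bar> 1 powr \<beta> \<le> (A\<^sub>1 / 2) * \<bar>v\<bar> powr \<beta>"
        using c A1 \<beta> by (intro mult_mono powr_mono2) auto
      thus ?thesis by (intro order.trans[OF small[OF True]]) auto
    next
      case False
      have "min \<bar>v\<bar> 1 powr \<beta> \<le> 1 powr \<beta>" using \<beta> by (intro powr_mono2) auto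
      hence "c * min \<bar>v\<bar> 1 powr \<beta> \<le> - ln m * 1" using c by (intro mult_mono) auto
      hence "exp (ln m) \<le> exp (- c * min \<bar>v\<bar> 1 powr \<beta>)" by simp
      thus ?thesis using large[of v] False m by simp
    qed
  qed
qed

section \<open>Fourier representation of trapezoids\<close>

lemma integrable_cauchy_kernel: "integrable lborel (\<lambda>x::real. c / (1 + x\<^sup>2))"
proof -
  have "einterval (-\<infinity>) \<infinity> = UNIV" by (auto simp: einterval_def)
  hence "integrable lborel (\<lambda>x::real. inverse (1 + x\<^sup>2))"
    using integrable_inverse_1_plus_square by (simp add: set_integrable_def)
  from integrable_mult_right[OF this, of c] show ?thesis by (simp add: divide_inverse)
qed

text \<open>The classical value is pi. It is left as a symbol, because it occurs in both limits that
  are compared at the end.\<close>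

definition fejer_const :: real where
  "fejer_const = (\<integral>u. (1 - cos u) / u\<^sup>2 \<partial>lborel)"

lemma one_minus_cos_le: "1 - cos (x::real) \<le> x\<^sup>2 / 2" "1 - cos x \<le> 2"
proof -
  have "1 - cos x = 2 * (sin (x / 2))\<^sup>2" using cos_double_sin[of "x / 2"] by simp
  also have "\<dots> \<le> 2 * (x / 2)\<^sup>2"
    using abs_sin_x_le_abs_x[of "x / 2"] by (intro mult_left_mono) (auto simp: abs_le_square_iff[symmetric])
  finally show "1 - cos x \<le> x\<^sup>2 / 2" by (simp add: power2_eq_square)
  show "1 - cos x \<le> 2" using cos_ge_minus_one[of x] by linarith
qed

lemma decay_combine:
  fixes u :: real
  assumes "N \<le> p" "N \<le> q / u\<^sup>2" "0 \<le> p" "0 \<le> q" "u \<noteq> 0"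
  shows "N \<le> (2 * (p + q)) / (1 + u\<^sup>2)"
proof (cases "u\<^sup>2 \<le> 1")
  case True
  have "N * (1 + u\<^sup>2) \<le> p * (1 + u\<^sup>2)" using assms by (intro mult_right_mono) auto
  also have "\<dots> \<le> p * 2" using True assms by (intro mult_left_mono) auto
  finally have "N * (1 + u\<^sup>2) \<le> 2 * (p + q)" using assms by simp
  thus ?thesis by (simp add: pos_le_divide_eq add_pos_nonneg)
next
  case False
  have "N * (1 + u\<^sup>2) \<le> q / u\<^sup>2 * (1 + u\<^sup>2)" using assms by (intro mult_right_mono) auto
  also have "\<dots> = q / u\<^sup>2 + q" using assms by (simp add: field_simps)
  also have "q / u\<^sup>2 \<le> q / 1" using False assms by (intro divide_left_mono) auto
  finally have "N * (1 + u\<^sup>2) \<le> 2 * (p + q)" using assms by simp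
  thus ?thesis by (simp add: pos_le_divide_eq add_pos_nonneg)
qed

lemma integrable_fejer: "integrable lborel (\<lambda>u::real. (1 - cos u) / u\<^sup>2)"
proof (rule Bochner_Integration.integrable_bound[OF integrable_cauchy_kernel[of 5]])
  show "AE u::real in lborel. norm ((1 - cos u) / u\<^sup>2) \<le> norm (5 / (1 + u\<^sup>2))"
  proof (rule AE_I2)
    fix u :: real
    show "norm ((1 - cos u) / u\<^sup>2) \<le> norm (5 / (1 + u\<^sup>2))"
    proof (cases "u = 0")
      case False
      have "(1 - cos u) / u\<^sup>2 \<le> 2 * (1 / 2 + 2) / (1 + u\<^sup>2)"
      proof (rule decay_combine)
        show "(1 - cos u) / u\<^sup>2 \<le> 1 / 2" using one_minus_cos_le(1)[of u] False by (simp add: pos_divide_le_eq)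
        show "(1 - cos u) / u\<^sup>2 \<le> 2 / u\<^sup>2" using one_minus_cos_le(2)[of u] by (intro divide_right_mono) auto
      qed (use False in auto)
      thus ?thesis by simp
    qed simp
  qed
qed measurable

lemma fejer_const_pos: "fejer_const > 0"
proof -
  have "0 < (1 - cos 1) / 4 * (1::real)" using cos_monotone_0_pi[of 0 1] pi_gt3 by simp
  also have "\<dots> = (\<integral>u. (1 - cos 1) / 4 * indicator {1..2::real} u \<partial>lborel)" by simp
  also have "\<dots> \<le> fejer_const" unfolding fejer_const_def
  proof (rule integral_mono[OF _ integrable_fejer])
    fix u :: real
    show "(1 - cos 1) / 4 * indicator {1..2} u \<le> (1 - cos u) / u\<^sup>2"
    proof (cases "u \<in> {1..2}")
      case True
      have "cos u \<le> cos 1" using True pi_gt3 by (intro cos_monotone_0_pi_le) auto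
      moreover have "u\<^sup>2 \<le> 2\<^sup>2" using True by (intro power_mono) auto
      ultimately have "(1 - cos 1) / 4 \<le> (1 - cos u) / u\<^sup>2"
        using True cos_le_one[of 1] by (intro frac_le) auto
      thus ?thesis using True by simp
    qed (auto intro: divide_nonneg_nonneg)
  qed simp
  finally show ?thesis .
qed

lemma abs_eq_integral: "(\<integral>u. (1 - cos (u * z)) / u\<^sup>2 \<partial>lborel) = \<bar>z\<bar> * fejer_const"
  and integrable_one_minus_cos: "integrable lborel (\<lambda>u::real. (1 - cos (u * z)) / u\<^sup>2)"
proof -
  have "(\<integral>u. (1 - cos (u * z)) / u\<^sup>2 \<partial>lborel) = \<bar>z\<bar> * fejer_const \<and> integrable lborel (\<lambda>u::real. (1 - cos (u * z)) / u\<^sup>2)"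
  proof (cases "z = 0")
    case False
    have eq: "(1 - cos (u * z)) / u\<^sup>2 = z\<^sup>2 * ((1 - cos (0 + z * u)) / (0 + z * u)\<^sup>2)" for u
      using False by (cases "u = 0") (simp_all add: power_mult_distrib mult.commute)
    have "fejer_const = \<bar>z\<bar> * (\<integral>u. (1 - cos (0 + z * u)) / (0 + z * u)\<^sup>2 \<partial>lborel)"
      unfolding fejer_const_def using False by (subst lborel_integral_real_affine[of z _ 0]) auto
    hence "(\<integral>u. (1 - cos (0 + z * u)) / (0 + z * u)\<^sup>2 \<partial>lborel) = fejer_const / \<bar>z\<bar>"
      using False by (simp add: field_simps)
    moreover have "integrable lborel (\<lambda>u. (1 - cos (0 + z * u)) / (0 + z * u)\<^sup>2)"
      using False by (intro lborel_integrable_real_affine integrable_fejer)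
    moreover have "z\<^sup>2 * (fejer_const / \<bar>z\<bar>) = \<bar>z\<bar> * fejer_const"
      using False by (simp add: power2_eq_square abs_if)
    ultimately show ?thesis unfolding eq integral_mult_right_zero by (simp only: integrable_mult_right)
  qed simp
  thus "(\<integral>u. (1 - cos (u * z)) / u\<^sup>2 \<partial>lborel) = \<bar>z\<bar> * fejer_const"
    "integrable lborel (\<lambda>u::real. (1 - cos (u * z)) / u\<^sup>2)" by auto
qed

text \<open>Four shifted absolute values whose coefficients sum to 0. Each absolute value is an
  integral of 1 - cos against u^(-2), and the constants 1 cancel in the combination.\<close>

definition trapezoid :: "real \<Rightarrow> real \<Rightarrow> real \<Rightarrow> real \<Rightarrow> real" where
  "trapezoid a b \<delta> z = (\<bar>z - (a - \<delta>)\<bar> - \<bar>z - a\<bar> - \<bar>z - b\<bar> + \<bar>z - (b + \<delta>)\<bar>) / (2 * \<delta>)"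

text \<open>The Fourier transform of the trapezoid up to a constant factor. In this product form
  both differences of exponentials are visibly small near u = 0, which compensates the u^2
  below.\<close>

definition trap_kernel :: "real \<Rightarrow> real \<Rightarrow> real \<Rightarrow> real \<Rightarrow> complex" where
  "trap_kernel a b \<delta> u = (iexp (u * \<delta>) - 1) * (iexp (- (u * a)) - iexp (- (u * (b + \<delta>)))) / of_real (2 * \<delta> * u\<^sup>2)"

lemma trapezoid_bounds:
  assumes "a \<le> b" "0 < \<delta>"
  shows "0 \<le> trapezoid a b \<delta> z" "trapezoid a b \<delta> z \<le> 1"
    and "z \<in> {a..b} \<Longrightarrow> trapezoid a b \<delta> z = 1"
    and "z \<notin> {a - \<delta>..b + \<delta>} \<Longrightarrow> trapezoid a b \<delta> z = 0"
  using assms by (auto simp: trapezoid_def field_simps abs_if)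

lemma trapezoid_measurable [measurable]: "trapezoid a b \<delta> \<in> borel_measurable borel"
  unfolding trapezoid_def by measurable

lemma trap_kernel_measurable [measurable]: "trap_kernel a b \<delta> \<in> borel_measurable borel"
  unfolding trap_kernel_def by measurable

lemma norm_iexp_minus_1_le: "norm (iexp x - 1) \<le> \<bar>x\<bar>"
  using iexp_approx1[of x 0] by simp

lemma norm_trap_kernel_le:
  assumes "a \<le> b" "0 < \<delta>"
  obtains B where "B \<ge> 0" "\<And>u. norm (trap_kernel a b \<delta> u) \<le> B / (1 + u\<^sup>2)"
proof -
  define B where "B = 2 * ((b + \<delta> - a) / 2 + 2 / \<delta>)"
  have B: "B \<ge> 0" using assms by (auto simp: B_def)
  show ?thesis
  proof (rule that[OF B])
    fix u :: real
    show "norm (trap_kernel a b \<delta> u) \<le> B / (1 + u\<^sup>2)"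
    proof (cases "u = 0")
      case False
      have n: "norm (trap_kernel a b \<delta> u) = norm (iexp (u * \<delta>) - 1) * norm (iexp (- (u * a)) - iexp (- (u * (b + \<delta>)))) / (2 * \<delta> * u\<^sup>2)"
        unfolding trap_kernel_def norm_divide norm_mult[symmetric] norm_of_real using assms by simp
      have d1: "norm (iexp (u * \<delta>) - 1) \<le> \<bar>u * \<delta>\<bar>" by (rule norm_iexp_minus_1_le)
      have d2: "norm (iexp (u * \<delta>) - 1) \<le> 1 + 1"
        by (rule order.trans[OF norm_triangle_ineq4]) (simp only: norm_exp_i_times norm_one order_refl)
      have e2: "norm (iexp (- (u * a)) - iexp (- (u * (b + \<delta>)))) \<le> 1 + 1"
        by (rule order.trans[OF norm_triangle_ineq4]) (simp only: norm_exp_i_times order_refl)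
      have e1: "norm (iexp (- (u * a)) - iexp (- (u * (b + \<delta>)))) \<le> \<bar>u\<bar> * (b + \<delta> - a)"
      proof -
        have "iexp (- (u * a)) - iexp (- (u * (b + \<delta>))) = iexp (- (u * (b + \<delta>))) * (iexp (u * (b + \<delta> - a)) - 1)"
          by (simp add: right_diff_distrib algebra_simps flip: exp_add)
        hence "norm (iexp (- (u * a)) - iexp (- (u * (b + \<delta>)))) = norm (iexp (u * (b + \<delta> - a)) - 1)"
          by (simp only: norm_mult norm_exp_i_times mult_1)
        also have "\<dots> \<le> \<bar>u * (b + \<delta> - a)\<bar>" by (rule norm_iexp_minus_1_le)
        finally show ?thesis using assms by (simp add: abs_mult)
      qed
      have "norm (trap_kernel a b \<delta> u) \<le> (\<bar>u * \<delta>\<bar> * (\<bar>u\<bar> * (b + \<delta> - a))) / (2 * \<delta> * u\<^sup>2)"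
        unfolding n using d1 e1 assms by (intro divide_right_mono mult_mono) auto
      also have "\<dots> = (b + \<delta> - a) / 2"
        using False assms by (simp add: abs_mult power2_eq_square field_simps)
      finally have 1: "norm (trap_kernel a b \<delta> u) \<le> (b + \<delta> - a) / 2" .
      have "norm (trap_kernel a b \<delta> u) \<le> (2 * 2) / (2 * \<delta> * u\<^sup>2)"
        unfolding n using d2 e2 assms by (intro divide_right_mono mult_mono) auto
      hence "norm (trap_kernel a b \<delta> u) \<le> (2 / \<delta>) / u\<^sup>2" by (simp add: field_simps)
      from decay_combine[OF 1 this] False assms show ?thesis by (simp add: B_def)
    qed (use B in \<open>simp add: trap_kernel_def\<close>)
  qed
qed

lemma integrable_trap_kernel:
  assumes "a \<le> b" "0 < \<delta>"
  shows "integrable lborel (trap_kernel a b \<delta>)"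
proof -
  obtain B where B: "B \<ge> 0" "\<And>u. norm (trap_kernel a b \<delta> u) \<le> B / (1 + u\<^sup>2)"
    using norm_trap_kernel_le[OF assms] by blast
  show ?thesis
    by (rule Bochner_Integration.integrable_bound[OF integrable_cauchy_kernel[of B]])
       (use B in \<open>auto intro!: AE_I2 simp: add_pos_nonneg abs_of_nonneg\<close>)
qed

lemma tendsto_iexp_quotient: "((\<lambda>u. (iexp (u * c) - 1) / of_real u) \<longlongrightarrow> \<i> * of_real c) (at (0::real))"
proof -
  have "((\<lambda>z. exp (\<i> * (z * of_real c))) has_field_derivative \<i> * of_real c) (at (0::complex))"
    by (auto intro!: derivative_eq_intros)
  hence "((\<lambda>z. (exp (\<i> * (z * of_real c)) - 1) / z) \<longlongrightarrow> \<i> * of_real c) (at (0::complex))"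
    by (simp add: DERIV_def)
  moreover have "filterlim complex_of_real (at 0) (at 0)"
    by (auto simp: filterlim_at eventually_at_filter intro!: tendsto_eq_intros)
  ultimately have "((\<lambda>u. (exp (\<i> * (complex_of_real u * of_real c)) - 1) / complex_of_real u) \<longlongrightarrow> \<i> * of_real c) (at 0)"
    by (rule filterlim_compose)
  thus ?thesis by simp
qed

text \<open>The kernel is 0 at u = 0 by the convention for division; the relevant value there is the
  limit, which carries the area b - a + \<delta> of the trapezoid.\<close>

lemma trap_kernel_tendsto:
  assumes "0 < \<delta>"
  shows "(trap_kernel a b \<delta> \<longlongrightarrow> - of_real (b - a + \<delta>) / 2) (at 0)"
proof -
  have "((\<lambda>u. ((iexp (u * \<delta>) - 1) / of_real u) * (((iexp (u * (- a)) - 1) / of_real u) - ((iexp (u * (- (b + \<delta>))) - 1) / of_real u)) / of_real (2 * \<delta>))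
     \<longlongrightarrow> (\<i> * of_real \<delta>) * (\<i> * of_real (- a) - \<i> * of_real (- (b + \<delta>))) / of_real (2 * \<delta>)) (at 0)"
    using assms by (intro tendsto_intros tendsto_iexp_quotient) auto
  also have "(\<lambda>u. ((iexp (u * \<delta>) - 1) / of_real u) * (((iexp (u * (- a)) - 1) / of_real u) - ((iexp (u * (- (b + \<delta>))) - 1) / of_real u)) / of_real (2 * \<delta>)) = trap_kernel a b \<delta>"
  proof
    have gen: "(x / U) * ((y - 1) / U - (w - 1) / U) / D = x * (y - w) / (D * U\<^sup>2)" for x y w U D :: complex
      by (simp add: power2_eq_square diff_divide_distrib[symmetric] mult_ac)
    fix u
    show "((iexp (u * \<delta>) - 1) / of_real u) * (((iexp (u * (- a)) - 1) / of_real u) - ((iexp (u * (- (b + \<delta>))) - 1) / of_real u)) / of_real (2 * \<delta>) = trap_kernel a b \<delta> u"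
      unfolding gen trap_kernel_def mult_minus_right by (simp only: of_real_mult of_real_power)
  qed
  also have "(\<i> * of_real \<delta>) * (\<i> * of_real (- a) - \<i> * of_real (- (b + \<delta>))) / of_real (2 * \<delta>) = - of_real (b - a + \<delta>) / 2"
    using assms by (simp add: complex_eq_iff Re_divide Im_divide power2_eq_square field_simps)
  finally show ?thesis .
qed

lemma trapezoid_eq_integral:
  assumes "a \<le> b" "0 < \<delta>"
  shows "trapezoid a b \<delta> z = - (1 / fejer_const) * (\<integral>u. Re (iexp (u * z) * trap_kernel a b \<delta> u) \<partial>lborel)"
proof -
  let ?f = "\<lambda>w u. (1 - cos (u * w)) / u\<^sup>2 :: real"
  have "Re (iexp (u * z) * trap_kernel a b \<delta> u) = (- 1 / (2 * \<delta>)) * (?f (z - (a - \<delta>)) u - ?f (z - a) u - ?f (z - b) u + ?f (z - (b + \<delta>)) u)" for u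
  proof -
    have "iexp (u * z) * ((iexp (u * \<delta>) - 1) * (iexp (- (u * a)) - iexp (- (u * (b + \<delta>)))))
      = iexp (u * (z - (a - \<delta>))) - iexp (u * (z - a)) - iexp (u * (z - b)) + iexp (u * (z - (b + \<delta>)))"
      by (simp add: algebra_simps flip: exp_add)
    hence "Re (iexp (u * z) * trap_kernel a b \<delta> u) = Re ((iexp (u * (z - (a - \<delta>))) - iexp (u * (z - a)) - iexp (u * (z - b)) + iexp (u * (z - (b + \<delta>)))) / of_real (2 * \<delta> * u\<^sup>2))"
      by (simp only: trap_kernel_def times_divide_eq_right)
    also have "\<dots> = (cos (u * (z - (a - \<delta>))) - cos (u * (z - a)) - cos (u * (z - b)) + cos (u * (z - (b + \<delta>)))) / (2 * \<delta> * u\<^sup>2)"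
      unfolding Re_divide_of_real by (simp add: Re_exp)
    also have "\<dots> = (- 1 / (2 * \<delta>)) * (?f (z - (a - \<delta>)) u - ?f (z - a) u - ?f (z - b) u + ?f (z - (b + \<delta>)) u)"
      by (cases "u = 0") (use assms in \<open>simp_all add: field_simps\<close>)
    finally show ?thesis .
  qed
  hence "(\<integral>u. Re (iexp (u * z) * trap_kernel a b \<delta> u) \<partial>lborel)
    = (\<integral>u. (- 1 / (2 * \<delta>)) * (?f (z - (a - \<delta>)) u - ?f (z - a) u - ?f (z - b) u + ?f (z - (b + \<delta>)) u) \<partial>lborel)"
    by (simp only:)
  also have "\<dots> = (- 1 / (2 * \<delta>)) * (\<integral>u. ?f (z - (a - \<delta>)) u - ?f (z - a) u - ?f (z - b) u + ?f (z - (b + \<delta>)) u \<partial>lborel)"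
    by (rule integral_mult_right_zero)
  also have "(\<integral>u. ?f (z - (a - \<delta>)) u - ?f (z - a) u - ?f (z - b) u + ?f (z - (b + \<delta>)) u \<partial>lborel)
     = \<bar>z - (a - \<delta>)\<bar> * fejer_const - \<bar>z - a\<bar> * fejer_const - \<bar>z - b\<bar> * fejer_const + \<bar>z - (b + \<delta>)\<bar> * fejer_const"
    by (subst Bochner_Integration.integral_add Bochner_Integration.integral_diff;
        (intro Bochner_Integration.integrable_diff integrable_one_minus_cos)?)+
       (simp only: abs_eq_integral)
  finally have I: "(\<integral>u. Re (iexp (u * z) * trap_kernel a b \<delta> u) \<partial>lborel)
    = (- 1 / (2 * \<delta>)) * ((\<bar>z - (a - \<delta>)\<bar> - \<bar>z - a\<bar> - \<bar>z - b\<bar> + \<bar>z - (b + \<delta>)\<bar>) * fejer_const)"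
    by (simp only: left_diff_distrib distrib_right)
  show ?thesis
  proof -
    have "N / d = - (1 / c) * ((- 1 / d) * (N * c))" if "c > 0" for N c d :: real
      using that by simp
    from this[OF fejer_const_pos] show ?thesis unfolding I trapezoid_def .
  qed
qed

text \<open>The kernel is integrable and the exponentials have modulus 1, so Fubini applies; the
  shift by y turns into a phase.\<close>

lemma expectation_trapezoid:
  assumes \<nu>: "real_distribution \<nu>" and ab: "a \<le> b" "0 < \<delta>"
  shows "(\<integral>z. trapezoid a b \<delta> (z - y) \<partial>\<nu>) = - (1 / fejer_const) * (\<integral>u. Re (char \<nu> u * iexp (- (u * y)) * trap_kernel a b \<delta> u) \<partial>lborel)"
proof -
  interpret \<nu>: real_distribution \<nu> by fact
  interpret P: pair_sigma_finite \<nu> "lborel :: real measure" by standard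
  let ?K = "trap_kernel a b \<delta>"
  let ?F = "\<lambda>z u. iexp (u * (z - y)) * ?K u"
  have K: "integrable lborel ?K" by (rule integrable_trap_kernel[OF ab])
  have normF: "norm (?F z u) = norm (?K u)" for z u by (simp only: norm_mult norm_exp_i_times mult_1)
  have meas: "(\<lambda>w. ?F (fst w) (snd w)) \<in> borel_measurable (\<nu> \<Otimes>\<^sub>M lborel)"
    by measurable
  have intu: "integrable lborel (?F z)" for z
    by (rule Bochner_Integration.integrable_bound[OF K]) (measurable, intro AE_I2, simp only: normF order_refl)
  have int: "integrable (\<nu> \<Otimes>\<^sub>M lborel) (\<lambda>w. ?F (fst w) (snd w))"
    by (rule P.Fubini_integrable[OF meas])
       (simp only: fst_conv snd_conv normF \<nu>.integrable_const, intro AE_I2, simp only: fst_conv snd_conv intu)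
  have "(\<integral>z. trapezoid a b \<delta> (z - y) \<partial>\<nu>) = (\<integral>z. - (1 / fejer_const) * Re (\<integral>u. ?F z u \<partial>lborel) \<partial>\<nu>)"
    using intu by (intro Bochner_Integration.integral_cong refl) (simp only: trapezoid_eq_integral[OF ab] integral_Re)
  also have "\<dots> = - (1 / fejer_const) * (\<integral>z. Re (\<integral>u. ?F z u \<partial>lborel) \<partial>\<nu>)" by simp
  also have "(\<integral>z. Re (\<integral>u. ?F z u \<partial>lborel) \<partial>\<nu>) = Re (\<integral>z. (\<integral>u. ?F z u \<partial>lborel) \<partial>\<nu>)"
    using P.integrable_fst[of ?F] int by (intro integral_Re) (simp add: case_prod_beta')
  also have "(\<integral>z. (\<integral>u. ?F z u \<partial>lborel) \<partial>\<nu>) = (\<integral>u. (\<integral>z. ?F z u \<partial>\<nu>) \<partial>lborel)"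
    using P.Fubini_integral[of ?F] int by (simp add: case_prod_beta')
  also have "(\<lambda>u. \<integral>z. ?F z u \<partial>\<nu>) = (\<lambda>u. char \<nu> u * iexp (- (u * y)) * ?K u)"
  proof
    fix u
    have "?F z u = iexp (u * z) * (iexp (- (u * y)) * ?K u)" for z
      by (simp add: algebra_simps flip: exp_add)
    hence "(\<integral>z. ?F z u \<partial>\<nu>) = (\<integral>z. iexp (u * z) * (iexp (- (u * y)) * ?K u) \<partial>\<nu>)" by (simp only:)
    also have "\<dots> = (\<integral>z. iexp (u * z) \<partial>\<nu>) * (iexp (- (u * y)) * ?K u)"
      by (rule integral_mult_left_zero)
    finally show "(\<integral>z. ?F z u \<partial>\<nu>) = char \<nu> u * iexp (- (u * y)) * ?K u"
      by (simp add: char_def mult.assoc)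
  qed
  also have "Re (\<integral>u. char \<nu> u * iexp (- (u * y)) * ?K u \<partial>lborel) = (\<integral>u. Re (char \<nu> u * iexp (- (u * y)) * ?K u) \<partial>lborel)"
  proof (rule integral_Re[symmetric], rule Bochner_Integration.integrable_bound[OF K])
    show "AE u in lborel. norm (char \<nu> u * iexp (- (u * y)) * ?K u) \<le> norm (?K u)"
      by (intro AE_I2) (simp only: norm_mult norm_exp_i_times mult_1_right, rule mult_left_le_one_le, auto simp: \<nu>.cmod_char_le_1)
  qed measurable
  finally show ?thesis .
qed


section \<open>From characteristic functions to local limits\<close>

text \<open>The bound has two parts because D / (1 + t^2) can dominate, whereas \<epsilon> n is
  constant in t. Against a kernel that is integrable in t / s n the latter contributes a term of
  order s n * \<epsilon> n, whence the rate required of \<epsilon>.\<close>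

locale scaled_char =
  fixes \<nu> :: "nat \<Rightarrow> real measure" and s :: "nat \<Rightarrow> real" and \<epsilon> :: "nat \<Rightarrow> real" and D :: real and \<Phi> :: "real \<Rightarrow> complex"
  assumes \<nu>: "\<And>n. real_distribution (\<nu> n)"
    and s: "filterlim s at_top sequentially"
    and bound: "\<forall>\<^sub>F n in sequentially. \<forall>t. norm (char (\<nu> n) (t / s n)) \<le> D / (1 + t\<^sup>2) + \<epsilon> n"
    and \<epsilon>: "(\<lambda>n. s n * \<epsilon> n) \<longlonglongrightarrow> 0"
    and lim: "\<And>t. (\<lambda>n. char (\<nu> n) (t / s n)) \<longlonglongrightarrow> \<Phi> t"
    and D: "D \<ge> 0"
begin

definition limit_density :: "real \<Rightarrow> real" where
  "limit_density x = (\<integral>t. Re (\<Phi> t * iexp (- (t * x))) \<partial>lborel) / (2 * fejer_const)"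

lemma \<epsilon>_tendsto: "\<epsilon> \<longlonglongrightarrow> 0"
proof -
  have "(\<lambda>n. s n * \<epsilon> n * (1 / s n)) \<longlonglongrightarrow> 0 * 0"
    by (intro tendsto_mult \<epsilon> tendsto_divide_0[OF tendsto_const] filterlim_at_top_imp_at_infinity s)
  hence "(\<lambda>n. s n * \<epsilon> n * (1 / s n)) \<longlonglongrightarrow> 0" by simp
  moreover have "\<forall>\<^sub>F n in sequentially. s n > 0" using s by (simp add: filterlim_at_top_dense)
  ultimately show ?thesis
    by (elim Lim_transform_eventually eventually_mono) simp
qed

lemma trapezoid_limit:
  assumes ab: "a \<le> b" "0 < \<delta>"
  shows "(\<lambda>n. s n * (\<integral>z. trapezoid a b \<delta> (z - s n * x) \<partial>\<nu> n)) \<longlonglongrightarrow> (b - a + \<delta>) * limit_density x"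
proof -
  let ?K = "trap_kernel a b \<delta>"
  obtain B where B: "B \<ge> 0" "\<And>u. norm (?K u) \<le> B / (1 + u\<^sup>2)"
    using norm_trap_kernel_le[OF ab] by blast
  have K: "integrable lborel ?K" by (rule integrable_trap_kernel[OF ab])
  have KB: "norm (?K u) \<le> B" for u
    by (rule order.trans[OF B(2)]) (simp add: pos_divide_le_eq add_pos_nonneg distrib_left B(1))
  define G where "G = (\<lambda>n t. char (\<nu> n) (t / s n) * iexp (- (t * x)) * ?K (t / s n))"
  \<comment> \<open>T keeps G only where a bound free of n holds, so dominated convergence applies
    to it. Elsewhere 1 / (1 + t^2) is at most \<epsilon> n, and G is at most (D + 1) \<epsilon> n
    times the kernel.\<close>
  define T where "T = (\<lambda>n t. of_bool (norm (char (\<nu> n) (t / s n)) \<le> (D + 1) / (1 + t\<^sup>2)) * G n t)"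
  have spos: "\<forall>\<^sub>F n in sequentially. s n > 0" using s by (simp add: filterlim_at_top_dense)
  \<comment> \<open>The bound itself forces the sign: let t grow with n fixed.\<close>
  have \<epsilon>nn: "\<forall>\<^sub>F n in sequentially. 0 \<le> \<epsilon> n"
  proof -
    show ?thesis using bound
    proof eventually_elim
      case (elim n)
      have "- \<epsilon> n \<le> D / (1 + t\<^sup>2)" for t using elim[rule_format, of t] norm_ge_zero[of "char (\<nu> n) (t / s n)"] by linarith
      hence ev: "\<forall>\<^sub>F t in at_top. - \<epsilon> n \<le> D / (1 + t\<^sup>2)" by (intro always_eventually allI)
      have "((\<lambda>t::real. D / (1 + t\<^sup>2)) \<longlongrightarrow> 0) at_top" by real_asymp
      from tendsto_lowerbound[OF this ev] show ?case by simp
    qed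
  qed
  have char_meas [measurable]: "char (\<nu> n) \<in> borel_measurable borel" for n
    by (rule real_distribution.char_measurable[OF \<nu>])
  have G_meas [measurable]: "G n \<in> borel_measurable borel" for n unfolding G_def by measurable
  have T_meas [measurable]: "T n \<in> borel_measurable borel" for n unfolding T_def by measurable
  have normG: "norm (G n t) = norm (char (\<nu> n) (t / s n)) * norm (?K (t / s n))" for n t
    unfolding G_def by (simp only: norm_mult norm_exp_i_times mult_1_right)
  have T_le: "norm (T n t) \<le> (D + 1) * B / (1 + t\<^sup>2)" for n t
  proof (cases "norm (char (\<nu> n) (t / s n)) \<le> (D + 1) / (1 + t\<^sup>2)")
    case True
    have "norm (T n t) = norm (char (\<nu> n) (t / s n)) * norm (?K (t / s n))"
      using True normG[of n t] by (simp add: T_def)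
    also have "\<dots> \<le> (D + 1) / (1 + t\<^sup>2) * B"
      using True KB[of "t / s n"] D by (intro mult_mono) (auto intro: divide_nonneg_nonneg)
    finally show ?thesis by simp
  qed (use D B(1) in \<open>simp add: T_def add_nonneg_nonneg\<close>)
  have K0: "(\<lambda>n. ?K (t / s n)) \<longlonglongrightarrow> - of_real (b - a + \<delta>) / 2" if "t \<noteq> 0" for t
  proof (rule filterlim_compose[OF trap_kernel_tendsto[OF ab(2)]])
    show "filterlim (\<lambda>n. t / s n) (at 0) sequentially"
      unfolding filterlim_at
    proof
      show "(\<lambda>n. t / s n) \<longlonglongrightarrow> 0"
        by (intro tendsto_divide_0[OF tendsto_const] filterlim_at_top_imp_at_infinity s)
      show "\<forall>\<^sub>F n in sequentially. t / s n \<in> UNIV \<and> t / s n \<noteq> 0"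
        using spos by eventually_elim (use that in auto)
    qed
  qed
  have T_lim: "(\<lambda>n. T n t) \<longlonglongrightarrow> \<Phi> t * iexp (- (t * x)) * (- of_real (b - a + \<delta>) / 2)" if "t \<noteq> 0" for t
  proof -
    have "(\<lambda>n. G n t) \<longlonglongrightarrow> \<Phi> t * iexp (- (t * x)) * (- of_real (b - a + \<delta>) / 2)"
      unfolding G_def by (intro tendsto_mult lim K0[OF that] tendsto_const)
    moreover have "\<forall>\<^sub>F n in sequentially. G n t = T n t"
    proof -
      have "\<forall>\<^sub>F n in sequentially. \<epsilon> n < 1 / (1 + t\<^sup>2)"
        by (rule order_tendstoD(2)[OF \<epsilon>_tendsto]) (simp add: add_pos_nonneg)
      thus ?thesis using bound
      proof eventually_elim
        case (elim n)
        have "norm (char (\<nu> n) (t / s n)) \<le> D / (1 + t\<^sup>2) + \<epsilon> n" using elim(2) by blast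
        also have "\<dots> \<le> (D + 1) / (1 + t\<^sup>2)" using elim(1) by (simp add: add_divide_distrib)
        finally show ?case by (simp add: T_def)
      qed
    qed
    ultimately show ?thesis by (rule Lim_transform_eventually)
  qed
  have \<Phi>_meas: "\<Phi> \<in> borel_measurable borel"
  proof (rule borel_measurable_LIMSEQ_metric)
    show "(\<lambda>t. char (\<nu> i) (t / s i)) \<in> borel_measurable borel" for i by measurable
    show "(\<lambda>i. char (\<nu> i) (t / s i)) \<longlonglongrightarrow> \<Phi> t" for t by (rule lim)
  qed
  have T_int: "(\<lambda>n. \<integral>t. Re (T n t) \<partial>lborel) \<longlonglongrightarrow> (\<integral>t. Re (\<Phi> t * iexp (- (t * x)) * (- of_real (b - a + \<delta>) / 2)) \<partial>lborel)"
  proof (rule integral_dominated_convergence[where w="\<lambda>t. (D + 1) * B / (1 + t\<^sup>2)"])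
    show "AE t in lborel. norm (Re (T n t)) \<le> (D + 1) * B / (1 + t\<^sup>2)" for n
      by (intro AE_I2) (auto intro: order.trans[OF abs_Re_le_cmod T_le])
    have "AE t in lborel. t \<noteq> (0::real)" by (rule AE_lborel_singleton)
    thus "AE t in lborel. (\<lambda>n. Re (T n t)) \<longlonglongrightarrow> Re (\<Phi> t * iexp (- (t * x)) * (- of_real (b - a + \<delta>) / 2))"
      by eventually_elim (intro tendsto_Re T_lim)
  qed (use \<Phi>_meas in \<open>auto intro: integrable_cauchy_kernel simp del: times_complex.sel\<close>)
  have diff: "(\<lambda>n. (\<integral>t. Re (G n t) \<partial>lborel) - (\<integral>t. Re (T n t) \<partial>lborel)) \<longlonglongrightarrow> 0"
  proof (rule Lim_null_comparison)
    have "(\<lambda>n. (D + 1) * (\<integral>u. norm (?K u) \<partial>lborel) * (s n * \<epsilon> n)) \<longlonglongrightarrow> (D + 1) * (\<integral>u. norm (?K u) \<partial>lborel) * 0"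
      by (intro tendsto_intros \<epsilon>)
    thus "(\<lambda>n. (D + 1) * (\<integral>u. norm (?K u) \<partial>lborel) * (s n * \<epsilon> n)) \<longlonglongrightarrow> 0" by simp
    show "\<forall>\<^sub>F n in sequentially. norm ((\<integral>t. Re (G n t) \<partial>lborel) - (\<integral>t. Re (T n t) \<partial>lborel)) \<le> (D + 1) * (\<integral>u. norm (?K u) \<partial>lborel) * (s n * \<epsilon> n)"
      using spos \<epsilon>nn bound
    proof eventually_elim
      case (elim n)
      have Ks: "integrable lborel (\<lambda>t. ?K (t / s n))"
        using lborel_integrable_real_affine[OF K, of "1 / s n" 0] elim by simp
      have KI: "(\<integral>t. norm (?K (t / s n)) \<partial>lborel) = s n * (\<integral>u. norm (?K u) \<partial>lborel)"
        using lborel_integral_real_affine[of "1 / s n" "\<lambda>u. norm (?K u)" 0] elim by (simp add: field_simps)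
      have c1: "norm (char (\<nu> n) u) \<le> 1" for u by (rule real_distribution.cmod_char_le_1[OF \<nu>])
      have Gi: "integrable lborel (G n)"
        by (rule Bochner_Integration.integrable_bound[OF Ks]) (auto simp: normG c1 mult_left_le_one_le intro!: AE_I2)
      have Ti: "integrable lborel (T n)"
        by (rule Bochner_Integration.integrable_bound[OF Gi]) (auto simp: T_def intro!: AE_I2)
      have pt: "norm (Re (G n t) - Re (T n t)) \<le> (D + 1) * \<epsilon> n * norm (?K (t / s n))" for t
      proof (cases "norm (char (\<nu> n) (t / s n)) \<le> (D + 1) / (1 + t\<^sup>2)")
        case False
        have ch: "norm (char (\<nu> n) (t / s n)) \<le> D / (1 + t\<^sup>2) + \<epsilon> n" using elim by blast
        with False have small: "1 / (1 + t\<^sup>2) \<le> \<epsilon> n" by (simp add: add_divide_distrib)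
        have "D / (1 + t\<^sup>2) + \<epsilon> n \<le> D * \<epsilon> n + \<epsilon> n" using mult_left_mono[OF small D] by simp
        hence "norm (char (\<nu> n) (t / s n)) \<le> (D + 1) * \<epsilon> n" using ch by (simp add: algebra_simps)
        hence "norm (G n t) \<le> (D + 1) * \<epsilon> n * norm (?K (t / s n))" unfolding normG by (intro mult_right_mono) auto
        moreover have "T n t = 0" using False by (simp add: T_def)
        ultimately show ?thesis using abs_Re_le_cmod[of "G n t"] by simp
      qed (use D elim in \<open>simp add: T_def\<close>)
      have "norm ((\<integral>t. Re (G n t) \<partial>lborel) - (\<integral>t. Re (T n t) \<partial>lborel)) = norm (\<integral>t. Re (G n t) - Re (T n t) \<partial>lborel)"
        using Gi Ti by simp
      also have "\<dots> \<le> (\<integral>t. norm (Re (G n t) - Re (T n t)) \<partial>lborel)" by (rule integral_norm_bound)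
      also have "\<dots> \<le> (\<integral>t. (D + 1) * \<epsilon> n * norm (?K (t / s n)) \<partial>lborel)"
        using Gi Ti Ks by (intro integral_mono pt integrable_norm Bochner_Integration.integrable_diff integrable_Re integrable_mult_right)
      also have "\<dots> = (D + 1) * (\<integral>u. norm (?K u) \<partial>lborel) * (s n * \<epsilon> n)" by (simp add: KI)
      finally show ?case .
    qed
  qed
  have "(\<lambda>n. \<integral>t. Re (G n t) \<partial>lborel) \<longlonglongrightarrow> (\<integral>t. Re (\<Phi> t * iexp (- (t * x)) * (- of_real (b - a + \<delta>) / 2)) \<partial>lborel)"
    using tendsto_add[OF diff T_int] by simp
  moreover have "(\<integral>t. Re (\<Phi> t * iexp (- (t * x)) * (- of_real (b - a + \<delta>) / 2)) \<partial>lborel) = (- (b - a + \<delta>) / 2) * (\<integral>t. Re (\<Phi> t * iexp (- (t * x))) \<partial>lborel)"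
  proof -
    have "Re (w * (- of_real (b - a + \<delta>) / 2)) = (- (b - a + \<delta>) / 2) * Re w" for w :: complex
      by (simp add: algebra_simps)
    thus ?thesis by (simp only: integral_mult_right_zero)
  qed
  ultimately have GI: "(\<lambda>n. \<integral>t. Re (G n t) \<partial>lborel) \<longlonglongrightarrow> (- (b - a + \<delta>) / 2) * (\<integral>t. Re (\<Phi> t * iexp (- (t * x))) \<partial>lborel)"
    by (simp only:)
  have "(\<lambda>n. - (1 / fejer_const) * (\<integral>t. Re (G n t) \<partial>lborel)) \<longlonglongrightarrow> - (1 / fejer_const) * ((- (b - a + \<delta>) / 2) * (\<integral>t. Re (\<Phi> t * iexp (- (t * x))) \<partial>lborel))"
    by (intro tendsto_intros GI)
  also have "- (1 / fejer_const) * ((- (b - a + \<delta>) / 2) * (\<integral>t. Re (\<Phi> t * iexp (- (t * x))) \<partial>lborel)) = (b - a + \<delta>) * limit_density x"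
    using fejer_const_pos by (simp only: limit_density_def) (simp add: field_simps)
  finally show ?thesis
  proof (rule Lim_transform_eventually)
    show "\<forall>\<^sub>F n in sequentially. - (1 / fejer_const) * (\<integral>t. Re (G n t) \<partial>lborel) = s n * (\<integral>z. trapezoid a b \<delta> (z - s n * x) \<partial>\<nu> n)"
      using spos
    proof eventually_elim
      case (elim n)
      have "(\<integral>u. Re (char (\<nu> n) u * iexp (- (u * (s n * x))) * ?K u) \<partial>lborel)
        = 1 / s n * (\<integral>t. Re (char (\<nu> n) (0 + 1 / s n * t) * iexp (- ((0 + 1 / s n * t) * (s n * x))) * ?K (0 + 1 / s n * t)) \<partial>lborel)"
        using elim by (subst lborel_integral_real_affine[of "1 / s n" _ 0]) auto
      also have "(\<lambda>t. Re (char (\<nu> n) (0 + 1 / s n * t) * iexp (- ((0 + 1 / s n * t) * (s n * x))) * ?K (0 + 1 / s n * t))) = (\<lambda>t. Re (G n t))"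
      proof
        fix t
        have "0 + 1 / s n * t = t / s n" "(t / s n) * (s n * x) = t * x" using elim by auto
        thus "Re (char (\<nu> n) (0 + 1 / s n * t) * iexp (- ((0 + 1 / s n * t) * (s n * x))) * ?K (0 + 1 / s n * t)) = Re (G n t)"
          by (simp only: G_def)
      qed
      finally show ?case unfolding expectation_trapezoid[OF \<nu> ab] using elim by simp
    qed
  qed
qed

text \<open>The indicator lies between the trapezoids with plateaus [a + \<delta>, b - \<delta>] and
  [a, b], both with ramps of width \<delta>. Their areas are b - a - \<delta> and b - a +
  \<delta>.\<close>

lemma interval_limit:
  assumes ab: "a < b"
  shows "(\<lambda>n. s n * measure (\<nu> n) {s n * x + a .. s n * x + b}) \<longlonglongrightarrow> limit_density x * (b - a)"
proof (rule tendstoI)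
  fix e :: real assume e: "e > 0"
  define L where "L = limit_density x"
  define \<delta> where "\<delta> = min ((b - a) / 4) (e / (2 * (\<bar>L\<bar> + 1)))"
  have \<delta>: "\<delta> > 0" "\<delta> \<le> (b - a) / 4"
    unfolding \<delta>_def using ab e by (simp, intro min.cobounded1)
  have \<delta>L: "\<delta> * \<bar>L\<bar> < e"
  proof -
    have "\<delta> * (\<bar>L\<bar> + 1) \<le> e / (2 * (\<bar>L\<bar> + 1)) * (\<bar>L\<bar> + 1)"
      unfolding \<delta>_def by (intro mult_right_mono min.cobounded2) auto
    also have "\<dots> = e / 2"
    proof -
      have "e / (2 * m) * m = e / 2" if "m > 0" for m :: real using that by simp
      from this[of "\<bar>L\<bar> + 1"] show ?thesis by simp
    qed
    finally have "\<delta> * (\<bar>L\<bar> + 1) \<le> e / 2" .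
    hence "\<delta> * \<bar>L\<bar> + \<delta> \<le> e / 2" by (simp add: algebra_simps)
    thus ?thesis using \<delta>(1) e by linarith
  qed
  have up: "(\<lambda>n. s n * (\<integral>z. trapezoid a b \<delta> (z - s n * x) \<partial>\<nu> n)) \<longlonglongrightarrow> (b - a + \<delta>) * L"
    unfolding L_def using ab \<delta> by (intro trapezoid_limit) auto
  have low: "(\<lambda>n. s n * (\<integral>z. trapezoid (a + \<delta>) (b - \<delta>) \<delta> (z - s n * x) \<partial>\<nu> n)) \<longlonglongrightarrow> (b - \<delta> - (a + \<delta>) + \<delta>) * L"
    unfolding L_def using ab \<delta> by (intro trapezoid_limit) auto
  have absL: "\<delta> * L \<le> \<delta> * \<bar>L\<bar>" "- (\<delta> * \<bar>L\<bar>) \<le> \<delta> * L"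
    using mult_left_mono[of L "\<bar>L\<bar>" \<delta>] mult_left_mono[of "- \<bar>L\<bar>" L \<delta>] \<delta>(1) by auto
  have "\<forall>\<^sub>F n in sequentially. s n * (\<integral>z. trapezoid a b \<delta> (z - s n * x) \<partial>\<nu> n) < L * (b - a) + e"
    by (rule order_tendstoD(2)[OF up]) (use absL \<delta>L in \<open>simp add: algebra_simps\<close>)
  moreover have "\<forall>\<^sub>F n in sequentially. L * (b - a) - e < s n * (\<integral>z. trapezoid (a + \<delta>) (b - \<delta>) \<delta> (z - s n * x) \<partial>\<nu> n)"
    by (rule order_tendstoD(1)[OF low]) (use absL \<delta>L in \<open>simp add: algebra_simps\<close>)
  moreover have "\<forall>\<^sub>F n in sequentially. s n > 0" using s by (simp add: filterlim_at_top_dense)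
  ultimately show "\<forall>\<^sub>F n in sequentially. dist (s n * measure (\<nu> n) {s n * x + a .. s n * x + b}) (limit_density x * (b - a)) < e"
  proof eventually_elim
    case (elim n)
    interpret \<nu>n: real_distribution "\<nu> n" by (rule \<nu>)
    let ?I = "{s n * x + a .. s n * x + b}"
    have int: "integrable (\<nu> n) (\<lambda>z. trapezoid a' b' \<delta> (z - y))" if "a' \<le> b'" for a' b' y
      using trapezoid_bounds(1,2)[OF that \<delta>(1)]
      by (intro \<nu>n.integrable_const_bound[where B=1] AE_I2) (simp_all add: abs_of_nonneg)
    have intI: "integrable (\<nu> n) (indicator ?I :: real \<Rightarrow> real)"
      by (intro \<nu>n.integrable_const_bound[where B=1]) auto
    have "measure (\<nu> n) ?I = (\<integral>z. indicator ?I z \<partial>\<nu> n)" by simp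
    also have "\<dots> \<le> (\<integral>z. trapezoid a b \<delta> (z - s n * x) \<partial>\<nu> n)"
    proof (rule integral_mono)
      fix z show "indicator ?I z \<le> trapezoid a b \<delta> (z - s n * x)"
        using trapezoid_bounds(1,3)[of a b \<delta> "z - s n * x"] ab \<delta>(1) by (auto simp: indicator_def)
    qed (use ab int intI in auto)
    finally have 1: "s n * measure (\<nu> n) ?I \<le> s n * (\<integral>z. trapezoid a b \<delta> (z - s n * x) \<partial>\<nu> n)"
      using elim by (intro mult_left_mono) auto
    have "(\<integral>z. trapezoid (a + \<delta>) (b - \<delta>) \<delta> (z - s n * x) \<partial>\<nu> n) \<le> (\<integral>z. indicator ?I z \<partial>\<nu> n)"
    proof (rule integral_mono)
      fix z show "trapezoid (a + \<delta>) (b - \<delta>) \<delta> (z - s n * x) \<le> indicator ?I z"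
        using trapezoid_bounds(2,4)[of "a + \<delta>" "b - \<delta>" \<delta> "z - s n * x"] ab \<delta> by (auto simp: indicator_def)
    qed (use ab \<delta> int intI in auto)
    also have "\<dots> = measure (\<nu> n) ?I" by simp
    finally have 2: "s n * (\<integral>z. trapezoid (a + \<delta>) (b - \<delta>) \<delta> (z - s n * x) \<partial>\<nu> n) \<le> s n * measure (\<nu> n) ?I"
      using elim by (intro mult_left_mono) auto
    show ?case using 1 2 elim unfolding dist_real_def L_def[symmetric] abs_less_iff by linarith
  qed
qed

end

text \<open>The inversion formula for a continuous density follows from the local limit theorem applied
  to the law of \<open>n Y\<close>, so the value of \<^const>\<open>fejer_const\<close> is never needed.\<close>

lemma (in scaled_char) limit_density_eq:
  assumes \<mu>: "real_distribution \<mu>" and char: "\<And>t. char \<mu> t = \<Phi> t"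
    and \<Phi>: "\<And>t. norm (\<Phi> t) \<le> D / (1 + t\<^sup>2)"
    and dens: "distributed \<mu> lborel (\<lambda>y. y) (\<lambda>x. ennreal (C x))" and C: "continuous_on UNIV C" "\<And>x. 0 \<le> C x"
  shows "limit_density x = C x"
proof -
  interpret \<mu>: real_distribution \<mu> by fact
  have Cm [measurable]: "C \<in> borel_measurable borel" by (rule borel_measurable_continuous_onI[OF C(1)])
  define \<rho> where "\<rho> = (\<lambda>n::nat. distr \<mu> borel (\<lambda>y. real n * y))"
  interpret Y: scaled_char \<rho> real "\<lambda>_. 0" D \<Phi>
  proof (rule scaled_char.intro)
    have ch: "char (\<rho> n) (t / real n) = \<Phi> t" if "n > 0" for n t
    proof -
      have "char (\<rho> n) (t / real n) = (\<integral>y. iexp (t / real n * (real n * y)) \<partial>\<mu>)"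
        unfolding \<rho>_def char_def by (subst integral_distr) auto
      also have "\<dots> = char \<mu> t" unfolding char_def using that by simp
      finally show ?thesis by (simp add: char)
    qed
    show "\<forall>\<^sub>F n in sequentially. \<forall>t. norm (char (\<rho> n) (t / real n)) \<le> D / (1 + t\<^sup>2) + 0"
      using eventually_gt_at_top[of 0] by eventually_elim (simp add: ch \<Phi>)
    show "\<And>n. real_distribution (\<rho> n)" unfolding \<rho>_def by (intro \<mu>.real_distribution_distr) simp
    show "\<And>t. (\<lambda>n. char (\<rho> n) (t / real n)) \<longlonglongrightarrow> \<Phi> t"
      by (rule Lim_transform_eventually[OF tendsto_const]) (use eventually_gt_at_top[of 0] in eventually_elim, simp add: ch)
  qed (use D in \<open>auto intro: filterlim_real_sequentially\<close>)
  \<comment> \<open>An interval of length 1 for n Y is one of length 1 / n for Y, so continuity of C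
    at x alone decides the limit.\<close>
  have "(\<lambda>n. real n * measure (\<rho> n) {real n * x + 0 .. real n * x + 1}) \<longlonglongrightarrow> C x"
  proof (rule tendstoI)
    fix e :: real assume e: "e > 0"
    have "isCont C x" using C(1) by (simp add: continuous_on_eq_continuous_at)
    then obtain d where d: "d > 0" "\<And>z. dist z x < d \<Longrightarrow> dist (C z) (C x) < e / 2"
      using e unfolding continuous_at_eps_delta by (metis half_gt_zero)
    have "\<forall>\<^sub>F n in sequentially. 1 / real n < d"
      by (rule order_tendstoD(2)[OF lim_1_over_n]) (use d in auto)
    thus "\<forall>\<^sub>F n in sequentially. dist (real n * measure (\<rho> n) {real n * x + 0 .. real n * x + 1}) (C x) < e"
      using eventually_gt_at_top[of 0]
    proof eventually_elim
      case (elim n)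
      let ?J = "{x .. x + 1 / real n}"
      have "measure (\<rho> n) {real n * x + 0 .. real n * x + 1} = measure \<mu> ((\<lambda>y. real n * y) -` {real n * x + 0 .. real n * x + 1} \<inter> space \<mu>)"
        unfolding \<rho>_def by (rule measure_distr) auto
      also have "(\<lambda>y. real n * y) -` {real n * x + 0 .. real n * x + 1} \<inter> space \<mu> = ?J"
        using elim by (auto simp: field_simps)
      also have "measure \<mu> ?J = (\<integral>y. indicator ?J y \<partial>\<mu>)" by simp
      also have "\<dots> = (\<integral>y. C y * indicator ?J y \<partial>lborel)"
        by (rule distributed_integral[OF dens, symmetric]) (use C(2) in auto)
      finally have eq: "measure (\<rho> n) {real n * x + 0 .. real n * x + 1} = (\<integral>y. C y * indicator ?J y \<partial>lborel)" .
      have int: "integrable lborel (\<lambda>y. f y * indicator ?J y)" if "continuous_on UNIV f" for f :: "real \<Rightarrow> real"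
        using borel_integrable_atLeastAtMost'[OF continuous_on_subset[OF that], of x "x + 1 / real n"]
        by (simp add: set_integrable_def mult.commute)
      have near: "C z \<le> C x + e / 2" "C x - e / 2 \<le> C z" if "z \<in> ?J" for z
      proof -
        have "\<bar>C z - C x\<bar> < e / 2" using d(2)[of z] that elim by (auto simp: dist_real_def)
        thus "C z \<le> C x + e / 2" "C x - e / 2 \<le> C z" by linarith+
      qed
      have "(\<integral>y. C y * indicator ?J y \<partial>lborel) \<le> (\<integral>y. (C x + e / 2) * indicator ?J y \<partial>lborel)"
        by (intro integral_mono int C continuous_on_const) (auto split: split_indicator intro: near)
      moreover have "(\<integral>y. (C x - e / 2) * indicator ?J y \<partial>lborel) \<le> (\<integral>y. C y * indicator ?J y \<partial>lborel)"
        by (intro integral_mono int C continuous_on_const) (auto split: split_indicator intro: near)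
      moreover have "(\<integral>y. k * indicator ?J y \<partial>lborel) = k / real n" for k :: real using elim by simp
      ultimately have "(\<integral>y. C y * indicator ?J y \<partial>lborel) \<le> (C x + e / 2) / real n" "(C x - e / 2) / real n \<le> (\<integral>y. C y * indicator ?J y \<partial>lborel)"
        by auto
      hence "real n * (\<integral>y. C y * indicator ?J y \<partial>lborel) \<le> C x + e / 2" "C x - e / 2 \<le> real n * (\<integral>y. C y * indicator ?J y \<partial>lborel)"
        using elim by (auto simp: field_simps)
      thus ?case unfolding eq dist_real_def using e by (simp add: abs_less_iff)
    qed
  qed
  moreover have "(\<lambda>n. real n * measure (\<rho> n) {real n * x + 0 .. real n * x + 1}) \<longlonglongrightarrow> Y.limit_density x * (1 - 0)"
    by (rule Y.interval_limit) simp
  ultimately have "Y.limit_density x = C x" using LIMSEQ_unique by fastforce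
  thus ?thesis by (simp add: limit_density_def Y.limit_density_def)
qed

section \<open>Local times\<close>

text \<open>Along the visits to one site the number of visits still to come, the present one
  included, runs through 1, ..., card B, so the increments of F telescope.\<close>

lemma sum_telescope_fibre:
  fixes F :: "nat \<Rightarrow> real"
  assumes "finite B" and F0: "F 0 = 0"
  shows "(\<Sum>k\<in>B. F (card {i\<in>B. k \<le> i}) - F (card {i\<in>B. k \<le> i} - 1)) = F (card (B :: nat set))"
  using \<open>finite B\<close>
proof (induction B rule: finite_linorder_min_induct)
  case (insert b A)
  have b: "b \<notin> A" using insert by auto
  have eqb: "{i \<in> insert b A. b \<le> i} = insert b A" using insert by force
  have eqk: "{i \<in> insert b A. k \<le> i} = {i \<in> A. k \<le> i}" if "k \<in> A" for k using insert that by force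
  have "(\<Sum>k\<in>insert b A. F (card {i\<in>insert b A. k \<le> i}) - F (card {i\<in>insert b A. k \<le> i} - 1))
    = (F (card (insert b A)) - F (card (insert b A) - 1)) + (\<Sum>k\<in>A. F (card {i\<in>A. k \<le> i}) - F (card {i\<in>A. k \<le> i} - 1))"
  proof -
    have "(\<Sum>k\<in>insert b A. F (card {i\<in>insert b A. k \<le> i}) - F (card {i\<in>insert b A. k \<le> i} - 1))
      = (F (card {i\<in>insert b A. b \<le> i}) - F (card {i\<in>insert b A. b \<le> i} - 1))
        + (\<Sum>k\<in>A. F (card {i\<in>insert b A. k \<le> i}) - F (card {i\<in>insert b A. k \<le> i} - 1))"
      using insert b by (intro sum.insert) auto
    also have "(\<Sum>k\<in>A. F (card {i\<in>insert b A. k \<le> i}) - F (card {i\<in>insert b A. k \<le> i} - 1))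
      = (\<Sum>k\<in>A. F (card {i\<in>A. k \<le> i}) - F (card {i\<in>A. k \<le> i} - 1))"
      by (intro sum.cong refl) (simp only: eqk)
    finally show ?thesis unfolding eqb .
  qed
  also have "\<dots> = F (card (insert b A))" using insert b by simp
  finally show ?case .
qed (use F0 in simp)

lemma sum_over_image_eq:
  fixes F :: "nat \<Rightarrow> real" and w :: "nat \<Rightarrow> 'b"
  assumes F0: "F 0 = 0"
  shows "(\<Sum>y\<in>w ` {..<n}. F (card {k. k < n \<and> w k = y}))
    = (\<Sum>k<n. F (card {i. k \<le> i \<and> i < n \<and> w i = w k}) - F (card {i. k \<le> i \<and> i < n \<and> w i = w k} - 1))"
proof -
  let ?h = "\<lambda>k. F (card {i. k \<le> i \<and> i < n \<and> w i = w k}) - F (card {i. k \<le> i \<and> i < n \<and> w i = w k} - 1)"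
  have "(\<Sum>k<n. ?h k) = (\<Sum>y\<in>w ` {..<n}. \<Sum>k\<in>{k \<in> {..<n}. w k = y}. ?h k)"
    by (rule sum.image_gen) simp
  also have "\<dots> = (\<Sum>y\<in>w ` {..<n}. F (card {k. k < n \<and> w k = y}))"
  proof (intro sum.cong refl)
    fix y
    let ?B = "{k \<in> {..<n}. w k = y}"
    have "(\<Sum>k\<in>?B. ?h k) = (\<Sum>k\<in>?B. F (card {i\<in>?B. k \<le> i}) - F (card {i\<in>?B. k \<le> i} - 1))"
    proof (intro sum.cong refl)
      fix k assume "k \<in> ?B"
      hence "{i. k \<le> i \<and> i < n \<and> w i = w k} = {i\<in>?B. k \<le> i}" by auto
      thus "?h k = F (card {i\<in>?B. k \<le> i}) - F (card {i\<in>?B. k \<le> i} - 1)" by simp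
    qed
    also have "\<dots> = F (card ?B)" by (rule sum_telescope_fibre[where F=F, OF _ F0]) simp
    also have "F (card ?B) = F (card {k. k < n \<and> w k = y})"
      by (intro arg_cong[where f=F] arg_cong[where f=card]) auto
    finally show "(\<Sum>k\<in>?B. ?h k) = F (card {k. k < n \<and> w k = y})" .
  qed
  finally show ?thesis by simp
qed

lemma visits_eq_card: "visits s xs = card {j. j \<le> length xs \<and> s + sum_list (take j xs) = 0}"
proof (induction xs arbitrary: s)
  case (Cons x xs)
  have "{j. j \<le> length (x # xs) \<and> s + sum_list (take j (x # xs)) = 0}
    = {j. j = 0 \<and> s = 0} \<union> Suc ` {j. j \<le> length xs \<and> (s + x) + sum_list (take j xs) = 0}" (is "?L = ?R")
  proof (intro set_eqI)
    fix j show "j \<in> ?L \<longleftrightarrow> j \<in> ?R"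
      by (cases j) (auto simp: add.assoc image_iff)
  qed
  also have "card \<dots> = card {j::nat. j = 0 \<and> s = 0} + card (Suc ` {j. j \<le> length xs \<and> (s + x) + sum_list (take j xs) = 0})"
    by (rule card_Un_disjoint) auto
  also have "card (Suc ` {j. j \<le> length xs \<and> (s + x) + sum_list (take j xs) = 0}) = visits (s + x) xs"
    by (subst card_image) (auto simp: Cons.IH)
  finally show ?case by (cases "s = 0") auto
qed (auto simp: card_1_singleton_iff)

section \<open>Local times and forward counts of the walk\<close>

definition ltime :: "(nat \<Rightarrow> 'w \<Rightarrow> int ^ 'd) \<Rightarrow> nat \<Rightarrow> int ^ 'd \<Rightarrow> 'w \<Rightarrow> nat" where
  "ltime X n y \<omega> = card {k. k < n \<and> walk X k \<omega> = y}"

definition wrange :: "(nat \<Rightarrow> 'w \<Rightarrow> int ^ 'd) \<Rightarrow> nat \<Rightarrow> 'w \<Rightarrow> (int ^ 'd) set" where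
  "wrange X n \<omega> = (\<lambda>k. walk X k \<omega>) ` {..<n}"

definition steps :: "(nat \<Rightarrow> 'w \<Rightarrow> 'b) \<Rightarrow> nat \<Rightarrow> nat \<Rightarrow> 'w \<Rightarrow> 'b list" where
  "steps X k m \<omega> = map (\<lambda>i. X i \<omega>) [Suc k..<Suc k + m]"

text \<open>Visits during [k, k + m] to the site occupied at time k, that at time k included. It is
  a function of the steps after time k alone, and its law does not depend on k.\<close>

definition fwd :: "(nat \<Rightarrow> 'w \<Rightarrow> int ^ 'd) \<Rightarrow> nat \<Rightarrow> nat \<Rightarrow> 'w \<Rightarrow> nat" where
  "fwd X k m \<omega> = visits 0 (steps X k m \<omega>)"

lemma length_steps [simp]: "length (steps X k m \<omega>) = m"
  by (simp add: steps_def)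

lemma steps_nth: "j < m \<Longrightarrow> steps X k m \<omega> ! j = X (Suc (k + j)) \<omega>"
  by (simp add: steps_def del: upt_Suc)

lemma walk_add_steps: "j \<le> m \<Longrightarrow> walk X (k + j) \<omega> = walk X k \<omega> + sum_list (take j (steps X k m \<omega>))"
proof (induction j)
  case (Suc j)
  have "take (Suc j) (steps X k m \<omega>) = take j (steps X k m \<omega>) @ [X (Suc (k + j)) \<omega>]"
    using Suc.prems by (subst take_Suc_conv_app_nth) (auto simp: steps_def simp del: upt_Suc)
  thus ?case using Suc by (simp add: walk_def add.assoc)
qed simp

lemma fwd_eq_card: "fwd X k m \<omega> = card {i. k \<le> i \<and> i \<le> k + m \<and> walk X i \<omega> = walk X k \<omega>}"
proof -
  have "{i. k \<le> i \<and> i \<le> k + m \<and> walk X i \<omega> = walk X k \<omega>} = (\<lambda>j. k + j) ` {j. j \<le> m \<and> sum_list (take j (steps X k m \<omega>)) = 0}"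
  proof safe
    fix i assume i: "k \<le> i" "i \<le> k + m" "walk X i \<omega> = walk X k \<omega>"
    with walk_add_steps[of "i - k" m X k \<omega>] show "i \<in> (\<lambda>j. k + j) ` {j. j \<le> m \<and> sum_list (take j (steps X k m \<omega>)) = 0}"
      by (intro image_eqI[of _ _ "i - k"]) auto
  qed (auto simp: walk_add_steps)
  hence "card {i. k \<le> i \<and> i \<le> k + m \<and> walk X i \<omega> = walk X k \<omega>} = card {j. j \<le> m \<and> sum_list (take j (steps X k m \<omega>)) = 0}"
    by (simp add: card_image)
  thus ?thesis by (simp add: fwd_def visits_eq_card)
qed

text \<open>The exchange of sites for times on which all later moment estimates rest. The horizon n
  - 1 - k makes the forward count end at time n - 1, the last time that enters
  \<open>ltime X n\<close>.\<close>

lemma sum_ltime: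
  fixes F :: "nat \<Rightarrow> real"
  assumes "F 0 = 0"
  shows "(\<Sum>y\<in>wrange X n \<omega>. F (ltime X n y \<omega>)) = (\<Sum>k<n. F (fwd X k (n - 1 - k) \<omega>) - F (fwd X k (n - 1 - k) \<omega> - 1))"
proof -
  have "{i. k \<le> i \<and> i < n \<and> walk X i \<omega> = walk X k \<omega>} = {i. k \<le> i \<and> i \<le> k + (n - 1 - k) \<and> walk X i \<omega> = walk X k \<omega>}" if "k < n" for k
    using that by auto
  hence "fwd X k (n - 1 - k) \<omega> = card {i. k \<le> i \<and> i < n \<and> walk X i \<omega> = walk X k \<omega>}" if "k < n" for k
    using that by (simp only: fwd_eq_card)
  thus ?thesis
    unfolding wrange_def ltime_def using sum_over_image_eq[where F=F and w="\<lambda>k. walk X k \<omega>" and n=n, OF assms] by simp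
qed

lemma fwd_ge_1: "1 \<le> fwd X k m \<omega>"
  using visits_0_pos[of "steps X k m \<omega>"] by (simp add: fwd_def)

lemma fwd_le: "fwd X k m \<omega> \<le> Suc m"
  using visits_le[of 0 "steps X k m \<omega>"] by (simp add: fwd_def)

lemma fwd_mono: "m \<le> m' \<Longrightarrow> fwd X k m \<omega> \<le> fwd X k m' \<omega>"
  unfolding fwd_eq_card by (intro card_mono) (auto intro: finite_subset[of _ "{..k + m'}"])

lemma ltime_pos: "y \<in> wrange X n \<omega> \<Longrightarrow> 1 \<le> ltime X n y \<omega>"
  by (auto simp: wrange_def ltime_def Suc_le_eq card_gt_0_iff)

text \<open>At the first visit to a site all of its visits are still to come.\<close>

lemma ltime_le_fwd:
  assumes "y \<in> wrange X n \<omega>"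
  obtains k where "k < n" "ltime X n y \<omega> = fwd X k (n - 1 - k) \<omega>"
proof -
  define B where "B = {k. k < n \<and> walk X k \<omega> = y}"
  have B: "finite B" "B \<noteq> {}" using assms by (auto simp: B_def wrange_def)
  define k where "k = Min B"
  have k: "k < n" "walk X k \<omega> = y" using Min_in[OF B] by (auto simp: k_def B_def)
  have kmin: "k \<le> i" if "i \<in> B" for i
    using Min_le[OF B(1) that] by (simp add: k_def)
  have "B = {i. k \<le> i \<and> i \<le> k + (n - 1 - k) \<and> walk X i \<omega> = walk X k \<omega>}"
  proof (intro set_eqI iffI)
    fix i assume "i \<in> B"
    thus "i \<in> {i. k \<le> i \<and> i \<le> k + (n - 1 - k) \<and> walk X i \<omega> = walk X k \<omega>}"
      using kmin[of i] k by (auto simp: B_def)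
  qed (use k in \<open>auto simp: B_def\<close>)
  thus ?thesis using that[of k] k by (simp add: ltime_def fwd_eq_card B_def[symmetric])
qed

lemma finite_wrange [simp]: "finite (wrange X n \<omega>)"
  by (simp add: wrange_def)

lemma sum_ltime_eq: "(\<Sum>y\<in>wrange X n \<omega>. real (ltime X n y \<omega>)) = real n"
proof -
  have "(\<Sum>y\<in>wrange X n \<omega>. real (ltime X n y \<omega>)) = (\<Sum>k<n. real (fwd X k (n - 1 - k) \<omega>) - real (fwd X k (n - 1 - k) \<omega> - 1))"
    using sum_ltime[of real X n \<omega>] by simp
  also have "\<dots> = (\<Sum>k<n. 1)"
    using fwd_ge_1[of X] by (intro sum.cong refl) (simp add: of_nat_diff)
  finally show ?thesis by simp
qed

lemma power_Suc_diff_le: "real (Suc j) ^ r - real j ^ r \<le> real r * real (Suc j) ^ (r - 1)"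
proof (cases r)
  case (Suc r')
  have "real (Suc j) ^ Suc r' - real j ^ Suc r' = (real (Suc j) - real j) * (\<Sum>p<Suc r'. real (Suc j) ^ p * real j ^ (r' - p))"
    by (rule diff_power_eq_sum)
  also have "\<dots> = (\<Sum>p<Suc r'. real (Suc j) ^ p * real j ^ (r' - p))" by simp
  also have "\<dots> \<le> (\<Sum>p<Suc r'. real (Suc j) ^ r')"
  proof (intro sum_mono)
    fix p assume "p \<in> {..<Suc r'}"
    have "real (Suc j) ^ p * real j ^ (r' - p) \<le> real (Suc j) ^ p * real (Suc j) ^ (r' - p)"
      by (intro mult_left_mono power_mono) auto
    also have "\<dots> = real (Suc j) ^ r'" using \<open>p \<in> {..<Suc r'}\<close> by (simp flip: power_add)
    finally show "real (Suc j) ^ p * real j ^ (r' - p) \<le> real (Suc j) ^ r'" .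
  qed
  finally show ?thesis using Suc by simp
qed simp

text \<open>Summation by parts: multiplication by 1 - x replaces the weights by their differences
  and so lowers the power by one.\<close>

lemma sum_geometric_moment:
  fixes x :: real
  assumes "0 \<le> x" "x < 1"
  shows "(\<Sum>j<J. real (Suc j) ^ r * x ^ j) \<le> fact r / (1 - x) ^ Suc r"
proof (induction r)
  case 0
  have "(1 - x) * (\<Sum>j<J. x ^ j) = 1 - x ^ J" by (rule one_diff_power_eq[symmetric])
  hence "(1 - x) * (\<Sum>j<J. x ^ j) \<le> 1" using assms by simp
  thus ?case using assms by (simp add: field_simps)
next
  case (Suc r)
  have ab: "(1 - x) * (\<Sum>j<J. real (Suc j) ^ s * x ^ j) \<le> (\<Sum>j<J. (real (Suc j) ^ s - real j ^ s) * x ^ j)" if "s > 0" for s J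
  proof -
    have "(1 - x) * (\<Sum>j<J. real (Suc j) ^ s * x ^ j) = (\<Sum>j<J. (real (Suc j) ^ s - real j ^ s) * x ^ j) - real J ^ s * x ^ J"
      using that by (induction J) (simp_all add: algebra_simps)
    thus ?thesis using assms by simp
  qed
  have d: "real (Suc j) ^ Suc r - real j ^ Suc r \<le> real (Suc r) * real (Suc j) ^ r" for j
    using power_Suc_diff_le[of j "Suc r"] by simp
  have "(1 - x) * (\<Sum>j<J. real (Suc j) ^ Suc r * x ^ j) \<le> (\<Sum>j<J. (real (Suc j) ^ Suc r - real j ^ Suc r) * x ^ j)"
    by (rule ab) simp
  also have "\<dots> \<le> (\<Sum>j<J. real (Suc r) * real (Suc j) ^ r * x ^ j)"
    using assms by (intro sum_mono mult_right_mono d) auto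
  also have "\<dots> = real (Suc r) * (\<Sum>j<J. real (Suc j) ^ r * x ^ j)"
    by (simp only: sum_distrib_left mult.assoc)
  also have "\<dots> \<le> real (Suc r) * (fact r / (1 - x) ^ Suc r)" using Suc.IH by (intro mult_left_mono) auto
  also have "\<dots> = fact (Suc r) / (1 - x) ^ Suc r" by simp
  finally have "(\<Sum>j<J. real (Suc j) ^ Suc r * x ^ j) \<le> fact (Suc r) / (1 - x) ^ Suc r / (1 - x)"
    using assms by (subst pos_le_divide_eq) (simp_all only: mult.commute diff_gt_0_iff_gt)
  thus ?case by (simp only: divide_divide_eq_left power_Suc2[symmetric])
qed

section \<open>Moments of local times\<close>

text \<open>From here on the law of the walk enters only through the growth of its Green function.
  The rate \<open>lam\<close> will be pi * A, in the plane and on the line alike.\<close>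

locale lattice_walk = prob_space M for M :: "'w measure" +
  fixes X :: "nat \<Rightarrow> 'w \<Rightarrow> int ^ 'd" and p :: "(int ^ 'd) pmf" and lam :: real
  assumes indep: "indep_vars (\<lambda>_. count_space UNIV) X {1..}"
    and law: "\<And>k. 1 \<le> k \<Longrightarrow> distr M (count_space UNIV) (X k) = measure_pmf p"
    and lam: "lam > 0"
    and green_asymp: "(\<lambda>n. green p n 0 / ln (real n)) \<longlonglongrightarrow> 1 / lam"
begin

lemma X_measurable: "1 \<le> k \<Longrightarrow> X k \<in> measurable M (count_space UNIV)"
  using indep by (auto simp: indep_vars_def)

lemma steps_measurable [measurable]: "steps X k m \<in> measurable M (count_space UNIV)"
proof (induction m arbitrary: k)
  case 0
  show ?case by (simp add: steps_def)
next
  case (Suc m)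
  have eq: "steps X k (Suc m) = (\<lambda>\<omega>. X (Suc k) \<omega> # steps X (Suc k) m \<omega>)"
    by (rule ext) (simp add: steps_def upt_conv_Cons del: upt_Suc)
  have "(\<lambda>\<omega>. (X (Suc k) \<omega>, steps X (Suc k) m \<omega>)) \<in> measurable M (count_space UNIV \<Otimes>\<^sub>M count_space UNIV)"
    using X_measurable[of "Suc k"] Suc by (intro measurable_Pair) auto
  hence "(\<lambda>\<omega>. (X (Suc k) \<omega>, steps X (Suc k) m \<omega>)) \<in> measurable M (count_space UNIV)"
    by (simp add: pair_measure_countable)
  from measurable_compose[OF this, of "\<lambda>(x, xs). x # xs" "count_space UNIV"] show ?case
    by (simp add: eq case_prod_beta)
qed

lemma fwd_measurable [measurable]: "fwd X k m \<in> measurable M (count_space UNIV)"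
  unfolding fwd_def by measurable

lemma prob_X_eq: "1 \<le> k \<Longrightarrow> prob (X k -` {x} \<inter> space M) = pmf p x"
  using measure_distr[OF X_measurable, of k "{x}"] law[of k] by (simp add: pmf.rep_eq)

lemma pmf_replicate_Cons: "pmf (replicate_pmf (Suc m) q) (x # xs) = pmf q x * pmf (replicate_pmf m q) xs"
proof -
  have "replicate_pmf (Suc m) q = map_pmf (\<lambda>(x, xs). x # xs) (pair_pmf q (replicate_pmf m q))"
    by (simp add: pair_pmf_def map_bind_pmf)
  moreover have "pmf (map_pmf (\<lambda>(x, xs). x # xs) (pair_pmf q (replicate_pmf m q))) ((\<lambda>(x, xs). x # xs) (x, xs)) = pmf (pair_pmf q (replicate_pmf m q)) (x, xs)"
    by (rule pmf_map_inj') (auto simp: inj_def)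
  ultimately show ?thesis by (simp add: pmf_pair)
qed

lemma pmf_replicate: "length xs = m \<Longrightarrow> pmf (replicate_pmf m q) xs = (\<Prod>i<m. pmf q (xs ! i))"
proof (induction m arbitrary: xs)
  case (Suc m)
  then obtain x ys where xs: "xs = x # ys" "length ys = m" by (cases xs) auto
  show ?case unfolding xs(1) pmf_replicate_Cons Suc.IH[OF xs(2)]
    by (subst prod.lessThan_Suc_shift) simp
qed simp

lemma distr_steps: "distr M (count_space UNIV) (steps X k m) = measure_pmf (replicate_pmf m p)"
proof (rule measure_eqI_countable[of _ UNIV])
  fix xs :: "(int ^ 'd) list"
  have "prob (steps X k m -` {xs} \<inter> space M) = pmf (replicate_pmf m p) xs"
  proof (cases "length xs = m")
    case False
    hence "steps X k m \<omega> \<noteq> xs" for \<omega> using length_steps[of X k m \<omega>] by auto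
    hence "steps X k m -` {xs} \<inter> space M = {}" by auto
    moreover have "xs \<notin> set_pmf (replicate_pmf m p)" using False by (auto simp: set_replicate_pmf)
    ultimately show ?thesis by (simp add: set_pmf_iff)
  next
    case True
    show ?thesis
    proof (cases "m = 0")
      case False
      have "steps X k m -` {xs} \<inter> space M = (\<Inter>i\<in>{Suc k..<Suc k + m}. X i -` {xs ! (i - Suc k)} \<inter> space M)"
      proof (intro set_eqI iffI)
        fix \<omega> assume \<omega>: "\<omega> \<in> steps X k m -` {xs} \<inter> space M"
        have "X i \<omega> = xs ! (i - Suc k)" if "i \<in> {Suc k..<Suc k + m}" for i
        proof -
          have "i - Suc k < m" using that by auto
          from steps_nth[OF this, of X k \<omega>] show ?thesis using \<omega> that by simp
        qed
        thus "\<omega> \<in> (\<Inter>i\<in>{Suc k..<Suc k + m}. X i -` {xs ! (i - Suc k)} \<inter> space M)" using \<omega> by auto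
      next
        fix \<omega> assume \<omega>: "\<omega> \<in> (\<Inter>i\<in>{Suc k..<Suc k + m}. X i -` {xs ! (i - Suc k)} \<inter> space M)"
        have "Suc k \<in> {Suc k..<Suc k + m}" using False by auto
        hence "\<omega> \<in> space M" using \<omega> by blast
        moreover have "steps X k m \<omega> = xs"
        proof (rule nth_equalityI)
          fix j assume "j < length (steps X k m \<omega>)"
          hence j: "j < m" by simp
          hence "Suc (k + j) \<in> {Suc k..<Suc k + m}" by auto
          hence "\<omega> \<in> X (Suc (k + j)) -` {xs ! (Suc (k + j) - Suc k)} \<inter> space M" using \<omega> by blast
          thus "steps X k m \<omega> ! j = xs ! j" using steps_nth[OF j, of X k \<omega>] by simp
        qed (use True in simp)
        ultimately show "\<omega> \<in> steps X k m -` {xs} \<inter> space M" by simp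
      qed
      also have "prob \<dots> = (\<Prod>i\<in>{Suc k..<Suc k + m}. prob (X i -` {xs ! (i - Suc k)} \<inter> space M))"
        using False by (intro indep_varsD[OF indep]) auto
      also have "\<dots> = (\<Prod>i\<in>{Suc k..<Suc k + m}. pmf p (xs ! (i - Suc k)))"
        by (intro prod.cong refl prob_X_eq) auto
      also have "\<dots> = (\<Prod>i<m. pmf p (xs ! i))"
        by (rule prod.reindex_bij_witness[of _ "\<lambda>i. i + Suc k" "\<lambda>i. i - Suc k"]) auto
      finally show ?thesis by (simp add: pmf_replicate[OF True])
    qed (use True in \<open>simp add: steps_def vimage_def prob_space\<close>)
  qed
  thus "emeasure (distr M (count_space UNIV) (steps X k m)) {xs} = emeasure (measure_pmf (replicate_pmf m p)) {xs}"
    by (simp add: emeasure_distr emeasure_eq_measure emeasure_pmf_single)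
qed auto

lemma prob_fwd: "prob {\<omega>\<in>space M. j \<le> fwd X k m \<omega>} = vtail p m 0 j"
proof -
  have "prob {\<omega>\<in>space M. j \<le> fwd X k m \<omega>} = measure (distr M (count_space UNIV) (steps X k m)) {xs. j \<le> visits 0 xs}"
    by (subst measure_distr) (auto simp: fwd_def intro!: arg_cong[where f=prob])
  thus ?thesis by (simp add: distr_steps vtail_def)
qed

lemma expectation_fwd_cong:
  fixes f :: "nat \<Rightarrow> real"
  shows "expectation (\<lambda>\<omega>. f (fwd X k m \<omega>)) = expectation (\<lambda>\<omega>. f (fwd X 0 m \<omega>))"
proof -
  have "expectation (\<lambda>\<omega>. f (fwd X k m \<omega>)) = (\<integral>xs. f (visits 0 xs) \<partial>measure_pmf (replicate_pmf m p))" for k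
    unfolding distr_steps[of k m, symmetric] fwd_def by (subst integral_distr) auto
  thus ?thesis by simp
qed

lemma integrable_bounded_count:
  fixes f :: "'z \<Rightarrow> real"
  assumes "Y \<in> measurable M (count_space UNIV)" "\<And>\<omega>. \<bar>f (Y \<omega>)\<bar> \<le> B"
  shows "integrable M (\<lambda>\<omega>. f (Y \<omega>))"
  by (rule integrable_const_bound[where B=B])
     (use assms(2) in simp, rule measurable_compose[OF assms(1), of f borel], simp)

lemma integrable_fwd: "integrable M (\<lambda>\<omega>. (f (fwd X k m \<omega>) :: real))"
proof (rule integrable_bounded_count[where f=f and Y="fwd X k m" and B="\<Sum>j\<le>Suc m. \<bar>f j\<bar>"])
  show "\<bar>f (fwd X k m \<omega>)\<bar> \<le> (\<Sum>j\<le>Suc m. \<bar>f j\<bar>)" for \<omega>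
    using fwd_le[of X k m \<omega>] by (intro member_le_sum) auto
qed measurable

lemma expectation_of_bool_fwd: "expectation (\<lambda>\<omega>. of_bool (j \<le> fwd X k m \<omega>)) = vtail p m 0 j"
proof -
  have "expectation (\<lambda>\<omega>. of_bool (j \<le> fwd X k m \<omega>)) = expectation (indicator {\<omega>\<in>space M. j \<le> fwd X k m \<omega>})"
    by (intro Bochner_Integration.integral_cong) (auto simp: indicator_def)
  also have "\<dots> = prob ({\<omega>\<in>space M. j \<le> fwd X k m \<omega>} \<inter> space M)"
    by (rule Bochner_Integration.integral_indicator)
  also have "{\<omega>\<in>space M. j \<le> fwd X k m \<omega>} \<inter> space M = {\<omega>\<in>space M. j \<le> fwd X k m \<omega>}" by auto
  finally show ?thesis by (simp only: prob_fwd)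
qed

lemma expectation_fwd_layer:
  fixes f :: "nat \<Rightarrow> real"
  shows "expectation (\<lambda>\<omega>. f (fwd X k m \<omega>)) = f 0 + (\<Sum>j=1..Suc m. (f j - f (j - 1)) * vtail p m 0 j)"
proof -
  have eq: "f L = f 0 + (\<Sum>j=1..N. (f j - f (j - 1)) * of_bool (j \<le> L))" if "L \<le> N" for L N
    using that
  proof (induction N)
    case (Suc N)
    show ?case
    proof (cases "L = Suc N")
      case True
      have "(\<Sum>j=1..Suc N. (f j - f (j - 1)) * of_bool (j \<le> Suc N)) = (\<Sum>j=1..Suc N. f j - f (j - 1))"
        by (intro sum.cong) auto
      also have "\<dots> = f (Suc N) - f 0" by (induction N) auto
      finally show ?thesis using True by simp
    next
      case False
      thus ?thesis using Suc by simp
    qed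
  qed simp
  have "expectation (\<lambda>\<omega>. f (fwd X k m \<omega>)) = expectation (\<lambda>\<omega>. f 0 + (\<Sum>j=1..Suc m. (f j - f (j - 1)) * of_bool (j \<le> fwd X k m \<omega>)))"
    using eq[OF fwd_le] by (intro Bochner_Integration.integral_cong refl)
  also have "\<dots> = f 0 + (\<Sum>j=1..Suc m. (f j - f (j - 1)) * expectation (\<lambda>\<omega>. of_bool (j \<le> fwd X k m \<omega>)))"
  proof -
    have i1: "integrable M (\<lambda>\<omega>. of_bool (j \<le> fwd X k m \<omega>) :: real)" for j
      by (rule integrable_fwd)
    have "expectation (\<lambda>\<omega>. \<Sum>j=1..Suc m. (f j - f (j - 1)) * of_bool (j \<le> fwd X k m \<omega>))
      = (\<Sum>j=1..Suc m. expectation (\<lambda>\<omega>. (f j - f (j - 1)) * of_bool (j \<le> fwd X k m \<omega>)))"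
      by (rule Bochner_Integration.integral_sum) (intro integrable_mult_right i1)
    moreover have "expectation (\<lambda>\<omega>. f 0 + (\<Sum>j=1..Suc m. (f j - f (j - 1)) * of_bool (j \<le> fwd X k m \<omega>)))
      = expectation (\<lambda>\<omega>. f 0) + expectation (\<lambda>\<omega>. \<Sum>j=1..Suc m. (f j - f (j - 1)) * of_bool (j \<le> fwd X k m \<omega>))"
      by (rule Bochner_Integration.integral_add) (intro integrable_const Bochner_Integration.integrable_sum integrable_mult_right i1)+
    moreover have "expectation (\<lambda>\<omega>. f 0) = f 0" by (simp add: prob_space)
    ultimately show ?thesis by (simp only: integral_mult_right_zero)
  qed
  finally show ?thesis by (simp only: expectation_of_bool_fwd)
qed

lemma expectation_fwd: "expectation (\<lambda>\<omega>. real (fwd X k m \<omega>)) = green p m 0"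
  unfolding expectation_fwd_layer[of real] green_def by (simp add: of_nat_diff)

text \<open>Layer cake formula with the geometric bound for the tails; the increments of j^r cost
  one power.\<close>

lemma expectation_fwd_power:
  assumes q: "escape p m > 0"
  shows "expectation (\<lambda>\<omega>. real (fwd X k m \<omega>) ^ r) \<le> fact r / escape p m ^ r"
proof (cases "r = 0")
  case False
  have x: "0 \<le> vtail p m 0 2" "vtail p m 0 2 < 1" using q by auto
  have "expectation (\<lambda>\<omega>. real (fwd X k m \<omega>) ^ r) = (\<Sum>j=1..Suc m. (real j ^ r - real (j - 1) ^ r) * vtail p m 0 j)"
    using False by (subst expectation_fwd_layer[of "\<lambda>j. real j ^ r"]) simp
  also have "\<dots> = (\<Sum>j<Suc m. (real (Suc j) ^ r - real j ^ r) * vtail p m 0 (Suc j))"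
    by (rule sum.reindex_bij_witness[of _ Suc "\<lambda>j. j - 1"]) auto
  also have "\<dots> \<le> (\<Sum>j<Suc m. (real r * real (Suc j) ^ (r - 1)) * vtail p m 0 2 ^ j)"
    by (intro sum_mono mult_mono power_Suc_diff_le vtail_le_power) auto
  also have "\<dots> = real r * (\<Sum>j<Suc m. real (Suc j) ^ (r - 1) * vtail p m 0 2 ^ j)"
    by (simp only: sum_distrib_left mult.assoc)
  also have "\<dots> \<le> real r * (fact (r - 1) / escape p m ^ Suc (r - 1))"
    by (intro mult_left_mono sum_geometric_moment x) auto
  also have "\<dots> = fact r / escape p m ^ r" using False by (simp add: fact_reduce)
  finally show ?thesis .
qed (simp add: prob_space)

lemma escape_lim: "(\<lambda>n. escape p n * ln (real n)) \<longlonglongrightarrow> lam"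
  by (rule escape_asymp[OF lam green_asymp])

text \<open>Positive for large times by the limit, hence always, because the escape probability
  decreases with the horizon.\<close>

lemma escape_pos: "escape p n > 0"
proof -
  have "\<forall>\<^sub>F n in sequentially. escape p n * ln (real n) > 0"
    by (rule order_tendstoD(1)[OF escape_lim lam])
  then obtain N where N: "\<And>k. k \<ge> N \<Longrightarrow> escape p k * ln (real k) > 0"
    by (auto simp: eventually_sequentially)
  have "escape p (max N (max n 1)) > 0"
    using N[of "max N (max n 1)"] by (auto simp: zero_less_mult_iff ln_less_zero_iff)
  moreover have "vtail p n 0 2 \<le> vtail p (max N (max n 1)) 0 2" by (rule vtail_mono) auto
  ultimately show ?thesis by linarith
qed

lemma escape_antimono: "m \<le> n \<Longrightarrow> escape p n \<le> escape p m"
  by (simp add: vtail_mono)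

lemma ltime_measurable [measurable]: "ltime X n y \<in> measurable M (count_space UNIV)"
proof -
  have "ltime X n y \<omega> = card {k. k < n \<and> sum_list (take k (steps X 0 n \<omega>)) = y}" for \<omega>
    unfolding ltime_def using walk_add_steps[of _ n X 0 \<omega>] by (intro arg_cong[where f=card] Collect_cong conj_cong refl) (simp add: walk_def)
  hence "ltime X n y = (\<lambda>xs. card {k. k < n \<and> sum_list (take k xs) = y}) \<circ> steps X 0 n" by (simp add: fun_eq_iff)
  thus ?thesis by simp
qed

lemma sum_ltime_measurable:
  fixes F :: "nat \<Rightarrow> real"
  shows "(\<lambda>\<omega>. \<Sum>y\<in>wrange X n \<omega>. F (ltime X n y \<omega>)) \<in> borel_measurable M"
proof -
  define w where "w = (\<lambda>xs k. sum_list (take k (xs :: (int ^ 'd) list)))"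
  have W: "walk X k \<omega> = w (steps X 0 n \<omega>) k" if "k < n" for k \<omega>
    using walk_add_steps[of k n X 0 \<omega>] that by (simp add: w_def walk_def)
  have "(\<Sum>y\<in>wrange X n \<omega>. F (ltime X n y \<omega>)) = (\<lambda>xs. \<Sum>y\<in>w xs ` {..<n}. F (card {k. k < n \<and> w xs k = y})) (steps X 0 n \<omega>)" for \<omega>
    unfolding wrange_def ltime_def using W[of _ \<omega>] by (intro sum.cong arg_cong[where f=F] arg_cong[where f=card]) (auto simp: image_iff)
  thus ?thesis by (simp add: measurable_compose[OF steps_measurable])
qed

lemma sum_ltime_bounded:
  fixes F :: "nat \<Rightarrow> real"
  shows "\<bar>\<Sum>y\<in>wrange X n \<omega>. F (ltime X n y \<omega>)\<bar> \<le> real n * (\<Sum>j\<le>n. \<bar>F j\<bar>)"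
proof -
  have lt: "ltime X n y \<omega> \<le> n" for y
    unfolding ltime_def using card_mono[of "{..<n}" "{k. k < n \<and> walk X k \<omega> = y}"] by auto
  have "\<bar>\<Sum>y\<in>wrange X n \<omega>. F (ltime X n y \<omega>)\<bar> \<le> (\<Sum>y\<in>wrange X n \<omega>. \<bar>F (ltime X n y \<omega>)\<bar>)" by (rule sum_abs)
  also have "\<dots> \<le> (\<Sum>y\<in>wrange X n \<omega>. \<Sum>j\<le>n. \<bar>F j\<bar>)"
    using lt by (intro sum_mono member_le_sum) auto
  also have "\<dots> = real (card (wrange X n \<omega>)) * (\<Sum>j\<le>n. \<bar>F j\<bar>)" by simp
  also have "\<dots> \<le> real n * (\<Sum>j\<le>n. \<bar>F j\<bar>)"
    using card_image_le[of "{..<n}" "\<lambda>k. walk X k \<omega>"] by (intro mult_right_mono) (auto simp: wrange_def sum_nonneg)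
  finally show ?thesis .
qed

lemma integrable_sum_ltime:
  fixes F :: "nat \<Rightarrow> real"
  shows "integrable M (\<lambda>\<omega>. \<Sum>y\<in>wrange X n \<omega>. F (ltime X n y \<omega>))"
  using sum_ltime_measurable sum_ltime_bounded by (intro integrable_const_bound[where B="real n * (\<Sum>j\<le>n. \<bar>F j\<bar>)"]) auto

text \<open>Passing from sites to times replaces an r-th power by r times the (r - 1)-th power of a
  forward count. One power is lost, so n sites' worth of mass carries only (ln n)^(r - 1).\<close>

lemma expectation_sum_ltime_power:
  assumes "r \<ge> 1"
  shows "expectation (\<lambda>\<omega>. \<Sum>y\<in>wrange X n \<omega>. real (ltime X n y \<omega>) ^ r) \<le> real n * fact r / escape p n ^ (r - 1)"
proof -
  have "expectation (\<lambda>\<omega>. \<Sum>y\<in>wrange X n \<omega>. real (ltime X n y \<omega>) ^ r)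
    = expectation (\<lambda>\<omega>. \<Sum>k<n. real (fwd X k (n - 1 - k) \<omega>) ^ r - real (fwd X k (n - 1 - k) \<omega> - 1) ^ r)"
    using assms by (intro Bochner_Integration.integral_cong refl sum_ltime) auto
  also have "\<dots> = (\<Sum>k<n. expectation (\<lambda>\<omega>. real (fwd X k (n - 1 - k) \<omega>) ^ r - real (fwd X k (n - 1 - k) \<omega> - 1) ^ r))"
    by (rule Bochner_Integration.integral_sum) (rule integrable_fwd[of "\<lambda>L. real L ^ r - real (L - 1) ^ r"])
  also have "\<dots> \<le> (\<Sum>k<n. fact r / escape p n ^ (r - 1))"
  proof (intro sum_mono)
    fix k assume k: "k \<in> {..<n}"
    have "expectation (\<lambda>\<omega>. real (fwd X k (n - 1 - k) \<omega>) ^ r - real (fwd X k (n - 1 - k) \<omega> - 1) ^ r)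
      \<le> expectation (\<lambda>\<omega>. real r * real (fwd X k (n - 1 - k) \<omega>) ^ (r - 1))"
    proof (rule integral_mono)
      show "integrable M (\<lambda>\<omega>. real (fwd X k (n - 1 - k) \<omega>) ^ r - real (fwd X k (n - 1 - k) \<omega> - 1) ^ r)"
        by (rule integrable_fwd[of "\<lambda>L. real L ^ r - real (L - 1) ^ r"])
      show "integrable M (\<lambda>\<omega>. real r * real (fwd X k (n - 1 - k) \<omega>) ^ (r - 1))"
        by (rule integrable_fwd[of "\<lambda>L. real r * real L ^ (r - 1)"])
      fix \<omega>
      obtain j where "fwd X k (n - 1 - k) \<omega> = Suc j" using fwd_ge_1[of X k "n - 1 - k" \<omega>] by (cases "fwd X k (n - 1 - k) \<omega>") auto
      thus "real (fwd X k (n - 1 - k) \<omega>) ^ r - real (fwd X k (n - 1 - k) \<omega> - 1) ^ r \<le> real r * real (fwd X k (n - 1 - k) \<omega>) ^ (r - 1)"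
        using power_Suc_diff_le[of j r] by simp
    qed
    also have "\<dots> = real r * expectation (\<lambda>\<omega>. real (fwd X k (n - 1 - k) \<omega>) ^ (r - 1))" by simp
    also have "\<dots> \<le> real r * (fact (r - 1) / escape p (n - 1 - k) ^ (r - 1))"
      by (intro mult_left_mono expectation_fwd_power escape_pos) auto
    also have "\<dots> = fact r / escape p (n - 1 - k) ^ (r - 1)" using assms by (simp add: fact_reduce)
    also have "\<dots> \<le> fact r / escape p n ^ (r - 1)"
    proof (intro divide_left_mono power_mono)
      show "escape p n \<le> escape p (n - 1 - k)" by (rule escape_antimono) auto
      show "0 \<le> escape p n" using escape_pos[of n] by linarith
      show "0 < escape p (n - 1 - k) ^ (r - 1) * escape p n ^ (r - 1)"
        by (intro mult_pos_pos zero_less_power escape_pos)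
    qed simp
    finally show "expectation (\<lambda>\<omega>. real (fwd X k (n - 1 - k) \<omega>) ^ r - real (fwd X k (n - 1 - k) \<omega> - 1) ^ r) \<le> fact r / escape p n ^ (r - 1)" .
  qed
  finally show ?thesis by simp
qed

text \<open>Each visited site is counted at its last visit: a time contributes exactly when the walk
  does not return to its present site before time n.\<close>

lemma expectation_card_wrange: "expectation (\<lambda>\<omega>. real (card (wrange X n \<omega>))) = (\<Sum>i<n. escape p i)"
proof -
  define F where "F = (\<lambda>j::nat. of_bool (j \<ge> 1) :: real)"
  have F1: "F (fwd X k m \<omega>) - F (fwd X k m \<omega> - 1) = 1 - of_bool (2 \<le> fwd X k m \<omega>)" for k m \<omega>
    using fwd_ge_1[of X k m \<omega>] by (auto simp: F_def)
  have pf: "expectation (\<lambda>\<omega>. 1 - of_bool (2 \<le> fwd X k m \<omega>)) = escape p m" for k m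
  proof -
    have "expectation (\<lambda>\<omega>. 1 - of_bool (2 \<le> fwd X k m \<omega>) :: real) = expectation (\<lambda>\<omega>. 1) - expectation (\<lambda>\<omega>. of_bool (2 \<le> fwd X k m \<omega>))"
      by (rule Bochner_Integration.integral_diff) (rule integrable_const, rule integrable_fwd)
    thus ?thesis by (simp only: expectation_of_bool_fwd) (simp add: prob_space)
  qed
  have "expectation (\<lambda>\<omega>. real (card (wrange X n \<omega>))) = expectation (\<lambda>\<omega>. \<Sum>y\<in>wrange X n \<omega>. F (ltime X n y \<omega>))"
  proof (intro Bochner_Integration.integral_cong refl)
    fix \<omega>
    have "(\<Sum>y\<in>wrange X n \<omega>. F (ltime X n y \<omega>)) = (\<Sum>y\<in>wrange X n \<omega>. 1)"
      using ltime_pos[of _ X n \<omega>] by (intro sum.cong refl) (simp add: F_def)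
    thus "real (card (wrange X n \<omega>)) = (\<Sum>y\<in>wrange X n \<omega>. F (ltime X n y \<omega>))" by simp
  qed
  also have "\<dots> = expectation (\<lambda>\<omega>. \<Sum>k<n. F (fwd X k (n - 1 - k) \<omega>) - F (fwd X k (n - 1 - k) \<omega> - 1))"
    by (intro Bochner_Integration.integral_cong refl sum_ltime) (simp add: F_def)
  also have "\<dots> = (\<Sum>k<n. expectation (\<lambda>\<omega>. 1 - of_bool (2 \<le> fwd X k (n - 1 - k) \<omega>)))"
    unfolding F1 by (rule Bochner_Integration.integral_sum) (rule integrable_fwd[of "\<lambda>L. 1 - of_bool (2 \<le> L)"])
  also have "\<dots> = (\<Sum>k<n. escape p (n - 1 - k))" unfolding pf ..
  also have "\<dots> = (\<Sum>i<n. escape p i)"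
    by (rule sum.reindex_bij_witness[of _ "\<lambda>i. n - 1 - i" "\<lambda>k. n - 1 - k"]) auto
  finally show ?thesis .
qed

text \<open>Union bound over the time of the first visit; a site with more than j visits has j
  returns ahead of it at that time.\<close>

lemma prob_ltime_large:
  "prob {\<omega>\<in>space M. \<exists>y\<in>wrange X n \<omega>. Suc j \<le> ltime X n y \<omega>} \<le> real n * (1 - escape p n) ^ j"
proof -
  have "{\<omega>\<in>space M. \<exists>y\<in>wrange X n \<omega>. Suc j \<le> ltime X n y \<omega>} \<subseteq> (\<Union>k<n. {\<omega>\<in>space M. Suc j \<le> fwd X k (n - 1 - k) \<omega>})"
    by (auto elim!: ltime_le_fwd[of _ X n])
  hence "prob {\<omega>\<in>space M. \<exists>y\<in>wrange X n \<omega>. Suc j \<le> ltime X n y \<omega>} \<le> prob (\<Union>k<n. {\<omega>\<in>space M. Suc j \<le> fwd X k (n - 1 - k) \<omega>})"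
    by (intro finite_measure_mono) auto
  also have "\<dots> \<le> (\<Sum>k<n. prob {\<omega>\<in>space M. Suc j \<le> fwd X k (n - 1 - k) \<omega>})"
    by (rule finite_measure_subadditive_finite) auto
  also have "\<dots> \<le> (\<Sum>k<n. (1 - escape p n) ^ j)"
  proof (intro sum_mono)
    fix k assume "k \<in> {..<n}"
    have "vtail p (n - 1 - k) 0 (Suc j) \<le> vtail p n 0 (Suc j)" by (rule vtail_mono) auto
    also have "\<dots> \<le> vtail p n 0 2 ^ j" by (rule vtail_le_power)
    finally show "prob {\<omega>\<in>space M. Suc j \<le> fwd X k (n - 1 - k) \<omega>} \<le> (1 - escape p n) ^ j" by (simp add: prob_fwd)
  qed
  finally show ?thesis by simp
qed

end

section \<open>A weak law for functionals of the local times\<close>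

lemma (in prob_space) expectation_abs_le_sqrt:
  assumes "integrable M (\<lambda>x. (Y x)\<^sup>2)" "Y \<in> borel_measurable M"
  shows "expectation (\<lambda>x. \<bar>Y x\<bar>) \<le> sqrt (expectation (\<lambda>x. (Y x)\<^sup>2))"
proof -
  have Y: "integrable M Y" by (rule square_integrable_imp_integrable[OF assms(2,1)])
  have "variance (\<lambda>x. \<bar>Y x\<bar>) = expectation (\<lambda>x. \<bar>Y x\<bar>\<^sup>2) - (expectation (\<lambda>x. \<bar>Y x\<bar>))\<^sup>2"
    using Y assms by (intro variance_eq) auto
  moreover have "variance (\<lambda>x. \<bar>Y x\<bar>) \<ge> 0" by simp
  ultimately have "(expectation (\<lambda>x. \<bar>Y x\<bar>))\<^sup>2 \<le> expectation (\<lambda>x. (Y x)\<^sup>2)" by simp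
  thus ?thesis by (rule real_le_rsqrt)
qed

abbreviation exp_law :: "real \<Rightarrow> real measure" where
  "exp_law l \<equiv> density lborel (exponential_density l)"

context lattice_walk
begin

text \<open>Short enough to be o(n), so that few pairs of windows overlap, and long enough that its
  logarithm is equivalent to \<open>ln n\<close>, so that forward counts cut off at the window keep
  their limit law.\<close>

definition window :: "nat \<Rightarrow> nat" where
  "window n = nat \<lfloor>real n / ln (real n)\<rfloor>"

lemma steps_indep:
  fixes f g :: "(int ^ 'd) list \<Rightarrow> real"
  assumes "k + m \<le> k'" and "\<And>xs. \<bar>f xs\<bar> \<le> B" "\<And>xs. \<bar>g xs\<bar> \<le> B"
  shows "expectation (\<lambda>\<omega>. f (steps X k m \<omega>) * g (steps X k' m' \<omega>))
    = expectation (\<lambda>\<omega>. f (steps X k m \<omega>)) * expectation (\<lambda>\<omega>. g (steps X k' m' \<omega>))"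
proof -
  define A where "A = {Suc k..<Suc k + m}"
  define A' where "A' = {Suc k'..<Suc k' + m'}"
  have ind: "indep_var (Pi\<^sub>M A (\<lambda>_. count_space UNIV)) (\<lambda>\<omega>. restrict (\<lambda>i. X i \<omega>) A)
      (Pi\<^sub>M A' (\<lambda>_. count_space UNIV)) (\<lambda>\<omega>. restrict (\<lambda>i. X i \<omega>) A')"
    using assms(1) by (intro indep_var_restrict[OF indep]) (auto simp: A_def A'_def)
  have meas: "(\<lambda>x. map x is :: (int ^ 'd) list) \<in> measurable (Pi\<^sub>M C (\<lambda>_. count_space UNIV)) (count_space UNIV)"
    if "set is \<subseteq> C" for C :: "nat set" and "is"
    using that
  proof (induction "is")
    case (Cons i "is")
    have "(\<lambda>x. (x i, map x is)) \<in> measurable (Pi\<^sub>M C (\<lambda>_. count_space UNIV)) (count_space UNIV \<Otimes>\<^sub>M (count_space UNIV :: (int ^ 'd) list measure))"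
      using Cons by (intro measurable_Pair measurable_component_singleton) auto
    hence "(\<lambda>x. (x i, map x is)) \<in> measurable (Pi\<^sub>M C (\<lambda>_. count_space UNIV)) (count_space (UNIV :: ((int ^ 'd) \<times> (int ^ 'd) list) set))"
      by (simp add: pair_measure_countable)
    from measurable_compose[OF this, of "\<lambda>(x, xs). x # xs" "count_space UNIV"] show ?case by simp
  qed simp
  have eqf: "f (steps X k m \<omega>) = ((\<lambda>x. f (map x [Suc k..<Suc k + m])) \<circ> (\<lambda>\<omega>. restrict (\<lambda>i. X i \<omega>) A)) \<omega>" for \<omega>
    unfolding comp_def steps_def A_def by (intro arg_cong[where f=f] map_cong refl) auto
  have eqg: "g (steps X k' m' \<omega>) = ((\<lambda>x. g (map x [Suc k'..<Suc k' + m'])) \<circ> (\<lambda>\<omega>. restrict (\<lambda>i. X i \<omega>) A')) \<omega>" for \<omega>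
    unfolding comp_def steps_def A'_def by (intro arg_cong[where f=g] map_cong refl) auto
  have "indep_var borel ((\<lambda>x. f (map x [Suc k..<Suc k + m])) \<circ> (\<lambda>\<omega>. restrict (\<lambda>i. X i \<omega>) A))
      borel ((\<lambda>x. g (map x [Suc k'..<Suc k' + m'])) \<circ> (\<lambda>\<omega>. restrict (\<lambda>i. X i \<omega>) A'))"
    by (rule indep_var_compose[OF ind]; rule measurable_compose[OF meas]; simp add: A_def A'_def del: upt_Suc)
  hence "indep_var borel (\<lambda>\<omega>. f (steps X k m \<omega>)) borel (\<lambda>\<omega>. g (steps X k' m' \<omega>))"
    unfolding eqf[THEN ext] eqg[THEN ext] .
  moreover have "integrable M (\<lambda>\<omega>. f (steps X k m \<omega>))" "integrable M (\<lambda>\<omega>. g (steps X k' m' \<omega>))"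
    by (rule integrable_bounded_count[OF steps_measurable assms(2)], rule integrable_bounded_count[OF steps_measurable assms(3)])
  ultimately show ?thesis by (rule indep_var_lebesgue_integral)
qed

lemma window_limits:
  "(\<lambda>n. real (window n) / real n) \<longlonglongrightarrow> 0"
  "(\<lambda>n. ln (real (window n)) / ln (real n)) \<longlonglongrightarrow> 1"
  "filterlim window at_top sequentially"
  "\<forall>\<^sub>F n in sequentially. window n \<le> n"
  unfolding window_def by real_asymp+

lemma fwd_law_limit:
  fixes f :: "real \<Rightarrow> real"
  assumes cont: "\<And>x. isCont f x" and bdd: "\<And>x. \<bar>f x\<bar> \<le> B"
  shows "(\<lambda>n. expectation (\<lambda>\<omega>. f (real (fwd X 0 (window n) \<omega>) / ln (real n)))) \<longlonglongrightarrow> (\<integral>x. f x \<partial>exp_law lam)"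
proof -
  interpret E: prob_space "exp_law lam" by (rule prob_space_exponential_density[OF lam])
  have Erd: "real_distribution (exp_law lam)"
    by (intro real_distribution.intro real_distribution_axioms.intro E.prob_space_axioms) auto
  define Y where "Y = (\<lambda>n \<omega>. real (fwd X 0 (window n) \<omega>) / ln (real n))"
  have Ym [measurable]: "Y n \<in> borel_measurable M" for n unfolding Y_def by measurable
  have cdfE: "cdf (exp_law lam) x = (if x \<ge> 0 then 1 - exp (- lam * x) else 0)" for x
  proof -
    have D: "distributed (exp_law lam) lborel (\<lambda>x. x) (exponential_density lam)"
      by (auto simp: distributed_def distr_id2)
    have le: "measure (exp_law lam) {..x} = 1 - exp (- lam * x)" if "x \<ge> 0" for x
      using E.exponential_distributedD_le[OF D that lam] by (simp add: mult.commute atMost_def)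
    show ?thesis
    proof (cases "x \<ge> 0")
      case False
      have "measure (exp_law lam) {..x} \<le> measure (exp_law lam) {..0}"
        using False by (intro E.finite_measure_mono) auto
      also have "\<dots> = 0" using le[of 0] by simp
      finally show ?thesis using False by (simp add: cdf_def measure_le_0_iff)
    qed (use le in \<open>simp add: cdf_def\<close>)
  qed
  have cdfY: "cdf (distr M borel (Y n)) x = (if x \<ge> 0 then 1 - vtail p (window n) 0 (Suc (nat \<lfloor>x * ln (real n)\<rfloor>)) else 0)" if n: "ln (real n) > 0" for n x
  proof -
    have "cdf (distr M borel (Y n)) x = prob {\<omega>\<in>space M. Y n \<omega> \<le> x}"
      by (simp add: cdf_def measure_distr) (intro arg_cong[where f=prob], auto)
    also have "\<dots> = (if x \<ge> 0 then 1 - vtail p (window n) 0 (Suc (nat \<lfloor>x * ln (real n)\<rfloor>)) else 0)"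
    proof (cases "x \<ge> 0")
      case True
      \<comment> \<open>For an integer count, being at most x ln n is the complement of reaching one
        more than the floor, which is the form of tail covered by
        \<open>vtail_asymp\<close>.\<close>
      have "{\<omega>\<in>space M. Y n \<omega> \<le> x} = space M - {\<omega>\<in>space M. Suc (nat \<lfloor>x * ln (real n)\<rfloor>) \<le> fwd X 0 (window n) \<omega>}"
      proof -
        have "Y n \<omega> \<le> x \<longleftrightarrow> \<not> Suc (nat \<lfloor>x * ln (real n)\<rfloor>) \<le> fwd X 0 (window n) \<omega>" for \<omega>
        proof -
          have "Y n \<omega> \<le> x \<longleftrightarrow> real (fwd X 0 (window n) \<omega>) \<le> x * ln (real n)"
            unfolding Y_def using n by (simp add: pos_divide_le_eq)
          also have "\<dots> \<longleftrightarrow> int (fwd X 0 (window n) \<omega>) \<le> \<lfloor>x * ln (real n)\<rfloor>" by (simp add: le_floor_iff)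
          also have "\<dots> \<longleftrightarrow> fwd X 0 (window n) \<omega> \<le> nat \<lfloor>x * ln (real n)\<rfloor>"
            using True n by (simp add: nat_le_iff le_nat_iff)
          finally show ?thesis by auto
        qed
        thus ?thesis by auto
      qed
      also have "prob \<dots> = 1 - vtail p (window n) 0 (Suc (nat \<lfloor>x * ln (real n)\<rfloor>))"
        by (subst prob_compl) (auto simp: prob_fwd)
      finally show ?thesis using True by simp
    next
      case False
      have "Y n \<omega> > x" for \<omega> using False n by (auto simp: Y_def intro: order.strict_trans2[of x 0])
      hence empty: "{\<omega>\<in>space M. Y n \<omega> \<le> x} = {}" by (auto simp: not_le)
      show ?thesis unfolding empty using False by simp
    qed
    finally show ?thesis .
  qed
  have lnpos: "\<forall>\<^sub>F n in sequentially. ln (real n) > 0" by real_asymp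
  have "weak_conv_m (\<lambda>n. distr M borel (Y n)) (exp_law lam)"
    unfolding weak_conv_m_def weak_conv_def
  proof (intro allI impI)
    fix x :: real
    consider "x < 0" | "x = 0" | "x > 0" by linarith
    thus "(\<lambda>n. cdf (distr M borel (Y n)) x) \<longlonglongrightarrow> cdf (exp_law lam) x"
    proof cases
      case 1
      show ?thesis by (rule Lim_transform_eventually[OF tendsto_const])
        (use lnpos in eventually_elim, use 1 in \<open>simp add: cdfY cdfE\<close>)
    next
      case 2
      show ?thesis by (rule Lim_transform_eventually[OF tendsto_const])
        (use lnpos in eventually_elim, use 2 in \<open>simp add: cdfY cdfE\<close>)
    next
      case 3
      have "(\<lambda>n. vtail p (window n) 0 (Suc (nat \<lfloor>x * ln (real n)\<rfloor>))) \<longlonglongrightarrow> exp (- lam * x)"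
      proof (rule vtail_asymp[OF lam escape_lim, where L="\<lambda>n. ln (real n)"])
        show "filterlim (\<lambda>n. window n div nat \<lfloor>x * ln (real n)\<rfloor>) at_top sequentially"
        proof -
          have "filterlim (\<lambda>n. nat \<lfloor>real (window n) / real (nat \<lfloor>x * ln (real n)\<rfloor>)\<rfloor>) at_top sequentially"
            unfolding window_def using 3 by real_asymp
          thus ?thesis by (simp add: floor_divide_of_nat_eq nat_int flip: of_nat_div)
        qed
        show "(\<lambda>n. ln (real (window n)) / ln (real n)) \<longlonglongrightarrow> 1" by (rule window_limits)
        show "(\<lambda>n. ln (real (window n div nat \<lfloor>x * ln (real n)\<rfloor>)) / ln (real n)) \<longlonglongrightarrow> 1"
        proof -
          have "(\<lambda>n. ln (real (nat \<lfloor>real (window n) / real (nat \<lfloor>x * ln (real n)\<rfloor>)\<rfloor>)) / ln (real n)) \<longlonglongrightarrow> 1"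
            unfolding window_def using 3 by real_asymp
          thus ?thesis by (simp add: floor_divide_of_nat_eq nat_int flip: of_nat_div)
        qed
        show "filterlim (\<lambda>n. ln (real n)) at_top sequentially" by real_asymp
        show "(\<lambda>n. real (nat \<lfloor>x * ln (real n)\<rfloor>) / ln (real n)) \<longlonglongrightarrow> x" using 3 by real_asymp
      qed
      hence "(\<lambda>n. 1 - vtail p (window n) 0 (Suc (nat \<lfloor>x * ln (real n)\<rfloor>))) \<longlonglongrightarrow> 1 - exp (- lam * x)"
        by (intro tendsto_intros)
      hence "(\<lambda>n. cdf (distr M borel (Y n)) x) \<longlonglongrightarrow> 1 - exp (- lam * x)"
        by (rule Lim_transform_eventually) (use lnpos in eventually_elim, use 3 in \<open>simp add: cdfY\<close>)
      thus ?thesis using 3 by (simp add: cdfE)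
    qed
  qed
  hence "(\<lambda>n. integral\<^sup>L (distr M borel (Y n)) f) \<longlonglongrightarrow> integral\<^sup>L (exp_law lam) f"
    using assms Erd by (intro weak_conv_imp_integral_bdd_continuous_conv[where B=B] real_distribution_distr) auto
  moreover have "integral\<^sup>L (distr M borel (Y n)) f = expectation (\<lambda>\<omega>. f (Y n \<omega>))" for n
    using cont by (intro integral_distr borel_measurable_continuous_onI continuous_at_imp_continuous_on) auto
  ultimately show ?thesis by (simp add: Y_def)
qed

text \<open>Three replacements, each controlled in mean: an increment of \<phi> by its derivative
  (Lipschitz), the full forward count by the count in a window (the gap has mean equal to a
  difference of Green functions with the same leading term), and the average over times by its
  expectation (second moments, disjoint windows being independent).\<close>

lemma functional_weak_law:
  fixes f \<phi> :: "real \<Rightarrow> real"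
  assumes bdd: "\<And>x. \<bar>f x\<bar> \<le> B" and lip: "\<And>x y. \<bar>f x - f y\<bar> \<le> K * \<bar>x - y\<bar>"
    and \<phi>0: "\<phi> 0 = 0" and der: "\<And>x. 0 \<le> x \<Longrightarrow> (\<phi> has_real_derivative f x) (at x)"
  shows "(\<lambda>n. expectation (\<lambda>\<omega>. \<bar>ln (real n) / real n * (\<Sum>y\<in>wrange X n \<omega>. \<phi> (real (ltime X n y \<omega>) / ln (real n))) - (\<integral>x. f x \<partial>exp_law lam)\<bar>)) \<longlonglongrightarrow> 0"
proof -
  define I where "I = (\<integral>x. f x \<partial>exp_law lam)"
  define \<tau> where "\<tau> = (\<lambda>n. expectation (\<lambda>\<omega>. f (real (fwd X 0 (window n) \<omega>) / ln (real n))))"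
  have B: "B \<ge> 0" using bdd[of 0] by linarith
  have K: "K \<ge> 0" using lip[of 0 1] by simp
  have cont: "isCont f x" for x
    unfolding continuous_at_eps_delta
  proof (intro allI impI)
    fix e :: real assume "e > 0"
    show "\<exists>d>0. \<forall>x'. dist x' x < d \<longrightarrow> dist (f x') (f x) < e"
    proof (intro exI[of _ "e / (K + 1)"] conjI allI impI)
      fix x' assume "dist x' x < e / (K + 1)"
      hence d: "(K + 1) * \<bar>x' - x\<bar> < e" using K by (simp add: dist_real_def field_simps)
      have "\<bar>f x' - f x\<bar> \<le> K * \<bar>x' - x\<bar>" by (rule lip)
      also have "\<dots> \<le> (K + 1) * \<bar>x' - x\<bar>" by (intro mult_right_mono) auto
      finally show "dist (f x') (f x) < e" using d by (simp add: dist_real_def)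
    qed (use \<open>e > 0\<close> K in simp)
  qed
  have \<tau>I: "\<tau> \<longlonglongrightarrow> I" unfolding \<tau>_def I_def by (rule fwd_law_limit[OF cont bdd])
  have G1: "(\<lambda>n. green p (window n) 0 / ln (real n)) \<longlonglongrightarrow> 1 / lam"
  proof -
    have "(\<lambda>n. green p (window n) 0 / ln (real (window n)) * (ln (real (window n)) / ln (real n))) \<longlonglongrightarrow> 1 / lam * 1"
      by (intro tendsto_mult window_limits filterlim_compose[OF green_asymp])
    hence "(\<lambda>n. green p (window n) 0 / ln (real (window n)) * (ln (real (window n)) / ln (real n))) \<longlonglongrightarrow> 1 / lam" by simp
    moreover have "\<forall>\<^sub>F n in sequentially. ln (real (window n)) > 0"
      by (rule eventually_compose_filterlim[OF _ window_limits(3)]) real_asymp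
    ultimately show ?thesis by (elim Lim_transform_eventually eventually_mono) simp
  qed
  \<comment> \<open>In order: the mean value step, truncation to a window, times too near n for a
    full window, fluctuation, and the bias of the mean.\<close>
  define bnd where "bnd = (\<lambda>n. K / ln (real n) + K * (green p n 0 / ln (real n) - green p (window n) 0 / ln (real n))
     + 2 * B * (real (window n) / real n) + sqrt (8 * B\<^sup>2 * (real (window n) / real n)) + \<bar>\<tau> n - I\<bar>)"
  have "(\<lambda>n. K / ln (real n)) \<longlonglongrightarrow> 0" by real_asymp
  moreover have "(\<lambda>n. K * (green p n 0 / ln (real n) - green p (window n) 0 / ln (real n))) \<longlonglongrightarrow> K * (1 / lam - 1 / lam)"
    by (intro tendsto_mult tendsto_const tendsto_diff[OF green_asymp G1])
  moreover have "(\<lambda>n. 2 * B * (real (window n) / real n)) \<longlonglongrightarrow> 2 * B * 0"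
    by (intro tendsto_mult tendsto_const window_limits)
  moreover have "(\<lambda>n. sqrt (8 * B\<^sup>2 * (real (window n) / real n))) \<longlonglongrightarrow> sqrt (8 * B\<^sup>2 * 0)"
    by (intro tendsto_real_sqrt tendsto_mult tendsto_const window_limits)
  moreover have "(\<lambda>n. \<bar>\<tau> n - I\<bar>) \<longlonglongrightarrow> \<bar>I - I\<bar>"
    by (intro tendsto_rabs tendsto_diff tendsto_const \<tau>I)
  ultimately have "bnd \<longlonglongrightarrow> 0 + K * (1 / lam - 1 / lam) + 2 * B * 0 + sqrt (8 * B\<^sup>2 * 0) + \<bar>I - I\<bar>"
    unfolding bnd_def by (intro tendsto_add)
  hence bnd0: "bnd \<longlonglongrightarrow> 0" by simp
  have lnpos: "\<forall>\<^sub>F n in sequentially. ln (real n) > 0" by real_asymp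
  show ?thesis
  proof (rule tendsto_sandwich[OF _ _ tendsto_const bnd0])
    show "\<forall>\<^sub>F n in sequentially. 0 \<le> expectation (\<lambda>\<omega>. \<bar>ln (real n) / real n * (\<Sum>y\<in>wrange X n \<omega>. \<phi> (real (ltime X n y \<omega>) / ln (real n))) - (\<integral>x. f x \<partial>exp_law lam)\<bar>)"
      by (intro always_eventually allI integral_nonneg_AE AE_I2) simp
    show "\<forall>\<^sub>F n in sequentially. expectation (\<lambda>\<omega>. \<bar>ln (real n) / real n * (\<Sum>y\<in>wrange X n \<omega>. \<phi> (real (ltime X n y \<omega>) / ln (real n))) - (\<integral>x. f x \<partial>exp_law lam)\<bar>) \<le> bnd n"
      using lnpos eventually_gt_at_top[of 0] window_limits(4)
    proof eventually_elim
      case (elim n)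
      define l where "l = ln (real n)"
      define m where "m = window n"
      have l: "l > 0" and n: "n > 0" and m: "m \<le> n" using elim by (auto simp: l_def m_def)
      define Lk where "Lk = (\<lambda>k \<omega>. real (fwd X k (n - 1 - k) \<omega>))"
      define g where "g = (\<lambda>k \<omega>. f (real (fwd X k m \<omega>) / l))"
      define W where "W = (\<lambda>\<omega>. l / real n * (\<Sum>y\<in>wrange X n \<omega>. \<phi> (real (ltime X n y \<omega>) / l)))"
      define T where "T = (\<lambda>\<omega>. (\<Sum>k<n. g k \<omega>) / real n)"
      have g_int [simp]: "integrable M (g k)" for k
        unfolding g_def by (rule integrable_fwd[of "\<lambda>L. f (real L / l)"])
      have gB: "\<bar>g k \<omega>\<bar> \<le> B" for k \<omega> by (simp add: g_def bdd)
      have g_mean: "expectation (g k) = \<tau> n" for k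
        unfolding g_def \<tau>_def l_def[symmetric] m_def[symmetric] by (rule expectation_fwd_cong[of "\<lambda>L. f (real L / l)"])
      have W_int: "integrable M W"
        unfolding W_def by (intro integrable_mult_right integrable_sum_ltime[of "\<lambda>j. \<phi> (real j / l)"])
      have T_int: "integrable M T" unfolding T_def by (intro integrable_divide Bochner_Integration.integrable_sum g_int)
      have W_eq: "W \<omega> = (\<Sum>k<n. l * (\<phi> (Lk k \<omega> / l) - \<phi> ((Lk k \<omega> - 1) / l))) / real n" for \<omega>
      proof -
        have "(\<Sum>y\<in>wrange X n \<omega>. \<phi> (real (ltime X n y \<omega>) / l))
           = (\<Sum>k<n. \<phi> (real (fwd X k (n - 1 - k) \<omega>) / l) - \<phi> (real (fwd X k (n - 1 - k) \<omega> - 1) / l))"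
          by (rule sum_ltime[of "\<lambda>j. \<phi> (real j / l)"]) (simp add: \<phi>0)
        also have "\<dots> = (\<Sum>k<n. \<phi> (Lk k \<omega> / l) - \<phi> ((Lk k \<omega> - 1) / l))"
          using fwd_ge_1[of X] by (intro sum.cong refl) (simp add: Lk_def of_nat_diff)
        finally have eq: "(\<Sum>y\<in>wrange X n \<omega>. \<phi> (real (ltime X n y \<omega>) / l)) = (\<Sum>k<n. \<phi> (Lk k \<omega> / l) - \<phi> ((Lk k \<omega> - 1) / l))" .
        show ?thesis unfolding W_def eq by (simp add: sum_distrib_left[symmetric])
      qed
      have mvt: "\<bar>l * (\<phi> (Lk k \<omega> / l) - \<phi> ((Lk k \<omega> - 1) / l)) - f (Lk k \<omega> / l)\<bar> \<le> K / l" for k \<omega>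
      proof -
        have L1: "Lk k \<omega> \<ge> 1" using fwd_ge_1[of X k "n - 1 - k" \<omega>] by (simp add: Lk_def)
        have lt: "(Lk k \<omega> - 1) / l < Lk k \<omega> / l" using l by (simp add: divide_strict_right_mono)
        have "\<exists>z. (Lk k \<omega> - 1) / l < z \<and> z < Lk k \<omega> / l \<and> \<phi> (Lk k \<omega> / l) - \<phi> ((Lk k \<omega> - 1) / l) = (Lk k \<omega> / l - (Lk k \<omega> - 1) / l) * f z"
        proof (rule MVT2[OF lt])
          fix x assume "(Lk k \<omega> - 1) / l \<le> x"
          moreover have "0 \<le> (Lk k \<omega> - 1) / l" using L1 l by simp
          ultimately show "(\<phi> has_real_derivative f x) (at x)" by (intro der) linarith
        qed
        then obtain z where z: "(Lk k \<omega> - 1) / l < z" "z < Lk k \<omega> / l" "\<phi> (Lk k \<omega> / l) - \<phi> ((Lk k \<omega> - 1) / l) = (Lk k \<omega> / l - (Lk k \<omega> - 1) / l) * f z"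
          by blast
        have "l * (\<phi> (Lk k \<omega> / l) - \<phi> ((Lk k \<omega> - 1) / l)) = f z"
          unfolding z(3) using l by (simp add: field_simps)
        hence "\<bar>l * (\<phi> (Lk k \<omega> / l) - \<phi> ((Lk k \<omega> - 1) / l)) - f (Lk k \<omega> / l)\<bar> \<le> K * \<bar>z - Lk k \<omega> / l\<bar>" using lip by simp
        also have "\<bar>z - Lk k \<omega> / l\<bar> \<le> 1 / l" using z(1,2) l by (simp add: diff_divide_distrib)
        finally show ?thesis using K by (simp add: mult_left_mono)
      qed
      \<comment> \<open>The last m times have no full window before n; only the trivial bound 2 B is
        used there, and they are a vanishing fraction of all times.\<close>
      have gap: "expectation (\<lambda>\<omega>. \<bar>f (Lk k \<omega> / l) - g k \<omega>\<bar>) \<le> K / l * (green p n 0 - green p m 0) + 2 * B * of_bool (n \<le> k + m)" if k: "k < n" for k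
      proof (cases "n \<le> k + m")
        case True
        have "expectation (\<lambda>\<omega>. \<bar>f (Lk k \<omega> / l) - g k \<omega>\<bar>) \<le> expectation (\<lambda>\<omega>. 2 * B)"
        proof (rule integral_mono)
          show "integrable M (\<lambda>\<omega>. \<bar>f (Lk k \<omega> / l) - g k \<omega>\<bar>)" unfolding Lk_def
            by (intro integrable_abs Bochner_Integration.integrable_diff g_int integrable_fwd[of "\<lambda>L. f (real L / l)"])
          show "\<bar>f (Lk k \<omega> / l) - g k \<omega>\<bar> \<le> 2 * B" for \<omega>
            using bdd[of "Lk k \<omega> / l"] gB[of k \<omega>] by linarith
        qed simp
        also have "\<dots> = 2 * B" by (simp add: prob_space)
        also have "\<dots> \<le> K / l * (green p n 0 - green p m 0) + 2 * B * of_bool (n \<le> k + m)"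
          using True K l green_mono[OF m, of p 0] by simp
        finally show ?thesis .
      next
        case False
        hence mle: "m \<le> n - 1 - k" using k by linarith
        have "expectation (\<lambda>\<omega>. \<bar>f (Lk k \<omega> / l) - g k \<omega>\<bar>) \<le> expectation (\<lambda>\<omega>. K / l * (real (fwd X k (n - 1 - k) \<omega>) - real (fwd X k m \<omega>)))"
        proof (rule integral_mono)
          show "integrable M (\<lambda>\<omega>. \<bar>f (Lk k \<omega> / l) - g k \<omega>\<bar>)" unfolding Lk_def
            by (intro integrable_abs Bochner_Integration.integrable_diff g_int integrable_fwd[of "\<lambda>L. f (real L / l)"])
          show "integrable M (\<lambda>\<omega>. K / l * (real (fwd X k (n - 1 - k) \<omega>) - real (fwd X k m \<omega>)))"
            by (intro integrable_mult_right Bochner_Integration.integrable_diff integrable_fwd)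
          fix \<omega>
          have "\<bar>f (Lk k \<omega> / l) - g k \<omega>\<bar> \<le> K * \<bar>Lk k \<omega> / l - real (fwd X k m \<omega>) / l\<bar>" unfolding g_def by (rule lip)
          also have "\<bar>Lk k \<omega> / l - real (fwd X k m \<omega>) / l\<bar> = (real (fwd X k (n - 1 - k) \<omega>) - real (fwd X k m \<omega>)) / l"
            using fwd_mono[OF mle, of X k \<omega>] l by (simp add: Lk_def diff_divide_distrib[symmetric])
          finally show "\<bar>f (Lk k \<omega> / l) - g k \<omega>\<bar> \<le> K / l * (real (fwd X k (n - 1 - k) \<omega>) - real (fwd X k m \<omega>))" by simp
        qed
        also have "\<dots> = K / l * (expectation (\<lambda>\<omega>. real (fwd X k (n - 1 - k) \<omega>)) - expectation (\<lambda>\<omega>. real (fwd X k m \<omega>)))"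
          by (subst integral_mult_right_zero, subst Bochner_Integration.integral_diff) (rule integrable_fwd, rule integrable_fwd, rule refl)
        also have "\<dots> = K / l * (green p (n - 1 - k) 0 - green p m 0)" by (simp only: expectation_fwd)
        also have "\<dots> \<le> K / l * (green p n 0 - green p m 0)"
          using K l green_mono[of "n - 1 - k" n p 0] by (intro mult_left_mono diff_right_mono) auto
        finally show ?thesis using False by simp
      qed
      have WT: "expectation (\<lambda>\<omega>. \<bar>W \<omega> - T \<omega>\<bar>) \<le> K / l + K / l * (green p n 0 - green p m 0) + 2 * B * (real m / real n)"
      proof -
        have "expectation (\<lambda>\<omega>. \<bar>W \<omega> - T \<omega>\<bar>) \<le> expectation (\<lambda>\<omega>. (\<Sum>k<n. K / l + \<bar>f (Lk k \<omega> / l) - g k \<omega>\<bar>) / real n)"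
        proof (rule integral_mono)
          show "integrable M (\<lambda>\<omega>. \<bar>W \<omega> - T \<omega>\<bar>)" by (intro integrable_abs Bochner_Integration.integrable_diff W_int T_int)
          show "integrable M (\<lambda>\<omega>. (\<Sum>k<n. K / l + \<bar>f (Lk k \<omega> / l) - g k \<omega>\<bar>) / real n)" unfolding Lk_def
            by (intro integrable_divide Bochner_Integration.integrable_sum Bochner_Integration.integrable_add integrable_const integrable_abs Bochner_Integration.integrable_diff g_int integrable_fwd[of "\<lambda>L. f (real L / l)"])
          fix \<omega>
          have "W \<omega> - T \<omega> = (\<Sum>k<n. l * (\<phi> (Lk k \<omega> / l) - \<phi> ((Lk k \<omega> - 1) / l)) - g k \<omega>) / real n"
            by (simp add: W_eq T_def sum_subtractf diff_divide_distrib)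
          hence "\<bar>W \<omega> - T \<omega>\<bar> = \<bar>\<Sum>k<n. l * (\<phi> (Lk k \<omega> / l) - \<phi> ((Lk k \<omega> - 1) / l)) - g k \<omega>\<bar> / real n" by simp
          also have "\<dots> \<le> (\<Sum>k<n. \<bar>l * (\<phi> (Lk k \<omega> / l) - \<phi> ((Lk k \<omega> - 1) / l)) - g k \<omega>\<bar>) / real n"
            by (intro divide_right_mono sum_abs) simp
          also have "\<dots> \<le> (\<Sum>k<n. K / l + \<bar>f (Lk k \<omega> / l) - g k \<omega>\<bar>) / real n"
          proof (intro divide_right_mono sum_mono)
            fix k
            show "\<bar>l * (\<phi> (Lk k \<omega> / l) - \<phi> ((Lk k \<omega> - 1) / l)) - g k \<omega>\<bar> \<le> K / l + \<bar>f (Lk k \<omega> / l) - g k \<omega>\<bar>"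
              using mvt[of k \<omega>] by linarith
          qed simp
          finally show "\<bar>W \<omega> - T \<omega>\<bar> \<le> (\<Sum>k<n. K / l + \<bar>f (Lk k \<omega> / l) - g k \<omega>\<bar>) / real n" .
        qed
        also have "\<dots> = (\<Sum>k<n. K / l + expectation (\<lambda>\<omega>. \<bar>f (Lk k \<omega> / l) - g k \<omega>\<bar>)) / real n"
        proof -
          have i: "integrable M (\<lambda>\<omega>. \<bar>f (Lk k \<omega> / l) - g k \<omega>\<bar>)" for k unfolding Lk_def
            by (intro integrable_abs Bochner_Integration.integrable_diff g_int integrable_fwd[of "\<lambda>L. f (real L / l)"])
          show ?thesis using i
            by (simp add: Bochner_Integration.integral_sum Bochner_Integration.integral_add prob_space)
        qed
        also have "\<dots> \<le> (\<Sum>k<n. K / l + (K / l * (green p n 0 - green p m 0) + 2 * B * of_bool (n \<le> k + m))) / real n"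
          by (intro divide_right_mono sum_mono add_left_mono gap) auto
        also have "\<dots> = K / l + K / l * (green p n 0 - green p m 0) + 2 * B * ((\<Sum>k<n. of_bool (n \<le> k + m)) / real n)"
          using n by (simp add: sum.distrib sum_distrib_left[symmetric] add_divide_distrib)
        also have "\<dots> \<le> K / l + K / l * (green p n 0 - green p m 0) + 2 * B * (real m / real n)"
        proof -
          have "(\<Sum>k<n. of_bool (n \<le> k + m)) = real (card {k\<in>{..<n}. n \<le> k + m})"
            by (simp add: sum.inter_filter[symmetric] of_bool_def)
          also have "card {k\<in>{..<n}. n \<le> k + m} \<le> card {n - m..<n}" by (intro card_mono) auto
          finally have "(\<Sum>k<n. of_bool (n \<le> k + m)) \<le> real m" using m by simp
          thus ?thesis using B by (intro add_left_mono mult_left_mono divide_right_mono) auto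
        qed
        finally show ?thesis .
      qed
      have T\<tau>: "expectation (\<lambda>\<omega>. \<bar>T \<omega> - \<tau> n\<bar>) \<le> sqrt (8 * B\<^sup>2 * (real m / real n))"
      proof -
        define h where "h = (\<lambda>k \<omega>. g k \<omega> - \<tau> n)"
        have \<tau>B: "\<bar>\<tau> n\<bar> \<le> B"
        proof -
          have "\<bar>\<tau> n\<bar> \<le> expectation (\<lambda>\<omega>. \<bar>g 0 \<omega>\<bar>)" unfolding g_mean[of 0, symmetric] by (rule integral_abs_bound)
          also have "\<dots> \<le> expectation (\<lambda>\<omega>. B)" by (intro integral_mono integrable_abs g_int gB) simp
          finally show ?thesis by (simp add: prob_space)
        qed
        have hB: "\<bar>h k \<omega>\<bar> \<le> 2 * B" for k \<omega> using gB[of k \<omega>] \<tau>B unfolding h_def by linarith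
        have h_int: "integrable M (h k)" for k unfolding h_def by simp
        have h_mean: "expectation (h k) = 0" for k unfolding h_def by (simp add: g_mean prob_space)
        \<comment> \<open>The clamp makes the bound required by \<open>steps_indep\<close> evident
          for all lists and, by \<open>hB\<close>, changes no value.\<close>
        have h_steps: "h k \<omega> = (\<lambda>xs. max (- 2 * B) (min (2 * B) (f (real (visits 0 xs) / l) - \<tau> n))) (steps X k m \<omega>)" for k \<omega>
          using hB[of k \<omega>] by (auto simp: h_def g_def fwd_def)
        have hh_int: "integrable M (\<lambda>\<omega>. h k \<omega> * h k' \<omega>)" for k k'
        proof (rule integrable_const_bound[where B="(2 * B) * (2 * B)"])
          show "AE \<omega> in M. norm (h k \<omega> * h k' \<omega>) \<le> 2 * B * (2 * B)"
            unfolding real_norm_def abs_mult by (rule AE_I2, rule mult_mono) (use hB B in auto)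
        qed (use h_int in measurable)
        have zero: "expectation (\<lambda>\<omega>. h k \<omega> * h k' \<omega>) = 0" if "k + m \<le> k'" for k k'
        proof -
          have "expectation (\<lambda>\<omega>. h k \<omega> * h k' \<omega>) = expectation (h k) * expectation (h k')"
            unfolding h_steps using B by (intro steps_indep[OF that, where B="2 * B"]) (auto simp: abs_le_iff)
          thus ?thesis by (simp add: h_mean)
        qed
        \<comment> \<open>Only pairs of times at distance less than m can be correlated; each time
          has at most 2 m such partners, which gives the factor m / n in the variance.\<close>
        have cov: "expectation (\<lambda>\<omega>. h k \<omega> * h k' \<omega>) \<le> 4 * B\<^sup>2 * of_bool (k' < k + m \<and> k < k' + m)" for k k'
        proof (cases "k' < k + m \<and> k < k' + m")
          case True
          have "expectation (\<lambda>\<omega>. h k \<omega> * h k' \<omega>) \<le> expectation (\<lambda>\<omega>. 4 * B\<^sup>2)"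
          proof (intro integral_mono hh_int)
            fix \<omega>
            have "h k \<omega> * h k' \<omega> \<le> \<bar>h k \<omega>\<bar> * \<bar>h k' \<omega>\<bar>" by (metis abs_ge_self abs_mult)
            also have "\<dots> \<le> (2 * B) * (2 * B)" using B by (intro mult_mono hB) auto
            finally show "h k \<omega> * h k' \<omega> \<le> 4 * B\<^sup>2" by (simp add: power2_eq_square)
          qed simp
          thus ?thesis using True by (simp add: prob_space)
        next
          case False
          hence "k + m \<le> k' \<or> k' + m \<le> k" by linarith
          thus ?thesis using zero[of k k'] zero[of k' k] by (auto simp: mult.commute)
        qed
        have Th: "T \<omega> - \<tau> n = (\<Sum>k<n. h k \<omega>) / real n" for \<omega>
          using n by (simp add: T_def h_def sum_subtractf diff_divide_distrib)
        have sq: "(T \<omega> - \<tau> n)\<^sup>2 = (\<Sum>k<n. \<Sum>k'<n. h k \<omega> * h k' \<omega>) / (real n)\<^sup>2" for \<omega>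
          unfolding Th by (simp add: power_divide power2_eq_square sum_product)
        have sq_int: "integrable M (\<lambda>\<omega>. (T \<omega> - \<tau> n)\<^sup>2)"
          unfolding sq by (intro integrable_divide Bochner_Integration.integrable_sum hh_int)
        have "expectation (\<lambda>\<omega>. (T \<omega> - \<tau> n)\<^sup>2) = (\<Sum>k<n. \<Sum>k'<n. expectation (\<lambda>\<omega>. h k \<omega> * h k' \<omega>)) / (real n)\<^sup>2"
          unfolding sq using hh_int by (simp add: Bochner_Integration.integral_sum)
        also have "\<dots> \<le> (\<Sum>k<n. \<Sum>k'<n. 4 * B\<^sup>2 * of_bool (k' < k + m \<and> k < k' + m)) / (real n)\<^sup>2"
          by (intro divide_right_mono sum_mono cov) simp
        also have "\<dots> \<le> (\<Sum>k<n. 4 * B\<^sup>2 * (2 * real m)) / (real n)\<^sup>2"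
        proof (intro divide_right_mono sum_mono)
          fix k
          have "(\<Sum>k'<n. of_bool (k' < k + m \<and> k < k' + m)) = real (card {k'\<in>{..<n}. k' < k + m \<and> k < k' + m})"
            by (simp add: sum.inter_filter[symmetric] of_bool_def)
          also have "card {k'\<in>{..<n}. k' < k + m \<and> k < k' + m} \<le> card {Suc k - m..<k + m}" by (intro card_mono) auto
          also have "card {Suc k - m..<k + m} \<le> 2 * m" by simp
          finally have "(\<Sum>k'<n. of_bool (k' < k + m \<and> k < k' + m)) \<le> 2 * real m" by simp
          thus "(\<Sum>k'<n. 4 * B\<^sup>2 * of_bool (k' < k + m \<and> k < k' + m)) \<le> 4 * B\<^sup>2 * (2 * real m)"
            unfolding sum_distrib_left[symmetric] by (intro mult_left_mono) auto
        qed simp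
        also have "\<dots> = 8 * B\<^sup>2 * (real m / real n)" using n by (simp add: power2_eq_square)
        finally have "sqrt (expectation (\<lambda>\<omega>. (T \<omega> - \<tau> n)\<^sup>2)) \<le> sqrt (8 * B\<^sup>2 * (real m / real n))" by simp
        moreover have "expectation (\<lambda>\<omega>. \<bar>T \<omega> - \<tau> n\<bar>) \<le> sqrt (expectation (\<lambda>\<omega>. (T \<omega> - \<tau> n)\<^sup>2))"
          using T_int by (intro expectation_abs_le_sqrt sq_int) auto
        ultimately show ?thesis by linarith
      qed
      have "expectation (\<lambda>\<omega>. \<bar>W \<omega> - I\<bar>) \<le> expectation (\<lambda>\<omega>. \<bar>W \<omega> - T \<omega>\<bar> + \<bar>T \<omega> - \<tau> n\<bar> + \<bar>\<tau> n - I\<bar>)"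
        using W_int T_int by (intro integral_mono) auto
      also have "\<dots> = expectation (\<lambda>\<omega>. \<bar>W \<omega> - T \<omega>\<bar>) + expectation (\<lambda>\<omega>. \<bar>T \<omega> - \<tau> n\<bar>) + \<bar>\<tau> n - I\<bar>"
        using W_int T_int by (simp add: prob_space)
      also have "\<dots> \<le> bnd n"
        using WT T\<tau> unfolding bnd_def l_def[symmetric] m_def[symmetric] by (simp add: right_diff_distrib)
      finally show ?case by (simp add: W_def I_def l_def)
    qed
  qed
qed

end

section \<open>Power sums of local times\<close>

lemma powr_lipschitz:
  fixes \<epsilon> :: real
  assumes "0 < \<epsilon>" "\<epsilon> \<le> s" "\<epsilon> \<le> t" "\<beta> \<le> 2"
  shows "\<bar>s powr (\<beta> - 1) - t powr (\<beta> - 1)\<bar> \<le> \<bar>\<beta> - 1\<bar> * \<epsilon> powr (\<beta> - 2) * \<bar>s - t\<bar>"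
proof -
  have "norm (t powr (\<beta> - 1) - s powr (\<beta> - 1)) \<le> \<bar>\<beta> - 1\<bar> * \<epsilon> powr (\<beta> - 2) * norm (t - s)"
  proof (rule field_differentiable_bound[where S="{\<epsilon>..}" and f'="\<lambda>x. (\<beta> - 1) * x powr (\<beta> - 2)"])
    fix z :: real assume z: "z \<in> {\<epsilon>..}"
    hence "((\<lambda>x. x powr (\<beta> - 1)) has_real_derivative (\<beta> - 1) * z powr (\<beta> - 1 - 1)) (at z)"
      using assms by (intro has_real_derivative_powr) auto
    thus "((\<lambda>x. x powr (\<beta> - 1)) has_real_derivative (\<beta> - 1) * z powr (\<beta> - 2)) (at z within {\<epsilon>..})"
      by (rule has_field_derivative_at_within[OF DERIV_cong]) simp
    have "z powr (\<beta> - 2) \<le> \<epsilon> powr (\<beta> - 2)" using z assms by (intro powr_mono2') auto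
    thus "norm ((\<beta> - 1) * z powr (\<beta> - 2)) \<le> \<bar>\<beta> - 1\<bar> * \<epsilon> powr (\<beta> - 2)"
      by (simp add: abs_mult mult_left_mono)
  qed (use assms in auto)
  thus ?thesis by (simp add: abs_minus_commute)
qed

lemma powr_add_le:
  fixes a b \<beta> :: real
  assumes "0 \<le> a" "0 \<le> b" "0 < \<beta>" "\<beta> \<le> 1"
  shows "(a + b) powr \<beta> \<le> a powr \<beta> + b powr \<beta>"
proof (cases "a = 0 \<or> b = 0")
  case False
  hence ab: "a > 0" "b > 0" using assms by auto
  have e: "x powr \<beta> = x * x powr (\<beta> - 1)" if "x > 0" for x :: real
    using that by (simp add: powr_diff)
  have "(a + b) powr \<beta> = a * (a + b) powr (\<beta> - 1) + b * (a + b) powr (\<beta> - 1)"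
    using ab by (subst e) (auto simp: distrib_right)
  also have "\<dots> \<le> a * a powr (\<beta> - 1) + b * b powr (\<beta> - 1)"
    using ab assms by (intro add_mono mult_left_mono powr_mono2') auto
  also have "\<dots> = a powr \<beta> + b powr \<beta>" using ab by (simp add: e)
  finally show ?thesis .
qed (use assms in auto)

lemma abs_powr_diff_le:
  fixes a b \<beta> :: real
  assumes "0 \<le> a" "0 \<le> b" "0 < \<beta>" "\<beta> \<le> 1"
  shows "\<bar>a powr \<beta> - b powr \<beta>\<bar> \<le> \<bar>a - b\<bar> powr \<beta>"
proof -
  have *: "\<bar>a powr \<beta> - b powr \<beta>\<bar> \<le> \<bar>a - b\<bar> powr \<beta>" if "b \<le> a" "0 \<le> b" for a b
  proof -
    have "b powr \<beta> \<le> a powr \<beta>" using that assms by (intro powr_mono2) auto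
    thus ?thesis using powr_add_le[of b "a - b" \<beta>] that assms by simp
  qed
  show ?thesis using *[of b a] *[of a b] assms by (cases "b \<le> a") (auto simp: abs_minus_commute)
qed

lemma abs_powr_diff_le_2:
  fixes a b \<beta> M :: real
  assumes "0 \<le> a" "0 \<le> b" "1 < \<beta>" "\<beta> \<le> 2" "a \<le> M" "b \<le> M" "1 \<le> M"
  shows "\<bar>a powr \<beta> - b powr \<beta>\<bar> \<le> 2 * M * \<bar>a - b\<bar>"
proof -
  have le: "z powr (\<beta> - 1) \<le> M" if "0 < z" "z \<le> M" for z
  proof -
    have "z powr (\<beta> - 1) \<le> M powr (\<beta> - 1)" using that assms by (intro powr_mono2) auto
    also have "\<dots> \<le> M powr 1" using assms by (intro powr_mono) auto
    finally show ?thesis using assms by simp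
  qed
  have *: "\<bar>a powr \<beta> - b powr \<beta>\<bar> \<le> 2 * M * \<bar>a - b\<bar>" if ab: "b < a" "0 \<le> b" "a \<le> M" for a b
  proof (cases "b = 0")
    case True
    have "a powr \<beta> = a * a powr (\<beta> - 1)" using ab by (simp add: powr_diff)
    also have "\<dots> \<le> a * (2 * M)" using ab le[of a] assms by (intro mult_left_mono) auto
    finally show ?thesis using True ab by (simp add: mult.commute)
  next
    case False
    have "\<exists>z. b < z \<and> z < a \<and> a powr \<beta> - b powr \<beta> = (a - b) * (\<beta> * z powr (\<beta> - 1))"
      using ab False by (intro MVT2 has_real_derivative_powr) auto
    then obtain z where z: "b < z" "z < a" "a powr \<beta> - b powr \<beta> = (a - b) * (\<beta> * z powr (\<beta> - 1))" by blast
    have "\<beta> * z powr (\<beta> - 1) \<le> 2 * M" using z ab assms le[of z] by (intro mult_mono) auto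
    hence "(a - b) * (\<beta> * z powr (\<beta> - 1)) \<le> (a - b) * (2 * M)" using ab by (intro mult_left_mono) auto
    moreover have "0 \<le> (a - b) * (\<beta> * z powr (\<beta> - 1))" using ab assms by simp
    ultimately show ?thesis unfolding z(3) using ab by (simp add: mult.commute)
  qed
  consider "b < a" | "a < b" | "a = b" by linarith
  thus ?thesis using *[of b a] *[of a b] assms by cases (auto simp: abs_minus_commute)
qed

text \<open>A saturating perturbation of \<open>x powr \<beta>\<close> whose derivative on \<open>[0, \<infinity>)\<close> is bounded and Lipschitz.\<close>

definition sat :: "real \<Rightarrow> real \<Rightarrow> real" where
  "sat \<epsilon> x = x / (1 + \<epsilon> * x) + \<epsilon>"

text \<open>The subtracted constant makes the function vanish at 0, as the passage from sites to
  times requires.\<close>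

definition sat_powr :: "real \<Rightarrow> real \<Rightarrow> real \<Rightarrow> real" where
  "sat_powr \<beta> \<epsilon> x = sat \<epsilon> x powr \<beta> - \<epsilon> powr \<beta>"

text \<open>The derivative of \<open>sat_powr\<close> on the half line, continued by a constant to
  negative arguments so that it is bounded and Lipschitz on the whole line.\<close>

definition sat_deriv :: "real \<Rightarrow> real \<Rightarrow> real \<Rightarrow> real" where
  "sat_deriv \<beta> \<epsilon> x = \<beta> * sat \<epsilon> (max 0 x) powr (\<beta> - 1) * (1 / (1 + \<epsilon> * max 0 x))\<^sup>2"

lemma one_plus_pos: "0 < (\<epsilon>::real) \<Longrightarrow> 0 \<le> x \<Longrightarrow> 0 < 1 + \<epsilon> * x"
  by (rule add_pos_nonneg) auto

lemma sat_bounds: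
  assumes "0 < \<epsilon>" "0 \<le> x"
  shows "\<epsilon> \<le> sat \<epsilon> x" "sat \<epsilon> x \<le> 1 / \<epsilon> + \<epsilon>" "sat \<epsilon> x \<le> x + \<epsilon>" "\<bar>x - sat \<epsilon> x\<bar> \<le> \<epsilon> * (1 + x\<^sup>2)"
proof -
  have pos: "1 + \<epsilon> * x > 0" using assms by (rule one_plus_pos)
  show "\<epsilon> \<le> sat \<epsilon> x" using assms by (simp add: sat_def)
  have "x / (1 + \<epsilon> * x) \<le> 1 / \<epsilon>" using assms pos by (simp add: field_simps)
  thus "sat \<epsilon> x \<le> 1 / \<epsilon> + \<epsilon>" by (simp add: sat_def)
  have "x / (1 + \<epsilon> * x) \<le> x / 1" using assms pos by (intro divide_left_mono) auto
  thus "sat \<epsilon> x \<le> x + \<epsilon>" by (simp add: sat_def)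
  have "x - x / (1 + \<epsilon> * x) = \<epsilon> * x\<^sup>2 / (1 + \<epsilon> * x)" using pos by (simp add: field_simps power2_eq_square)
  moreover have "\<epsilon> * x\<^sup>2 / (1 + \<epsilon> * x) \<le> \<epsilon> * x\<^sup>2 / 1" using assms pos by (intro divide_left_mono) auto
  moreover have "0 \<le> \<epsilon> * x\<^sup>2 / (1 + \<epsilon> * x)" using assms pos by simp
  moreover have "0 \<le> \<epsilon> * x\<^sup>2" using assms by simp
  ultimately show "\<bar>x - sat \<epsilon> x\<bar> \<le> \<epsilon> * (1 + x\<^sup>2)"
    using assms unfolding sat_def abs_le_iff distrib_left by linarith
qed

lemma sat_powr_0: "0 < \<epsilon> \<Longrightarrow> sat_powr \<beta> \<epsilon> 0 = 0"
  by (simp add: sat_powr_def sat_def)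

lemma sat_powr_deriv:
  assumes "0 < \<epsilon>" "0 \<le> x"
  shows "(sat_powr \<beta> \<epsilon> has_real_derivative sat_deriv \<beta> \<epsilon> x) (at x)"
proof -
  have pos: "1 + \<epsilon> * x > 0" using assms by (rule one_plus_pos)
  have spos: "sat \<epsilon> x > 0" using sat_bounds(1)[OF assms] assms by linarith
  have d: "(sat \<epsilon> has_real_derivative (1 / (1 + \<epsilon> * x))\<^sup>2) (at x)"
  proof -
    have "((\<lambda>x. x / (1 + \<epsilon> * x) + \<epsilon>) has_real_derivative (1 * (1 + \<epsilon> * x) - x * \<epsilon>) / ((1 + \<epsilon> * x) * (1 + \<epsilon> * x))) (at x)"
      using pos by (auto intro!: derivative_eq_intros)
    also have "(1 * (1 + \<epsilon> * x) - x * \<epsilon>) / ((1 + \<epsilon> * x) * (1 + \<epsilon> * x)) = (1 / (1 + \<epsilon> * x))\<^sup>2"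
      by (simp add: power2_eq_square mult.commute)
    finally show ?thesis by (simp add: sat_def[abs_def])
  qed
  have "((\<lambda>x. sat \<epsilon> x powr \<beta>) has_real_derivative (\<beta> * sat \<epsilon> x powr (\<beta> - 1)) * (1 / (1 + \<epsilon> * x))\<^sup>2) (at x)"
    by (rule DERIV_chain2[OF has_real_derivative_powr[OF spos] d])
  from DERIV_diff[OF this DERIV_const[of "\<epsilon> powr \<beta>"]] show ?thesis
    using assms by (simp add: sat_powr_def[abs_def] sat_deriv_def)
qed

text \<open>On the half line \<open>sat\<close> has values in
  [\<epsilon>, 1 / \<epsilon> + \<epsilon>], away from 0 and from infinity, where the power \<beta>
  - 1 is bounded and Lipschitz whatever its sign.\<close>

lemma sat_deriv_bounded_lipschitz:
  assumes \<epsilon>: "0 < \<epsilon>" and \<beta>: "0 < \<beta>" "\<beta> \<le> 2"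
  obtains B K where "\<And>x. \<bar>sat_deriv \<beta> \<epsilon> x\<bar> \<le> B" "\<And>x y. \<bar>sat_deriv \<beta> \<epsilon> x - sat_deriv \<beta> \<epsilon> y\<bar> \<le> K * \<bar>x - y\<bar>"
proof -
  define A where "A = (\<lambda>x. sat \<epsilon> x powr (\<beta> - 1))"
  define u where "u = (\<lambda>x. 1 / (1 + \<epsilon> * x))"
  define a where "a = \<epsilon> powr (\<beta> - 1) + (1 / \<epsilon> + \<epsilon>) powr (\<beta> - 1)"
  define L where "L = \<bar>\<beta> - 1\<bar> * \<epsilon> powr (\<beta> - 2)"
  have u: "0 < u x" "u x \<le> 1" if "0 \<le> x" for x using that \<epsilon> one_plus_pos[OF \<epsilon> that] by (auto simp: u_def)
  have A: "0 \<le> A x" "A x \<le> a" if "0 \<le> x" for x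
  proof -
    show "0 \<le> A x" by (simp add: A_def)
    show "A x \<le> a"
    proof (cases "\<beta> \<ge> 1")
      case True
      have "A x \<le> (1 / \<epsilon> + \<epsilon>) powr (\<beta> - 1)" unfolding A_def
        using True sat_bounds[OF \<epsilon> that] \<epsilon> by (intro powr_mono2) auto
      thus ?thesis by (simp add: a_def add_increasing)
    next
      case False
      have "A x \<le> \<epsilon> powr (\<beta> - 1)" unfolding A_def
        using False sat_bounds[OF \<epsilon> that] \<epsilon> by (intro powr_mono2') auto
      thus ?thesis by (simp add: a_def add_increasing2)
    qed
  qed
  have du: "\<bar>u x - u y\<bar> \<le> \<epsilon> * \<bar>x - y\<bar>" if "0 \<le> x" "0 \<le> y" for x y
  proof -
    have p: "1 + \<epsilon> * x \<ge> 1" "1 + \<epsilon> * y \<ge> 1" using that \<epsilon> by auto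
    have "u x - u y = \<epsilon> * (y - x) * (u x * u y)" using p by (simp add: u_def divide_simps) (simp add: algebra_simps)
    hence "\<bar>u x - u y\<bar> = \<epsilon> * \<bar>x - y\<bar> * (u x * u y)" using u[OF that(1)] u[OF that(2)] \<epsilon> by (simp add: abs_mult abs_minus_commute)
    also have "\<dots> \<le> \<epsilon> * \<bar>x - y\<bar> * (1 * 1)" using u[OF that(1)] u[OF that(2)] \<epsilon> by (intro mult_left_mono mult_mono) auto
    finally show ?thesis by simp
  qed
  have ds: "\<bar>sat \<epsilon> x - sat \<epsilon> y\<bar> \<le> \<bar>x - y\<bar>" if "0 \<le> x" "0 \<le> y" for x y
  proof -
    have p: "1 + \<epsilon> * x \<ge> 1" "1 + \<epsilon> * y \<ge> 1" using that \<epsilon> by auto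
    have "sat \<epsilon> x - sat \<epsilon> y = (x - y) * (u x * u y)" using p by (simp add: sat_def u_def divide_simps) (simp add: algebra_simps)
    hence "\<bar>sat \<epsilon> x - sat \<epsilon> y\<bar> = \<bar>x - y\<bar> * (u x * u y)" using u[OF that(1)] u[OF that(2)] by (simp add: abs_mult)
    also have "\<dots> \<le> \<bar>x - y\<bar> * (1 * 1)" using u[OF that(1)] u[OF that(2)] by (intro mult_left_mono mult_mono) auto
    finally show ?thesis by simp
  qed
  have L: "L \<ge> 0" by (simp add: L_def)
  have a: "a \<ge> 0" by (simp add: a_def)
  have dA: "\<bar>A x - A y\<bar> \<le> L * \<bar>x - y\<bar>" if "0 \<le> x" "0 \<le> y" for x y
  proof -
    have "\<bar>A x - A y\<bar> \<le> L * \<bar>sat \<epsilon> x - sat \<epsilon> y\<bar>" unfolding A_def L_def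
      using sat_bounds(1)[OF \<epsilon> that(1)] sat_bounds(1)[OF \<epsilon> that(2)] \<epsilon> \<beta> by (intro powr_lipschitz)
    also have "\<dots> \<le> L * \<bar>x - y\<bar>" using L ds[OF that] by (intro mult_left_mono)
    finally show ?thesis .
  qed
  have f: "sat_deriv \<beta> \<epsilon> x = \<beta> * (A (max 0 x) * (u (max 0 x))\<^sup>2)" for x
    by (simp add: sat_deriv_def A_def u_def)
  show ?thesis
  proof (rule that[of "\<beta> * (a * 1)" "\<beta> * (L + a * (2 * \<epsilon>))"])
    fix x y :: real
    have m: "0 \<le> max 0 x" "0 \<le> max 0 y" by auto
    have usq: "(u z)\<^sup>2 \<le> 1" if "0 \<le> z" for z using u[OF that] by (simp add: power_le_one)
    have "A (max 0 x) * (u (max 0 x))\<^sup>2 \<le> a * 1" using A[OF m(1)] usq[OF m(1)] a by (intro mult_mono) auto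
    thus "\<bar>sat_deriv \<beta> \<epsilon> x\<bar> \<le> \<beta> * (a * 1)"
      unfolding f using \<beta> A[OF m(1)] by (simp add: abs_mult mult_left_mono)
    have "A (max 0 x) * (u (max 0 x))\<^sup>2 - A (max 0 y) * (u (max 0 y))\<^sup>2
      = (A (max 0 x) - A (max 0 y)) * (u (max 0 x))\<^sup>2 + A (max 0 y) * ((u (max 0 x) - u (max 0 y)) * (u (max 0 x) + u (max 0 y)))"
      by (simp add: algebra_simps power2_eq_square)
    also have "\<bar>\<dots>\<bar> \<le> \<bar>A (max 0 x) - A (max 0 y)\<bar> * (u (max 0 x))\<^sup>2 + A (max 0 y) * (\<bar>u (max 0 x) - u (max 0 y)\<bar> * (u (max 0 x) + u (max 0 y)))"
      using u[OF m(1)] u[OF m(2)] A[OF m(2)] by (intro order.trans[OF abs_triangle_ineq]) (simp add: abs_mult)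
    also have "\<dots> \<le> (L * \<bar>max 0 x - max 0 y\<bar>) * 1 + a * ((\<epsilon> * \<bar>max 0 x - max 0 y\<bar>) * 2)"
    proof (rule add_mono)
      show "\<bar>A (max 0 x) - A (max 0 y)\<bar> * (u (max 0 x))\<^sup>2 \<le> (L * \<bar>max 0 x - max 0 y\<bar>) * 1"
        using L by (intro mult_mono dA[OF m] usq[OF m(1)] mult_nonneg_nonneg) auto
      have "u (max 0 x) + u (max 0 y) \<le> 2" "0 \<le> u (max 0 x) + u (max 0 y)" using u[OF m(1)] u[OF m(2)] by linarith+
      hence "\<bar>u (max 0 x) - u (max 0 y)\<bar> * (u (max 0 x) + u (max 0 y)) \<le> (\<epsilon> * \<bar>max 0 x - max 0 y\<bar>) * 2"
        using \<epsilon> by (intro mult_mono du[OF m] mult_nonneg_nonneg) auto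
      moreover have "0 \<le> \<bar>u (max 0 x) - u (max 0 y)\<bar> * (u (max 0 x) + u (max 0 y))"
        using u[OF m(1)] u[OF m(2)] by (intro mult_nonneg_nonneg) auto
      ultimately show "A (max 0 y) * (\<bar>u (max 0 x) - u (max 0 y)\<bar> * (u (max 0 x) + u (max 0 y))) \<le> a * ((\<epsilon> * \<bar>max 0 x - max 0 y\<bar>) * 2)"
        by (rule mult_mono[OF A(2)[OF m(2)] _ a])
    qed
    also have "\<dots> = (L + a * (2 * \<epsilon>)) * \<bar>max 0 x - max 0 y\<bar>" by (simp add: algebra_simps)
    also have "\<dots> \<le> (L + a * (2 * \<epsilon>)) * \<bar>x - y\<bar>" using L a \<epsilon> by (intro mult_left_mono) auto
    finally have "\<beta> * \<bar>A (max 0 x) * (u (max 0 x))\<^sup>2 - A (max 0 y) * (u (max 0 y))\<^sup>2\<bar> \<le> \<beta> * ((L + a * (2 * \<epsilon>)) * \<bar>x - y\<bar>)"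
      using \<beta> by (intro mult_left_mono) auto
    thus "\<bar>sat_deriv \<beta> \<epsilon> x - sat_deriv \<beta> \<epsilon> y\<bar> \<le> \<beta> * (L + a * (2 * \<epsilon>)) * \<bar>x - y\<bar>"
      unfolding f right_diff_distrib[symmetric] abs_mult using \<beta> by (simp add: mult.assoc)
  qed
qed

text \<open>The error of \<open>sat\<close> is at most \<epsilon> (1 + x^2), and for \<beta> > 1 the
  power costs a further linear factor. Hence a cubic weight, whose sums over the visited sites are
  under control, with a coefficient that vanishes with \<epsilon>.\<close>

lemma sat_powr_error:
  assumes \<epsilon>: "0 < \<epsilon>" "\<epsilon> \<le> 1" and \<beta>: "0 < \<beta>" "\<beta> \<le> 2" and x: "0 \<le> x"
  shows "\<bar>x powr \<beta> - sat_powr \<beta> \<epsilon> x\<bar> \<le> (4 * \<epsilon> + 2 * \<epsilon> powr \<beta>) * (1 + x) ^ 3"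
proof -
  note b = sat_bounds[OF \<epsilon>(1) x]
  have s0: "0 \<le> sat \<epsilon> x" using b(1) \<epsilon> by linarith
  have c1: "1 \<le> (1 + x) ^ 3" using x by (intro one_le_power) auto
  have c2: "1 + x\<^sup>2 \<le> (1 + x) ^ 3" using x by (simp add: eval_nat_numeral algebra_simps)
  have main: "\<bar>x powr \<beta> - sat \<epsilon> x powr \<beta>\<bar> \<le> (4 * \<epsilon> + \<epsilon> powr \<beta>) * (1 + x) ^ 3"
  proof (cases "\<beta> \<le> 1")
    case True
    have "\<bar>x powr \<beta> - sat \<epsilon> x powr \<beta>\<bar> \<le> \<bar>x - sat \<epsilon> x\<bar> powr \<beta>"
      using x s0 \<beta> True by (intro abs_powr_diff_le)
    also have "\<dots> \<le> (\<epsilon> * (1 + x\<^sup>2)) powr \<beta>" using b(4) \<beta> by (intro powr_mono2) auto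
    also have "\<dots> = \<epsilon> powr \<beta> * (1 + x\<^sup>2) powr \<beta>" using \<epsilon> by (simp add: powr_mult)
    also have "\<dots> \<le> \<epsilon> powr \<beta> * (1 + x\<^sup>2) powr 1" using True by (intro mult_left_mono powr_mono) auto
    also have "\<dots> \<le> \<epsilon> powr \<beta> * (1 + x) ^ 3" using c2 by (intro mult_left_mono) (auto simp: add_nonneg_nonneg)
    also have "\<dots> \<le> (4 * \<epsilon> + \<epsilon> powr \<beta>) * (1 + x) ^ 3" using \<epsilon> x by (intro mult_right_mono) auto
    finally show ?thesis .
  next
    case False
    have "\<bar>x powr \<beta> - sat \<epsilon> x powr \<beta>\<bar> \<le> 2 * (x + 1) * \<bar>x - sat \<epsilon> x\<bar>"
      using x s0 b(3) \<beta> \<epsilon> False by (intro abs_powr_diff_le_2) auto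
    also have "\<dots> \<le> 2 * (x + 1) * (\<epsilon> * (1 + x\<^sup>2))" using b(4) x by (intro mult_left_mono) auto
    also have "\<dots> = 2 * \<epsilon> * ((1 + x) * (1 + x\<^sup>2))" by (simp add: algebra_simps)
    also have "\<dots> \<le> 2 * \<epsilon> * (1 + x) ^ 3"
    proof -
      have "(1 + x) * (1 + x\<^sup>2) \<le> (1 + x) * (1 + x)\<^sup>2" using x by (intro mult_left_mono) (auto simp: power2_sum)
      thus ?thesis using \<epsilon> by (intro mult_left_mono) (auto simp: eval_nat_numeral)
    qed
    also have "\<dots> \<le> (4 * \<epsilon> + \<epsilon> powr \<beta>) * (1 + x) ^ 3" using \<epsilon> x by (intro mult_right_mono) auto
    finally show ?thesis .
  qed
  have "\<bar>x powr \<beta> - sat_powr \<beta> \<epsilon> x\<bar> \<le> \<bar>x powr \<beta> - sat \<epsilon> x powr \<beta>\<bar> + \<epsilon> powr \<beta>"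
    unfolding sat_powr_def using powr_ge_zero[of \<epsilon> \<beta>] by linarith
  also have "\<dots> \<le> (4 * \<epsilon> + \<epsilon> powr \<beta>) * (1 + x) ^ 3 + \<epsilon> powr \<beta> * (1 + x) ^ 3"
    using main mult_left_mono[OF c1, of "\<epsilon> powr \<beta>"] by simp
  also have "\<dots> = (4 * \<epsilon> + 2 * \<epsilon> powr \<beta>) * (1 + x) ^ 3" by (simp add: algebra_simps)
  finally show ?thesis .
qed

section \<open>Gamma integrals\<close>

lemma has_bochner_integral_Gamma:
  assumes s: "0 < s" and l: "0 < (l::real)"
  shows "has_bochner_integral lborel (\<lambda>x. indicator {0..} x * (x powr (s - 1) * exp (- l * x))) (Gamma s / l powr s)"
proof -
  define G where "G = (\<lambda>t::real. indicator {0..} t * t powr (s - 1) / exp t)"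
  have "(\<integral>\<^sup>+t. ennreal (G t) \<partial>lborel) = ennreal (Gamma s)"
    using Gamma_conv_nn_integral_real[OF s] by (simp add: G_def)
  hence "has_bochner_integral lborel G (Gamma s)"
    using Gamma_real_pos[OF s] by (intro has_bochner_integral_nn_integral) (auto simp: G_def)
  hence G: "integrable lborel G" "integral\<^sup>L lborel G = Gamma s"
    by (auto simp: has_bochner_integral_iff)
  have eq: "G (0 + l * x) = l powr (s - 1) * (indicator {0..} x * (x powr (s - 1) * exp (- l * x)))" for x
    using l by (auto simp: G_def indicator_def powr_mult exp_minus field_simps zero_le_mult_iff)
  have i: "integrable lborel (\<lambda>x. l powr (s - 1) * (indicator {0..} x * (x powr (s - 1) * exp (- l * x))))"
    using lborel_integrable_real_affine[OF G(1), of l 0] l unfolding eq by simp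
  have "Gamma s = l * (l powr (s - 1) * (\<integral>x. indicator {0..} x * (x powr (s - 1) * exp (- l * x)) \<partial>lborel))"
    using lborel_integral_real_affine[of l G 0] l G(2) unfolding eq by simp
  moreover have "l * l powr (s - 1) = l powr s" using l by (simp add: powr_diff)
  ultimately have "Gamma s = l powr s * (\<integral>x. indicator {0..} x * (x powr (s - 1) * exp (- l * x)) \<partial>lborel)"
    by (simp add: mult.assoc[symmetric])
  moreover have "integrable lborel (\<lambda>x. indicator {0..} x * (x powr (s - 1) * exp (- l * x)))"
    using i l by (simp only: integrable_mult_left_iff) auto
  ultimately show ?thesis using l by (simp add: has_bochner_integral_iff field_simps)
qed

text \<open>In the limit the integrand is \<beta> x^(\<beta> - 1) against an exponential law of rate
  l, with integral \<beta> Gamma(\<beta>) / l^(\<beta> - 1). This is where the Gamma factor of the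
  theorem originates.\<close>

lemma sat_deriv_integral_limit:
  assumes \<beta>: "0 < \<beta>" "\<beta> \<le> 2" and l: "0 < l"
  shows "(\<lambda>j. \<integral>x. sat_deriv \<beta> (1 / real (Suc j)) x \<partial>exp_law l) \<longlonglongrightarrow> Gamma (\<beta> + 1) / l powr (\<beta> - 1)"
proof -
  define \<epsilon> where "\<epsilon> = (\<lambda>j. 1 / real (Suc j))"
  have \<epsilon>: "0 < \<epsilon> j" "\<epsilon> j \<le> 1" for j by (auto simp: \<epsilon>_def)
  have \<epsilon>0: "\<epsilon> \<longlonglongrightarrow> 0" unfolding \<epsilon>_def by (rule LIMSEQ_Suc[OF lim_1_over_n])
  have \<epsilon>pos: "1 + \<epsilon> j * x > 0" if "0 \<le> x" for x j by (rule one_plus_pos[OF \<epsilon>(1) that])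
  define w where "w = (\<lambda>x. indicator {0..} x * (x powr (\<beta> - 1) * exp (- l * x)) + (indicator {0..} x * (x powr (1 - 1) * exp (- l * x)) + indicator {0..} x * (x powr (2 - 1) * exp (- l * x))))"
  have w: "integrable lborel w"
    unfolding w_def
    by (intro Bochner_Integration.integrable_add has_bochner_integral_Gamma[OF _ l, THEN integrable.intros] \<beta>) simp_all
  have meas [measurable]: "sat_deriv \<beta> e \<in> borel_measurable borel" for e
    unfolding sat_deriv_def[abs_def] sat_def by measurable
  have bound: "sat_deriv \<beta> (\<epsilon> j) x * exp (- l * x) \<le> 2 * w x" if x: "x > 0" for j x
  proof -
    have sb: "\<epsilon> j \<le> sat (\<epsilon> j) x" "sat (\<epsilon> j) x \<le> x + \<epsilon> j" using sat_bounds[OF \<epsilon>(1)] x by auto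
    have "sat (\<epsilon> j) x powr (\<beta> - 1) * (1 / (1 + \<epsilon> j * x))\<^sup>2 \<le> x powr (\<beta> - 1) + (1 + x)"
    proof (cases "\<beta> \<ge> 1")
      case True
      have "sat (\<epsilon> j) x powr (\<beta> - 1) \<le> (x + 1) powr (\<beta> - 1)"
        using True sb \<epsilon>[of j] by (intro powr_mono2) auto
      also have "\<dots> \<le> (x + 1) powr 1" using x \<beta> by (intro powr_mono) auto
      finally have "sat (\<epsilon> j) x powr (\<beta> - 1) * (1 / (1 + \<epsilon> j * x))\<^sup>2 \<le> (1 + x) * 1"
        using x \<epsilon>pos[of x j] \<epsilon>[of j] by (intro mult_mono) (auto simp: power_le_one)
      thus ?thesis by (simp add: add_increasing)
    next
      case False
      \<comment> \<open>For \<beta> < 1 the inequality sat \<ge> x z turns the negative power into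
        x^(\<beta> - 1) z^(\<beta> - 1). The factor z^2 of the derivative absorbs z^(\<beta> - 1),
        and the remaining singularity at 0 is integrable.\<close>
      define z where "z = 1 / (1 + \<epsilon> j * x)"
      have z: "0 < z" "z \<le> 1" using x \<epsilon>pos[of x j] \<epsilon>[of j] by (auto simp: z_def)
      have "sat (\<epsilon> j) x powr (\<beta> - 1) \<le> (x * z) powr (\<beta> - 1)"
        using False x z \<epsilon>[of j] by (intro powr_mono2') (auto simp: sat_def z_def)
      also have "\<dots> = x powr (\<beta> - 1) * z powr (\<beta> - 1)" using x z by (simp add: powr_mult)
      finally have "sat (\<epsilon> j) x powr (\<beta> - 1) * z\<^sup>2 \<le> x powr (\<beta> - 1) * z powr (\<beta> - 1) * z\<^sup>2"
        by (intro mult_right_mono) auto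
      also have "\<dots> = x powr (\<beta> - 1) * z powr (\<beta> + 1)"
      proof -
        have "z powr (\<beta> - 1) * z\<^sup>2 = z powr (\<beta> - 1) * z powr 2" using z by (simp add: powr_numeral)
        also have "\<dots> = z powr ((\<beta> - 1) + 2)" by (rule powr_add[symmetric])
        also have "(\<beta> - 1) + 2 = \<beta> + 1" by simp
        finally show ?thesis by (simp add: mult.assoc)
      qed
      also have "\<dots> \<le> x powr (\<beta> - 1) * 1" using z \<beta> by (intro mult_left_mono powr_le1) auto
      finally show ?thesis using x by (simp add: z_def add_increasing2)
    qed
    hence "\<beta> * (sat (\<epsilon> j) x powr (\<beta> - 1) * (1 / (1 + \<epsilon> j * x))\<^sup>2) * exp (- l * x) \<le> 2 * (x powr (\<beta> - 1) + (1 + x)) * exp (- l * x)"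
      using \<beta> x by (intro mult_right_mono mult_mono) auto
    also have "\<dots> = 2 * w x" using x by (simp add: w_def algebra_simps)
    finally show ?thesis using x by (simp add: sat_deriv_def mult.assoc)
  qed
  have nonneg: "0 \<le> sat_deriv \<beta> (\<epsilon> j) x" for j x using \<beta> by (simp add: sat_deriv_def)
  have "(\<lambda>j. \<integral>x. exponential_density l x * sat_deriv \<beta> (\<epsilon> j) x \<partial>lborel) \<longlonglongrightarrow> (\<integral>x. l * \<beta> * (indicator {0..} x * (x powr (\<beta> - 1) * exp (- l * x))) \<partial>lborel)"
  proof (rule integral_dominated_convergence[where w="\<lambda>x. 2 * l * w x"])
    have nz: "AE x in lborel. x \<noteq> (0::real)" by (rule AE_lborel_singleton)
    show "AE x in lborel. (\<lambda>j. exponential_density l x * sat_deriv \<beta> (\<epsilon> j) x) \<longlonglongrightarrow> l * \<beta> * (indicator {0..} x * (x powr (\<beta> - 1) * exp (- l * x)))"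
      using nz
    proof eventually_elim
      case (elim x)
      show ?case
      proof (cases "x > 0")
        case True
        have "(\<lambda>j. l * exp (- x * l) * (\<beta> * (x / (1 + \<epsilon> j * x) + \<epsilon> j) powr (\<beta> - 1) * (1 / (1 + \<epsilon> j * x))\<^sup>2)) \<longlonglongrightarrow> l * exp (- x * l) * (\<beta> * (x / (1 + 0 * x) + 0) powr (\<beta> - 1) * (1 / (1 + 0 * x))\<^sup>2)"
          using True by (intro tendsto_intros \<epsilon>0) auto
        thus ?thesis using True by (simp add: exponential_density_def erlang_density_def sat_deriv_def sat_def mult_ac)
      next
        case False
        thus ?thesis using elim by (simp add: exponential_density_def)
      qed
    qed
    show "AE x in lborel. norm (exponential_density l x * sat_deriv \<beta> (\<epsilon> j) x) \<le> 2 * l * w x" for j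
      using nz
    proof eventually_elim
      case (elim x)
      show ?case
      proof (cases "x > 0")
        case True
        have "l * (sat_deriv \<beta> (\<epsilon> j) x * exp (- l * x)) \<le> l * (2 * w x)"
          using bound[OF True] l by (intro mult_left_mono) auto
        thus ?thesis using True l nonneg[of j x] by (simp add: exponential_density_def abs_mult mult_ac)
      next
        case False
        thus ?thesis using elim by (simp add: exponential_density_def w_def)
      qed
    qed
  qed (use w in auto)
  also have "(\<integral>x. l * \<beta> * (indicator {0..} x * (x powr (\<beta> - 1) * exp (- l * x))) \<partial>lborel) = l * \<beta> * (Gamma \<beta> / l powr \<beta>)"
    using has_bochner_integral_Gamma[OF \<beta>(1) l] by (subst integral_mult_right_zero) (simp add: has_bochner_integral_iff)
  also have "\<dots> = Gamma (\<beta> + 1) / l powr (\<beta> - 1)"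
    using Gamma_plus1[of \<beta>] \<beta> l by (simp add: powr_diff nonpos_Ints_def)
  finally have "(\<lambda>j. \<integral>x. exponential_density l x * sat_deriv \<beta> (\<epsilon> j) x \<partial>lborel) \<longlonglongrightarrow> Gamma (\<beta> + 1) / l powr (\<beta> - 1)" .
  moreover have "(\<integral>x. sat_deriv \<beta> (\<epsilon> j) x \<partial>exp_law l) = (\<integral>x. exponential_density l x * sat_deriv \<beta> (\<epsilon> j) x \<partial>lborel)" for j
    using l by (subst integral_density) (auto simp: exponential_density_nonneg)
  ultimately show ?thesis by (simp add: \<epsilon>_def)
qed

context lattice_walk
begin

lemma escape_ge_ev: "\<forall>\<^sub>F n in sequentially. lam / (2 * ln (real n)) \<le> escape p n"
proof -
  have "\<forall>\<^sub>F n in sequentially. lam / 2 < escape p n * ln (real n)"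
    by (rule order_tendstoD(1)[OF escape_lim]) (use lam in auto)
  moreover have "\<forall>\<^sub>F n in sequentially. ln (real n) > 0" by real_asymp
  ultimately show ?thesis by eventually_elim (simp add: field_simps)
qed

lemma expectation_power_sum_le:
  assumes "r \<ge> 1"
  obtains C where "C > 0" "\<forall>\<^sub>F n in sequentially. expectation (\<lambda>\<omega>. \<Sum>y\<in>wrange X n \<omega>. real (ltime X n y \<omega>) ^ r) \<le> C * real n * ln (real n) ^ (r - 1)"
proof -
  define C where "C = fact r * (2 / lam) ^ (r - 1)"
  have "C > 0" using lam by (simp add: C_def)
  moreover have "\<forall>\<^sub>F n in sequentially. ln (real n) > 0" by real_asymp
  hence "\<forall>\<^sub>F n in sequentially. expectation (\<lambda>\<omega>. \<Sum>y\<in>wrange X n \<omega>. real (ltime X n y \<omega>) ^ r) \<le> C * real n * ln (real n) ^ (r - 1)"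
    using escape_ge_ev
  proof eventually_elim
    case (elim n)
    have pos: "0 < lam / (2 * ln (real n))" using elim lam by simp
    have "expectation (\<lambda>\<omega>. \<Sum>y\<in>wrange X n \<omega>. real (ltime X n y \<omega>) ^ r) \<le> real n * fact r / escape p n ^ (r - 1)"
      by (rule expectation_sum_ltime_power[OF assms])
    also have "\<dots> \<le> real n * fact r / (lam / (2 * ln (real n))) ^ (r - 1)"
      using elim pos escape_pos[of n] by (intro divide_left_mono power_mono mult_pos_pos zero_less_power) auto
    also have "\<dots> = C * real n * ln (real n) ^ (r - 1)"
      using elim lam by (simp add: C_def power_divide power_mult_distrib field_simps)
    finally show ?case .
  qed
  ultimately show ?thesis using that by blast
qed

lemma expectation_range_le:
  obtains C where "C > 0" "\<forall>\<^sub>F n in sequentially. expectation (\<lambda>\<omega>. real (card (wrange X n \<omega>))) \<le> C * real n / ln (real n)"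
proof -
  \<comment> \<open>Times below sqrt n are too few to matter at the scale n / ln n, and after them
    the escape probability is at most its value at sqrt n, about 2 lam / ln n; this is the origin of
    the 2 in the constant.\<close>
  define k where "k = (\<lambda>n::nat. nat \<lfloor>sqrt (real n)\<rfloor>)"
  have k: "filterlim k at_top sequentially" unfolding k_def by real_asymp
  have "(\<lambda>n. escape p (k n) * ln (real (k n)) * (ln (real n) / ln (real (k n)))) \<longlonglongrightarrow> lam * 2"
  proof (intro tendsto_mult filterlim_compose[OF escape_lim k])
    show "(\<lambda>n. ln (real n) / ln (real (k n))) \<longlonglongrightarrow> 2" unfolding k_def by real_asymp
  qed
  moreover have "(\<lambda>n. real (k n) * ln (real n) / real n) \<longlonglongrightarrow> 0" unfolding k_def by real_asymp
  ultimately have "(\<lambda>n. real (k n) * ln (real n) / real n + escape p (k n) * ln (real (k n)) * (ln (real n) / ln (real (k n)))) \<longlonglongrightarrow> 0 + lam * 2"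
    by (intro tendsto_add)
  hence "\<forall>\<^sub>F n in sequentially. real (k n) * ln (real n) / real n + escape p (k n) * ln (real (k n)) * (ln (real n) / ln (real (k n))) < 2 * lam + 1"
    by (rule order_tendstoD(2)) simp
  moreover have "\<forall>\<^sub>F n in sequentially. ln (real (k n)) > 0" by (rule eventually_compose_filterlim[OF _ k]) real_asymp
  moreover have "\<forall>\<^sub>F n in sequentially. ln (real n) > 0" by real_asymp
  ultimately have "\<forall>\<^sub>F n in sequentially. expectation (\<lambda>\<omega>. real (card (wrange X n \<omega>))) \<le> (2 * lam + 1) * real n / ln (real n)"
    using eventually_gt_at_top[of 0]
  proof eventually_elim
    case (elim n)
    have "(\<Sum>i<n. escape p i) \<le> (\<Sum>i<n. of_bool (i < k n) + escape p (k n))"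
    proof (intro sum_mono)
      fix i
      show "escape p i \<le> of_bool (i < k n) + escape p (k n)"
      proof (cases "i < k n")
        case True
        have "escape p i \<le> 1" by simp
        moreover have "of_bool (i < k n) = (1::real)" using True by simp
        ultimately show ?thesis using escape_pos[of "k n"] by linarith
      qed (use escape_antimono[of "k n" i] in auto)
    qed
    also have "\<dots> = real (card {i\<in>{..<n}. i < k n}) + real n * escape p (k n)"
      by (simp add: sum.distrib sum.inter_filter[symmetric] of_bool_def)
    also have "card {i\<in>{..<n}. i < k n} \<le> card {..<k n}" by (intro card_mono) auto
    finally have "expectation (\<lambda>\<omega>. real (card (wrange X n \<omega>))) \<le> real (k n) + real n * escape p (k n)"
      by (simp add: expectation_card_wrange)
    also have "\<dots> = (real (k n) * ln (real n) / real n + escape p (k n) * ln (real (k n)) * (ln (real n) / ln (real (k n)))) * (real n / ln (real n))"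
      using elim by (simp add: field_simps)
    also have "\<dots> \<le> (2 * lam + 1) * (real n / ln (real n))" using elim by (intro mult_right_mono) auto
    finally show ?case by simp
  qed
  thus ?thesis using lam by (intro that[of "2 * lam + 1"]) auto
qed

text \<open>The saturation parameter is fixed before n: the cost of the replacement is c, small with
  \<epsilon>, times normalised means of the range and of the cubic sum, which are bounded in n. Only
  then is the weak law applied.\<close>

theorem power_sum_limit:
  assumes \<beta>: "0 < \<beta>" "\<beta> \<le> 2"
  shows "(\<lambda>n. expectation (\<lambda>\<omega>. \<bar>(\<Sum>y\<in>wrange X n \<omega>. real (ltime X n y \<omega>) powr \<beta>) / (real n * ln (real n) powr (\<beta> - 1)) - Gamma (\<beta> + 1) / lam powr (\<beta> - 1)\<bar>)) \<longlonglongrightarrow> 0"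
proof (rule tendstoI)
  fix e :: real assume e: "e > 0"
  define v where "v = Gamma (\<beta> + 1) / lam powr (\<beta> - 1)"
  obtain C1 where C1: "C1 > 0" "\<forall>\<^sub>F n in sequentially. expectation (\<lambda>\<omega>. real (card (wrange X n \<omega>))) \<le> C1 * real n / ln (real n)"
    by (rule expectation_range_le)
  obtain C3 where C3: "C3 > 0" "\<forall>\<^sub>F n in sequentially. expectation (\<lambda>\<omega>. \<Sum>y\<in>wrange X n \<omega>. real (ltime X n y \<omega>) ^ 3) \<le> C3 * real n * ln (real n) ^ (3 - 1)"
    by (rule expectation_power_sum_le[of 3]) auto
  \<comment> \<open>The 4 comes from (1 + x)^3 \<le> 4 (1 + x^3) for x \<ge> 0; the constant part is
    paid for by the range, the cubic part by the third power sum.\<close>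
  define C where "C = 4 * (C1 + C3)"
  have C: "C > 0" using C1 C3 by (simp add: C_def)
  have "(\<lambda>j. (4 * (1 / real (Suc j)) + 2 * (1 / real (Suc j)) powr \<beta>) * C) \<longlonglongrightarrow> 0"
  proof -
    have l0: "(\<lambda>j. 1 / real (Suc j)) \<longlonglongrightarrow> 0" by (rule LIMSEQ_Suc[OF lim_1_over_n])
    have "(\<lambda>j. (1 / real (Suc j)) powr \<beta>) \<longlonglongrightarrow> 0"
      using \<beta> by (intro tendsto_zero_powrI[OF l0 tendsto_const]) auto
    hence "(\<lambda>j. (4 * (1 / real (Suc j)) + 2 * (1 / real (Suc j)) powr \<beta>) * C) \<longlonglongrightarrow> (4 * 0 + 2 * 0) * C"
      by (intro tendsto_intros l0)
    thus ?thesis by simp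
  qed
  hence ev1: "\<forall>\<^sub>F j in sequentially. (4 * (1 / real (Suc j)) + 2 * (1 / real (Suc j)) powr \<beta>) * C < e / 3"
    using e by (intro order_tendstoD(2)) auto
  have ev2: "\<forall>\<^sub>F j in sequentially. dist (\<integral>x. sat_deriv \<beta> (1 / real (Suc j)) x \<partial>exp_law lam) v < e / 3"
    unfolding v_def using e by (intro tendstoD[OF sat_deriv_integral_limit[OF \<beta> lam]]) auto
  from eventually_conj[OF ev1 ev2] obtain j where
    j: "(4 * (1 / real (Suc j)) + 2 * (1 / real (Suc j)) powr \<beta>) * C < e / 3"
       "dist (\<integral>x. sat_deriv \<beta> (1 / real (Suc j)) x \<partial>exp_law lam) v < e / 3"
    by (auto simp only: eventually_sequentially)
  define \<epsilon> where "\<epsilon> = 1 / real (Suc j)"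
  define c where "c = 4 * \<epsilon> + 2 * \<epsilon> powr \<beta>"
  define I where "I = (\<integral>x. sat_deriv \<beta> \<epsilon> x \<partial>exp_law lam)"
  have \<epsilon>: "0 < \<epsilon>" "\<epsilon> \<le> 1" by (auto simp: \<epsilon>_def)
  have c: "c \<ge> 0" "c * C < e / 3" using \<epsilon> j(1) by (auto simp: c_def \<epsilon>_def)
  have Iv: "\<bar>I - v\<bar> < e / 3" using j(2) by (simp add: I_def \<epsilon>_def dist_real_def)
  obtain B K where BK: "\<And>x. \<bar>sat_deriv \<beta> \<epsilon> x\<bar> \<le> B" "\<And>x y. \<bar>sat_deriv \<beta> \<epsilon> x - sat_deriv \<beta> \<epsilon> y\<bar> \<le> K * \<bar>x - y\<bar>"
    using sat_deriv_bounded_lipschitz[OF \<epsilon>(1) \<beta>] by blast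
  have "\<forall>\<^sub>F n in sequentially. expectation (\<lambda>\<omega>. \<bar>ln (real n) / real n * (\<Sum>y\<in>wrange X n \<omega>. sat_powr \<beta> \<epsilon> (real (ltime X n y \<omega>) / ln (real n))) - I\<bar>) < e / 3"
    unfolding I_def using e
    by (intro order_tendstoD(2)[OF functional_weak_law[OF BK sat_powr_0[OF \<epsilon>(1)] sat_powr_deriv[OF \<epsilon>(1)]]]) auto
  moreover have "\<forall>\<^sub>F n in sequentially. ln (real n) > 0" by real_asymp
  ultimately show "\<forall>\<^sub>F n in sequentially. dist (expectation (\<lambda>\<omega>. \<bar>(\<Sum>y\<in>wrange X n \<omega>. real (ltime X n y \<omega>) powr \<beta>) / (real n * ln (real n) powr (\<beta> - 1)) - Gamma (\<beta> + 1) / lam powr (\<beta> - 1)\<bar>)) 0 < e"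
    using C1(2) C3(2) eventually_gt_at_top[of 0]
  proof eventually_elim
    case (elim n)
    define l where "l = ln (real n)"
    have l: "l > 0" and n: "n > 0" using elim by (auto simp: l_def)
    define V where "V = (\<lambda>\<omega>. (\<Sum>y\<in>wrange X n \<omega>. real (ltime X n y \<omega>) powr \<beta>) / (real n * l powr (\<beta> - 1)))"
    define W where "W = (\<lambda>\<omega>. l / real n * (\<Sum>y\<in>wrange X n \<omega>. sat_powr \<beta> \<epsilon> (real (ltime X n y \<omega>) / l)))"
    define Q where "Q = (\<lambda>\<omega>. c * (4 * (l / real n * real (card (wrange X n \<omega>)) + (\<Sum>y\<in>wrange X n \<omega>. real (ltime X n y \<omega>) ^ 3) / (real n * l\<^sup>2))))"
    have V_int: "integrable M V" unfolding V_def
      by (intro integrable_divide integrable_sum_ltime[of "\<lambda>j. real j powr \<beta>"])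
    have W_int: "integrable M W" unfolding W_def
      by (intro integrable_mult_right integrable_sum_ltime[of "\<lambda>j. sat_powr \<beta> \<epsilon> (real j / l)"])
    have R_int: "integrable M (\<lambda>\<omega>. real (card (wrange X n \<omega>)))"
      using integrable_sum_ltime[of "\<lambda>_. 1" n] by simp
    have S_int: "integrable M (\<lambda>\<omega>. \<Sum>y\<in>wrange X n \<omega>. real (ltime X n y \<omega>) ^ 3)"
      by (rule integrable_sum_ltime[of "\<lambda>j. real j ^ 3"])
    have Q_int: "integrable M Q" unfolding Q_def
      by (intro integrable_mult_right Bochner_Integration.integrable_add integrable_divide R_int S_int)
    have VW: "\<bar>V \<omega> - W \<omega>\<bar> \<le> Q \<omega>" for \<omega>
    proof -
      have "V \<omega> = l / real n * (\<Sum>y\<in>wrange X n \<omega>. (real (ltime X n y \<omega>) / l) powr \<beta>)"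
      proof -
        have "(real (ltime X n y \<omega>) / l) powr \<beta> = real (ltime X n y \<omega>) powr \<beta> / l powr \<beta>" for y
          using l by (simp add: powr_divide)
        thus ?thesis using l n by (simp add: V_def powr_diff sum_divide_distrib[symmetric])
      qed
      hence "V \<omega> - W \<omega> = l / real n * (\<Sum>y\<in>wrange X n \<omega>. (real (ltime X n y \<omega>) / l) powr \<beta> - sat_powr \<beta> \<epsilon> (real (ltime X n y \<omega>) / l))"
        by (simp only: W_def sum_subtractf right_diff_distrib)
      hence "\<bar>V \<omega> - W \<omega>\<bar> = l / real n * \<bar>\<Sum>y\<in>wrange X n \<omega>. (real (ltime X n y \<omega>) / l) powr \<beta> - sat_powr \<beta> \<epsilon> (real (ltime X n y \<omega>) / l)\<bar>"
        using l n by (simp add: abs_mult)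
      also have "\<dots> \<le> l / real n * (\<Sum>y\<in>wrange X n \<omega>. c * (4 * (1 + (real (ltime X n y \<omega>) / l) ^ 3)))"
      proof (intro mult_left_mono order.trans[OF sum_abs] sum_mono)
        fix y
        define x where "x = real (ltime X n y \<omega>) / l"
        have x: "x \<ge> 0" using l by (simp add: x_def)
        have "\<bar>x powr \<beta> - sat_powr \<beta> \<epsilon> x\<bar> \<le> c * (1 + x) ^ 3" unfolding c_def by (rule sat_powr_error[OF \<epsilon> \<beta> x])
        also have "\<dots> \<le> c * (4 * (1 + x ^ 3))"
        proof (intro mult_left_mono c(1))
          have "4 * (1 + x ^ 3) - (1 + x) ^ 3 = 3 * ((1 - x)\<^sup>2 * (1 + x))"
            by (simp add: eval_nat_numeral algebra_simps)
          moreover have "\<dots> \<ge> 0" using x by simp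
          ultimately show "(1 + x) ^ 3 \<le> 4 * (1 + x ^ 3)" by linarith
        qed
        finally show "\<bar>(real (ltime X n y \<omega>) / l) powr \<beta> - sat_powr \<beta> \<epsilon> (real (ltime X n y \<omega>) / l)\<bar> \<le> c * (4 * (1 + (real (ltime X n y \<omega>) / l) ^ 3))"
          by (simp add: x_def)
      qed (use l in auto)
      also have "\<dots> = Q \<omega>"
      proof -
        have "(\<Sum>y\<in>wrange X n \<omega>. c * (4 * (1 + (real (ltime X n y \<omega>) / l) ^ 3)))
          = c * (4 * (real (card (wrange X n \<omega>)) + (\<Sum>y\<in>wrange X n \<omega>. real (ltime X n y \<omega>) ^ 3) / l ^ 3))"
          by (simp only: sum_distrib_left[symmetric] sum.distrib power_divide sum_divide_distrib[symmetric]) simp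
        thus ?thesis using l n by (simp add: Q_def field_simps eval_nat_numeral)
      qed
      finally show ?thesis .
    qed
    have EQ: "expectation Q \<le> c * C"
    proof -
      have "expectation Q = c * (4 * (l / real n * expectation (\<lambda>\<omega>. real (card (wrange X n \<omega>))) + expectation (\<lambda>\<omega>. \<Sum>y\<in>wrange X n \<omega>. real (ltime X n y \<omega>) ^ 3) / (real n * l\<^sup>2)))"
        unfolding Q_def using R_int S_int by simp
      also have "\<dots> \<le> c * (4 * (l / real n * (C1 * real n / l) + (C3 * real n * l ^ (3 - 1)) / (real n * l\<^sup>2)))"
        using elim l c(1) by (intro mult_left_mono add_mono divide_right_mono) (auto simp: l_def)
      also have "\<dots> = c * C" using l n by (simp add: C_def)
      finally show ?thesis .
    qed
    have "expectation (\<lambda>\<omega>. \<bar>V \<omega> - v\<bar>) \<le> expectation (\<lambda>\<omega>. Q \<omega> + \<bar>W \<omega> - I\<bar> + \<bar>I - v\<bar>)"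
    proof (rule integral_mono)
      show "\<bar>V \<omega> - v\<bar> \<le> Q \<omega> + \<bar>W \<omega> - I\<bar> + \<bar>I - v\<bar>" for \<omega> using VW[of \<omega>] by linarith
    qed (use V_int W_int Q_int in auto)
    also have "\<dots> = expectation Q + expectation (\<lambda>\<omega>. \<bar>W \<omega> - I\<bar>) + \<bar>I - v\<bar>"
      using W_int Q_int by (simp add: prob_space)
    also have "\<dots> < e" using EQ c(2) Iv elim(1) unfolding W_def l_def by linarith
    finally have "expectation (\<lambda>\<omega>. \<bar>V \<omega> - v\<bar>) < e" .
    moreover have "0 \<le> expectation (\<lambda>\<omega>. \<bar>V \<omega> - v\<bar>)" by simp
    ultimately show ?case by (simp add: dist_real_def V_def v_def l_def)
  qed
qed

end

section \<open>The law of the steps\<close>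

lemma (in prob_space) distr_countable_pmf:
  fixes Y :: "'a \<Rightarrow> 'b :: countable"
  assumes "Y \<in> measurable M (count_space UNIV)"
  obtains p where "distr M (count_space UNIV) Y = measure_pmf p"
proof -
  define N where "N = distr M (count_space UNIV) Y"
  interpret N: prob_space N unfolding N_def by (rule prob_space_distr[OF assms])
  have sets: "sets N = UNIV" by (simp add: N_def)
  have "(\<Union>x\<in>{x. measure N {x} = 0}. {x}) \<in> null_sets N"
    by (intro null_sets_UN') (auto simp: null_sets_def sets N.emeasure_eq_measure)
  hence "AE x in N. measure N {x} \<noteq> 0"
    by (rule AE_I') auto
  hence "N \<in> {M. prob_space M \<and> sets M = UNIV \<and> (AE x in M. measure M {x} \<noteq> 0)}"
    using sets N.prob_space_axioms by simp
  hence "measure_pmf (Abs_pmf N) = N" by (rule Abs_pmf_inverse)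
  thus ?thesis using that[of "Abs_pmf N"] by (simp add: N_def)
qed

lemma walk_law:
  fixes X :: "nat \<Rightarrow> 'w \<Rightarrow> int ^ 'd"
  assumes "prob_space M" and iid: "iid M (count_space UNIV) X {1..}"
  obtains p where "\<And>k. 1 \<le> k \<Longrightarrow> distr M (count_space UNIV) (X k) = measure_pmf p"
proof -
  interpret prob_space M by fact
  have "X 1 \<in> measurable M (count_space UNIV)"
    using iid by (auto simp: iid_def indep_vars_def)
  then obtain p where p: "distr M (count_space UNIV) (X 1) = measure_pmf p"
    by (rule distr_countable_pmf)
  have "distr M (count_space UNIV) (X k) = measure_pmf p" if "1 \<le> k" for k
  proof -
    have "distr M (count_space UNIV) (X k) = distr M (count_space UNIV) (X 1)"
      using iid that unfolding iid_def by (metis atLeast_iff order_refl)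
    thus ?thesis by (simp only: p)
  qed
  thus ?thesis by (rule that)
qed

text \<open>Convergence of S_n / n is the hypothesis of \<open>log_expansion\<close> with exponent 1
  and the same constant A on both sides of 0. The logarithmic expansion is then turned into an
  additive one.\<close>

lemma lchar_local_of_cauchy:
  fixes X :: "nat \<Rightarrow> 'w \<Rightarrow> int ^ 'd"
  assumes M: "prob_space M" and indep: "prob_space.indep_vars M (\<lambda>_. count_space UNIV) X {1..}"
    and law: "\<And>k. 1 \<le> k \<Longrightarrow> distr M (count_space UNIV) (X k) = measure_pmf p"
    and cw: "cauchy_walk M X A" and \<eta>: "\<eta> > 0"
  shows "\<exists>\<delta>>0. \<forall>\<theta>. norm \<theta> \<le> \<delta> \<longrightarrow> norm (1 - lchar p \<theta> - A * norm \<theta>) \<le> \<eta> * norm \<theta>"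
proof -
  interpret prob_space M by fact
  have A: "A > 0" and card: "CARD('d) = 1" using cw by (auto simp: cauchy_walk_def)
  obtain i :: 'd where i: "UNIV = {i}" using card by (auto simp: card_1_singleton_iff)
  obtain \<mu> where \<mu>: "real_distribution \<mu>" "\<And>t. char \<mu> t = of_real (exp (- A * \<bar>t\<bar>))"
    "weak_conv_m (\<lambda>n. distr M borel (\<lambda>\<omega>. real_of_int (walk X n \<omega> $ i) / real n)) \<mu>"
    using cw by (auto simp: cauchy_walk_def)
  define \<phi> where "\<phi> = (\<lambda>t. lchar p (axis i t))"
  have \<phi>: "\<phi> t = (\<integral>x. iexp (t * real_of_int (x $ i)) \<partial>measure_pmf p)" for t
    unfolding \<phi>_def lchar_def by (simp add: inner_axis' emb_def)
  have X_meas: "X k \<in> measurable M (count_space UNIV)" if "1 \<le> k" for k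
    using indep that by (auto simp: indep_vars_def)
  have walk_meas: "(\<lambda>\<omega>. real_of_int (walk X n \<omega> $ i) / real n) \<in> borel_measurable M" for n
  proof -
    have "(\<lambda>\<omega>. real_of_int (X k \<omega> $ i)) \<in> borel_measurable M" if "1 \<le> k" for k
      by (rule measurable_compose[OF X_meas[OF that]]) simp
    thus ?thesis by (auto simp: walk_def)
  qed
  have char_walk: "char (distr M borel (\<lambda>\<omega>. real_of_int (walk X n \<omega> $ i) / real n)) t = \<phi> (t / real n) ^ n" for n t
  proof -
    have iv: "indep_vars (\<lambda>_. borel) (\<lambda>k \<omega>. real_of_int (X k \<omega> $ i) / real n) {1..n}"
      by (rule indep_vars_compose2[OF indep_vars_subset[OF indep], where Y="\<lambda>_ x. real_of_int (x $ i) / real n"]) auto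
    have c: "char (distr M borel (\<lambda>\<omega>. real_of_int (X k \<omega> $ i) / real n)) t = \<phi> (t / real n)" if k: "1 \<le> k" for k
    proof -
      have "char (distr M borel (\<lambda>\<omega>. real_of_int (X k \<omega> $ i) / real n)) t = (\<integral>\<omega>. iexp (t / real n * real_of_int (X k \<omega> $ i)) \<partial>M)"
        unfolding char_def
        by (subst integral_distr) (auto intro!: measurable_compose[OF X_meas[OF k]])
      also have "\<dots> = (\<integral>x. iexp (t / real n * real_of_int (x $ i)) \<partial>distr M (count_space UNIV) (X k))"
        using X_meas[OF k] by (subst integral_distr) auto
      finally show ?thesis by (simp only: law[OF k] \<phi>)
    qed
    have "char (distr M borel (\<lambda>\<omega>. \<Sum>k\<in>{1..n}. real_of_int (X k \<omega> $ i) / real n)) t = (\<Prod>k\<in>{1..n}. \<phi> (t / real n))"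
      unfolding char_distr_sum[OF iv] by (intro prod.cong refl c) auto
    thus ?thesis by (simp add: walk_def sum_divide_distrib)
  qed
  have rd: "real_distribution (distr M borel (\<lambda>\<omega>. real_of_int (walk X n \<omega> $ i) / real n))" for n
    using walk_meas by (rule real_distribution_distr)
  have conv: "\<forall>\<^sub>F n in sequentially. \<forall>t. \<bar>t\<bar> \<le> 1 \<longrightarrow>
      norm (\<phi> (t * real n powr (- 1 / 1)) ^ n - exp (- (of_real (\<bar>t\<bar> powr 1) * of_real A))) < e" if e: "e > 0" for e
    using weak_conv_char_uniform[OF rd \<mu>(1) \<mu>(3) e] eventually_gt_at_top[of 0]
  proof eventually_elim
    case (elim n)
    have "\<phi> (t * real n powr (- 1 / 1)) = \<phi> (t / real n)" for t
      using elim by (simp add: powr_minus_divide)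
    moreover have "exp (- (of_real (\<bar>t\<bar> powr 1) * of_real A)) = char \<mu> t" for t
      by (simp add: \<mu>(2) exp_of_real[symmetric] mult.commute)
    ultimately show ?case using elim by (simp only: char_walk simp_thms)
  qed
  have cont: "continuous_on UNIV \<phi>"
  proof -
    define \<rho> where "\<rho> = distr (measure_pmf p) borel (\<lambda>x. real_of_int (x $ i))"
    interpret \<rho>: real_distribution \<rho> unfolding \<rho>_def by (intro prob_space.real_distribution_distr) (auto intro: prob_space_measure_pmf)
    have "\<phi> = char \<rho>"
      unfolding \<rho>_def char_def by (rule ext, subst integral_distr) (auto simp: \<phi>)
    thus ?thesis by (auto intro!: continuous_at_imp_continuous_on \<rho>.isCont_char)
  qed
  have \<phi>0: "\<phi> 0 = 1" by (simp add: \<phi>)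
  obtain \<delta>1 where \<delta>1: "\<delta>1 > 0" "\<And>v. \<bar>v\<bar> \<le> \<delta>1 \<Longrightarrow> \<exists>r. norm r \<le> \<eta> / 2 \<and> \<phi> v = exp (- (of_real (\<bar>v\<bar> powr 1) * (of_real A + r)))"
    using log_expansion[OF cont \<phi>0, of 1 "\<lambda>_. of_real A" "\<eta> / 2", OF _ conv] \<eta> by auto
  define B where "B = A + \<eta>"
  have B: "B > 0" using A \<eta> by (simp add: B_def)
  \<comment> \<open>The bound 1 / B keeps |z| \<le> 1, so that exp |Re z| \<le> 3; the last one
    makes the quadratic remainder 3 (|v| B)^2 at most |v| \<eta> / 2.\<close>
  define \<delta> where "\<delta> = min \<delta>1 (min (1 / B) (\<eta> / (6 * B\<^sup>2)))"
  have \<delta>: "\<delta> > 0" "\<delta> \<le> \<delta>1" "\<delta> \<le> 1 / B" "\<delta> \<le> \<eta> / (6 * B\<^sup>2)" using \<delta>1 B \<eta> by (auto simp: \<delta>_def)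
  have "norm (1 - lchar p \<theta> - A * norm \<theta>) \<le> \<eta> * norm \<theta>" if \<theta>: "norm \<theta> \<le> \<delta>" for \<theta> :: "real ^ 'd"
  proof -
    define v where "v = \<theta> $ i"
    have ax: "\<theta> = axis i v"
    proof (rule vec_eq_iff[THEN iffD2], rule allI)
      fix j show "\<theta> $ j = axis i v $ j" using i by (metis UNIV_I axis_nth singletonD v_def)
    qed
    have nv: "norm \<theta> = \<bar>v\<bar>" by (subst ax) (simp add: norm_eq_sqrt_inner inner_axis_axis real_sqrt_mult[symmetric] power2_eq_square[symmetric])
    obtain r where r: "norm r \<le> \<eta> / 2" "\<phi> v = exp (- (of_real \<bar>v\<bar> * (of_real A + r)))"
      using \<delta>1(2)[of v] \<theta> \<delta>(2) nv by force
    define z where "z = - (of_real \<bar>v\<bar> * (of_real A + r))"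
    have "norm (of_real A + r) \<le> B"
      using norm_triangle_ineq[of "of_real A" r] r(1) A \<eta> by (simp add: B_def)
    hence nz: "norm z \<le> \<bar>v\<bar> * B" unfolding z_def by (simp add: norm_mult mult_left_mono)
    also have "\<bar>v\<bar> * B \<le> 1 / B * B" using \<theta> \<delta>(3) nv B by (intro mult_right_mono) auto
    also have "\<dots> = 1" using B by simp
    finally have "norm z \<le> 1" .
    hence "\<bar>Re z\<bar> \<le> 1" using abs_Re_le_cmod[of z] by linarith
    hence "exp \<bar>Re z\<bar> \<le> 3" using exp_le order.trans[of "exp \<bar>Re z\<bar>" "exp 1" 3] by simp
    hence "exp \<bar>Re z\<bar> * (norm z)\<^sup>2 \<le> 3 * (norm z)\<^sup>2" by (intro mult_right_mono) auto
    moreover have "norm (exp z - 1 - z) \<le> exp \<bar>Re z\<bar> * (norm z)\<^sup>2"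
      using Taylor_exp[of z 1] by (simp add: diff_diff_eq power2_eq_square)
    ultimately have "norm (exp z - 1 - z) \<le> 3 * (norm z)\<^sup>2" by linarith
    also have "\<dots> \<le> 3 * (\<bar>v\<bar> * B)\<^sup>2" using nz by (intro mult_left_mono power_mono) auto
    also have "\<dots> = \<bar>v\<bar> * (3 * (\<bar>v\<bar> * B\<^sup>2))" by (simp only: power2_eq_square mult_ac)
    also have "\<dots> \<le> \<bar>v\<bar> * (\<eta> / 2)"
    proof (intro mult_left_mono)
      have "\<bar>v\<bar> \<le> \<eta> / (6 * B\<^sup>2)" using \<theta> \<delta>(4) nv by linarith
      thus "3 * (\<bar>v\<bar> * B\<^sup>2) \<le> \<eta> / 2" using B by (simp add: field_simps)
    qed auto
    finally have 1: "norm (exp z - 1 - z) \<le> \<bar>v\<bar> * (\<eta> / 2)" .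
    have "lchar p \<theta> = exp z" using r(2) by (subst ax) (simp add: \<phi>_def z_def)
    moreover have "1 - exp z - of_real (A * \<bar>v\<bar>) = of_real \<bar>v\<bar> * r - (exp z - 1 - z)"
      by (simp add: z_def algebra_simps)
    ultimately have "norm (1 - lchar p \<theta> - of_real (A * norm \<theta>)) \<le> norm (of_real \<bar>v\<bar> * r) + norm (exp z - 1 - z)"
      using norm_triangle_ineq4 by (simp only: nv) 
    also have "norm (of_real \<bar>v\<bar> * r) \<le> \<bar>v\<bar> * (\<eta> / 2)"
      unfolding norm_mult using r(1) by (intro mult_mono) auto
    finally show ?thesis using 1 by (simp add: nv mult.commute[of \<eta>])
  qed
  thus ?thesis using \<delta>(1) by blast
qed

theorem lattice_walk_of_assumptions:
  fixes X :: "nat \<Rightarrow> 'w \<Rightarrow> int ^ 'd"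
  assumes M: "prob_space M" and iid: "iid M (count_space UNIV) X {1..}"
    and cases: "planar_walk M X \<and> A = 2 * sqrt (det (variance_matrix M (X 1))) \<or> cauchy_walk M X A"
    and span: "spans_lattice M (X 1)"
  obtains p where "lattice_walk M X p (pi * A)"
proof -
  interpret prob_space M by fact
  obtain p where law: "\<And>k. 1 \<le> k \<Longrightarrow> distr M (count_space UNIV) (X k) = measure_pmf p"
    using walk_law[OF M iid] by blast
  have indep: "indep_vars (\<lambda>_. count_space UNIV) X {1..}" using iid by (simp add: iid_def)
  have X1: "X 1 \<in> measurable M (count_space UNIV)" using indep by (auto simp: indep_vars_def)
  have law1: "distr M (count_space UNIV) (X 1) = measure_pmf p" by (rule law) simp
  have tr: "(\<integral>x. f x \<partial>measure_pmf p) = (\<integral>\<omega>. f (X 1 \<omega>) \<partial>M)" for f :: "int ^ 'd \<Rightarrow> real"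
    unfolding law1[symmetric] using X1 by (subst integral_distr) auto
  have tri: "integrable (measure_pmf p) f = integrable M (\<lambda>\<omega>. f (X 1 \<omega>))" for f :: "int ^ 'd \<Rightarrow> real"
    unfolding law1[symmetric] using X1 by (subst integrable_distr_eq) auto
  have var: "variance_matrix (measure_pmf p) (\<lambda>x. x) = variance_matrix M (X 1)"
    by (simp add: variance_matrix_def tr)
  have span': "H = UNIV" if "0 \<in> H" "\<And>x y. x \<in> H \<Longrightarrow> y \<in> H \<Longrightarrow> x - y \<in> H" "set_pmf p \<subseteq> H" for H
  proof -
    have "AE x in measure_pmf p. x \<in> H" using that(3) by (auto simp: AE_measure_pmf_iff)
    hence "AE \<omega> in M. X 1 \<omega> \<in> H"
      unfolding law1[symmetric] using X1 by (subst (asm) AE_distr_iff) auto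
    thus ?thesis using span that(1,2) unfolding spans_lattice_def by blast
  qed
  have "A > 0 \<and> (\<lambda>n. green p n 0 / ln (real n)) \<longlonglongrightarrow> 1 / (pi * A)"
    using cases
  proof
    assume pl: "planar_walk M X \<and> A = 2 * sqrt (det (variance_matrix M (X 1)))"
    hence card: "CARD('d) = 2" and sq: "\<And>i. integrable (measure_pmf p) (\<lambda>x. (real_of_int (x $ i))\<^sup>2)"
      and mean: "\<And>i. (\<integral>x. real_of_int (x $ i) \<partial>measure_pmf p) = 0"
      and inv: "invertible (variance_matrix (measure_pmf p) (\<lambda>x. x))"
      and A: "A = 2 * sqrt (det (variance_matrix (measure_pmf p) (\<lambda>x. x)))"
      by (auto simp: planar_walk_def tr tri var)
    show ?thesis using green_asymp_planar[OF card sq mean inv span' A] by blast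
  next
    assume cw: "cauchy_walk M X A"
    hence card: "CARD('d) = 1" and A: "A > 0" by (auto simp: cauchy_walk_def)
    show ?thesis
      using green_asymp_cauchy[OF card A lchar_local_of_cauchy[OF M indep law cw] span'] A by blast
  qed
  hence "lattice_walk M X p (pi * A)"
    using indep law by unfold_locales auto
  thus ?thesis by (rule that)
qed

section \<open>The characteristic function of the walk in random scenery\<close>

lemma (in prob_space) char_sum_scenery:
  fixes s :: "nat \<Rightarrow> 'b" and \<xi> :: "'b \<Rightarrow> 'a \<Rightarrow> real"
  assumes indep: "indep_vars (\<lambda>_. borel) \<xi> UNIV" and law: "\<And>y. distr M borel (\<xi> y) = \<nu>"
  shows "(\<integral>\<omega>. iexp (u * (\<Sum>k<n. \<xi> (s k) \<omega>)) \<partial>M) = (\<Prod>y\<in>s ` {..<n}. char \<nu> (u * real (card {k. k < n \<and> s k = y})))"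
proof -
  define N where "N = (\<lambda>y. real (card {k. k < n \<and> s k = y}))"
  have \<xi>m [measurable]: "\<xi> y \<in> borel_measurable M" for y using indep by (auto simp: indep_vars_def)
  have eq: "(\<Sum>k<n. \<xi> (s k) \<omega>) = (\<Sum>y\<in>s ` {..<n}. N y * \<xi> y \<omega>)" for \<omega>
  proof -
    have "(\<Sum>k<n. \<xi> (s k) \<omega>) = (\<Sum>y\<in>s ` {..<n}. \<Sum>k\<in>{k \<in> {..<n}. s k = y}. \<xi> (s k) \<omega>)"
      by (rule sum.image_gen) simp
    also have "\<dots> = (\<Sum>y\<in>s ` {..<n}. N y * \<xi> y \<omega>)"
      by (intro sum.cong refl) (simp add: N_def)
    finally show ?thesis .
  qed
  have iv: "indep_vars (\<lambda>_. borel) (\<lambda>y \<omega>. N y * \<xi> y \<omega>) (s ` {..<n})"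
    by (rule indep_vars_compose2[OF indep_vars_subset[OF indep], where Y="\<lambda>y x. N y * x"]) auto
  have "(\<integral>\<omega>. iexp (u * (\<Sum>k<n. \<xi> (s k) \<omega>)) \<partial>M) = char (distr M borel (\<lambda>\<omega>. \<Sum>y\<in>s ` {..<n}. N y * \<xi> y \<omega>)) u"
    unfolding eq char_def by (subst integral_distr) auto
  also have "\<dots> = (\<Prod>y\<in>s ` {..<n}. char (distr M borel (\<lambda>\<omega>. N y * \<xi> y \<omega>)) u)"
    by (rule char_distr_sum[OF iv])
  also have "\<dots> = (\<Prod>y\<in>s ` {..<n}. char \<nu> (u * N y))"
  proof (intro prod.cong refl)
    fix y
    have "char (distr M borel (\<lambda>\<omega>. N y * \<xi> y \<omega>)) u = (\<integral>\<omega>. iexp (u * N y * \<xi> y \<omega>) \<partial>M)"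
      unfolding char_def by (subst integral_distr) (auto simp: mult.assoc)
    also have "\<dots> = char \<nu> (u * N y)"
      unfolding char_def law[of y, symmetric] by (subst integral_distr) auto
    finally show "char (distr M borel (\<lambda>\<omega>. N y * \<xi> y \<omega>)) u = char \<nu> (u * N y)" .
  qed
  finally show ?thesis by (simp add: N_def)
qed

text \<open>Independence of the two generated \<sigma>-algebras makes the joint law of the first n
  steps and the whole scenery a product. Fubini then freezes the walk, and the scenery factorises
  over the visited sites.\<close>

lemma char_rwrs:
  fixes X :: "nat \<Rightarrow> 'w \<Rightarrow> int ^ 'd"
  assumes M: "prob_space M" and ws: "walk_scenery M X \<xi>"
  shows "rwrs X \<xi> n \<in> borel_measurable M"
    and "char (distr M borel (rwrs X \<xi> n)) u = (\<integral>\<omega>. (\<Prod>y\<in>wrange X n \<omega>. char (distr M borel (\<xi> 0)) (u * real (ltime X n y \<omega>))) \<partial>M)"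
proof -
  interpret prob_space M by fact
  define T where "T = (Pi\<^sub>M UNIV (\<lambda>_. borel) :: (int ^ 'd \<Rightarrow> real) measure)"
  define S where "S = (Pi\<^sub>M {1..} (\<lambda>_. count_space UNIV) :: (nat \<Rightarrow> int ^ 'd) measure)"
  define \<nu> where "\<nu> = distr M borel (\<xi> 0)"
  have indX: "indep_vars (\<lambda>_. count_space UNIV) X {1..}" and ind\<xi>: "indep_vars (\<lambda>_. borel) \<xi> UNIV"
    and law: "\<And>y. distr M borel (\<xi> y) = \<nu>"
    using ws by (auto simp: walk_scenery_def iid_def \<nu>_def)
  have Xm: "(\<lambda>\<omega>. \<lambda>k\<in>{1..}. X k \<omega>) \<in> measurable M S"
    unfolding S_def using indX by (intro measurable_restrict) (auto simp: indep_vars_def)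
  have \<xi>m [measurable]: "\<xi> y \<in> borel_measurable M" for y using ind\<xi> by (auto simp: indep_vars_def)
  have \<xi>T: "(\<lambda>\<omega> y. \<xi> y \<omega>) \<in> measurable M T"
    unfolding T_def by (rule measurable_PiM_single') (auto simp: PiE_def)
  have mapm: "(\<lambda>x. map x [Suc 0..<Suc n]) \<in> measurable S (count_space UNIV)"
  proof -
    have map: "(\<lambda>x. map x xs) \<in> measurable S (count_space UNIV)" if "set xs \<subseteq> {1..}" for xs
      using that
    proof (induction xs)
      case (Cons k xs)
      have "(\<lambda>x. x k) \<in> measurable S (count_space UNIV)"
        unfolding S_def using Cons by (intro measurable_component_singleton) auto
      hence "(\<lambda>x. (x k, map x xs)) \<in> measurable S (count_space UNIV \<Otimes>\<^sub>M count_space UNIV)"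
        using Cons by (intro measurable_Pair) auto
      hence "(\<lambda>x. (x k, map x xs)) \<in> measurable S (count_space UNIV)"
        by (simp add: pair_measure_countable)
      from measurable_compose[OF this, of "\<lambda>(a, b). a # b" "count_space UNIV"] show ?case by simp
    qed simp
    show ?thesis by (rule map) auto
  qed
  have steps_eq: "steps X 0 n = (\<lambda>\<omega>. map (\<lambda>k\<in>{1..}. X k \<omega>) [Suc 0..<Suc n])"
    by (rule ext) (simp add: steps_def del: upt_Suc)
  have sm: "steps X 0 n \<in> measurable M (count_space UNIV)"
    unfolding steps_eq by (rule measurable_compose[OF Xm mapm])
  have prodlaw: "distr M (count_space UNIV) (steps X 0 n) \<Otimes>\<^sub>M distr M T (\<lambda>\<omega> y. \<xi> y \<omega>)
    = distr M (count_space UNIV \<Otimes>\<^sub>M T) (\<lambda>\<omega>. (steps X 0 n \<omega>, \<lambda>y. \<xi> y \<omega>))"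
  proof (rule pair_measure_eqI)
    show "sigma_finite_measure (distr M (count_space UNIV) (steps X 0 n))"
      using prob_space_distr[OF sm] by (simp add: prob_space_imp_sigma_finite)
    show "sigma_finite_measure (distr M T (\<lambda>\<omega> y. \<xi> y \<omega>))"
      using prob_space_distr[OF \<xi>T] by (simp add: prob_space_imp_sigma_finite)
    fix B C assume B: "B \<in> sets (distr M (count_space UNIV) (steps X 0 n))" and C: "C \<in> sets (distr M T (\<lambda>\<omega> y. \<xi> y \<omega>))"
    define B' where "B' = (\<lambda>x. map x [Suc 0..<Suc n]) -` B \<inter> space S"
    have "B' \<in> sets S" unfolding B'_def by (rule measurable_sets[OF mapm]) simp
    hence "(\<lambda>\<omega>. \<lambda>k\<in>{1..}. X k \<omega>) -` B' \<inter> space M \<in> sets (vimage_algebra (space M) (\<lambda>\<omega>. \<lambda>k\<in>{1..}. X k \<omega>) S)"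
      by (rule in_vimage_algebra)
    moreover have "(\<lambda>\<omega>. \<lambda>k\<in>{1..}. X k \<omega>) -` B' \<inter> space M = steps X 0 n -` B \<inter> space M"
      using measurable_space[OF Xm] unfolding B'_def steps_eq by auto
    moreover have "(\<lambda>\<omega> y. \<xi> y \<omega>) -` C \<inter> space M \<in> sets (vimage_algebra (space M) (\<lambda>\<omega> y. \<xi> y \<omega>) T)"
      using C by (intro in_vimage_algebra) simp
    ultimately have "prob ((steps X 0 n -` B \<inter> space M) \<inter> ((\<lambda>\<omega> y. \<xi> y \<omega>) -` C \<inter> space M))
      = prob (steps X 0 n -` B \<inter> space M) * prob ((\<lambda>\<omega> y. \<xi> y \<omega>) -` C \<inter> space M)"
      using ws unfolding walk_scenery_def S_def[symmetric] T_def[symmetric] by (intro indep_setD) auto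
    moreover have "(steps X 0 n -` B \<inter> space M) \<inter> ((\<lambda>\<omega> y. \<xi> y \<omega>) -` C \<inter> space M)
      = (\<lambda>\<omega>. (steps X 0 n \<omega>, \<lambda>y. \<xi> y \<omega>)) -` (B \<times> C) \<inter> space M" by auto
    ultimately show "emeasure (distr M (count_space UNIV) (steps X 0 n)) B * emeasure (distr M T (\<lambda>\<omega> y. \<xi> y \<omega>)) C
      = emeasure (distr M (count_space UNIV \<Otimes>\<^sub>M T) (\<lambda>\<omega>. (steps X 0 n \<omega>, \<lambda>y. \<xi> y \<omega>))) (B \<times> C)"
      using C sm \<xi>T by (simp add: emeasure_distr emeasure_eq_measure ennreal_mult)
  qed (simp only: sets_distr, rule sets_pair_measure_cong, simp_all)
  \<comment> \<open>The scenery is read at random sites. As lists of steps form a countable space,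
    joint measurability only has to be checked for each fixed list.\<close>
  define Z where "Z = (\<lambda>(l :: (int ^ 'd) list, y :: int ^ 'd \<Rightarrow> real). \<Sum>k<n. y (sum_list (take k l)))"
  have Zm: "Z \<in> borel_measurable (count_space UNIV \<Otimes>\<^sub>M T)"
  proof (rule measurable_pair_measure_countable1)
    fix l :: "(int ^ 'd) list"
    have "(\<lambda>y. y i) \<in> borel_measurable T" for i
      unfolding T_def using measurable_component_singleton[of i UNIV "\<lambda>_. borel"] by simp
    thus "(\<lambda>y. Z (l, y)) \<in> borel_measurable T" by (simp add: Z_def)
  qed simp
  have walk: "walk X k \<omega> = sum_list (take k (steps X 0 n \<omega>))" if "k \<le> n" for k \<omega>
    using walk_add_steps[OF that, of X 0 \<omega>] by (simp add: walk_def)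
  have rw: "rwrs X \<xi> n \<omega> = Z (steps X 0 n \<omega>, \<lambda>y. \<xi> y \<omega>)" for \<omega>
    by (simp add: rwrs_def Z_def walk)
  have pm: "(\<lambda>\<omega>. (steps X 0 n \<omega>, \<lambda>y. \<xi> y \<omega>)) \<in> measurable M (count_space UNIV \<Otimes>\<^sub>M T)"
    using sm \<xi>T by simp
  show rm: "rwrs X \<xi> n \<in> borel_measurable M"
    using measurable_compose[OF pm Zm] by (simp add: rw[symmetric])
  interpret L: prob_space "distr M (count_space UNIV) (steps X 0 n)" by (rule prob_space_distr[OF sm])
  interpret Y: prob_space "distr M T (\<lambda>\<omega> y. \<xi> y \<omega>)" by (rule prob_space_distr[OF \<xi>T])
  interpret LY: pair_prob_space "distr M (count_space UNIV) (steps X 0 n)" "distr M T (\<lambda>\<omega> y. \<xi> y \<omega>)" ..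
  have gm: "(\<lambda>x. iexp (u * Z x)) \<in> borel_measurable (count_space UNIV \<Otimes>\<^sub>M T)" using Zm by measurable
  have gi: "integrable (distr M (count_space UNIV) (steps X 0 n) \<Otimes>\<^sub>M distr M T (\<lambda>\<omega> y. \<xi> y \<omega>)) (\<lambda>x. iexp (u * Z x))"
    using gm by (intro LY.integrable_const_bound[where B=1]) (auto simp: prodlaw)
  define G where "G = (\<lambda>l :: (int ^ 'd) list. \<Prod>y\<in>(\<lambda>k. sum_list (take k l)) ` {..<n}. char \<nu> (u * real (card {k. k < n \<and> sum_list (take k l) = y})))"
  have "char (distr M borel (rwrs X \<xi> n)) u = (\<integral>\<omega>. iexp (u * rwrs X \<xi> n \<omega>) \<partial>M)"
    unfolding char_def using rm by (subst integral_distr) auto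
  also have "\<dots> = (\<integral>x. iexp (u * Z x) \<partial>distr M (count_space UNIV \<Otimes>\<^sub>M T) (\<lambda>\<omega>. (steps X 0 n \<omega>, \<lambda>y. \<xi> y \<omega>)))"
    unfolding rw by (subst integral_distr[OF pm gm]) simp
  also have "\<dots> = (\<integral>l. (\<integral>y. iexp (u * Z (l, y)) \<partial>distr M T (\<lambda>\<omega> y. \<xi> y \<omega>)) \<partial>distr M (count_space UNIV) (steps X 0 n))"
    unfolding prodlaw[symmetric] by (rule LY.integral_fst'[OF gi, symmetric])
  also have "\<dots> = (\<integral>l. G l \<partial>distr M (count_space UNIV) (steps X 0 n))"
  proof (intro Bochner_Integration.integral_cong refl)
    fix l :: "(int ^ 'd) list"
    have m: "(\<lambda>y. iexp (u * Z (l, y))) \<in> borel_measurable T"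
      by (rule measurable_compose[OF measurable_Pair1' gm]) simp
    have "(\<integral>y. iexp (u * Z (l, y)) \<partial>distr M T (\<lambda>\<omega> y. \<xi> y \<omega>)) = (\<integral>\<omega>. iexp (u * (\<Sum>k<n. \<xi> (sum_list (take k l)) \<omega>)) \<partial>M)"
      by (subst integral_distr[OF \<xi>T m]) (simp add: Z_def)
    also have "\<dots> = G l" unfolding G_def by (rule char_sum_scenery[OF ind\<xi> law])
    finally show "(\<integral>y. iexp (u * Z (l, y)) \<partial>distr M T (\<lambda>\<omega> y. \<xi> y \<omega>)) = G l" .
  qed
  also have "\<dots> = (\<integral>\<omega>. G (steps X 0 n \<omega>) \<partial>M)" using sm by (subst integral_distr) auto
  also have "\<dots> = (\<integral>\<omega>. (\<Prod>y\<in>wrange X n \<omega>. char \<nu> (u * real (ltime X n y \<omega>))) \<partial>M)"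
  proof (intro Bochner_Integration.integral_cong refl)
    fix \<omega>
    have 1: "wrange X n \<omega> = (\<lambda>k. sum_list (take k (steps X 0 n \<omega>))) ` {..<n}"
      unfolding wrange_def by (intro image_cong refl) (simp add: walk)
    have 2: "{k. k < n \<and> walk X k \<omega> = y} = {k. k < n \<and> sum_list (take k (steps X 0 n \<omega>)) = y}" for y
      using walk[of _ \<omega>] by auto
    show "G (steps X 0 n \<omega>) = (\<Prod>y\<in>wrange X n \<omega>. char \<nu> (u * real (ltime X n y \<omega>)))"
      unfolding G_def 1 ltime_def 2 ..
  qed
  finally show "char (distr M borel (rwrs X \<xi> n)) u = (\<integral>\<omega>. (\<Prod>y\<in>wrange X n \<omega>. char (distr M borel (\<xi> 0)) (u * real (ltime X n y \<omega>))) \<partial>M)"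
    unfolding \<nu>_def .
qed

section \<open>Negative moments of power sums\<close>

text \<open>The V_n of the overview: for n \<ge> 2 and \<beta> > 0 the denominator is
  \<open>norming \<beta> n powr \<beta>\<close>.\<close>

definition scaled_power_sum :: "(nat \<Rightarrow> 'w \<Rightarrow> int ^ 'd) \<Rightarrow> real \<Rightarrow> nat \<Rightarrow> 'w \<Rightarrow> real" where
  "scaled_power_sum X \<beta> n \<omega> = (\<Sum>y\<in>wrange X n \<omega>. real (ltime X n y \<omega>) powr \<beta>) / (real n * ln (real n) powr (\<beta> - 1))"

text \<open>Jensen's inequality for the convex function \<open>z powr - p\<close>, the weights \<open>N y / m\<close> and the
  points \<open>N y powr (\<beta> - 1)\<close>.\<close>

lemma neg_power_mean:
  fixes N :: "'b \<Rightarrow> real"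
  assumes S: "finite S" "S \<noteq> {}" and N: "\<And>y. y \<in> S \<Longrightarrow> N y > 0" and p: "p > 0"
  defines "m \<equiv> \<Sum>y\<in>S. N y"
  shows "((\<Sum>y\<in>S. N y powr \<beta>) / m) powr - p \<le> (\<Sum>y\<in>S. N y powr (1 + (1 - \<beta>) * p)) / m"
proof -
  define a where "a = (\<Sum>y\<in>S. N y powr \<beta>) / m"
  have m: "m > 0" unfolding m_def using S N by (intro sum_pos) auto
  have "N y powr \<beta> > 0" if "y \<in> S" for y using N[OF that] by simp
  hence "(\<Sum>y\<in>S. N y powr \<beta>) > 0" by (intro sum_pos S)
  hence a: "a > 0" using m by (simp add: a_def)
  \<comment> \<open>Tangent to the convex function at x = 1. The points are normalised by a, so
    their weighted mean is 1 and the linear term cancels in the sum.\<close>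
  have tangent: "1 - p * (x - 1) \<le> x powr - p" if "x > 0" for x
  proof -
    have "1 - p * (x - 1) \<le> 1 - p * ln x"
      using ln_le_minus_one[OF that] p by simp
    also have "\<dots> \<le> exp (- p * ln x)" using exp_ge_add_one_self[of "- p * ln x"] by simp
    finally show ?thesis using that by (simp add: powr_def)
  qed
  have "m = (\<Sum>y\<in>S. N y * (1 - p * (N y powr (\<beta> - 1) / a - 1)))"
  proof -
    have "(\<Sum>y\<in>S. N y * (1 - p * (N y powr (\<beta> - 1) / a - 1))) = (\<Sum>y\<in>S. (1 + p) * N y - p / a * N y powr \<beta>)"
    proof (intro sum.cong refl)
      fix y assume "y \<in> S"
      hence "N y * N y powr (\<beta> - 1) = N y powr \<beta>" using N[of y] by (simp add: powr_mult_base)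
      thus "N y * (1 - p * (N y powr (\<beta> - 1) / a - 1)) = (1 + p) * N y - p / a * N y powr \<beta>"
        by (simp add: algebra_simps)
    qed
    also have "\<dots> = (1 + p) * m - p / a * (\<Sum>y\<in>S. N y powr \<beta>)"
      by (simp only: sum_subtractf sum_distrib_left m_def)
    also have "(\<Sum>y\<in>S. N y powr \<beta>) = a * m" using m by (simp add: a_def)
    also have "(1 + p) * m - p / a * (a * m) = m"
    proof -
      have "p / a * (a * m) = p * m" using a by simp
      thus ?thesis by (simp add: distrib_right)
    qed
    finally show ?thesis by simp
  qed
  also have "\<dots> \<le> (\<Sum>y\<in>S. N y * (N y powr (\<beta> - 1) / a) powr - p)"
  proof (intro sum_mono mult_left_mono tangent)
    show "0 < N y powr (\<beta> - 1) / a" "0 \<le> N y" if "y \<in> S" for y using N[OF that] a by simp_all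
  qed
  also have "\<dots> = (\<Sum>y\<in>S. a powr p * N y powr (1 + (1 - \<beta>) * p))"
  proof (intro sum.cong refl)
    fix y assume "y \<in> S"
    note Ny = N[OF this]
    have "(N y powr (\<beta> - 1) / a) powr - p = N y powr ((\<beta> - 1) * - p) / a powr - p"
      using a by (simp add: powr_divide powr_powr)
    also have "\<dots> = a powr p * N y powr ((1 - \<beta>) * p)"
      using a by (simp add: powr_minus field_simps)
    finally show "N y * (N y powr (\<beta> - 1) / a) powr - p = a powr p * N y powr (1 + (1 - \<beta>) * p)"
      using Ny by (simp add: powr_add)
  qed
  also have "\<dots> = a powr p * (\<Sum>y\<in>S. N y powr (1 + (1 - \<beta>) * p))" by (simp add: sum_distrib_left)
  finally have "m \<le> a powr p * (\<Sum>y\<in>S. N y powr (1 + (1 - \<beta>) * p))" .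
  thus ?thesis using a m unfolding a_def[symmetric] by (simp add: powr_minus field_simps)
qed

lemma scaled_power_sum_neg_power_le:
  assumes n: "n \<ge> 2" and p: "p > 0"
  shows "scaled_power_sum X \<beta> n \<omega> powr - p
    \<le> (\<Sum>y\<in>wrange X n \<omega>. real (ltime X n y \<omega>) powr (1 + (1 - \<beta>) * p)) * (ln (real n) powr ((\<beta> - 1) * p) / real n)"
proof -
  define l where "l = ln (real n)"
  have l: "l > 0" using n by (simp add: l_def)
  have pos: "real (ltime X n y \<omega>) > 0" if "y \<in> wrange X n \<omega>" for y
    using ltime_pos[OF that] by simp
  have ne: "wrange X n \<omega> \<noteq> {}" using n by (auto simp: wrange_def lessThan_empty_iff)
  have "scaled_power_sum X \<beta> n \<omega> powr - p
    = ((\<Sum>y\<in>wrange X n \<omega>. real (ltime X n y \<omega>) powr \<beta>) / real n) powr - p * l powr ((\<beta> - 1) * p)"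
  proof -
    define x where "x = (\<Sum>y\<in>wrange X n \<omega>. real (ltime X n y \<omega>) powr \<beta>) / real n"
    have x: "x \<ge> 0" by (simp add: x_def sum_nonneg)
    have "scaled_power_sum X \<beta> n \<omega> = x / l powr (\<beta> - 1)"
      by (simp add: scaled_power_sum_def l_def x_def)
    hence "scaled_power_sum X \<beta> n \<omega> powr - p = x powr - p / l powr ((\<beta> - 1) * - p)"
      using x by (simp add: powr_divide powr_powr)
    also have "l powr ((\<beta> - 1) * - p) = inverse (l powr ((\<beta> - 1) * p))"
      by (simp add: powr_minus)
    finally show ?thesis by (simp only: x_def divide_inverse inverse_inverse_eq)
  qed
  also have "\<dots> \<le> (\<Sum>y\<in>wrange X n \<omega>. real (ltime X n y \<omega>) powr (1 + (1 - \<beta>) * p)) / real n * l powr ((\<beta> - 1) * p)"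
    using neg_power_mean[of "wrange X n \<omega>" "\<lambda>y. real (ltime X n y \<omega>)" p \<beta>, OF finite_wrange ne pos p]
    by (intro mult_right_mono) (simp_all add: sum_ltime_eq)
  finally show ?thesis by (simp add: l_def)
qed

text \<open>From exp (- x) \<le> (p / x)^p, where \<beta> p \<ge> 2 makes the decay in t at least
  quadratic; for |t| \<le> 1 the rational factor is already at least 1.\<close>

lemma exp_neg_le_rational:
  fixes t :: real
  assumes c: "c > 0" and \<beta>: "\<beta> > 0" and p: "2 / \<beta> \<le> p" and U: "U > 0"
  shows "exp (- c * (\<bar>t\<bar> powr \<beta> * U)) \<le> 2 / (1 + t\<^sup>2) * (1 + (p / c) powr p * U powr - p)"
proof (cases "\<bar>t\<bar> \<le> 1")
  case True
  hence t2: "t\<^sup>2 \<le> 1" using power_mono[of "\<bar>t\<bar>" 1 2] by simp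
  have "exp (- c * (\<bar>t\<bar> powr \<beta> * U)) \<le> 1" using c U by simp
  also have "1 \<le> 2 / (1 + t\<^sup>2)" using t2 by (simp add: le_divide_eq add_pos_nonneg)
  also have "2 / (1 + t\<^sup>2) * 1 \<le> 2 / (1 + t\<^sup>2) * (1 + (p / c) powr p * U powr - p)"
    by (intro mult_left_mono) auto
  finally show ?thesis by simp
next
  case False
  define s where "s = \<bar>t\<bar>"
  have s: "s > 1" using False by (simp add: s_def)
  have p0: "p > 0" using \<beta> p by (smt (verit) divide_pos_pos)
  define x where "x = c * (s powr \<beta> * U)"
  have x: "x > 0" using c U s by (simp add: x_def)
  have "exp (- x) = exp (- x / p) powr p" using p0 by (simp add: powr_def)
  also have "\<dots> \<le> (p / x) powr p"
  proof (intro powr_mono2)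
    have "x / p \<le> exp (x / p)" using exp_ge_add_one_self[of "x / p"] by linarith
    hence "inverse (exp (x / p)) \<le> inverse (x / p)" using x p0 by (intro le_imp_inverse_le) auto
    thus "exp (- x / p) \<le> p / x" by (simp add: exp_minus)
  qed (use p0 in auto)
  also have "p / x = (p / c) * inverse U * s powr - \<beta>"
    using c U s by (simp add: x_def powr_minus field_simps)
  also have "\<dots> powr p = (p / c) powr p * U powr - p * s powr (- \<beta> * p)"
  proof -
    have "(x * y * z) powr p = x powr p * y powr p * z powr p" if "0 \<le> x" "0 \<le> y" "0 \<le> z" for x y z :: real
      using that by (simp add: powr_mult)
    from this[of "p / c" "inverse U" "s powr - \<beta>"]
    have "((p / c) * inverse U * s powr - \<beta>) powr p = (p / c) powr p * inverse U powr p * (s powr - \<beta>) powr p"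
      using c U p0 by simp
    moreover have "inverse U powr p = U powr - p"
    proof -
      have "inverse U = U powr - 1" using U by (simp add: powr_neg_one divide_inverse)
      hence "inverse U powr p = (U powr - 1) powr p" by (rule arg_cong)
      thus ?thesis by (simp only: powr_powr mult_minus_left mult_1)
    qed
    moreover have "(s powr - \<beta>) powr p = s powr (- \<beta> * p)" by (rule powr_powr)
    ultimately show ?thesis by (simp only:)
  qed
  also have "\<dots> \<le> (p / c) powr p * U powr - p * (2 / (1 + t\<^sup>2))"
  proof (intro mult_left_mono)
    have "2 \<le> \<beta> * p" using p \<beta> by (simp add: field_simps)
    hence "s powr (- \<beta> * p) \<le> s powr (- 2)" using s by (intro powr_mono) auto
    also have "\<dots> = 1 / t\<^sup>2" using s by (simp add: powr_minus powr_numeral s_def divide_inverse)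
    also have "\<dots> \<le> 2 / (1 + t\<^sup>2)"
    proof -
      have "1 < t\<^sup>2" using False one_less_power[of "\<bar>t\<bar>" 2] by simp
      thus ?thesis by (simp add: divide_simps add_pos_nonneg)
    qed
    finally show "s powr (- \<beta> * p) \<le> 2 / (1 + t\<^sup>2)" .
  qed auto
  also have "\<dots> \<le> 2 / (1 + t\<^sup>2) * (1 + (p / c) powr p * U powr - p)"
    by (simp add: distrib_left mult.commute)
  finally show ?thesis by (simp add: x_def s_def)
qed

lemma scaled_power_sum_nonneg: "scaled_power_sum X \<beta> n \<omega> \<ge> 0"
  by (simp add: scaled_power_sum_def sum_nonneg)

lemma scaled_power_sum_pos:
  assumes "n \<ge> 2"
  shows "scaled_power_sum X \<beta> n \<omega> > 0"
proof -
  have "(\<Sum>y\<in>wrange X n \<omega>. real (ltime X n y \<omega>) powr \<beta>) > 0"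
  proof (rule sum_pos)
    show "wrange X n \<omega> \<noteq> {}" using assms by (auto simp: wrange_def lessThan_empty_iff)
    show "0 < real (ltime X n y \<omega>) powr \<beta>" if "y \<in> wrange X n \<omega>" for y
      using ltime_pos[OF that] by simp
  qed simp
  thus ?thesis using assms by (simp add: scaled_power_sum_def)
qed

context lattice_walk
begin

lemma scaled_power_sum_integrable: "integrable M (scaled_power_sum X \<beta> n)"
  unfolding scaled_power_sum_def[abs_def]
  by (intro integrable_divide integrable_sum_ltime[of "\<lambda>j. real j powr \<beta>"])

text \<open>The exponent r is tuned so that the Jensen exponent 1 + (1 - \<beta>) r becomes one
  whose sum over sites is known: an integer at least 2 if \<beta> < 1, the exponent 1 with sum n if
  \<beta> = 1, the exponent 0 with sum equal to the range if \<beta> > 1.\<close>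

lemma scaled_power_sum_neg_moment:
  assumes \<beta>: "0 < \<beta>" "\<beta> \<le> 2"
  obtains r C where "2 / \<beta> \<le> r" "0 < r" "0 \<le> C"
    "\<forall>\<^sub>F n in sequentially. \<exists>G. integrable M G \<and> (\<forall>\<omega>. scaled_power_sum X \<beta> n \<omega> powr - r \<le> G \<omega>) \<and> expectation G \<le> C"
proof -
  define S where "S = (\<lambda>r n \<omega>. \<Sum>y\<in>wrange X n \<omega>. real (ltime X n y \<omega>) powr (1 + (1 - \<beta>) * r))"
  have ev: "\<forall>\<^sub>F n in sequentially. n \<ge> (2::nat)" by (rule eventually_ge_at_top)
  obtain r C where pC: "2 / \<beta> \<le> r" "0 < r" "0 \<le> C" "\<forall>\<^sub>F n in sequentially. expectation (S r n) \<le> C * real n * ln (real n) powr ((1 - \<beta>) * r)"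
  proof (cases \<beta> "1 :: real" rule: linorder_cases)
    case less
    \<comment> \<open>The choice gives q - 1 \<ge> 2 (1 - \<beta>) / \<beta>, which is 2 / \<beta>
      \<le> r; the offset 2 also makes r positive.\<close>
    define q where "q = nat \<lceil>2 * (1 - \<beta>) / \<beta>\<rceil> + 2"
    define r where "r = (real q - 1) / (1 - \<beta>)"
    have qp: "(1 - \<beta>) * r = real q - 1" using less by (simp add: r_def)
    have "2 * (1 - \<beta>) / \<beta> \<le> real q - 1" unfolding q_def by linarith
    hence "2 / \<beta> \<le> r" using less \<beta> by (simp add: r_def field_simps)
    moreover have "r > 0" using less by (simp add: r_def q_def)
    moreover obtain C where C: "C > 0" "\<forall>\<^sub>F n in sequentially. expectation (\<lambda>\<omega>. \<Sum>y\<in>wrange X n \<omega>. real (ltime X n y \<omega>) ^ q) \<le> C * real n * ln (real n) ^ (q - 1)"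
      by (rule expectation_power_sum_le[of q]) (auto simp: q_def)
    have "\<forall>\<^sub>F n in sequentially. expectation (S r n) \<le> C * real n * ln (real n) powr ((1 - \<beta>) * r)"
      using C(2) ev
    proof eventually_elim
      case (elim n)
      have "S r n = (\<lambda>\<omega>. \<Sum>y\<in>wrange X n \<omega>. real (ltime X n y \<omega>) ^ q)"
      proof (rule ext)
        fix \<omega>
        show "S r n \<omega> = (\<Sum>y\<in>wrange X n \<omega>. real (ltime X n y \<omega>) ^ q)"
          unfolding S_def qp using ltime_pos[of _ X n \<omega>] by (intro sum.cong refl) (force simp: powr_realpow[symmetric])
      qed
      moreover have "ln (real n) ^ (q - 1) = ln (real n) powr ((1 - \<beta>) * r)"
      proof -
        have "ln (real n) ^ (q - 1) = ln (real n) powr real (q - 1)" using elim by (intro powr_realpow[symmetric]) auto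
        also have "real (q - 1) = (1 - \<beta>) * r" unfolding qp by (simp add: q_def)
        finally show ?thesis .
      qed
      ultimately show ?case using elim by simp
    qed
    ultimately show ?thesis using that[of r C] C(1) by simp
  next
    case equal
    have "\<forall>\<^sub>F n in sequentially. expectation (S 2 n) \<le> 1 * real n * ln (real n) powr ((1 - \<beta>) * 2)"
      using ev by eventually_elim (simp add: S_def equal sum_ltime_eq prob_space)
    thus ?thesis using that[of 2 1] equal by simp
  next
    case greater
    \<comment> \<open>Here 2 / \<beta> \<le> r amounts to \<beta> \<le> 2, with equality at \<beta>
      = 2.\<close>
    define r where "r = 1 / (\<beta> - 1)"
    have qp: "(1 - \<beta>) * r = - 1" using greater by (simp add: r_def field_simps)
    obtain C where C: "C > 0" "\<forall>\<^sub>F n in sequentially. expectation (\<lambda>\<omega>. real (card (wrange X n \<omega>))) \<le> C * real n / ln (real n)"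
      by (rule expectation_range_le)
    have "\<forall>\<^sub>F n in sequentially. expectation (S r n) \<le> C * real n * ln (real n) powr ((1 - \<beta>) * r)"
      using C(2) ev
    proof eventually_elim
      case (elim n)
      have "S r n = (\<lambda>\<omega>. real (card (wrange X n \<omega>)))"
      proof (rule ext)
        fix \<omega>
        have "S r n \<omega> = (\<Sum>y\<in>wrange X n \<omega>. 1)"
          unfolding S_def qp using ltime_pos[of _ X n \<omega>] by (intro sum.cong refl) force
        thus "S r n \<omega> = real (card (wrange X n \<omega>))" by simp
      qed
      thus ?case using elim by (simp add: qp powr_minus divide_inverse)
    qed
    moreover have "2 / \<beta> \<le> r" "r > 0" using greater \<beta> by (simp_all add: r_def field_simps)
    ultimately show ?thesis using that[of r C] C(1) by simp
  qed
  have "\<forall>\<^sub>F n in sequentially. \<exists>G. integrable M G \<and> (\<forall>\<omega>. scaled_power_sum X \<beta> n \<omega> powr - r \<le> G \<omega>) \<and> expectation G \<le> C"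
    using pC(4) ev
  proof eventually_elim
    case (elim n)
    define k where "k = ln (real n) powr ((\<beta> - 1) * r) / real n"
    have k: "k \<ge> 0" by (simp add: k_def)
    have Si: "integrable M (S r n)" unfolding S_def
      by (rule integrable_sum_ltime[of "\<lambda>j. real j powr (1 + (1 - \<beta>) * r)"])
    have "expectation (\<lambda>\<omega>. S r n \<omega> * k) \<le> C"
    proof -
      have "expectation (\<lambda>\<omega>. S r n \<omega> * k) = expectation (S r n) * k" by simp
      also have "\<dots> \<le> C * real n * ln (real n) powr ((1 - \<beta>) * r) * k" using elim k by (intro mult_right_mono)
      also have "\<dots> = C * (ln (real n) powr ((1 - \<beta>) * r) * ln (real n) powr ((\<beta> - 1) * r))"
        using elim by (simp add: k_def)
      also have "\<dots> = C" using elim by (simp add: powr_add[symmetric] algebra_simps)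
      finally show ?thesis .
    qed
    moreover have "scaled_power_sum X \<beta> n \<omega> powr - r \<le> S r n \<omega> * k" for \<omega>
      unfolding S_def k_def by (rule scaled_power_sum_neg_power_le[OF elim(2) pC(2)])
    ultimately show ?case using Si by (intro exI[of _ "\<lambda>\<omega>. S r n \<omega> * k"]) auto
  qed
  thus ?thesis using that pC by blast
qed

section \<open>Sites visited often\<close>

text \<open>The threshold is far above the logarithmic size of typical local times, so the event is
  rarer than any power of n, and far below the norming, so that off it all arguments
  \<open>t / norming \<beta> n * ltime\<close> tend to 0 uniformly over the sites.\<close>

definition crowded :: "nat \<Rightarrow> 'w set" where
  "crowded n = {\<omega>\<in>space M. \<exists>y\<in>wrange X n \<omega>. real n powr (1 / 4) < real (ltime X n y \<omega>)}"

lemma crowded_eq: "crowded n = {\<omega>\<in>space M. \<exists>y\<in>wrange X n \<omega>. Suc (nat \<lfloor>real n powr (1 / 4)\<rfloor>) \<le> ltime X n y \<omega>}"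
proof -
  have "real n powr (1 / 4) < real k \<longleftrightarrow> Suc (nat \<lfloor>real n powr (1 / 4)\<rfloor>) \<le> k" for k
  proof -
    have "real n powr (1 / 4) \<ge> 0" by simp
    thus ?thesis by linarith
  qed
  thus ?thesis by (simp add: crowded_def)
qed

lemma crowded_sets [measurable]: "crowded n \<in> events"
proof -
  have "crowded n = {\<omega>\<in>space M. \<exists>y. real n powr (1 / 4) < real (ltime X n y \<omega>)}"
  proof -
    have "y \<in> wrange X n \<omega>" if "real n powr (1 / 4) < real (ltime X n y \<omega>)" for y \<omega>
    proof -
      have "0 \<le> real n powr (1 / 4)" by simp
      hence "ltime X n y \<omega> \<noteq> 0" using that by linarith
      hence "{k. k < n \<and> walk X k \<omega> = y} \<noteq> {}" unfolding ltime_def by (metis card.empty)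
      thus ?thesis by (auto simp: wrange_def)
    qed
    thus ?thesis unfolding crowded_def by blast
  qed
  thus ?thesis by simp
qed

lemma prob_crowded_le:
  "\<forall>\<^sub>F n in sequentially. prob (crowded n) \<le> real n * exp (- (real n powr (1 / 4) - 1) * lam / (2 * ln (real n)))"
  using escape_ge_ev eventually_ge_at_top[of 2]
proof eventually_elim
  case (elim n)
  define j where "j = nat \<lfloor>real n powr (1 / 4)\<rfloor>"
  have j: "real n powr (1 / 4) - 1 \<le> real j" unfolding j_def by linarith
  have "prob (crowded n) \<le> real n * (1 - escape p n) ^ j"
    unfolding crowded_eq j_def[symmetric] by (rule prob_ltime_large)
  also have "\<dots> \<le> real n * exp (- escape p n) ^ j"
    using exp_ge_add_one_self[of "- escape p n"] by (intro mult_left_mono power_mono) auto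
  also have "exp (- escape p n) ^ j = exp (- (real j * escape p n))"
    using exp_of_nat_mult[of j "- escape p n", symmetric] by (simp only: mult_minus_right)
  also have "real n * \<dots> \<le> real n * exp (- (real n powr (1 / 4) - 1) * lam / (2 * ln (real n)))"
  proof (intro mult_left_mono)
    have "(real n powr (1 / 4) - 1) * (lam / (2 * ln (real n))) \<le> real j * (lam / (2 * ln (real n)))"
      using j elim lam by (intro mult_right_mono) auto
    also have "\<dots> \<le> real j * escape p n" using elim by (intro mult_left_mono) auto
    finally have "(real n powr (1 / 4) - 1) * (lam / (2 * ln (real n))) \<le> real j * escape p n" .
    moreover have "- x * lam / z = - (x * (lam / z))" for x z by simp
    ultimately show "exp (- (real j * escape p n)) \<le> exp (- (real n powr (1 / 4) - 1) * lam / (2 * ln (real n)))"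
      by (simp only: exp_le_cancel_iff neg_le_iff_le)
  qed auto
  finally show ?case .
qed

lemma prod_ltime_measurable:
  fixes F :: "nat \<Rightarrow> complex"
  shows "(\<lambda>\<omega>. \<Prod>y\<in>wrange X n \<omega>. F (ltime X n y \<omega>)) \<in> borel_measurable M"
proof -
  define w where "w = (\<lambda>xs k. sum_list (take k (xs :: (int ^ 'd) list)))"
  have W: "walk X k \<omega> = w (steps X 0 n \<omega>) k" if "k < n" for k \<omega>
    using walk_add_steps[of k n X 0 \<omega>] that by (simp add: w_def walk_def)
  have "(\<Prod>y\<in>wrange X n \<omega>. F (ltime X n y \<omega>)) = (\<lambda>xs. \<Prod>y\<in>w xs ` {..<n}. F (card {k. k < n \<and> w xs k = y})) (steps X 0 n \<omega>)" for \<omega>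
    unfolding wrange_def ltime_def using W[of _ \<omega>] by (intro prod.cong arg_cong[where f=F] arg_cong[where f=card]) (auto simp: image_iff)
  thus ?thesis by (simp add: measurable_compose[OF steps_measurable])
qed

end

lemma norm_exp_diff_le:
  fixes z w :: complex
  assumes "Re z \<le> 0" "Re w \<le> 0"
  shows "norm (exp z - exp w) \<le> norm (z - w)"
proof -
  have "norm (exp z - exp w) \<le> 1 * norm (z - w)"
  proof (rule field_differentiable_bound[where S="{z. Re z \<le> 0}" and f'=exp])
    show "convex {z. Re z \<le> 0}" by (rule convex_halfspace_Re_le)
    show "(exp has_field_derivative exp x) (at x within {z. Re z \<le> 0})" for x :: complex
      by (rule has_field_derivative_at_within[OF DERIV_exp])
    show "norm (exp x) \<le> 1" if "x \<in> {z. Re z \<le> 0}" for x using that by simp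
    show "z \<in> {z. Re z \<le> 0}" "w \<in> {z. Re z \<le> 0}" using assms by simp_all
  qed
  thus ?thesis by simp
qed

section \<open>Norming\<close>

lemma norming_pos: "n \<ge> 2 \<Longrightarrow> norming \<beta> n > 0"
  by (simp add: norming_def)

lemma norming_powr:
  assumes "n \<ge> 2" "\<beta> > 0"
  shows "norming \<beta> n powr \<beta> = real n * ln (real n) powr (\<beta> - 1)"
  using assms by (simp add: norming_def powr_mult powr_powr)

lemma norming_eq: "\<beta> > 0 \<Longrightarrow> norming \<beta> n = real n powr (1 / \<beta>) * ln (real n) powr (1 - 1 / \<beta>)"
  by (simp add: norming_def diff_divide_distrib)

lemma
  assumes "0 < \<beta>" "\<beta> \<le> 2"
  shows filterlim_norming: "filterlim (norming \<beta>) at_top sequentially"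
    and norming_dominates: "(\<lambda>n. real n powr (1 / 4) / norming \<beta> n) \<longlonglongrightarrow> 0"
    and norming_exp1: "c > 0 \<Longrightarrow> (\<lambda>n. norming \<beta> n * exp (- c * real n powr (1 / 4))) \<longlonglongrightarrow> 0"
    and norming_exp2: "c > 0 \<Longrightarrow> (\<lambda>n. norming \<beta> n * (real n * exp (- (real n powr (1 / 4) - 1) * c / (2 * ln (real n))))) \<longlonglongrightarrow> 0"
proof -
  define a where "a = 1 / \<beta>"
  have a: "a > 1 / 4" "a > 0" using assms by (auto simp: a_def field_simps)
  have eq: "norming \<beta> = (\<lambda>n. real n powr a * ln (real n) powr (1 - a))"
    using assms by (simp add: norming_eq a_def fun_eq_iff)
  show "filterlim (norming \<beta>) at_top sequentially" unfolding eq using a by real_asymp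
  show "(\<lambda>n. real n powr (1 / 4) / norming \<beta> n) \<longlonglongrightarrow> 0" unfolding eq using a by real_asymp
  show "(\<lambda>n. norming \<beta> n * exp (- c * real n powr (1 / 4))) \<longlonglongrightarrow> 0" if "c > 0"
    unfolding eq using that a by real_asymp
  show "(\<lambda>n. norming \<beta> n * (real n * exp (- (real n powr (1 / 4) - 1) * c / (2 * ln (real n))))) \<longlonglongrightarrow> 0" if "c > 0"
  proof (rule tendsto_sandwich[OF _ _ tendsto_const])
    \<comment> \<open>Lowering the exponent from 1/4 to 1/8 absorbs the logarithm and every
      constant.\<close>
    have "\<forall>\<^sub>F n in sequentially. real n powr (1 / 8) \<le> (real n powr (1 / 4) - 1) * c / (2 * ln (real n))"
      using that by real_asymp
    thus "\<forall>\<^sub>F n in sequentially. norming \<beta> n * (real n * exp (- (real n powr (1 / 4) - 1) * c / (2 * ln (real n)))) \<le> norming \<beta> n * (real n * exp (- (real n powr (1 / 8))))"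
    proof eventually_elim
      case (elim n)
      moreover have "- x * c / z = - (x * c / z)" for x z by simp
      ultimately show ?case by (intro mult_left_mono) (simp_all only: exp_le_cancel_iff neg_le_iff_le of_nat_0_le_iff, simp add: norming_def)
    qed
    show "(\<lambda>n. norming \<beta> n * (real n * exp (- (real n powr (1 / 8))))) \<longlonglongrightarrow> 0"
      unfolding eq using a by real_asymp
    show "\<forall>\<^sub>F n in sequentially. 0 \<le> norming \<beta> n * (real n * exp (- (real n powr (1 / 4) - 1) * c / (2 * ln (real n))))"
      by (intro always_eventually allI) (simp add: norming_def)
  qed
qed

section \<open>The decay exponent\<close>

text \<open>The bounds on the local times and on t / b_n multiply to 1, so the truncation in the
  decay bound is inactive and the exponent is exactly a multiple of the scaled power sum.\<close>

lemma decay_exponent_small: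
  assumes n: "n \<ge> 2" and \<beta>: "0 < \<beta>"
    and good: "\<And>y. y \<in> wrange X n \<omega> \<Longrightarrow> real (ltime X n y \<omega>) \<le> real n powr (1 / 4)"
    and t: "\<bar>t / norming \<beta> n\<bar> \<le> real n powr (- 1 / 4)"
  shows "(\<Sum>y\<in>wrange X n \<omega>. min \<bar>t / norming \<beta> n * real (ltime X n y \<omega>)\<bar> 1 powr \<beta>) = \<bar>t\<bar> powr \<beta> * scaled_power_sum X \<beta> n \<omega>"
proof -
  have b: "norming \<beta> n > 0" by (rule norming_pos[OF n])
  have "min \<bar>t / norming \<beta> n * real (ltime X n y \<omega>)\<bar> 1 powr \<beta>
    = \<bar>t\<bar> powr \<beta> / norming \<beta> n powr \<beta> * real (ltime X n y \<omega>) powr \<beta>" if y: "y \<in> wrange X n \<omega>" for y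
  proof -
    have "\<bar>t / norming \<beta> n * real (ltime X n y \<omega>)\<bar> \<le> real n powr (- 1 / 4) * real n powr (1 / 4)"
      unfolding abs_mult using t good[OF y] by (intro mult_mono) auto
    also have "\<dots> = 1" using n by (simp add: powr_add[symmetric])
    finally have "min \<bar>t / norming \<beta> n * real (ltime X n y \<omega>)\<bar> 1 = \<bar>t\<bar> / norming \<beta> n * real (ltime X n y \<omega>)"
      using b by (simp add: abs_mult)
    thus ?thesis using b by (simp add: powr_mult powr_divide)
  qed
  hence "(\<Sum>y\<in>wrange X n \<omega>. min \<bar>t / norming \<beta> n * real (ltime X n y \<omega>)\<bar> 1 powr \<beta>)
    = \<bar>t\<bar> powr \<beta> / norming \<beta> n powr \<beta> * (\<Sum>y\<in>wrange X n \<omega>. real (ltime X n y \<omega>) powr \<beta>)"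
    by (simp add: sum_distrib_left)
  thus ?thesis using norming_powr[OF n \<beta>] by (simp add: scaled_power_sum_def)
qed

text \<open>Local times sum to n and none exceeds n^(1/4), so at least n^(3/4) sites are visited.
  Each of them contributes at least n^(- \<beta> / 4), which is at least n^(-1/2) because \<beta>
  \<le> 2.\<close>

lemma decay_exponent_large:
  assumes n: "n \<ge> 2" and \<beta>: "0 < \<beta>" "\<beta> \<le> 2"
    and good: "\<And>y. y \<in> wrange X n \<omega> \<Longrightarrow> real (ltime X n y \<omega>) \<le> real n powr (1 / 4)"
    and t: "\<bar>t / norming \<beta> n\<bar> \<ge> real n powr (- 1 / 4)"
  shows "real n powr (1 / 4) \<le> (\<Sum>y\<in>wrange X n \<omega>. min \<bar>t / norming \<beta> n * real (ltime X n y \<omega>)\<bar> 1 powr \<beta>)"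
proof -
  define R where "R = real (card (wrange X n \<omega>))"
  have "real n = (\<Sum>y\<in>wrange X n \<omega>. real (ltime X n y \<omega>))" by (simp add: sum_ltime_eq)
  also have "\<dots> \<le> (\<Sum>y\<in>wrange X n \<omega>. real n powr (1 / 4))" by (intro sum_mono good)
  also have "\<dots> = R * real n powr (1 / 4)" by (simp add: R_def)
  finally have "real n * real n powr (- 3 / 4) \<le> R * real n powr (1 / 4) * real n powr (- 3 / 4)"
    by (intro mult_right_mono) auto
  moreover have "real n * real n powr (- 3 / 4) = real n powr (1 / 4)"
    using n powr_add[of "real n" 1 "- 3 / 4"] by simp
  moreover have "real n powr (1 / 4) * real n powr (- 3 / 4) = real n powr (- 1 / 2)"
    by (simp add: powr_add[symmetric])
  ultimately have "real n powr (1 / 4) \<le> R * real n powr (- 1 / 2)" by (simp add: mult.assoc)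
  also have "\<dots> = (\<Sum>y\<in>wrange X n \<omega>. real n powr (- 1 / 2))" by (simp add: R_def)
  also have "\<dots> \<le> (\<Sum>y\<in>wrange X n \<omega>. min \<bar>t / norming \<beta> n * real (ltime X n y \<omega>)\<bar> 1 powr \<beta>)"
  proof (intro sum_mono)
    fix y assume y: "y \<in> wrange X n \<omega>"
    have "real n powr (- 1 / 4) * 1 \<le> \<bar>t / norming \<beta> n\<bar> * real (ltime X n y \<omega>)"
      using t ltime_pos[OF y] by (intro mult_mono) auto
    hence 1: "real n powr (- 1 / 4) \<le> \<bar>t / norming \<beta> n * real (ltime X n y \<omega>)\<bar>" by (simp add: abs_mult)
    have "real n powr (- 1 / 4) \<le> real n powr 0" using n by (intro powr_mono) auto
    hence 2: "real n powr (- 1 / 4) \<le> min \<bar>t / norming \<beta> n * real (ltime X n y \<omega>)\<bar> 1" using 1 n by simp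
    have "real n powr (- 1 / 2) \<le> real n powr (- 1 / 4 * \<beta>)" using n \<beta> by (intro powr_mono) auto
    also have "\<dots> = (real n powr (- 1 / 4)) powr \<beta>" by (simp add: powr_powr)
    also have "\<dots> \<le> min \<bar>t / norming \<beta> n * real (ltime X n y \<omega>)\<bar> 1 powr \<beta>"
      using 2 \<beta> by (intro powr_mono2) auto
    finally show "real n powr (- 1 / 2) \<le> min \<bar>t / norming \<beta> n * real (ltime X n y \<omega>)\<bar> 1 powr \<beta>" .
  qed
  finally show ?thesis .
qed

section \<open>Convergence of the characteristic functions\<close>

locale scenery_walk = lattice_walk M X p lam
  for M :: "'w measure" and X :: "nat \<Rightarrow> 'w \<Rightarrow> int ^ 'd" and p lam +
  fixes \<nu> \<mu> :: "real measure" and \<beta> A\<^sub>1 A\<^sub>2 :: real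
  assumes \<nu>: "real_distribution \<nu>" and stable: "strictly_stable \<beta> A\<^sub>1 A\<^sub>2 \<mu>"
    and nda: "normal_domain_of_attraction \<nu> \<beta> \<mu>" and snl: "strongly_nonlattice \<nu>"
begin

text \<open>The characteristic function of Z_n / b_n at t, conditional on the walk.\<close>

definition char_prod :: "nat \<Rightarrow> real \<Rightarrow> 'w \<Rightarrow> complex" where
  "char_prod n t \<omega> = (\<Prod>y\<in>wrange X n \<omega>. char \<nu> (t / norming \<beta> n * real (ltime X n y \<omega>)))"

definition limit_scale :: real where
  "limit_scale = Gamma (\<beta> + 1) / lam powr (\<beta> - 1)"

lemma \<beta>: "0 < \<beta>" "\<beta> \<le> 2" and A\<^sub>1: "0 < A\<^sub>1"
  using stable by (auto simp: strictly_stable_def)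

lemma limit_scale_pos: "limit_scale > 0"
  using \<beta> lam by (simp add: limit_scale_def Gamma_real_pos)

lemma crowded_integrable: "integrable M (indicator (crowded n) :: 'w \<Rightarrow> real)"
  by (intro integrable_const_bound[where B=1] borel_measurable_indicator crowded_sets AE_I2) (simp add: indicator_def)

lemma norm_char_prod_le: "norm (char_prod n t \<omega>) \<le> 1"
proof -
  interpret \<nu>: real_distribution \<nu> by (rule \<nu>)
  show ?thesis unfolding char_prod_def prod_norm[symmetric] by (intro prod_le_1) (auto simp: \<nu>.cmod_char_le_1)
qed

lemma char_prod_measurable [measurable]: "char_prod n t \<in> borel_measurable M"
  unfolding char_prod_def[abs_def] by (rule prod_ltime_measurable[of "\<lambda>k. char \<nu> (t / norming \<beta> n * real k)"])

lemma char_prod_integrable: "integrable M (char_prod n t)"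
  by (intro integrable_const_bound[where B=1]) (auto simp: norm_char_prod_le)

text \<open>A pointwise estimate integrated. The crowded event costs its probability since the
  product has modulus at most 1; off it, small t / b_n is paid for by the negative moment and large
  t / b_n by exp (- c n^(1/4)). Adding all the costs avoids a case distinction in t after
  integration.\<close>

lemma char_prod_bound:
  obtains c D where "c > 0" "D \<ge> 0"
    "\<forall>\<^sub>F n in sequentially. \<forall>t. norm (expectation (char_prod n t)) \<le> D / (1 + t\<^sup>2) + (exp (- c * real n powr (1 / 4)) + prob (crowded n))"
proof -
  obtain c where c: "c > 0" "\<And>v. norm (char \<nu> v) \<le> exp (- c * min \<bar>v\<bar> 1 powr \<beta>)"
    using char_decay_bound[OF \<nu> stable nda snl] by blast
  obtain q C where qC: "2 / \<beta> \<le> q" "0 < q" "0 \<le> C"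
    "\<forall>\<^sub>F n in sequentially. \<exists>G. integrable M G \<and> (\<forall>\<omega>. scaled_power_sum X \<beta> n \<omega> powr - q \<le> G \<omega>) \<and> expectation G \<le> C"
    using scaled_power_sum_neg_moment[OF \<beta>] by blast
  define K where "K = (q / c) powr q"
  have K: "K \<ge> 0" by (simp add: K_def)
  define D where "D = 2 * (1 + K * C)"
  have D: "D \<ge> 0" using K qC(3) by (simp add: D_def)
  have "\<forall>\<^sub>F n in sequentially. \<forall>t. norm (expectation (char_prod n t)) \<le> D / (1 + t\<^sup>2) + (exp (- c * real n powr (1 / 4)) + prob (crowded n))"
    using qC(4) eventually_ge_at_top[of 2]
  proof eventually_elim
    case (elim n)
    then obtain G where G: "integrable M G" "\<And>\<omega>. scaled_power_sum X \<beta> n \<omega> powr - q \<le> G \<omega>" "expectation G \<le> C" by blast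
    show ?case
    proof
      fix t :: real
      have pw: "norm (char_prod n t \<omega>) \<le> 2 / (1 + t\<^sup>2) * (1 + K * G \<omega>) + exp (- c * real n powr (1 / 4)) + indicator (crowded n) \<omega>"
        if \<omega>: "\<omega> \<in> space M" for \<omega>
      proof (cases "\<omega> \<in> crowded n")
        case True
        have "0 \<le> G \<omega>" by (rule order.trans[OF _ G(2)]) simp
        hence "0 \<le> 2 / (1 + t\<^sup>2) * (1 + K * G \<omega>)" using K by (simp add: add_nonneg_nonneg)
        thus ?thesis using True norm_char_prod_le[of n t \<omega>] by (simp add: add_increasing)
      next
        case False
        hence good: "real (ltime X n y \<omega>) \<le> real n powr (1 / 4)" if "y \<in> wrange X n \<omega>" for y
          using \<omega> that by (force simp: crowded_def not_less)
        define W where "W = (\<Sum>y\<in>wrange X n \<omega>. min \<bar>t / norming \<beta> n * real (ltime X n y \<omega>)\<bar> 1 powr \<beta>)"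
        have "norm (char_prod n t \<omega>) \<le> (\<Prod>y\<in>wrange X n \<omega>. exp (- c * min \<bar>t / norming \<beta> n * real (ltime X n y \<omega>)\<bar> 1 powr \<beta>))"
          unfolding char_prod_def prod_norm[symmetric] by (intro prod_mono conjI c(2) norm_ge_zero)
        also have "\<dots> = exp (- c * W)" by (simp add: exp_sum[symmetric] W_def sum_distrib_left)
        also have "\<dots> \<le> 2 / (1 + t\<^sup>2) * (1 + K * G \<omega>) + exp (- c * real n powr (1 / 4))"
        proof (cases "\<bar>t / norming \<beta> n\<bar> \<le> real n powr (- 1 / 4)")
          case True
          have "exp (- c * W) = exp (- c * (\<bar>t\<bar> powr \<beta> * scaled_power_sum X \<beta> n \<omega>))"
            unfolding W_def using decay_exponent_small[OF elim(2) \<beta>(1) good True] by simp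
          also have "\<dots> \<le> 2 / (1 + t\<^sup>2) * (1 + K * scaled_power_sum X \<beta> n \<omega> powr - q)"
            unfolding K_def by (rule exp_neg_le_rational[OF c(1) \<beta>(1) qC(1) scaled_power_sum_pos[OF elim(2)]])
          also have "\<dots> \<le> 2 / (1 + t\<^sup>2) * (1 + K * G \<omega>)"
            using K G(2)[of \<omega>] by (intro mult_left_mono add_left_mono) auto
          finally show ?thesis by (simp add: add_increasing2)
        next
          case False
          hence "real n powr (1 / 4) \<le> W"
            unfolding W_def by (intro decay_exponent_large[OF elim(2) \<beta> good]) auto
          hence "exp (- c * W) \<le> exp (- c * real n powr (1 / 4))" using c(1) by simp
          moreover have "0 \<le> G \<omega>" by (rule order.trans[OF _ G(2)]) simp
          hence "0 \<le> 2 / (1 + t\<^sup>2) * (1 + K * G \<omega>)" using K by (simp add: add_nonneg_nonneg)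
          ultimately show ?thesis by linarith
        qed
        finally show ?thesis using False by simp
      qed
      have "norm (expectation (char_prod n t)) \<le> expectation (\<lambda>\<omega>. norm (char_prod n t \<omega>))"
        by (rule integral_norm_bound)
      also have "\<dots> \<le> expectation (\<lambda>\<omega>. 2 / (1 + t\<^sup>2) * (1 + K * G \<omega>) + exp (- c * real n powr (1 / 4)) + indicator (crowded n) \<omega>)"
      proof (rule integral_mono[OF integrable_norm[OF char_prod_integrable] _ pw])
        show "integrable M (\<lambda>\<omega>. 2 / (1 + t\<^sup>2) * (1 + K * G \<omega>) + exp (- c * real n powr (1 / 4)) + indicator (crowded n) \<omega>)"
          by (intro Bochner_Integration.integrable_add integrable_mult_right G(1) crowded_integrable integrable_const)
      qed
      also have "\<dots> = 2 / (1 + t\<^sup>2) * (1 + K * expectation G) + exp (- c * real n powr (1 / 4)) + prob (crowded n)"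
      proof -
        have "expectation (\<lambda>\<omega>. u * (1 + K * G \<omega>) + v + indicator (crowded n) \<omega>) = u * (1 + K * expectation G) + v + prob (crowded n)" for u v
          using G(1) crowded_integrable by (simp add: prob_space)
        thus ?thesis .
      qed
      also have "\<dots> \<le> 2 / (1 + t\<^sup>2) * (1 + K * C) + exp (- c * real n powr (1 / 4)) + prob (crowded n)"
        using G(3) K by (intro add_right_mono mult_left_mono add_left_mono) auto
      finally show "norm (expectation (char_prod n t)) \<le> D / (1 + t\<^sup>2) + (exp (- c * real n powr (1 / 4)) + prob (crowded n))"
        by (simp add: D_def)
    qed
  qed
  thus ?thesis using that c(1) D by blast
qed

lemma norming_crowded: "(\<lambda>n. norming \<beta> n * prob (crowded n)) \<longlonglongrightarrow> 0"
proof (rule tendsto_sandwich[OF _ _ tendsto_const norming_exp2[OF \<beta> lam]])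
  show "\<forall>\<^sub>F n in sequentially. 0 \<le> norming \<beta> n * prob (crowded n)"
    by (intro always_eventually allI) (simp add: norming_def)
  show "\<forall>\<^sub>F n in sequentially. norming \<beta> n * prob (crowded n) \<le> norming \<beta> n * (real n * exp (- (real n powr (1 / 4) - 1) * lam / (2 * ln (real n))))"
    using prob_crowded_le by eventually_elim (intro mult_left_mono, auto simp: norming_def)
qed

lemma prob_crowded_tendsto: "(\<lambda>n. prob (crowded n)) \<longlonglongrightarrow> 0"
proof -
  have "(\<lambda>n. norming \<beta> n * prob (crowded n) * (1 / norming \<beta> n)) \<longlonglongrightarrow> 0 * 0"
    by (intro tendsto_mult norming_crowded tendsto_divide_0[OF tendsto_const] filterlim_at_top_imp_at_infinity filterlim_norming \<beta>)
  hence "(\<lambda>n. norming \<beta> n * prob (crowded n) * (1 / norming \<beta> n)) \<longlonglongrightarrow> 0" by simp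
  thus ?thesis
  proof (rule Lim_transform_eventually)
    show "\<forall>\<^sub>F n in sequentially. norming \<beta> n * prob (crowded n) * (1 / norming \<beta> n) = prob (crowded n)"
      using eventually_ge_at_top[of 2]
    proof eventually_elim
      case (elim n)
      show ?case using norming_pos[OF elim, of \<beta>] by simp
    qed
  qed
qed

definition limit_char :: "real \<Rightarrow> complex" where
  "limit_char t = exp (- (of_real (\<bar>t\<bar> powr \<beta>) * (of_real limit_scale * (of_real A\<^sub>1 + \<i> * of_real (A\<^sub>2 * sgn t)))))"

text \<open>The site errors in the stable expansion are relative to |v|^\<beta>. Weighted by a y
  they add up to at most e times the scaled power sum, so the number of visited sites does not
  enter.\<close>

lemma char_prod_expansion:
  assumes e: "e > 0"
  shows "\<forall>\<^sub>F n in sequentially. \<forall>\<omega>\<in>space M - crowded n. \<exists>r. norm r \<le> e * scaled_power_sum X \<beta> n \<omega> \<and>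
    char_prod n t \<omega> = exp (- (of_real (\<bar>t\<bar> powr \<beta>) * (of_real (scaled_power_sum X \<beta> n \<omega>) * (of_real A\<^sub>1 + \<i> * of_real (A\<^sub>2 * sgn t)) + r)))"
proof -
  define \<zeta> where "\<zeta> = of_real A\<^sub>1 + \<i> * of_real (A\<^sub>2 * sgn t)"
  obtain \<delta> where \<delta>: "\<delta> > 0" "\<And>v. \<bar>v\<bar> \<le> \<delta> \<Longrightarrow> \<exists>r. norm r \<le> e \<and>
    char \<nu> v = exp (- (of_real (\<bar>v\<bar> powr \<beta>) * (of_real A\<^sub>1 + \<i> * of_real (A\<^sub>2 * sgn v) + r)))"
    using stable_char_expansion[OF \<nu> stable nda e] by blast
  have "(\<lambda>n. \<bar>t\<bar> * (real n powr (1 / 4) / norming \<beta> n)) \<longlonglongrightarrow> \<bar>t\<bar> * 0"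
    by (intro tendsto_intros norming_dominates \<beta>)
  hence "\<forall>\<^sub>F n in sequentially. \<bar>t\<bar> * (real n powr (1 / 4) / norming \<beta> n) < \<delta>"
    by (rule order_tendstoD(2)) (use \<delta>(1) in simp)
  thus ?thesis using eventually_ge_at_top[of 2]
  proof eventually_elim
    case (elim n)
    have b: "norming \<beta> n > 0" by (rule norming_pos[OF elim(2)])
    show ?case unfolding \<zeta>_def[symmetric]
    proof
      fix \<omega> assume \<omega>: "\<omega> \<in> space M - crowded n"
      define U where "U = scaled_power_sum X \<beta> n \<omega>"
      define a where "a = (\<lambda>y. real (ltime X n y \<omega>) powr \<beta> / norming \<beta> n powr \<beta>)"
      have Ua: "U = (\<Sum>y\<in>wrange X n \<omega>. a y)"
        by (simp add: U_def scaled_power_sum_def a_def norming_powr[OF elim(2) \<beta>(1)] sum_divide_distrib)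
      have "\<exists>r. norm r \<le> e \<and> char \<nu> (t / norming \<beta> n * real (ltime X n y \<omega>)) = exp (- (of_real (\<bar>t\<bar> powr \<beta> * a y) * (\<zeta> + r)))"
        if y: "y \<in> wrange X n \<omega>" for y
      proof -
        define v where "v = t / norming \<beta> n * real (ltime X n y \<omega>)"
        have N: "1 \<le> ltime X n y \<omega>" by (rule ltime_pos[OF y])
        have "\<bar>v\<bar> = \<bar>t\<bar> * (real (ltime X n y \<omega>) / norming \<beta> n)" using b by (simp add: v_def abs_mult)
        also have "\<dots> \<le> \<bar>t\<bar> * (real n powr (1 / 4) / norming \<beta> n)"
          using \<omega> y b by (intro mult_left_mono divide_right_mono) (auto simp: crowded_def not_less)
        finally have "\<bar>v\<bar> \<le> \<delta>" using elim(1) by linarith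
        then obtain r where r: "norm r \<le> e" "char \<nu> v = exp (- (of_real (\<bar>v\<bar> powr \<beta>) * (of_real A\<^sub>1 + \<i> * of_real (A\<^sub>2 * sgn v) + r)))"
          using \<delta>(2) by blast
        have "sgn v = sgn t" using b N by (simp add: v_def sgn_mult sgn_divide)
        moreover have "\<bar>v\<bar> powr \<beta> = \<bar>t\<bar> powr \<beta> * a y"
          using b by (simp add: v_def a_def abs_mult powr_mult powr_divide)
        ultimately show ?thesis using r unfolding v_def[symmetric] by (auto simp: \<zeta>_def)
      qed
      then obtain r where r: "\<And>y. y \<in> wrange X n \<omega> \<Longrightarrow> norm (r y) \<le> e"
        "\<And>y. y \<in> wrange X n \<omega> \<Longrightarrow> char \<nu> (t / norming \<beta> n * real (ltime X n y \<omega>)) = exp (- (of_real (\<bar>t\<bar> powr \<beta> * a y) * (\<zeta> + r y)))"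
        by metis
      define E where "E = (\<Sum>y\<in>wrange X n \<omega>. of_real (a y) * r y)"
      have "norm E \<le> (\<Sum>y\<in>wrange X n \<omega>. e * a y)"
        unfolding E_def
      proof (rule sum_norm_le)
        fix y assume y: "y \<in> wrange X n \<omega>"
        have a0: "a y \<ge> 0" by (simp add: a_def)
        have "a y * norm (r y) \<le> a y * e" using r(1)[OF y] a0 by (intro mult_left_mono)
        thus "norm (of_real (a y) * r y) \<le> e * a y"
          by (simp only: norm_mult norm_of_real abs_of_nonneg[OF a0] mult.commute[of e])
      qed
      hence "norm E \<le> e * U" by (simp add: Ua sum_distrib_left)
      moreover have "char_prod n t \<omega> = exp (- (of_real (\<bar>t\<bar> powr \<beta>) * (of_real U * \<zeta> + E)))"
      proof -
        have "char_prod n t \<omega> = (\<Prod>y\<in>wrange X n \<omega>. exp (- (of_real (\<bar>t\<bar> powr \<beta> * a y) * (\<zeta> + r y))))"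
          unfolding char_prod_def by (intro prod.cong refl r(2))
        also have "\<dots> = exp (\<Sum>y\<in>wrange X n \<omega>. - (of_real (\<bar>t\<bar> powr \<beta> * a y) * (\<zeta> + r y)))"
          by (rule exp_sum[symmetric]) simp
        also have "(\<Sum>y\<in>wrange X n \<omega>. - (of_real (\<bar>t\<bar> powr \<beta> * a y) * (\<zeta> + r y))) = - (of_real (\<bar>t\<bar> powr \<beta>) * (of_real U * \<zeta> + E))"
          by (simp only: Ua E_def of_real_sum of_real_mult sum_distrib_left sum_distrib_right sum_negf[symmetric] sum.distrib[symmetric] distrib_left mult.assoc)
        finally show ?thesis .
      qed
      ultimately show "\<exists>r. norm r \<le> e * scaled_power_sum X \<beta> n \<omega> \<and>
          char_prod n t \<omega> = exp (- (of_real (\<bar>t\<bar> powr \<beta>) * (of_real (scaled_power_sum X \<beta> n \<omega>) * \<zeta> + r)))"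
        unfolding U_def by blast
    qed
  qed
qed

text \<open>Convergence in mean of the scaled power sum passes through the exponential, which is
  1-Lipschitz on the closed left half plane; the work is to keep both exponents there.\<close>

lemma char_prod_tendsto: "(\<lambda>n. expectation (char_prod n t)) \<longlonglongrightarrow> limit_char t"
proof (rule tendstoI)
  fix e :: real assume e: "e > 0"
  define \<zeta> where "\<zeta> = of_real A\<^sub>1 + \<i> * of_real (A\<^sub>2 * sgn t)"
  define T where "T = \<bar>t\<bar> powr \<beta>"
  \<comment> \<open>The bound by \<open>A\<^sub>1\<close> keeps the real part of the exponent
    nonpositive despite the error r; the other bound makes T * limit_scale * \<kappa>, the part of
    the error that survives the limit, less than e.\<close>
  define \<kappa> where "\<kappa> = min A\<^sub>1 (e / (2 * (T * limit_scale + 1)))"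
  have T: "T \<ge> 0" by (simp add: T_def)
  have Tl: "T * limit_scale \<ge> 0" using T limit_scale_pos by simp
  have \<kappa>: "\<kappa> > 0" "\<kappa> \<le> A\<^sub>1" "T * limit_scale * \<kappa> < e"
  proof -
    show "\<kappa> > 0" "\<kappa> \<le> A\<^sub>1" using e A\<^sub>1 Tl by (auto simp: \<kappa>_def)
    have "\<kappa> \<le> e / (2 * (T * limit_scale + 1))" unfolding \<kappa>_def by (rule min.cobounded2)
    hence "T * limit_scale * \<kappa> \<le> T * limit_scale * (e / (2 * (T * limit_scale + 1)))" by (intro mult_left_mono Tl)
    also have "\<dots> \<le> (T * limit_scale + 1) * (e / (2 * (T * limit_scale + 1)))" using e Tl by (intro mult_right_mono) auto
    also have "\<dots> = e / 2"
    proof -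
      have gen: "m * (e / (2 * m)) = e / 2" if "m > 0" for m :: real using that by simp
      show ?thesis by (rule gen) (use Tl in linarith)
    qed
    finally show "T * limit_scale * \<kappa> < e" using e by linarith
  qed
  define Q where "Q = (\<lambda>n. T * (norm \<zeta> + \<kappa>) * expectation (\<lambda>\<omega>. \<bar>scaled_power_sum X \<beta> n \<omega> - limit_scale\<bar>) + T * limit_scale * \<kappa> + 2 * prob (crowded n))"
  have "(\<lambda>n. expectation (\<lambda>\<omega>. \<bar>scaled_power_sum X \<beta> n \<omega> - limit_scale\<bar>)) \<longlonglongrightarrow> 0"
    unfolding scaled_power_sum_def limit_scale_def by (rule power_sum_limit[OF \<beta>])
  hence "Q \<longlonglongrightarrow> T * (norm \<zeta> + \<kappa>) * 0 + T * limit_scale * \<kappa> + 2 * 0"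
    unfolding Q_def by (intro tendsto_intros prob_crowded_tendsto)
  hence "\<forall>\<^sub>F n in sequentially. Q n < e" by (rule order_tendstoD(2)) (use \<kappa>(3) in simp)
  thus "\<forall>\<^sub>F n in sequentially. dist (expectation (char_prod n t)) (limit_char t) < e"
    using char_prod_expansion[OF \<kappa>(1), of t]
  proof eventually_elim
    case (elim n)
    have norm_lim: "norm (limit_char t) \<le> 1"
      using A\<^sub>1 limit_scale_pos by (simp add: limit_char_def)
    have pw: "norm (char_prod n t \<omega> - limit_char t)
      \<le> T * (norm \<zeta> + \<kappa>) * \<bar>scaled_power_sum X \<beta> n \<omega> - limit_scale\<bar> + T * limit_scale * \<kappa> + 2 * indicator (crowded n) \<omega>"
      if \<omega>: "\<omega> \<in> space M" for \<omega>
    proof (cases "\<omega> \<in> crowded n")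
      case True
      have "norm (char_prod n t \<omega> - limit_char t) \<le> 2"
        using norm_triangle_ineq4[of "char_prod n t \<omega>" "limit_char t"] norm_lim norm_char_prod_le[of n t \<omega>] by linarith
      moreover have "0 \<le> T * (norm \<zeta> + \<kappa>) * \<bar>scaled_power_sum X \<beta> n \<omega> - limit_scale\<bar>" using T \<kappa>(1) by simp
      moreover have "0 \<le> T * limit_scale * \<kappa>" using Tl \<kappa>(1) by simp
      ultimately show ?thesis using True by simp
    next
      case False
      define U where "U = scaled_power_sum X \<beta> n \<omega>"
      have U: "U \<ge> 0" by (simp add: U_def scaled_power_sum_nonneg)
      obtain r where r: "norm r \<le> \<kappa> * U" "char_prod n t \<omega> = exp (- (of_real T * (of_real U * \<zeta> + r)))"
        using elim(2) False \<omega> unfolding U_def T_def \<zeta>_def by blast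
      have lim: "limit_char t = exp (- (of_real T * (of_real limit_scale * \<zeta>)))"
        by (simp add: limit_char_def T_def \<zeta>_def)
      have Re\<zeta>: "Re \<zeta> = A\<^sub>1" by (simp add: \<zeta>_def)
      have "\<kappa> * U \<le> A\<^sub>1 * U" using \<kappa>(2) U by (rule mult_right_mono)
      hence "0 \<le> U * A\<^sub>1 + Re r" using abs_Re_le_cmod[of r] r(1) by (simp add: mult.commute)
      hence "0 \<le> T * (U * A\<^sub>1 + Re r)" using T by simp
      hence Re1: "Re (- (of_real T * (of_real U * \<zeta> + r))) \<le> 0"
        by (simp only: uminus_complex.sel plus_complex.sel times_complex.sel Re_complex_of_real Im_complex_of_real Re\<zeta> mult_zero_left diff_0_right neg_le_0_iff_le)
      have "0 \<le> T * (limit_scale * A\<^sub>1)" using T limit_scale_pos A\<^sub>1 by simp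
      hence Re2: "Re (- (of_real T * (of_real limit_scale * \<zeta>))) \<le> 0"
        by (simp only: uminus_complex.sel times_complex.sel Re_complex_of_real Im_complex_of_real Re\<zeta> mult_zero_left diff_0_right neg_le_0_iff_le)
      have "norm (char_prod n t \<omega> - limit_char t) \<le> norm (- (of_real T * (of_real U * \<zeta> + r)) - - (of_real T * (of_real limit_scale * \<zeta>)))"
        unfolding r(2) lim by (rule norm_exp_diff_le[OF Re1 Re2])
      also have "- (of_real T * (of_real U * \<zeta> + r)) - - (of_real T * (of_real limit_scale * \<zeta>)) = - (of_real T * (of_real (U - limit_scale) * \<zeta> + r))"
        by (simp add: algebra_simps)
      also have "norm \<dots> = T * norm (of_real (U - limit_scale) * \<zeta> + r)" using T by (simp add: norm_mult del: of_real_diff)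
      also have "\<dots> \<le> T * (\<bar>U - limit_scale\<bar> * norm \<zeta> + \<kappa> * (\<bar>U - limit_scale\<bar> + limit_scale))"
      proof (intro mult_left_mono T)
        have "norm (of_real (U - limit_scale) * \<zeta> + r) \<le> norm (of_real (U - limit_scale) * \<zeta>) + norm r" by (rule norm_triangle_ineq)
        also have "norm (of_real (U - limit_scale) * \<zeta>) = \<bar>U - limit_scale\<bar> * norm \<zeta>" by (simp only: norm_mult norm_of_real)
        also have "norm r \<le> \<kappa> * (\<bar>U - limit_scale\<bar> + limit_scale)"
        proof (rule order.trans[OF r(1)])
          show "\<kappa> * U \<le> \<kappa> * (\<bar>U - limit_scale\<bar> + limit_scale)" using \<kappa>(1) by (intro mult_left_mono) auto
        qed
        finally show "norm (of_real (U - limit_scale) * \<zeta> + r) \<le> \<bar>U - limit_scale\<bar> * norm \<zeta> + \<kappa> * (\<bar>U - limit_scale\<bar> + limit_scale)" by simp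
      qed
      also have "\<dots> = T * (norm \<zeta> + \<kappa>) * \<bar>U - limit_scale\<bar> + T * limit_scale * \<kappa>"
        by (simp add: algebra_simps)
      finally show ?thesis using False by (simp add: U_def)
    qed
    have si: "integrable M (\<lambda>\<omega>. \<bar>scaled_power_sum X \<beta> n \<omega> - limit_scale\<bar>)"
      by (intro integrable_abs Bochner_Integration.integrable_diff scaled_power_sum_integrable) simp
    have ci: "integrable M (\<lambda>\<omega>. char_prod n t \<omega> - limit_char t)"
      by (intro Bochner_Integration.integrable_diff char_prod_integrable) simp
    have "expectation (char_prod n t) - limit_char t = expectation (\<lambda>\<omega>. char_prod n t \<omega> - limit_char t)"
      using char_prod_integrable by (simp add: prob_space)
    hence "dist (expectation (char_prod n t)) (limit_char t) \<le> expectation (\<lambda>\<omega>. norm (char_prod n t \<omega> - limit_char t))"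
      using integral_norm_bound[of M "\<lambda>\<omega>. char_prod n t \<omega> - limit_char t"] by (simp only: dist_norm)
    also have "\<dots> \<le> expectation (\<lambda>\<omega>. T * (norm \<zeta> + \<kappa>) * \<bar>scaled_power_sum X \<beta> n \<omega> - limit_scale\<bar> + T * limit_scale * \<kappa> + 2 * indicator (crowded n) \<omega>)"
    proof (rule integral_mono[OF integrable_norm[OF ci] _ pw])
      show "integrable M (\<lambda>\<omega>. T * (norm \<zeta> + \<kappa>) * \<bar>scaled_power_sum X \<beta> n \<omega> - limit_scale\<bar> + T * limit_scale * \<kappa> + 2 * indicator (crowded n) \<omega>)"
        by (intro Bochner_Integration.integrable_add integrable_mult_right si crowded_integrable integrable_const)
    qed
    also have "\<dots> = Q n"
    proof -
      have "expectation (\<lambda>\<omega>. u * \<bar>scaled_power_sum X \<beta> n \<omega> - limit_scale\<bar> + v + 2 * indicator (crowded n) \<omega>)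
        = u * expectation (\<lambda>\<omega>. \<bar>scaled_power_sum X \<beta> n \<omega> - limit_scale\<bar>) + v + 2 * prob (crowded n)" for u v
        using si crowded_integrable by (simp add: prob_space)
      thus ?thesis by (simp only: Q_def)
    qed
    finally show ?case using elim(1) by simp
  qed
qed

end

theorem theorem3:
  fixes M :: "'w measure"
    and X :: "nat \<Rightarrow> 'w \<Rightarrow> int ^ 'd"
    and \<xi> :: "int ^ 'd \<Rightarrow> 'w \<Rightarrow> real"
    and \<mu> :: "real measure"
    and A \<beta> A\<^sub>1 A\<^sub>2 :: real
    and C :: "real \<Rightarrow> real"
    and x a b :: real
  assumes "prob_space M"
    and "walk_scenery M X \<xi>"
    and "planar_walk M X \<and> A = 2 * sqrt (det (variance_matrix M (X 1))) \<or> cauchy_walk M X A"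
    and "spans_lattice M (X 1)"
    and "strictly_stable \<beta> A\<^sub>1 A\<^sub>2 \<mu>"
    and "normal_domain_of_attraction (distr M borel (\<xi> 0)) \<beta> \<mu>"
    and "\<beta> = 1 \<Longrightarrow>
      bdd_above ((\<lambda>t. \<bar>\<integral>\<omega>. \<xi> 0 \<omega> * indicator {\<omega>. \<bar>\<xi> 0 \<omega>\<bar> \<le> t} \<omega> \<partial>M\<bar>) ` {0<..})"
    and "strongly_nonlattice (distr M borel (\<xi> 0))"
    and "continuous_density \<mu>
      (\<lambda>y. (Gamma (\<beta> + 1) / (pi * A) powr (\<beta> - 1)) powr (1 / \<beta>) * y) C"
    and "a < b"
  shows "(\<lambda>n. norming \<beta> n *
      measure M {\<omega> \<in> space M. rwrs X \<xi> n \<omega> \<in> {norming \<beta> n * x + a .. norming \<beta> n * x + b}})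
    \<longlonglongrightarrow> C x * (b - a)"
proof -
  interpret prob_space M by fact
  define \<nu> where "\<nu> = distr M borel (\<xi> 0)"
  have iid: "iid M (count_space UNIV) X {1..}" using assms(2) by (simp add: walk_scenery_def)
  have \<xi>0: "\<xi> 0 \<in> borel_measurable M" using assms(2) by (auto simp: walk_scenery_def iid_def indep_vars_def)
  obtain p where lw: "lattice_walk M X p (pi * A)"
    by (rule lattice_walk_of_assumptions[OF assms(1) iid assms(3,4)])
  have rd: "real_distribution \<nu>" unfolding \<nu>_def by (rule real_distribution_distr[OF \<xi>0])
  interpret scenery_walk M X p "pi * A" \<nu> \<mu> \<beta> A\<^sub>1 A\<^sub>2
    by (rule scenery_walk.intro[OF lw], rule scenery_walk_axioms.intro[OF rd assms(5) assms(6,8)[folded \<nu>_def]])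
  note rm = char_rwrs(1)[OF assms(1,2)]
  define \<rho> where "\<rho> = (\<lambda>n. distr M borel (rwrs X \<xi> n))"
  have char_\<rho>: "char (\<rho> n) (t / norming \<beta> n) = expectation (char_prod n t)" for n t
    unfolding \<rho>_def char_rwrs(2)[OF assms(1,2), folded \<nu>_def] char_prod_def ..
  obtain c D where cD: "c > 0" "D \<ge> 0"
    "\<forall>\<^sub>F n in sequentially. \<forall>t. norm (expectation (char_prod n t)) \<le> D / (1 + t\<^sup>2) + (exp (- c * real n powr (1 / 4)) + prob (crowded n))"
    using char_prod_bound by blast
  define \<epsilon> where "\<epsilon> = (\<lambda>n. exp (- c * real n powr (1 / 4)) + prob (crowded n))"
  interpret scaled_char \<rho> "norming \<beta>" \<epsilon> D limit_char
  proof (rule scaled_char.intro)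
    show "real_distribution (\<rho> n)" for n unfolding \<rho>_def by (rule real_distribution_distr[OF rm])
    show "filterlim (norming \<beta>) at_top sequentially" by (rule filterlim_norming[OF \<beta>])
    show "\<forall>\<^sub>F n in sequentially. \<forall>t. norm (char (\<rho> n) (t / norming \<beta> n)) \<le> D / (1 + t\<^sup>2) + \<epsilon> n"
      using cD(3) by (simp only: char_\<rho> \<epsilon>_def)
    have "(\<lambda>n. norming \<beta> n * exp (- c * real n powr (1 / 4)) + norming \<beta> n * prob (crowded n)) \<longlonglongrightarrow> 0 + 0"
      by (intro tendsto_add norming_exp1[OF \<beta> cD(1)] norming_crowded)
    thus "(\<lambda>n. norming \<beta> n * \<epsilon> n) \<longlonglongrightarrow> 0" by (simp add: \<epsilon>_def distrib_left)
    show "(\<lambda>n. char (\<rho> n) (t / norming \<beta> n)) \<longlonglongrightarrow> limit_char t" for t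
      unfolding char_\<rho> by (rule char_prod_tendsto)
  qed (rule cD(2))
  \<comment> \<open>The factor in the definition of the limit variable. Its power \<beta> is the
    limit of the scaled power sums, so \<gamma> Y(1) has characteristic function
    \<open>limit_char\<close>.\<close>
  define \<gamma> where "\<gamma> = limit_scale powr (1 / \<beta>)"
  have \<gamma>: "\<gamma> > 0" "\<gamma> powr \<beta> = limit_scale"
    using limit_scale_pos \<beta> by (simp_all add: \<gamma>_def powr_powr)
  define \<mu>' where "\<mu>' = distr \<mu> borel (\<lambda>y. \<gamma> * y)"
  interpret \<mu>: real_distribution \<mu> using assms(5) by (simp add: strictly_stable_def)
  have dens: "distributed \<mu> lborel (\<lambda>y. \<gamma> * y) (\<lambda>y. ennreal (C y))" and C: "continuous_on UNIV C" "\<And>y. 0 \<le> C y"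
    using assms(9) by (simp_all add: continuous_density_def \<gamma>_def limit_scale_def)
  have "limit_density x = C x"
  proof (rule limit_density_eq)
    show "real_distribution \<mu>'" unfolding \<mu>'_def by (intro \<mu>.real_distribution_distr) simp
    show "char \<mu>' t = limit_char t" for t
    proof -
      have "char \<mu>' t = char \<mu> (\<gamma> * t)"
        unfolding \<mu>'_def char_def by (subst integral_distr) (simp_all add: mult_ac)
      also have "\<dots> = exp (- (of_real (\<bar>\<gamma> * t\<bar> powr \<beta>) * (of_real A\<^sub>1 + \<i> * of_real (A\<^sub>2 * sgn (\<gamma> * t)))))"
        using assms(5) unfolding strictly_stable_def by blast
      also have "\<bar>\<gamma> * t\<bar> powr \<beta> = \<bar>t\<bar> powr \<beta> * limit_scale"
        using \<gamma> by (simp add: abs_mult powr_mult)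
      also have "sgn (\<gamma> * t) = sgn t" using \<gamma> by (simp add: sgn_mult)
      finally show ?thesis by (simp add: limit_char_def mult.assoc)
    qed
    \<comment> \<open>Inherited from the bound before the limit, since \<epsilon> n tends to 0 for
      fixed t.\<close>
    show "norm (limit_char t) \<le> D / (1 + t\<^sup>2)" for t
    proof (rule tendsto_le[OF sequentially_bot])
      show "(\<lambda>n. norm (char (\<rho> n) (t / norming \<beta> n))) \<longlonglongrightarrow> norm (limit_char t)" by (intro tendsto_norm lim)
      have "(\<lambda>n. D / (1 + t\<^sup>2) + \<epsilon> n) \<longlonglongrightarrow> D / (1 + t\<^sup>2) + 0" by (intro tendsto_intros \<epsilon>_tendsto)
      thus "(\<lambda>n. D / (1 + t\<^sup>2) + \<epsilon> n) \<longlonglongrightarrow> D / (1 + t\<^sup>2)" by simp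
      show "\<forall>\<^sub>F n in sequentially. norm (char (\<rho> n) (t / norming \<beta> n)) \<le> D / (1 + t\<^sup>2) + \<epsilon> n"
        using bound by eventually_elim blast
    qed
    have "distr \<mu>' lborel (\<lambda>y. y) = distr \<mu> lborel (\<lambda>y. \<gamma> * y)"
      unfolding \<mu>'_def by (subst distr_distr) (auto simp: comp_def)
    thus "distributed \<mu>' lborel (\<lambda>y. y) (\<lambda>y. ennreal (C y))"
      using dens by (simp add: distributed_def \<mu>'_def)
  qed (fact C)+
  moreover have "measure (\<rho> n) {norming \<beta> n * x + a .. norming \<beta> n * x + b}
    = measure M {\<omega> \<in> space M. rwrs X \<xi> n \<omega> \<in> {norming \<beta> n * x + a .. norming \<beta> n * x + b}}" for n
    unfolding \<rho>_def using rm by (subst measure_distr) (auto intro!: arg_cong[where f="measure M"])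
  ultimately show ?thesis using interval_limit[OF assms(10), of x] by (simp only:)
qed

end
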